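(* Let $\mathbf s\in\mathbb R^j$. Let $K\subset\mathbb R^n$ be a compact subset such that $(K-K)\cap\mathbb Z^n=\{0\}$, and let $\{u_\gamma\}_{\gamma\in\mathbb Z^n}$ be a family of elements of $\mathcal H^{\mathbf s}(\mathbb R^n)\cap\mathcal D'_K(\mathbb R^n)$. Put $$u=\sum_{\gamma\in\mathbb Z^n}\tau_\gamma u_\gamma=\sum_{\gamma\in\mathbb Z^n}u_\gamma(\cdot-\gamma)\in\mathcal D'(\mathbb R^n).$$ Then the following statements are equivalent: (a) $u\in\mathcal H^{\mathbf s}(\mathbb R^n)$. (b) $\sum_{\gamma\in\mathbb Z^n}\|u_\gamma\|_{\mathcal H^{\mathbf s}}^2<\infty$. Moreover, there is $C\ge 1$, which does not depend on the family $\{u_\gamma\}_{\gamma\in\mathbb Z^n}$, such that $$C^{-1}\|u\|_{\mathcal H^{\mathbf s}}\le\Big(\sum_{\gamma\in\mathbb Z^n}\|u_\gamma\|_{\mathcal H^{\mathbf s}}^2\Big)^{1/2}\le C\|u\|_{\mathcal H^{\mathbf s}}.$$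
   Context: Let $j\in\{1,\dots,n\}$ and $\mathbb R^n=\mathbb R^{n_1}\times\cdots\times\mathbb R^{n_j}$ with $n_1,\dots,n_j$ positive integers. For $\mathbf s=(s_1,\dots,s_j)\in\mathbb R^j$ and $\xi=(\xi_1,\dots,\xi_j)\in\mathbb R^{n_1}\times\cdots\times\mathbb R^{n_j}$ put $\langle\langle\xi\rangle\rangle^{\mathbf s}=\prod_{l=1}^j(1+|\xi_l|^2)^{s_l/2}$, and let $\langle\langle D\rangle\rangle^{\mathbf s}$ be the corresponding Fourier multiplier. Then $\mathcal H^{\mathbf s}(\mathbb R^n)=\{u\in\mathcal S'(\mathbb R^n):\langle\langle D\rangle\rangle^{\mathbf s}u\in L^2(\mathbb R^n)\}$ with norm $\|u\|_{\mathcal H^{\mathbf s}}=\|\langle\langle D\rangle\rangle^{\mathbf s}u\|_{L^2}$. $\mathcal D'_K(\mathbb R^n)$ denotes the distributions on $\mathbb R^n$ with support in $K$. For $x\in\mathbb R^n$, $\tau_xu=u(\cdot-x)$ is the translate of $u$ by $x$. *)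

theory Defs
  imports "HOL-Analysis.Analysis"
begin

section \<open>Test functions and Schwartz functions\<close>

definition partial_deriv :: "'n \<Rightarrow> (real^'n::finite \<Rightarrow> complex) \<Rightarrow> real^'n \<Rightarrow> complex" where
  "partial_deriv i f = (\<lambda>x. frechet_derivative f (at x) (axis i 1))"

text \<open>Multi-indices are encoded as lists of coordinates: \<open>[i, i, k]\<close> stands for the derivative
  \<open>\<partial>\<^sub>i \<partial>\<^sub>i \<partial>\<^sub>k\<close>. For smooth functions the order in the list is irrelevant, so every
  multi-index of order \<open>m\<close> is represented by at least one list of length \<open>m\<close>.\<close>

definition partial_derivs :: "'n list \<Rightarrow> (real^'n::finite \<Rightarrow> complex) \<Rightarrow> real^'n \<Rightarrow> complex" where
  "partial_derivs \<alpha> f = foldr partial_deriv \<alpha> f"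

definition smooth :: "(real^'n::finite \<Rightarrow> complex) \<Rightarrow> bool" where
  "smooth f \<longleftrightarrow> (\<forall>\<alpha> x. partial_derivs \<alpha> f differentiable (at x))"

definition function_support :: "(real^'n::finite \<Rightarrow> complex) \<Rightarrow> (real^'n) set" where
  "function_support f = closure {x. f x \<noteq> 0}"

definition test_functions :: "(real^'n::finite \<Rightarrow> complex) set" where
  "test_functions = {\<phi>. smooth \<phi> \<and> compact (function_support \<phi>)}"

definition schwartz_functions :: "(real^'n::finite \<Rightarrow> complex) set" where
  "schwartz_functions =
    {\<phi>. smooth \<phi> \<and> (\<forall>k \<alpha>. bounded (range (\<lambda>x. (1 + norm x) ^ k *\<^sub>R partial_derivs \<alpha> \<phi> x)))}"

definition schwartz_seminorm :: "nat \<Rightarrow> nat \<Rightarrow> (real^'n::finite \<Rightarrow> complex) \<Rightarrow> real" where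
  "schwartz_seminorm k m \<phi> =
    (\<Sum>\<alpha> | length \<alpha> \<le> m. SUP x. (1 + norm x) ^ k * cmod (partial_derivs \<alpha> \<phi> x))"

section \<open>Distributions\<close>

text \<open>A distribution is a functional on all functions of which only the values on the relevant
  test space matter; two functionals that agree on that space are the same distribution.\<close>

type_synonym 'n functional = "(real^'n \<Rightarrow> complex) \<Rightarrow> complex"

definition complex_linear_on :: "(real^'n::finite \<Rightarrow> complex) set \<Rightarrow> 'n functional \<Rightarrow> bool" where
  "complex_linear_on V u \<longleftrightarrow>
    (\<forall>\<phi>\<in>V. \<forall>\<psi>\<in>V. \<forall>a c. u (\<lambda>x. a * \<phi> x + c * \<psi> x) = a * u \<phi> + c * u \<psi>)"

definition distributions :: "'n::finite functional set" where
  "distributions = {u. complex_linear_on test_functions u \<and>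
    (\<forall>L. compact L \<longrightarrow> (\<exists>C m. \<forall>\<phi>\<in>test_functions. function_support \<phi> \<subseteq> L \<longrightarrow>
      cmod (u \<phi>) \<le> C * schwartz_seminorm 0 m \<phi>))}"

definition tempered_distributions :: "'n::finite functional set" where
  "tempered_distributions = {T. complex_linear_on schwartz_functions T \<and>
    (\<exists>C k m. \<forall>\<phi>\<in>schwartz_functions. cmod (T \<phi>) \<le> C * schwartz_seminorm k m \<phi>)}"

definition distribution_support :: "'n::finite functional \<Rightarrow> (real^'n) set" where
  "distribution_support u = {x. \<forall>V. open V \<and> x \<in> V \<longrightarrow>
    (\<exists>\<phi>\<in>test_functions. function_support \<phi> \<subseteq> V \<and> u \<phi> \<noteq> 0)}"

definition distributions_in :: "(real^'n::finite) set \<Rightarrow> 'n functional set" where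
  "distributions_in K = {u \<in> distributions. distribution_support u \<subseteq> K}"

definition translate :: "real^'n::finite \<Rightarrow> 'n functional \<Rightarrow> 'n functional" where
  "translate h u = (\<lambda>\<phi>. u (\<lambda>x. \<phi> (x + h)))"

section \<open>Fourier multipliers\<close>

text \<open>The normalisation is the one for which \<open>D = - \<i> \<partial>\<close> has symbol \<open>\<xi>\<close>.\<close>

definition fourier :: "(real^'n::finite \<Rightarrow> complex) \<Rightarrow> real^'n \<Rightarrow> complex" where
  "fourier \<phi> = (\<lambda>\<xi>. LINT x|lborel. cis (- (x \<bullet> \<xi>)) * \<phi> x)"

definition inverse_fourier :: "(real^'n::finite \<Rightarrow> complex) \<Rightarrow> real^'n \<Rightarrow> complex" where
  "inverse_fourier \<phi> =
    (\<lambda>x. complex_of_real (1 / (2 * pi) ^ CARD('n)) * (LINT \<xi>|lborel. cis (x \<bullet> \<xi>) * \<phi> \<xi>))"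

text \<open>The operations on tempered distributions are the usual ones, defined by duality.\<close>

definition fourier_distr :: "'n::finite functional \<Rightarrow> 'n functional" where
  "fourier_distr T = (\<lambda>\<phi>. T (fourier \<phi>))"

definition inverse_fourier_distr :: "'n::finite functional \<Rightarrow> 'n functional" where
  "inverse_fourier_distr T = (\<lambda>\<phi>. T (inverse_fourier \<phi>))"

definition mult_distr :: "(real^'n::finite \<Rightarrow> real) \<Rightarrow> 'n functional \<Rightarrow> 'n functional" where
  "mult_distr m T = (\<lambda>\<phi>. T (\<lambda>\<xi>. complex_of_real (m \<xi>) * \<phi> \<xi>))"

definition fourier_multiplier :: "(real^'n::finite \<Rightarrow> real) \<Rightarrow> 'n functional \<Rightarrow> 'n functional" where
  "fourier_multiplier m T = inverse_fourier_distr (mult_distr m (fourier_distr T))"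

section \<open>The Sobolev spaces\<close>

text \<open>A splitting of \<open>\<real>\<^sup>n\<close> into \<open>j\<close> factors is given by the map \<open>blk\<close> sending each coordinate
  to the factor it belongs to; the factor \<open>l\<close> has dimension \<open>card {i. blk i = l}\<close>, and all these
  dimensions are positive iff \<open>blk\<close> is surjective.\<close>

definition block_norm :: "('n::finite \<Rightarrow> 'j::finite) \<Rightarrow> 'j \<Rightarrow> real^'n \<Rightarrow> real" where
  "block_norm blk l \<xi> = sqrt (\<Sum>i | blk i = l. (\<xi> $ i)\<^sup>2)"

definition weight :: "('n::finite \<Rightarrow> 'j::finite) \<Rightarrow> real^'j \<Rightarrow> real^'n \<Rightarrow> real" where
  "weight blk s \<xi> = (\<Prod>l\<in>UNIV. (1 + (block_norm blk l \<xi>)\<^sup>2) powr (s $ l / 2))"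

definition square_integrable :: "(real^'n::finite \<Rightarrow> complex) \<Rightarrow> bool" where
  "square_integrable f \<longleftrightarrow>
    f \<in> borel_measurable lborel \<and> integrable lborel (\<lambda>x. (cmod (f x))\<^sup>2)"

definition L2_norm :: "(real^'n::finite \<Rightarrow> complex) \<Rightarrow> real" where
  "L2_norm f = sqrt (LINT x|lborel. (cmod (f x))\<^sup>2)"

text \<open>\<open>bessel_image blk s u f\<close>: the distribution \<open>u\<close> is tempered, i.e. is the restriction of some
  tempered \<open>T\<close> (which is unique on Schwartz functions), and applying the multiplier with symbol
  \<open>weight blk s\<close> to \<open>T\<close> gives the function \<open>f\<close> in \<open>L\<^sup>2\<close> (which is unique almost everywhere).\<close>

definition bessel_image ::
  "('n::finite \<Rightarrow> 'j::finite) \<Rightarrow> real^'j \<Rightarrow> 'n functional \<Rightarrow> (real^'n \<Rightarrow> complex) \<Rightarrow> bool" where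
  "bessel_image blk s u f \<longleftrightarrow> square_integrable f \<and>
    (\<exists>T\<in>tempered_distributions. (\<forall>\<phi>\<in>test_functions. T \<phi> = u \<phi>) \<and>
      (\<forall>\<phi>\<in>schwartz_functions.
        fourier_multiplier (weight blk s) T \<phi> = (LINT x|lborel. f x * \<phi> x)))"

definition sobolev :: "('n::finite \<Rightarrow> 'j::finite) \<Rightarrow> real^'j \<Rightarrow> 'n functional set" where
  "sobolev blk s = {u. \<exists>f. bessel_image blk s u f}"

definition sobolev_norm :: "('n::finite \<Rightarrow> 'j::finite) \<Rightarrow> real^'j \<Rightarrow> 'n functional \<Rightarrow> real" where
  "sobolev_norm blk s u = L2_norm (SOME f. bessel_image blk s u f)"

section \<open>Sums of translates over the integer lattice\<close>

definition int_lattice :: "(real^'n::finite) set" where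
  "int_lattice = {x. \<forall>i. x $ i \<in> \<int>}"

text \<open>The sum is taken in the weak topology of distributions, i.e. pointwise on test functions.\<close>

definition lattice_sum :: "(real^'n::finite \<Rightarrow> 'n functional) \<Rightarrow> 'n functional" where
  "lattice_sum U = (\<lambda>\<phi>. \<Sum>\<^sub>\<infinity>\<gamma>\<in>int_lattice. translate \<gamma> (U \<gamma>) \<phi>)"

end

theory Submission
  imports Defs "HOL-Probability.Probability"
begin

text \<open>By duality and the Riesz representation theorem, \<open>u\<close> lies in the Sobolev space with norm at most
  \<open>M\<close> iff \<open>\<bar>u(\<psi>)\<bar> \<le> M N(\<psi>)\<close> for all test functions \<open>\<psi>\<close>, where \<open>N\<close> is the Sobolev norm of order
  \<open>-s\<close>. Choose a test function \<open>\<theta>\<close> that is \<open>1\<close> near \<open>K\<close> and whose support misses all nonzero lattice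
  translates of \<open>K\<close>, and put \<open>\<theta>\<^sub>\<gamma> = \<theta>(\<cdot> - \<gamma>)\<close>. Two almost-orthogonality estimates are
  needed: \<open>\<Sum> N(\<theta>\<^sub>\<gamma> \<phi>)\<^sup>2 \<le> C N(\<phi>)\<^sup>2\<close> and \<open>N(\<Sum> \<theta>\<^sub>\<gamma> \<psi>\<^sub>\<gamma>)\<^sup>2 \<le> C \<Sum> N(\<psi>\<^sub>\<gamma>)\<^sup>2\<close>. The first bounds
  \<open>u(\<phi>) = \<Sum> u\<^sub>\<gamma>((\<theta>\<^sub>\<gamma> \<phi>)(\<cdot> + \<gamma>))\<close> by the Cauchy--Schwarz inequality. For the second, take test functions
  that nearly attain the norms of the \<open>u\<^sub>\<gamma>\<close>, translate them by \<open>\<gamma>\<close> to \<open>\<psi>\<^sub>\<gamma>\<close>, and pair \<open>u\<close> with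
  \<open>\<Sum> \<theta>\<^sub>\<gamma> \<psi>\<^sub>\<gamma>\<close>. The first estimate follows from Plancherel's theorem in the position of a sliding
  window, and the second from the first by duality.\<close>

section \<open>Smooth functions\<close>

text \<open>The multiplier of order \<open>s\<close> is nonlocal in general: the L2 functions
  representing the single \<open>U \<gamma>\<close> overlap although the translates of
  \<open>K\<close> are disjoint, so their norms cannot simply be added by orthogonality. Passing to
  the pairing moves the weight onto smooth functions, where cutting, translating and gluing are
  explicit. Of the weight only the properties collected in \<open>admissible\<close> are used; the
  splitting into factors disappears once Peetre's inequality is known, and the weight and its
  inverse stand on the same footing. The condition on K - K says that \<open>K\<close> and
  \<open>K + \<gamma>\<close> are disjoint for nonzero \<gamma>. It yields the cutoff \<theta>, and
  with it a way to recover single coefficients: on a function cut off around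
  \<open>K + \<gamma>\<close> only the \<gamma>-th term of the sum acts. The almost-orthogonality
  estimates are proved for finite subsets of the lattice with constants independent of the subset,
  so the infinite sum enters only as a supremum. The constants come from \<theta>, which is fixed
  before any family, and this makes the final C independent of the family.\<close>

lemma partial_derivs_Nil [simp]: "partial_derivs [] f = f"
  by (simp add: partial_derivs_def)

lemma partial_derivs_Cons [simp]: "partial_derivs (i # \<alpha>) f = partial_deriv i (partial_derivs \<alpha> f)"
  by (simp add: partial_derivs_def)

lemma partial_derivs_append: "partial_derivs (\<alpha> @ \<beta>) f = partial_derivs \<alpha> (partial_derivs \<beta> f)"
  by (simp add: partial_derivs_def)

section \<open>Calculus rules for partial derivatives\<close>

lemma partial_deriv_eq:
  "(f has_derivative f') (at x) \<Longrightarrow> partial_deriv i f x = f' (axis i 1)"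
  using frechet_derivative_at[of f f' x] by (simp add: partial_deriv_def)

lemma partial_deriv_add:
  assumes "\<And>x. f differentiable (at x)" "\<And>x. g differentiable (at x)"
  shows "partial_deriv i (\<lambda>x. f x + g x) = (\<lambda>x. partial_deriv i f x + partial_deriv i g x)"
proof
  fix x
  show "partial_deriv i (\<lambda>x. f x + g x) x = partial_deriv i f x + partial_deriv i g x"
    using partial_deriv_eq[OF has_derivative_add[OF
        iffD1[OF frechet_derivative_works assms(1)] iffD1[OF frechet_derivative_works assms(2)]]]
    by (simp add: partial_deriv_def)
qed

lemma partial_deriv_mult:
  assumes "\<And>x. f differentiable (at x)" "\<And>x. g differentiable (at x)"
  shows "partial_deriv i (\<lambda>x. f x * g x) = (\<lambda>x. partial_deriv i f x * g x + f x * partial_deriv i g x)"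
proof
  fix x
  show "partial_deriv i (\<lambda>x. f x * g x) x = partial_deriv i f x * g x + f x * partial_deriv i g x"
    using partial_deriv_eq[OF has_derivative_mult[OF
        iffD1[OF frechet_derivative_works assms(1)] iffD1[OF frechet_derivative_works assms(2)]]]
    by (simp add: partial_deriv_def)
qed

lemma partial_deriv_const: "partial_deriv i (\<lambda>x. c) = (\<lambda>x. 0)"
  using partial_deriv_eq[OF has_derivative_const] by fastforce

lemma partial_deriv_cmult:
  assumes "\<And>x. f differentiable (at x)"
  shows "partial_deriv i (\<lambda>x. c * f x) = (\<lambda>x. c * partial_deriv i f x)"
  using partial_deriv_mult[of "\<lambda>_. c" f] assms by (simp add: partial_deriv_const)

lemma partial_deriv_affine:
  assumes "\<And>x. f differentiable (at x)"
  shows "partial_deriv i (\<lambda>x. f (c *\<^sub>R x + h)) = (\<lambda>x. of_real c * partial_deriv i f (c *\<^sub>R x + h))"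
proof
  fix x
  let ?D = "frechet_derivative f (at (c *\<^sub>R x + h))"
  have D: "(f has_derivative ?D) (at (c *\<^sub>R x + h))"
    using assms frechet_derivative_works by blast
  have "((\<lambda>x. f (c *\<^sub>R x + h)) has_derivative (\<lambda>y. ?D (c *\<^sub>R y))) (at x)"
    by (rule has_derivative_compose[of "\<lambda>x. c *\<^sub>R x + h" "\<lambda>y. c *\<^sub>R y", OF _ D])
       (auto intro!: derivative_eq_intros)
  then have "partial_deriv i (\<lambda>x. f (c *\<^sub>R x + h)) x = ?D (c *\<^sub>R axis i 1)"
    by (rule partial_deriv_eq)
  also have "\<dots> = c *\<^sub>R ?D (axis i 1)"
    using has_derivative_linear[OF D] by (simp add: linear_cmul)
  finally show "partial_deriv i (\<lambda>x. f (c *\<^sub>R x + h)) x = of_real c * partial_deriv i f (c *\<^sub>R x + h)"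
    by (simp add: partial_deriv_def scaleR_conv_of_real)
qed

lemma partial_deriv_cnj:
  assumes "\<And>x. f differentiable (at x)"
  shows "partial_deriv i (\<lambda>x. cnj (f x)) = (\<lambda>x. cnj (partial_deriv i f x))"
proof
  fix x
  show "partial_deriv i (\<lambda>x. cnj (f x)) x = cnj (partial_deriv i f x)"
    using partial_deriv_eq[OF has_derivative_cnj[OF iffD1[OF frechet_derivative_works assms]]]
    by (simp add: partial_deriv_def)
qed

lemma differentiable_affine:
  fixes f :: "real^'n::finite \<Rightarrow> complex"
  assumes "\<And>x. f differentiable (at x)"
  shows "(\<lambda>x. f (c *\<^sub>R x + h)) differentiable (at x)"
  using differentiable_chain_at[of "\<lambda>x. c *\<^sub>R x + h" x f] assms
  by (auto simp: o_def)

lemma differentiable_cnj: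
  fixes f :: "real^'n::finite \<Rightarrow> complex"
  shows "f differentiable (at x) \<Longrightarrow> (\<lambda>x. cnj (f x)) differentiable (at x)"
  unfolding differentiable_def using has_derivative_cnj by blast

text \<open>Smooth functions, slowly increasing functions and Schwartz functions are the instances of this
  notion for three growth conditions \<open>B\<close>.\<close>

definition smooth_with :: "((real^'n::finite \<Rightarrow> complex) \<Rightarrow> bool) \<Rightarrow> (real^'n \<Rightarrow> complex) \<Rightarrow> bool" where
  "smooth_with B f \<longleftrightarrow> (\<forall>\<alpha>. (\<forall>x. partial_derivs \<alpha> f differentiable (at x)) \<and> B (partial_derivs \<alpha> f))"

text \<open>By induction on the multi-index every derivative of \<open>f\<close> stays in the
  invariant class \<open>A\<close>, so no formula for a higher derivative is ever written
  down.\<close>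

lemma smooth_with_coinduct:
  assumes "A f"
    and "\<And>g x. A g \<Longrightarrow> g differentiable (at x)" "\<And>g. A g \<Longrightarrow> B g" "\<And>g i. A g \<Longrightarrow> A (partial_deriv i g)"
  shows "smooth_with B f"
proof -
  have "A (partial_derivs \<alpha> f)" for \<alpha>
    by (induction \<alpha>) (use assms in auto)
  then show ?thesis using assms by (auto simp: smooth_with_def)
qed

lemma smooth_withD:
  assumes "smooth_with B f"
  shows "f differentiable (at x)" "B f" "smooth_with B (partial_deriv i f)"
    "smooth_with B (partial_derivs \<alpha> f)"
proof -
  show "f differentiable (at x)" "B f"
    using assms unfolding smooth_with_def by (metis partial_derivs_Nil)+
  show *: "smooth_with B (partial_derivs \<alpha> f)" for \<alpha>
    using assms unfolding smooth_with_def partial_derivs_append[symmetric] by blast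
  show "smooth_with B (partial_deriv i f)" using *[of "[i]"] by simp
qed

lemma smooth_with_mono: "smooth_with B f \<Longrightarrow> (\<And>f. B f \<Longrightarrow> B' f) \<Longrightarrow> smooth_with B' f"
  by (auto simp: smooth_with_def)

lemma smooth_with_True: "smooth f \<longleftrightarrow> smooth_with (\<lambda>_. True) f"
  by (auto simp: smooth_def smooth_with_def)

lemma smooth_with_imp_smooth: "smooth_with B f \<Longrightarrow> smooth f"
  by (auto simp: smooth_def smooth_with_def)

section \<open>Products, sums, compositions and affine images of smooth functions with growth
  conditions\<close>

inductive product_sums :: "(('a \<Rightarrow> complex) \<Rightarrow> bool) \<Rightarrow> (('a \<Rightarrow> complex) \<Rightarrow> bool) \<Rightarrow> ('a \<Rightarrow> complex) \<Rightarrow> bool"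
  for P Q where
  prod: "P f \<Longrightarrow> Q g \<Longrightarrow> product_sums P Q (\<lambda>x. f x * g x)"
| sum: "product_sums P Q u \<Longrightarrow> product_sums P Q v \<Longrightarrow> product_sums P Q (\<lambda>x. u x + v x)"

text \<open>The Leibniz rule leads from one product to a sum of two, so single products are no
  invariant for \<open>smooth_with_coinduct\<close>, but their finite sums are. \<open>P\<close> and
  \<open>Q\<close> are kept apart because the two factors may obey different growth conditions or,
  as in \<open>smooth_with_compose\<close>, because one of them runs through a list of
  derivatives.\<close>

lemma smooth_with_product_sums:
  fixes P Q :: "(real^'n::finite \<Rightarrow> complex) \<Rightarrow> bool"
  assumes f: "product_sums P Q f"
    and P: "\<And>g x. P g \<Longrightarrow> g differentiable (at x)" and Q: "\<And>g x. Q g \<Longrightarrow> g differentiable (at x)"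
    and add: "\<And>u v. B u \<Longrightarrow> B v \<Longrightarrow> B (\<lambda>x. u x + v x)"
    and mult: "\<And>u v. P u \<Longrightarrow> Q v \<Longrightarrow> B (\<lambda>x. u x * v x)"
    and deriv: "\<And>u v i. P u \<Longrightarrow> Q v \<Longrightarrow>
      product_sums P Q (\<lambda>x. partial_deriv i u x * v x + u x * partial_deriv i v x)"
  shows "smooth_with B f"
proof (rule smooth_with_coinduct[of "product_sums P Q"])
  show "product_sums P Q f" by fact
next
  fix g :: "real^'n \<Rightarrow> complex" and x assume "product_sums P Q g"
  then show "g differentiable (at x)" by induction (simp_all add: P Q)
next
  fix g :: "real^'n \<Rightarrow> complex" assume "product_sums P Q g"
  then show "B g" by induction (simp_all add: add mult)
next
  fix g :: "real^'n \<Rightarrow> complex" and i assume "product_sums P Q g"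
  then have "(\<forall>x. g differentiable (at x)) \<and> product_sums P Q (partial_deriv i g)"
  proof induction
    case (prod f g)
    then show ?case using deriv[of f g i] partial_deriv_mult[of f g i]
      by (simp add: P Q)
  next
    case (sum u v)
    then show ?case using partial_deriv_add[of u v i] product_sums.sum[of P Q "partial_deriv i u" "partial_deriv i v"]
      by simp
  qed
  then show "product_sums P Q (partial_deriv i g)" ..
qed

lemma smooth_with_mult:
  assumes "smooth_with B1 f" "smooth_with B2 g"
    and "\<And>u v. B u \<Longrightarrow> B v \<Longrightarrow> B (\<lambda>x. u x + v x)"
    and "\<And>u v. B1 u \<Longrightarrow> B2 v \<Longrightarrow> B (\<lambda>x. u x * v x)"
  shows "smooth_with B (\<lambda>x. f x * g x)"
proof (rule smooth_with_product_sums[where P = "smooth_with B1" and Q = "smooth_with B2"])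
  show "product_sums (smooth_with B1) (smooth_with B2) (\<lambda>x. f x * g x)"
    using assms by (auto intro: product_sums.prod)
  show "product_sums (smooth_with B1) (smooth_with B2)
       (\<lambda>x. partial_deriv i u x * v x + u x * partial_deriv i v x)"
    if "smooth_with B1 u" "smooth_with B2 v" for u v i
    using that by (intro product_sums.sum product_sums.prod smooth_withD(3))
next
  show "B (\<lambda>x. u x * v x)" if "smooth_with B1 u" "smooth_with B2 v" for u v
    by (rule assms(4)[OF smooth_withD(2)[OF that(1)] smooth_withD(2)[OF that(2)]])
qed (use assms(3) smooth_withD(1) in auto)

lemma smooth_with_add:
  assumes f: "smooth_with B f" and g: "smooth_with B g"
    and add: "\<And>u v. B u \<Longrightarrow> B v \<Longrightarrow> B (\<lambda>x. u x + v x)"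
  shows "smooth_with B (\<lambda>x. f x + g x)"
proof (rule smooth_with_coinduct[where A = "\<lambda>h. \<exists>f g. smooth_with B f \<and> smooth_with B g \<and> h = (\<lambda>x. f x + g x)"])
  show "\<exists>f' g'. smooth_with B f' \<and> smooth_with B g' \<and> (\<lambda>x. f x + g x) = (\<lambda>x. f' x + g' x)"
    using f g by blast
next
  fix h i assume "\<exists>f g. smooth_with B f \<and> smooth_with B g \<and> h = (\<lambda>x. f x + g x)"
  then obtain f g where fg: "smooth_with B f" "smooth_with B g" "h = (\<lambda>x. f x + g x)" by blast
  then have "partial_deriv i h = (\<lambda>x. partial_deriv i f x + partial_deriv i g x)"
    by (simp add: partial_deriv_add smooth_withD(1))
  then show "\<exists>f g. smooth_with B f \<and> smooth_with B g \<and> partial_deriv i h = (\<lambda>x. f x + g x)"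
    using fg smooth_withD(3) by blast
next
  fix h x assume "\<exists>f g. smooth_with B f \<and> smooth_with B g \<and> h = (\<lambda>x. f x + g x)"
  then obtain f g where fg: "smooth_with B f" "smooth_with B g" "h = (\<lambda>x. f x + g x)" by blast
  show "h differentiable (at x)" using fg by (simp add: smooth_withD(1))
  show "B h" unfolding fg(3) by (rule add[OF smooth_withD(2)[OF fg(1)] smooth_withD(2)[OF fg(2)]])
qed

lemma smooth_with_const:
  assumes "B (\<lambda>x. c)" "B (\<lambda>x. 0)"
  shows "smooth_with B (\<lambda>x. c)"
  by (rule smooth_with_coinduct[where A = "\<lambda>h. h = (\<lambda>x. c) \<or> h = (\<lambda>x. 0)"])
     (use assms in \<open>auto simp: partial_deriv_const\<close>)

lemma smooth_with_linear:
  fixes f :: "real^'n::finite \<Rightarrow> complex"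
  assumes f: "bounded_linear f" "B f" "\<And>c. B (\<lambda>x. c)"
  shows "smooth_with B f"
proof (rule smooth_with_coinduct[where A = "\<lambda>h. h = f \<or> (\<exists>c. h = (\<lambda>x. c))"])
  have D: "(f has_derivative f) (at x)" for x
    using f(1) by (rule bounded_linear_imp_has_derivative)
  fix g x i assume g: "g = f \<or> (\<exists>c. g = (\<lambda>x. c))"
  show "g differentiable (at x)" using g D by (auto intro: differentiableI)
  show "B g" using g f by auto
  have "partial_deriv i f = (\<lambda>x. f (axis i 1))"
    using partial_deriv_eq[OF D] by blast
  then show "partial_deriv i g = f \<or> (\<exists>c. partial_deriv i g = (\<lambda>x. c))"
    using g by (auto simp: partial_deriv_const)
qed simp

text \<open>\<open>G k\<close> plays the k-th derivative of \<open>G 0\<close>. Differentiating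
  \<open>u * G k (q x)\<close> yields the derivative of \<open>u\<close> times
  \<open>G k (q x)\<close> plus \<open>u\<close> times the derivative of \<open>q\<close> times
  \<open>G (Suc k) (q x)\<close>, again a sum of products of a smooth function and some
  \<open>G k (q x)\<close>.\<close>

lemma smooth_with_compose:
  fixes q :: "real^'n::finite \<Rightarrow> real"
  assumes q: "smooth_with B (\<lambda>x. of_real (q x))"
    and G: "\<And>k x. (G k has_real_derivative G (Suc k) (q x)) (at (q x))"
    and BG: "\<And>k. B (\<lambda>x. of_real (G k (q x)))" and B1: "B (\<lambda>x. 1)" "B (\<lambda>x. 0)"
    and add: "\<And>u v. B u \<Longrightarrow> B v \<Longrightarrow> B (\<lambda>x. u x + v x)"
    and mult: "\<And>u v. B u \<Longrightarrow> B v \<Longrightarrow> B (\<lambda>x. u x * v x)"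
  shows "smooth_with B (\<lambda>x. of_real (G 0 (q x)))"
proof -
  let ?Q = "\<lambda>h. \<exists>k. h = (\<lambda>x. complex_of_real (G k (q x)))"
  have qd: "((\<lambda>x. complex_of_real (q x)) has_derivative
      frechet_derivative (\<lambda>x. complex_of_real (q x)) (at x)) (at x)" for x
    using smooth_withD(1)[OF q] frechet_derivative_works by blast
  have qd': "(q has_derivative (\<lambda>h. Re (frechet_derivative (\<lambda>x. complex_of_real (q x)) (at x) h))) (at x)" for x
    using bounded_linear.has_derivative[OF bounded_linear_Re qd[of x]] by simp
  have Gd: "((\<lambda>x. complex_of_real (G k (q x))) has_derivative
     (\<lambda>h. complex_of_real (G (Suc k) (q x) * Re (frechet_derivative (\<lambda>x. complex_of_real (q x)) (at x) h)))) (at x)" for k x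
    by (rule has_derivative_of_real, rule has_derivative_compose[OF qd', of "G k" "\<lambda>h. G (Suc k) (q x) * h"])
       (use G in \<open>simp add: has_field_derivative_def\<close>)
  \<comment> \<open>\<open>q\<close> is real valued but is differentiated as a complex function; its
    derivative must be seen to be real before it can be matched with the real chain rule for
    \<open>G\<close>.\<close>
  have real: "Im (frechet_derivative (\<lambda>x. complex_of_real (q x)) (at x) h) = 0" for x h
  proof -
    have "((\<lambda>x. Im (complex_of_real (q x))) has_derivative
        (\<lambda>h. Im (frechet_derivative (\<lambda>x. complex_of_real (q x)) (at x) h))) (at x)"
      by (rule bounded_linear.has_derivative[OF bounded_linear_Im qd])
    then have "(\<lambda>h. Im (frechet_derivative (\<lambda>x. complex_of_real (q x)) (at x) h)) = (\<lambda>_. 0)"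
      unfolding Im_complex_of_real by (rule has_derivative_unique) (rule has_derivative_const)
    then show ?thesis by (rule fun_cong)
  qed
  have pd: "partial_deriv i (\<lambda>x. complex_of_real (G k (q x))) =
      (\<lambda>x. partial_deriv i (\<lambda>x. of_real (q x)) x * of_real (G (Suc k) (q x)))" for i k
  proof
    fix x
    show "partial_deriv i (\<lambda>x. complex_of_real (G k (q x))) x =
      partial_deriv i (\<lambda>x. of_real (q x)) x * of_real (G (Suc k) (q x))"
      using partial_deriv_eq[OF Gd, of i k x] real[of x "axis i 1"]
      by (simp add: partial_deriv_def complex_eq_iff)
  qed
  \<comment> \<open>The factor 1 brings the composition into the form smooth function times
    \<open>G k (q x)\<close>.\<close>
  have "smooth_with B (\<lambda>x. 1 * complex_of_real (G 0 (q x)))"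
  proof (rule smooth_with_product_sums[where P = "smooth_with B" and Q = ?Q])
    show "product_sums (smooth_with B) ?Q (\<lambda>x. 1 * complex_of_real (G 0 (q x)))"
      using B1 by (intro product_sums.prod smooth_with_const) blast+
    show "g differentiable (at x)" if "?Q g" for g x
      using that Gd by (auto simp: differentiable_def)
    show "product_sums (smooth_with B) ?Q (\<lambda>x. partial_deriv i u x * v x + u x * partial_deriv i v x)"
      if u: "smooth_with B u" and v: "?Q v" for u v i
    proof (rule product_sums.sum)
      show "product_sums (smooth_with B) ?Q (\<lambda>x. partial_deriv i u x * v x)"
        by (rule product_sums.prod[of "smooth_with B" "partial_deriv i u" ?Q v]) (fact smooth_withD(3)[OF u] v)+
      obtain k where k: "v = (\<lambda>x. complex_of_real (G k (q x)))" using v by blast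
      have "product_sums (smooth_with B) ?Q
        (\<lambda>x. (u x * partial_deriv i (\<lambda>x. of_real (q x)) x) * of_real (G (Suc k) (q x)))"
      proof (rule product_sums.prod)
        show "smooth_with B (\<lambda>x. u x * partial_deriv i (\<lambda>x. of_real (q x)) x)"
          by (rule smooth_with_mult[OF u smooth_withD(3)[OF q]]) (use add mult in auto)
      qed blast
      then show "product_sums (smooth_with B) ?Q (\<lambda>x. u x * partial_deriv i v x)"
        unfolding k pd by (simp add: mult.assoc)
    qed
  next
    show "B (\<lambda>x. u x * v x)" if u: "smooth_with B u" and v: "?Q v" for u v
    proof -
      obtain k where k: "v = (\<lambda>x. complex_of_real (G k (q x)))" using v by blast
      show ?thesis unfolding k by (rule mult[OF smooth_withD(2)[OF u] BG])
    qed
  qed (use add smooth_withD(1) in auto)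
  then show ?thesis by simp
qed

lemma smooth_with_affine:
  assumes f: "smooth_with B f" and B: "\<And>d u. B u \<Longrightarrow> B' (\<lambda>x. of_real d * u (c *\<^sub>R x + h))"
  shows "smooth_with B' (\<lambda>x. f (c *\<^sub>R x + h))"
\<comment> \<open>Each derivative contributes one more factor \<open>c\<close>; the scalar
  \<open>d\<close> in the invariant collects them.\<close>
proof (rule smooth_with_coinduct[where A = "\<lambda>g. \<exists>d f. smooth_with B f \<and> g = (\<lambda>x. of_real d * f (c *\<^sub>R x + h))"])
  show "\<exists>d f'. smooth_with B f' \<and> (\<lambda>x. f (c *\<^sub>R x + h)) = (\<lambda>x. complex_of_real d * f' (c *\<^sub>R x + h))"
    using f by (intro exI[of _ 1] exI[of _ f]) auto
next
  fix g i assume "\<exists>d f. smooth_with B f \<and> g = (\<lambda>x. complex_of_real d * f (c *\<^sub>R x + h))"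
  then obtain d f where f: "smooth_with B f" "g = (\<lambda>x. of_real d * f (c *\<^sub>R x + h))" by blast
  then have "partial_deriv i g = (\<lambda>x. of_real (d * c) * partial_deriv i f (c *\<^sub>R x + h))"
    by (simp add: partial_deriv_cmult differentiable_affine partial_deriv_affine smooth_withD(1) mult.assoc)
  then show "\<exists>d f. smooth_with B f \<and> partial_deriv i g = (\<lambda>x. complex_of_real d * f (c *\<^sub>R x + h))"
    using f smooth_withD(3) by blast
next
  fix g x assume "\<exists>d f. smooth_with B f \<and> g = (\<lambda>x. complex_of_real d * f (c *\<^sub>R x + h))"
  then obtain d f where f: "smooth_with B f" "g = (\<lambda>x. of_real d * f (c *\<^sub>R x + h))" by blast
  show "g differentiable (at x)" using f by (simp add: smooth_withD(1) differentiable_affine)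
  show "B' g" unfolding f(2) by (rule B[OF smooth_withD(2)[OF f(1)]])
qed

lemma smooth_with_cnj:
  assumes "smooth_with B f" and B: "\<And>u. B u \<Longrightarrow> B (\<lambda>x. cnj (u x))"
  shows "smooth_with B (\<lambda>x. cnj (f x))"
proof (rule smooth_with_coinduct[where A = "\<lambda>g. \<exists>f. smooth_with B f \<and> g = (\<lambda>x. cnj (f x))"])
  show "\<exists>f'. smooth_with B f' \<and> (\<lambda>x. cnj (f x)) = (\<lambda>x. cnj (f' x))"
    using assms(1) by blast
next
  fix g x i assume "\<exists>f. smooth_with B f \<and> g = (\<lambda>x. cnj (f x))"
  then obtain f where f: "smooth_with B f" "g = (\<lambda>x. cnj (f x))" by blast
  show "g differentiable (at x)" using f by (simp add: smooth_withD(1) differentiable_cnj)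
  show "B g" unfolding f(2) by (rule B[OF smooth_withD(2)[OF f(1)]])
  have "partial_deriv i g = (\<lambda>x. cnj (partial_deriv i f x))"
    unfolding f(2) by (rule partial_deriv_cnj[OF smooth_withD(1)[OF f(1)]])
  then show "\<exists>f. smooth_with B f \<and> partial_deriv i g = (\<lambda>x. cnj (f x))"
    using smooth_withD(3)[OF f(1)] by blast
qed

lemma partial_derivs_affine:
  assumes "smooth f"
  shows "partial_derivs \<alpha> (\<lambda>x. f (c *\<^sub>R x + h)) =
    (\<lambda>x. of_real (c ^ length \<alpha>) * partial_derivs \<alpha> f (c *\<^sub>R x + h))"
proof (induction \<alpha>)
  case (Cons i \<alpha>)
  have d: "partial_derivs \<alpha> f differentiable (at x)" for x using assms by (simp add: smooth_def)
  show ?case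
    unfolding partial_derivs_Cons Cons
    using d by (simp add: partial_deriv_cmult partial_deriv_affine differentiable_affine mult_ac)
qed simp

lemma smooth_add: "smooth f \<Longrightarrow> smooth g \<Longrightarrow> smooth (\<lambda>x. f x + g x)"
  unfolding smooth_with_True by (rule smooth_with_add) auto

lemma smooth_mult: "smooth f \<Longrightarrow> smooth g \<Longrightarrow> smooth (\<lambda>x. f x * g x)"
  unfolding smooth_with_True by (rule smooth_with_mult) auto

lemma smooth_const: "smooth (\<lambda>x. c)"
  unfolding smooth_with_True by (rule smooth_with_const) auto

lemma smooth_affine: "smooth f \<Longrightarrow> smooth (\<lambda>x. f (c *\<^sub>R x + h))"
  unfolding smooth_with_True by (rule smooth_with_affine) auto

lemma smooth_prod:
  "(\<And>i. i \<in> F \<Longrightarrow> smooth (f i)) \<Longrightarrow> smooth (\<lambda>x. \<Prod>i\<in>F. f i x)"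
  by (induction F rule: infinite_finite_induct) (auto intro: smooth_mult smooth_const)

lemma smooth_sum:
  "(\<And>i. i \<in> F \<Longrightarrow> smooth (f i)) \<Longrightarrow> smooth (\<lambda>x. \<Sum>i\<in>F. f i x)"
  by (induction F rule: infinite_finite_induct) (auto intro: smooth_add smooth_const)

lemma smooth_imp_continuous: "smooth f \<Longrightarrow> continuous_on UNIV f"
  using differentiable_imp_continuous_within[of f] smooth_withD(1)[of _ f]
  by (auto simp: smooth_with_True continuous_on_eq_continuous_within)

lemma smooth_partial_derivs: "smooth f \<Longrightarrow> smooth (partial_derivs \<alpha> f)"
  unfolding smooth_with_True by (rule smooth_withD)

subsection \<open>Cutoff functions\<close>

text \<open>Serves twice: exponent -1 gives the quotients in the cutoff functions, and general real
  exponents give the brackets in the weight. The growth condition concerns all powers of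
  \<open>q\<close> at once because each derivative lowers the exponent by one.\<close>

lemma smooth_powr:
  fixes q :: "real^'n::finite \<Rightarrow> real"
  assumes q: "smooth_with B (\<lambda>x. of_real (q x))" and pos: "\<And>x. q x > 0"
    and BG: "\<And>b c. B (\<lambda>x. of_real (c * q x powr b))" and B1: "B (\<lambda>x. 1)" "B (\<lambda>x. 0)"
    and add: "\<And>u v. B u \<Longrightarrow> B v \<Longrightarrow> B (\<lambda>x. u x + v x)"
    and mult: "\<And>u v. B u \<Longrightarrow> B v \<Longrightarrow> B (\<lambda>x. u x * v x)"
  shows "smooth_with B (\<lambda>x. of_real (q x powr a))"
proof -
  \<comment> \<open>The k-th derivative of \<open>t powr a\<close>, with the falling factorial of
    \<open>a\<close> as coefficient.\<close>
  define G :: "nat \<Rightarrow> real \<Rightarrow> real" where "G k t = (\<Prod>i<k. a - of_nat i) * t powr (a - of_nat k)" for k t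
  have "smooth_with B (\<lambda>x. of_real (G 0 (q x)))"
  proof (rule smooth_with_compose[OF q])
    show "(G k has_real_derivative G (Suc k) (q x)) (at (q x))" for k x
      unfolding G_def using pos[of x]
      by (auto intro!: derivative_eq_intros simp: diff_diff_eq algebra_simps)
    show "B (\<lambda>x. complex_of_real (G k (q x)))" for k
      unfolding G_def by (rule BG)
  qed (use B1 add mult in auto)
  then show ?thesis by (simp add: G_def)
qed

text \<open>For \<open>p = 1\<close> this is the classical function exp(-1/t), extended by 0 and
  flat at the origin. The polynomial in 1/t is carried along to make the family closed under
  differentiation.\<close>

definition flat :: "real poly \<Rightarrow> real \<Rightarrow> real" where
  "flat p t = (if t > 0 then poly p (1 / t) * exp (- 1 / t) else 0)"

lemma poly_exp_tendsto_0: "((\<lambda>y. poly p y * exp (- y)) \<longlongrightarrow> (0::real)) at_top"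
proof -
  have "((\<lambda>y. \<Sum>i\<le>degree p. coeff p i * (y ^ i / exp y)) \<longlongrightarrow> (\<Sum>i\<le>degree p. coeff p i * 0)) at_top"
    by (intro tendsto_intros tendsto_power_div_exp_0)
  then show ?thesis
    by (simp add: poly_altdef exp_minus sum_distrib_right divide_inverse mult.assoc)
qed

lemma flat_tendsto_0: "(flat p \<longlongrightarrow> 0) (at 0)"
proof (rule filterlim_split_at)
  show "(flat p \<longlongrightarrow> 0) (at_left 0)"
    by (rule tendsto_eventually) (auto simp: flat_def eventually_at_left_field intro: exI[of _ "-1"])
  have "((\<lambda>t. poly p (1 / t) * exp (- (1 / t))) \<longlongrightarrow> 0) (at_right 0)"
    by (rule filterlim_compose[OF poly_exp_tendsto_0])
       (simp add: divide_inverse filterlim_inverse_at_top_right)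
  then show "(flat p \<longlongrightarrow> 0) (at_right 0)"
    by (rule Lim_transform_eventually)
       (auto simp: flat_def eventually_at_right_field intro: exI[of _ "1"])
qed

text \<open>For t > 0 the derivative of p(1/t) exp(-1/t) is (1/t)^2 (p - p')(1/t) exp(-1/t), and
  \<open>[:0, 0, 1:]\<close> is the square of the variable 1/t.\<close>

lemma has_derivative_flat:
  "(flat p has_real_derivative flat ([:0, 0, 1:] * (p - pderiv p)) t) (at t)"
proof -
  consider "t > 0" | "t = 0" | "t < 0" by linarith
  then show ?thesis
  proof cases
    case 1
    have "((\<lambda>t. poly p (1 / t) * exp (- 1 / t)) has_real_derivative
        flat ([:0, 0, 1:] * (p - pderiv p)) t) (at t)"
      using 1 by (auto intro!: derivative_eq_intros poly_DERIV
          simp: flat_def field_simps power2_eq_square)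
    then show ?thesis
      by (rule has_field_derivative_transform_within_open[of _ _ _ "{0<..}"]) (use 1 in \<open>auto simp: flat_def\<close>)
  next
    case 2
    \<comment> \<open>At 0 the difference quotient is \<open>flat p h / h\<close>, and the division
      by \<open>h\<close> is absorbed into the polynomial as one more factor 1/h.\<close>
    have "((\<lambda>h. (flat p (0 + h) - flat p 0) / h) \<longlongrightarrow> 0) (at 0)"
    proof (rule Lim_transform_eventually[OF flat_tendsto_0[of "[:0, 1:] * p"]])
      show "\<forall>\<^sub>F h in at 0. flat ([:0, 1:] * p) h = (flat p (0 + h) - flat p 0) / h"
        by (auto simp: eventually_at_filter flat_def)
    qed
    then show ?thesis using 2 by (simp add: DERIV_def flat_def)
  next
    case 3
    have "((\<lambda>t. 0) has_real_derivative flat ([:0, 0, 1:] * (p - pderiv p)) t) (at t)"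
      using 3 by (simp add: flat_def)
    then show ?thesis
      by (rule has_field_derivative_transform_within_open[of _ _ _ "{..<0}"]) (use 3 in \<open>auto simp: flat_def\<close>)
  qed
qed

lemma smooth_flat:
  fixes q :: "real^'n::finite \<Rightarrow> real"
  assumes q: "smooth (\<lambda>x. of_real (q x))"
  shows "smooth (\<lambda>x. of_real (flat p (q x)))"
proof -
  define P where "P k = ((\<lambda>p. [:0, 0, 1:] * (p - pderiv p)) ^^ k) p" for k
  have "smooth_with (\<lambda>_. True) (\<lambda>x. of_real (flat (P 0) (q x)))"
    by (rule smooth_with_compose[where G = "\<lambda>k. flat (P k)"])
       (use q has_derivative_flat in \<open>auto simp: P_def smooth_with_True\<close>)
  then show ?thesis by (simp add: P_def smooth_with_True)
qed

lemma smooth_linear: "bounded_linear f \<Longrightarrow> smooth f"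
  unfolding smooth_with_True by (rule smooth_with_linear) auto

lemma smooth_norm_square: "smooth (\<lambda>x::real^'n::finite. of_real (x \<bullet> x))"
proof -
  have "smooth (\<lambda>x::real^'n. \<Sum>i\<in>UNIV. of_real (x $ i) * of_real (x $ i))"
    by (intro smooth_sum smooth_mult smooth_linear bounded_linear_of_real
        bounded_linear_compose[OF bounded_linear_of_real bounded_linear_vec_nth])
  then show ?thesis by (simp add: inner_vec_def)
qed

lemma ball_bump:
  fixes c :: "real^'n::finite"
  assumes r: "r > 0"
  shows "\<exists>b :: real^'n \<Rightarrow> real. smooth (\<lambda>x. of_real (b x)) \<and> (\<forall>x. 0 \<le> b x \<and> b x \<le> 1) \<and>
    (\<forall>x. dist c x \<le> r \<longrightarrow> b x = 1) \<and> (\<forall>x. dist c x \<ge> 2 * r \<longrightarrow> b x = 0)"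
proof -
  \<comment> \<open>Chosen so that \<open>q x \<ge> 1\<close> on the closed ball of radius r and
    \<open>q x \<le> 0\<close> from distance sqrt 2 * r on, hence from 2 * r on; the squared
    distance keeps it smooth at the centre. The bump is the quotient of \<open>flat 1 (q x)\<close>
    by \<open>flat 1 (q x) + flat 1 (1 - q x)\<close>, whose denominator is positive since
    \<open>q x\<close> and \<open>1 - q x\<close> are never both nonpositive.\<close>
  define q where "q x = 2 - (x - c) \<bullet> (x - c) / r\<^sup>2" for x :: "real^'n"
  have q: "smooth (\<lambda>x. complex_of_real (q x))"
    using smooth_add[OF smooth_const[of 2] smooth_mult[OF smooth_const[of "- 1 / r\<^sup>2"]
      smooth_affine[OF smooth_norm_square, of 1 "- c"]]]
    by (simp add: q_def)
  have q1: "smooth (\<lambda>x. complex_of_real (1 - q x))"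
    using smooth_add[OF smooth_const[of 1] smooth_mult[OF smooth_const[of "- 1"] q]] by simp
  define d where "d x = flat 1 (q x) + flat 1 (1 - q x)" for x
  have flat: "flat 1 t \<ge> 0" "t > 0 \<Longrightarrow> flat 1 t > 0" for t by (auto simp: flat_def)
  have dpos: "d x > 0" for x
    unfolding d_def using flat[of "q x"] flat[of "1 - q x"] by (cases "q x > 0") (auto intro: add_pos_nonneg add_nonneg_pos)
  have d: "smooth (\<lambda>x. complex_of_real (d x))"
    unfolding d_def of_real_add by (intro smooth_add smooth_flat q q1)
  have "smooth (\<lambda>x. complex_of_real (d x powr (-1)))"
    unfolding smooth_with_True by (rule smooth_powr) (use d dpos in \<open>auto simp: smooth_with_True\<close>)
  then have s: "smooth (\<lambda>x. complex_of_real (flat 1 (q x) / d x))"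
    using smooth_mult[OF smooth_flat[OF q, of 1]] dpos
    by (simp add: powr_minus_divide less_imp_le divide_inverse)
  have dist: "(x - c) \<bullet> (x - c) = (dist c x)\<^sup>2" for x
    using power2_norm_eq_inner[of "x - c"] by (simp add: dist_norm norm_minus_commute)
  show ?thesis
  proof (intro exI[of _ "\<lambda>x. flat 1 (q x) / d x"] conjI allI impI s)
    show "0 \<le> flat 1 (q x) / d x" "flat 1 (q x) / d x \<le> 1" for x
      using dpos[of x] flat(1)[of "q x"] flat(1)[of "1 - q x"] by (auto simp: d_def field_simps)
    show "flat 1 (q x) / d x = 1" if "dist c x \<le> r" for x
    proof -
      have "(dist c x)\<^sup>2 \<le> r\<^sup>2" using that by (intro power_mono) auto
      then have "q x \<ge> 1" using r by (simp add: q_def dist field_simps)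
      then show ?thesis using flat(2)[of "q x"] by (simp add: d_def flat_def)
    qed
    show "flat 1 (q x) / d x = 0" if "dist c x \<ge> 2 * r" for x
    proof -
      have "2 * r\<^sup>2 \<le> (2 * r)\<^sup>2" by (simp add: power2_eq_square)
      also have "\<dots> \<le> (dist c x)\<^sup>2" using that r by (intro power_mono) auto
      finally have "q x \<le> 0" using r by (simp add: q_def dist field_simps)
      then show ?thesis by (simp add: flat_def)
    qed
  qed
qed

section \<open>Supports, test functions and cutoffs near compact sets\<close>

lemma function_support_subset: "closed L \<Longrightarrow> function_support f \<subseteq> L \<longleftrightarrow> (\<forall>x. x \<notin> L \<longrightarrow> f x = 0)"
proof -
  assume "closed L"
  then have "closure {x. f x \<noteq> 0} \<subseteq> L \<longleftrightarrow> {x. f x \<noteq> 0} \<subseteq> L"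
    using closure_minimal closure_subset by (metis subset_trans)
  then show ?thesis unfolding function_support_def by blast
qed

lemma outside_function_support: "x \<notin> function_support f \<Longrightarrow> f x = 0"
  using closure_subset[of "{x. f x \<noteq> 0}"] unfolding function_support_def by blast

lemma test_functionsI:
  assumes "smooth \<phi>" "compact L" "\<And>x. x \<notin> L \<Longrightarrow> \<phi> x = 0"
  shows "\<phi> \<in> test_functions"
proof -
  have "function_support \<phi> \<subseteq> L"
    using assms function_support_subset[of L \<phi>] compact_imp_closed[of L] by auto
  then have "compact (function_support \<phi>)"
    using assms(2) bounded_subset compact_imp_bounded unfolding function_support_def compact_eq_bounded_closed by blast
  then show ?thesis using assms(1) by (simp add: test_functions_def)
qed

lemma test_functionsD:
  assumes "\<phi> \<in> test_functions"
  shows "smooth \<phi>" "compact (function_support \<phi>)"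
  using assms by (auto simp: test_functions_def)

text \<open>A smooth substitute for the maximum: the expression is 1 wherever one \<open>b i\<close>
  is 1 and 0 wherever all of them vanish.\<close>

lemma finite_cutoff:
  fixes b :: "'i \<Rightarrow> real^'n::finite \<Rightarrow> real"
  assumes "finite I" "\<And>i. i \<in> I \<Longrightarrow> smooth (\<lambda>x. of_real (b i x))" "\<And>i x. i \<in> I \<Longrightarrow> 0 \<le> b i x \<and> b i x \<le> 1"
  shows "smooth (\<lambda>x. complex_of_real (1 - (\<Prod>i\<in>I. 1 - b i x)))"
    "0 \<le> 1 - (\<Prod>i\<in>I. 1 - b i x)" "1 - (\<Prod>i\<in>I. 1 - b i x) \<le> 1"
proof -
  have c: "smooth (\<lambda>x. 1 - f x)" if "smooth f" for f :: "real^'n \<Rightarrow> complex"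
    using smooth_add[OF smooth_const[of 1] smooth_mult[OF smooth_const[of "- 1"] that]] by simp
  show "smooth (\<lambda>x. complex_of_real (1 - (\<Prod>i\<in>I. 1 - b i x)))"
    using assms by (simp, intro c smooth_prod) auto
  show "0 \<le> 1 - (\<Prod>i\<in>I. 1 - b i x)" using prod_le_1[of I "\<lambda>i. 1 - b i x"] assms by auto
  show "1 - (\<Prod>i\<in>I. 1 - b i x) \<le> 1" using assms by (auto intro!: prod_nonneg)
qed

text \<open>The value 1 is attained on an open neighbourhood \<open>V\<close> of \<open>C\<close>.
  Multiplication by \<open>1 - b\<close> therefore moves a closed support off \<open>C\<close>,
  which is what pairing with a distribution supported in \<open>C\<close> requires.\<close>

lemma cutoff_function:
  fixes C S :: "(real^'n::finite) set"
  assumes "compact C" "open S" "C \<subseteq> S"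
  obtains b :: "real^'n \<Rightarrow> real" and V where "(\<lambda>x. of_real (b x)) \<in> test_functions" "open V" "C \<subseteq> V"
    "\<And>x. x \<in> V \<Longrightarrow> b x = 1" "\<And>x. 0 \<le> b x \<and> b x \<le> 1" "function_support (\<lambda>x. of_real (b x)) \<subseteq> S"
proof -
  have "\<forall>x\<in>C. \<exists>r>0. cball x r \<subseteq> S" using assms open_contains_cball by blast
  then obtain r where r: "\<And>x. x \<in> C \<Longrightarrow> r x > 0 \<and> cball x (r x) \<subseteq> S" by metis
  have cov: "C \<subseteq> (\<Union>x\<in>C. ball x (r x / 2))"
  proof
    fix x assume "x \<in> C"
    then show "x \<in> (\<Union>x\<in>C. ball x (r x / 2))" using r by (intro UN_I[of x]) auto
  qed
  obtain D where D: "D \<subseteq> C" "finite D" "C \<subseteq> (\<Union>x\<in>D. ball x (r x / 2))"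
    by (rule compactE_image[OF assms(1) _ cov]) auto
  define P where "P c b \<longleftrightarrow> smooth (\<lambda>x. of_real (b x)) \<and> (\<forall>x. 0 \<le> b x \<and> b x \<le> 1) \<and>
    (\<forall>x. dist c x \<le> r c / 2 \<longrightarrow> b x = 1) \<and> (\<forall>x. dist c x \<ge> r c \<longrightarrow> b x = 0)"
    for c and b :: "real^'n \<Rightarrow> real"
  have "\<forall>c\<in>D. \<exists>b. P c b"
    using ball_bump[of "r _ / 2"] r D(1) unfolding P_def by fastforce
  then obtain b where "\<forall>c\<in>D. P c (b c)" using bchoice[of D P] by blast
  then have b: "smooth (\<lambda>x. of_real (b c x))" "0 \<le> b c x \<and> b c x \<le> 1"
    "dist c x \<le> r c / 2 \<Longrightarrow> b c x = 1" "dist c x \<ge> r c \<Longrightarrow> b c x = 0" if "c \<in> D" for c x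
    using that unfolding P_def by blast+
  define f where "f x = 1 - (\<Prod>c\<in>D. 1 - b c x)" for x
  define L where "L = (\<Union>c\<in>D. cball c (r c))"
  have L: "compact L" "L \<subseteq> S" using D r by (auto simp: L_def)
  have fL: "f x = 0" if "x \<notin> L" for x
    using that b by (auto simp: f_def L_def intro!: prod.neutral)
  show ?thesis
  proof (rule that)
    show "(\<lambda>x. complex_of_real (f x)) \<in> test_functions"
      by (rule test_functionsI[OF _ L(1)]) (use finite_cutoff[of D b] D b fL in \<open>auto simp: f_def\<close>)
    show "open (\<Union>x\<in>D. ball x (r x / 2))" by auto
    show "C \<subseteq> (\<Union>x\<in>D. ball x (r x / 2))" by fact
    show "f x = 1" if x: "x \<in> (\<Union>x\<in>D. ball x (r x / 2))" for x
    proof -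
      obtain c where "c \<in> D" "dist c x < r c / 2" using x by auto
      then have "\<exists>c\<in>D. 1 - b c x = 0" using b[of c] by force
      then show ?thesis using D(2) by (simp add: f_def)
    qed
    show "0 \<le> f x \<and> f x \<le> 1" for x using finite_cutoff[of D b] D b by (auto simp: f_def)
    show "function_support (\<lambda>x. complex_of_real (f x)) \<subseteq> S"
      using function_support_subset[of L "\<lambda>x. complex_of_real (f x)"] fL L compact_imp_closed by auto
  qed
qed

section \<open>Schwartz functions\<close>

definition rapid :: "(real^'n::finite \<Rightarrow> complex) \<Rightarrow> bool" where
  "rapid f \<longleftrightarrow> (\<forall>k. \<exists>C. \<forall>x. (1 + norm x) ^ k * cmod (f x) \<le> C)"

text \<open>\<open>smooth_with slow\<close> is the multiplier space of the Schwartz functions,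
  commonly called O_M: every derivative has polynomial growth, with an exponent that may depend on
  the derivative.\<close>

definition slow :: "(real^'n::finite \<Rightarrow> complex) \<Rightarrow> bool" where
  "slow f \<longleftrightarrow> (\<exists>C N. \<forall>x. cmod (f x) \<le> C * (1 + norm x) ^ N)"

lemma schwartz_functions_iff: "\<phi> \<in> schwartz_functions \<longleftrightarrow> smooth_with rapid \<phi>"
proof -
  have "bounded (range (\<lambda>x. (1 + norm x) ^ k *\<^sub>R f x)) \<longleftrightarrow> (\<exists>C. \<forall>x. (1 + norm x) ^ k * cmod (f x) \<le> C)"
    for k and f :: "real^'n \<Rightarrow> complex"
    by (auto simp: bounded_iff)
  then show ?thesis
    unfolding schwartz_functions_def smooth_def smooth_with_def rapid_def by blast
qed

lemma rapid_add: "rapid f \<Longrightarrow> rapid g \<Longrightarrow> rapid (\<lambda>x. f x + g x)"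
  unfolding rapid_def
proof (intro allI)
  fix k assume "\<forall>k. \<exists>C. \<forall>x. (1 + norm x) ^ k * cmod (f x) \<le> C" "\<forall>k. \<exists>C. \<forall>x. (1 + norm x) ^ k * cmod (g x) \<le> C"
  then obtain C D where CD: "\<And>x. (1 + norm x) ^ k * cmod (f x) \<le> C" "\<And>x. (1 + norm x) ^ k * cmod (g x) \<le> D" by metis
  have "(1 + norm x) ^ k * cmod (f x + g x) \<le> C + D" for x
  proof -
    have "(1 + norm x) ^ k * cmod (f x + g x) \<le> (1 + norm x) ^ k * (cmod (f x) + cmod (g x))"
      by (intro mult_left_mono norm_triangle_ineq) auto
    then show ?thesis using CD[of x] by (simp add: distrib_left)
  qed
  then show "\<exists>C. \<forall>x. (1 + norm x) ^ k * cmod (f x + g x) \<le> C" by blast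
qed

lemma rapid_mult_slow:
  assumes "rapid f" "slow g"
  shows "rapid (\<lambda>x. f x * g x)"
  unfolding rapid_def
proof
  fix k
  obtain D N where D: "\<And>x. cmod (g x) \<le> D * (1 + norm x) ^ N" using assms(2) unfolding slow_def by blast
  obtain C where C: "\<And>x. (1 + norm x) ^ (k + N) * cmod (f x) \<le> C" using assms(1) unfolding rapid_def by blast
  have D0: "D \<ge> 0" using D[of 0] by (simp add: order_trans[OF norm_ge_zero])
  have "(1 + norm x) ^ k * cmod (f x * g x) \<le> C * D" for x
  proof -
    have "(1 + norm x) ^ k * cmod (f x * g x) \<le> (1 + norm x) ^ k * (cmod (f x) * (D * (1 + norm x) ^ N))"
      unfolding norm_mult by (intro mult_left_mono D) auto
    also have "\<dots> = ((1 + norm x) ^ (k + N) * cmod (f x)) * D" by (simp add: power_add mult_ac)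
    also have "\<dots> \<le> C * D" by (intro mult_right_mono C D0)
    finally show ?thesis .
  qed
  then show "\<exists>C. \<forall>x. (1 + norm x) ^ k * cmod (f x * g x) \<le> C" by blast
qed

lemma rapid_imp_slow: "rapid f \<Longrightarrow> slow f"
  unfolding rapid_def slow_def
proof -
  assume "\<forall>k. \<exists>C. \<forall>x. (1 + norm x) ^ k * cmod (f x) \<le> C"
  then obtain C where "\<forall>x. (1 + norm x) ^ 0 * cmod (f x) \<le> C" by blast
  then show "\<exists>C N. \<forall>x. cmod (f x) \<le> C * (1 + norm x) ^ N" by (intro exI[of _ C] exI[of _ 0]) auto
qed

lemma slow_add:
  assumes "slow f" "slow g"
  shows "slow (\<lambda>x. f x + g x)"
proof -
  obtain C N where C: "\<And>x. cmod (f x) \<le> C * (1 + norm x) ^ N" using assms(1) unfolding slow_def by blast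
  obtain D M where D: "\<And>x. cmod (g x) \<le> D * (1 + norm x) ^ M" using assms(2) unfolding slow_def by blast
  have C0: "C \<ge> 0" using C[of 0] by (simp add: order_trans[OF norm_ge_zero])
  have D0: "D \<ge> 0" using D[of 0] by (simp add: order_trans[OF norm_ge_zero])
  have "cmod (f x + g x) \<le> (C + D) * (1 + norm x) ^ (N + M)" for x
  proof -
    have "cmod (f x + g x) \<le> C * (1 + norm x) ^ N + D * (1 + norm x) ^ M"
      using norm_triangle_ineq[of "f x" "g x"] C[of x] D[of x] by linarith
    also have "\<dots> \<le> C * (1 + norm x) ^ (N + M) + D * (1 + norm x) ^ (N + M)"
      by (intro add_mono mult_left_mono power_increasing C0 D0) auto
    finally show ?thesis by (simp add: distrib_right)
  qed
  then show ?thesis unfolding slow_def by blast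
qed

lemma slow_mult:
  assumes "slow f" "slow g"
  shows "slow (\<lambda>x. f x * g x)"
proof -
  obtain C N where C: "\<And>x. cmod (f x) \<le> C * (1 + norm x) ^ N" using assms(1) unfolding slow_def by blast
  obtain D M where D: "\<And>x. cmod (g x) \<le> D * (1 + norm x) ^ M" using assms(2) unfolding slow_def by blast
  have C0: "C \<ge> 0" using C[of 0] by (simp add: order_trans[OF norm_ge_zero])
  have "cmod (f x * g x) \<le> (C * D) * (1 + norm x) ^ (N + M)" for x
  proof -
    have "cmod (f x * g x) \<le> (C * (1 + norm x) ^ N) * (D * (1 + norm x) ^ M)"
      unfolding norm_mult using C0 by (intro mult_mono C D) auto
    then show ?thesis by (simp add: power_add mult_ac)
  qed
  then show ?thesis unfolding slow_def by blast
qed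

lemma slow_bounded: "(\<And>x. cmod (f x) \<le> C) \<Longrightarrow> slow f"
  unfolding slow_def by (intro exI[of _ C] exI[of _ 0]) auto

lemma slow_linear: "bounded_linear f \<Longrightarrow> slow f"
proof -
  assume "bounded_linear f"
  then obtain K where K: "K \<ge> 0" "\<And>x. cmod (f x) \<le> norm x * K" using bounded_linear.nonneg_bounded by blast
  have "cmod (f x) \<le> K * (1 + norm x) ^ 1" for x using K(1) K(2)[of x] by (simp add: algebra_simps)
  then show ?thesis unfolding slow_def by blast
qed

lemma rapid_cnj: "rapid f \<Longrightarrow> rapid (\<lambda>x. cnj (f x))"
  by (simp add: rapid_def)

lemma rapid_affine:
  assumes f: "rapid f" and c: "c \<noteq> 0"
  shows "rapid (\<lambda>x. of_real d * f (c *\<^sub>R x + h))"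
  unfolding rapid_def
proof
  fix k
  obtain C where C: "\<And>x. (1 + norm x) ^ k * cmod (f x) \<le> C" using f unfolding rapid_def by blast
  \<comment> \<open>From |x| \<le> (|c x + h| + |h|) / |c|: powers of \<open>1 + norm x\<close> are
    controlled by the same powers at the image point.\<close>
  define M where "M = 1 + (1 + norm h) / \<bar>c\<bar>"
  have M: "1 + norm x \<le> M * (1 + norm (c *\<^sub>R x + h))" for x
  proof -
    have "norm (c *\<^sub>R x) \<le> norm (c *\<^sub>R x + h) + norm h"
      using norm_triangle_ineq4[of "c *\<^sub>R x + h" h] by simp
    then have "norm x \<le> (norm (c *\<^sub>R x + h) + norm h) / \<bar>c\<bar>" using c by (simp add: field_simps)
    also have "\<dots> \<le> (1 + norm h) / \<bar>c\<bar> * (1 + norm (c *\<^sub>R x + h))"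
      using c by (simp add: field_simps)
    finally have "norm x \<le> (1 + norm h) / \<bar>c\<bar> * (1 + norm (c *\<^sub>R x + h))" .
    moreover have "M * (1 + norm (c *\<^sub>R x + h)) =
        (1 + norm (c *\<^sub>R x + h)) + (1 + norm h) / \<bar>c\<bar> * (1 + norm (c *\<^sub>R x + h))"
      unfolding M_def by (simp only: distrib_right mult_1)
    ultimately show ?thesis using norm_ge_zero[of "c *\<^sub>R x + h"] by linarith
  qed
  have "(1 + norm x) ^ k * cmod (of_real d * f (c *\<^sub>R x + h)) \<le> \<bar>d\<bar> * (M ^ k * C)" for x
  proof -
    have "(1 + norm x) ^ k * cmod (of_real d * f (c *\<^sub>R x + h))
      \<le> (M * (1 + norm (c *\<^sub>R x + h))) ^ k * cmod (of_real d * f (c *\<^sub>R x + h))"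
      by (intro mult_right_mono power_mono M) auto
    also have "\<dots> = \<bar>d\<bar> * (M ^ k * ((1 + norm (c *\<^sub>R x + h)) ^ k * cmod (f (c *\<^sub>R x + h))))"
      by (simp add: power_mult_distrib norm_mult)
    also have "\<dots> \<le> \<bar>d\<bar> * (M ^ k * C)"
      by (intro mult_left_mono C) (auto simp: M_def)
    finally show ?thesis .
  qed
  then show "\<exists>C. \<forall>x. (1 + norm x) ^ k * cmod (of_real d * f (c *\<^sub>R x + h)) \<le> C" by blast
qed

lemma schwartz_mult_slow:
  "f \<in> schwartz_functions \<Longrightarrow> smooth_with slow g \<Longrightarrow> (\<lambda>x. f x * g x) \<in> schwartz_functions"
  unfolding schwartz_functions_iff by (rule smooth_with_mult[of rapid _ slow]) (auto intro: rapid_add rapid_mult_slow)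

lemma schwartz_imp_slow: "f \<in> schwartz_functions \<Longrightarrow> smooth_with slow f"
  unfolding schwartz_functions_iff by (rule smooth_with_mono[of rapid]) (auto intro: rapid_imp_slow)

lemma schwartz_mult:
  "f \<in> schwartz_functions \<Longrightarrow> g \<in> schwartz_functions \<Longrightarrow> (\<lambda>x. f x * g x) \<in> schwartz_functions"
  by (rule schwartz_mult_slow[OF _ schwartz_imp_slow])

lemma schwartz_add:
  "f \<in> schwartz_functions \<Longrightarrow> g \<in> schwartz_functions \<Longrightarrow> (\<lambda>x. f x + g x) \<in> schwartz_functions"
  unfolding schwartz_functions_iff by (rule smooth_with_add) (auto intro: rapid_add)

lemma smooth_with_slow_const: "smooth_with slow (\<lambda>x. c)"
  by (rule smooth_with_const) (auto intro: slow_bounded)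

lemma smooth_with_slow_add: "smooth_with slow f \<Longrightarrow> smooth_with slow g \<Longrightarrow> smooth_with slow (\<lambda>x. f x + g x)"
  by (rule smooth_with_add) (auto intro: slow_add)

lemma smooth_with_slow_mult: "smooth_with slow f \<Longrightarrow> smooth_with slow g \<Longrightarrow> smooth_with slow (\<lambda>x. f x * g x)"
  by (rule smooth_with_mult[of slow _ slow]) (auto intro: slow_add slow_mult)

lemma smooth_with_slow_linear: "bounded_linear f \<Longrightarrow> smooth_with slow f"
  by (rule smooth_with_linear) (auto intro: slow_linear slow_bounded)

lemma schwartz_cmult: "f \<in> schwartz_functions \<Longrightarrow> (\<lambda>x. c * f x) \<in> schwartz_functions"
  using schwartz_mult_slow[OF _ smooth_with_slow_const, of f c] by (simp add: mult.commute)

lemma schwartz_diff: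
  "f \<in> schwartz_functions \<Longrightarrow> g \<in> schwartz_functions \<Longrightarrow> (\<lambda>x. f x - g x) \<in> schwartz_functions"
  using schwartz_add[OF _ schwartz_cmult, of f g "- 1"] by simp

lemma schwartz_zero: "(\<lambda>x. 0) \<in> schwartz_functions"
  unfolding schwartz_functions_iff by (rule smooth_with_const) (auto simp: rapid_def)

lemma schwartz_sum:
  "(\<And>i. i \<in> F \<Longrightarrow> f i \<in> schwartz_functions) \<Longrightarrow> (\<lambda>x. \<Sum>i\<in>F. f i x) \<in> schwartz_functions"
  by (induction F rule: infinite_finite_induct) (auto intro: schwartz_add schwartz_zero)

lemma schwartz_cnj: "f \<in> schwartz_functions \<Longrightarrow> (\<lambda>x. cnj (f x)) \<in> schwartz_functions"
  unfolding schwartz_functions_iff by (rule smooth_with_cnj) (auto intro: rapid_cnj)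

lemma schwartz_affine:
  "f \<in> schwartz_functions \<Longrightarrow> c \<noteq> 0 \<Longrightarrow> (\<lambda>x. f (c *\<^sub>R x + h)) \<in> schwartz_functions"
  unfolding schwartz_functions_iff by (rule smooth_with_affine[of rapid]) (auto intro: rapid_affine)

lemma schwartz_translate: "f \<in> schwartz_functions \<Longrightarrow> (\<lambda>x. f (x + h)) \<in> schwartz_functions"
  using schwartz_affine[of f 1 h] by simp

lemma schwartz_reflect: "f \<in> schwartz_functions \<Longrightarrow> (\<lambda>x. f (h - x)) \<in> schwartz_functions"
  using schwartz_affine[of f "-1" h] by simp

lemma schwartz_partial_derivs: "f \<in> schwartz_functions \<Longrightarrow> partial_derivs \<alpha> f \<in> schwartz_functions"
  unfolding schwartz_functions_iff by (rule smooth_withD)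

lemma schwartz_partial_deriv: "f \<in> schwartz_functions \<Longrightarrow> partial_deriv i f \<in> schwartz_functions"
  unfolding schwartz_functions_iff by (rule smooth_withD)

lemma schwartz_imp_smooth: "f \<in> schwartz_functions \<Longrightarrow> smooth f"
  by (simp add: schwartz_functions_def)

lemma schwartz_imp_continuous: "f \<in> schwartz_functions \<Longrightarrow> continuous_on UNIV f"
  by (intro smooth_imp_continuous schwartz_imp_smooth)

lemma schwartz_imp_rapid: "f \<in> schwartz_functions \<Longrightarrow> rapid f"
  unfolding schwartz_functions_iff by (rule smooth_withD)

lemma schwartz_measurable [measurable_dest]: "f \<in> schwartz_functions \<Longrightarrow> f \<in> borel_measurable borel"
  by (intro borel_measurable_continuous_onI schwartz_imp_continuous)

lemma schwartz_coordinate: "f \<in> schwartz_functions \<Longrightarrow> (\<lambda>x. of_real (x $ i) * f x) \<in> schwartz_functions"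
  using schwartz_mult_slow[OF _ smooth_with_slow_linear[OF bounded_linear_compose[OF bounded_linear_of_real
    bounded_linear_vec_nth[of i]]], of f]
  by (simp add: mult.commute)

section \<open>Locality of derivatives, and the test functions as a subspace of the Schwartz
  functions\<close>

lemma partial_deriv_zero_on_open:
  assumes "open V" "\<And>x. x \<in> V \<Longrightarrow> f x = 0" "x \<in> V"
  shows "partial_deriv i f x = 0"
proof -
  have "(f has_derivative (\<lambda>_. 0)) (at x)"
    by (rule has_derivative_transform_within_open[of "\<lambda>_. 0" _ _ _ V]) (use assms in auto)
  then show ?thesis using partial_deriv_eq by fastforce
qed

lemma partial_derivs_zero_on_open:
  assumes "open V" "\<And>x. x \<in> V \<Longrightarrow> f x = 0" "x \<in> V"
  shows "partial_derivs \<alpha> f x = 0"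
  using assms(3)
proof (induction \<alpha> arbitrary: x)
  case (Cons i \<alpha>)
  then show ?case using partial_deriv_zero_on_open[OF assms(1), of "partial_derivs \<alpha> f"] by simp
qed (use assms(2) in simp)

lemma partial_derivs_outside_support: "x \<notin> function_support f \<Longrightarrow> partial_derivs \<alpha> f x = 0"
  by (rule partial_derivs_zero_on_open[of "- function_support f"])
     (auto simp: function_support_def intro: outside_function_support[unfolded function_support_def])

lemma test_imp_schwartz:
  assumes "\<phi> \<in> test_functions" shows "\<phi> \<in> schwartz_functions"
proof -
  have "rapid (partial_derivs \<alpha> \<phi>)" for \<alpha>
    unfolding rapid_def
  proof
    fix k
    let ?f = "\<lambda>x. (1 + norm x) ^ k * cmod (partial_derivs \<alpha> \<phi> x)"
    have "continuous_on (function_support \<phi>) ?f"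
      using smooth_imp_continuous[OF smooth_partial_derivs[OF test_functionsD(1)[OF assms]], of \<alpha>]
      by (intro continuous_intros) (auto intro: continuous_on_subset)
    then have "compact (?f ` function_support \<phi>)"
      using compact_continuous_image test_functionsD(2)[OF assms] by blast
    then have "bounded (?f ` function_support \<phi>)" by (rule compact_imp_bounded)
    then obtain C where C: "\<And>x. x \<in> function_support \<phi> \<Longrightarrow> norm (?f x) \<le> C"
      unfolding bounded_iff by blast
    have "?f x \<le> max C 0" for x
      using C[of x] partial_derivs_outside_support[of x \<phi> \<alpha>] by (cases "x \<in> function_support \<phi>") auto
    then show "\<exists>C. \<forall>x. ?f x \<le> C" by blast
  qed
  then show ?thesis
    using test_functionsD(1)[OF assms] unfolding schwartz_functions_iff smooth_with_def smooth_def by blast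
qed

lemma test_mult_smooth:
  assumes "\<phi> \<in> test_functions" "smooth g"
  shows "(\<lambda>x. \<phi> x * g x) \<in> test_functions"
  by (rule test_functionsI[of _ "function_support \<phi>"])
     (use test_functionsD[OF assms(1)] assms in \<open>auto simp: outside_function_support intro: smooth_mult\<close>)

lemma test_add:
  assumes "\<phi> \<in> test_functions" "\<psi> \<in> test_functions"
  shows "(\<lambda>x. \<phi> x + \<psi> x) \<in> test_functions"
  by (rule test_functionsI[of _ "function_support \<phi> \<union> function_support \<psi>"])
     (use test_functionsD assms in \<open>auto simp: outside_function_support intro: smooth_add\<close>)

lemma test_zero: "(\<lambda>x. 0) \<in> test_functions"
  by (rule test_functionsI[of _ "{}"]) (auto intro: smooth_const)

lemma test_cmult: "\<phi> \<in> test_functions \<Longrightarrow> (\<lambda>x. c * \<phi> x) \<in> test_functions"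
  using test_mult_smooth[OF _ smooth_const, of \<phi> c] by (simp add: mult.commute)

lemma test_sum:
  "(\<And>i. i \<in> F \<Longrightarrow> f i \<in> test_functions) \<Longrightarrow> (\<lambda>x. \<Sum>i\<in>F. f i x) \<in> test_functions"
  by (induction F rule: infinite_finite_induct) (auto intro: test_add test_zero)

lemma test_translate:
  assumes "\<phi> \<in> test_functions" shows "(\<lambda>x. \<phi> (x + h)) \<in> test_functions"
proof (rule test_functionsI)
  show "smooth (\<lambda>x. \<phi> (x + h))" using smooth_affine[OF test_functionsD(1)[OF assms], of 1 h] by simp
  show "compact ((\<lambda>x. x - h) ` function_support \<phi>)"
    using test_functionsD(2)[OF assms] by (intro compact_continuous_image continuous_intros)
  show "\<phi> (x + h) = 0" if "x \<notin> (\<lambda>x. x - h) ` function_support \<phi>" for x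
    using that by (intro outside_function_support) (auto simp: image_iff)
qed

subsection \<open>Seminorms\<close>

lemma finite_multi_indices: "finite {\<alpha> :: 'n::finite list. length \<alpha> \<le> m}"
  using finite_lists_length_le[of "UNIV :: 'n set" m] by simp

lemma schwartz_seminorm_upper:
  assumes "\<phi> \<in> schwartz_functions" "length \<alpha> \<le> m"
  shows "(1 + norm x) ^ k * cmod (partial_derivs \<alpha> \<phi> x) \<le> schwartz_seminorm k m \<phi>"
proof -
  let ?t = "\<lambda>\<alpha> x. (1 + norm x) ^ k * cmod (partial_derivs \<alpha> \<phi> x)"
  have bdd: "bdd_above (range (?t \<alpha>))" for \<alpha>
    using schwartz_imp_rapid[OF schwartz_partial_derivs[OF assms(1)], of \<alpha>]
    unfolding rapid_def bdd_above_def by blast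
  have up: "?t \<alpha> x \<le> (SUP x. ?t \<alpha> x)" for \<alpha> x
    using bdd by (intro cSUP_upper) auto
  have nn: "0 \<le> (SUP x. ?t \<alpha> x)" for \<alpha>
    using up[of 0 \<alpha>] by (rule order_trans[rotated]) simp
  have "(SUP x. ?t \<alpha> x) \<le> schwartz_seminorm k m \<phi>"
    unfolding schwartz_seminorm_def
    by (rule member_le_sum[where f = "\<lambda>\<alpha>. SUP x. ?t \<alpha> x"]) (use nn assms finite_multi_indices in auto)
  then show ?thesis using up[of x \<alpha>] by linarith
qed

lemma schwartz_seminorm_least:
  fixes \<phi> :: "real^'n::finite \<Rightarrow> complex"
  assumes "\<And>\<alpha> x. length \<alpha> \<le> m \<Longrightarrow> (1 + norm x) ^ k * cmod (partial_derivs \<alpha> \<phi> x) \<le> M"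
  shows "schwartz_seminorm k m \<phi> \<le> real (card {\<alpha> :: 'n list. length \<alpha> \<le> m}) * M"
  unfolding schwartz_seminorm_def
proof (rule sum_bounded_above)
  fix \<alpha> :: "'n list" assume "\<alpha> \<in> {\<alpha>. length \<alpha> \<le> m}"
  then show "(SUP x. (1 + norm x) ^ k * cmod (partial_derivs \<alpha> \<phi> x)) \<le> M"
    by (intro cSUP_least assms) auto
qed

lemma schwartz_seminorm_nonneg: "\<phi> \<in> schwartz_functions \<Longrightarrow> 0 \<le> schwartz_seminorm k m \<phi>"
  using schwartz_seminorm_upper[where \<alpha> = "[]" and x = 0, of \<phi> m k] by (simp add: order_trans[OF norm_ge_zero])

subsection \<open>Density of the test functions\<close>

text \<open>The errors made by dilated cutoffs and all derivatives of these errors are sums of terms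
  of this shape. A derivative falling on the dilated \<open>m\<close> yields a factor 1/(N+1), which
  is absorbed into \<open>c N\<close>; so one estimate for the whole class replaces a computation
  for each multi-index.\<close>

inductive small_family :: "(nat \<Rightarrow> real^'n::finite \<Rightarrow> complex) \<Rightarrow> bool" where
  base: "\<psi> \<in> schwartz_functions \<Longrightarrow>
    smooth_with (\<lambda>m. bounded (range m) \<and> (\<forall>x\<in>ball 0 1. m x = 0)) m \<Longrightarrow> (\<And>N. \<bar>c N\<bar> \<le> 1) \<Longrightarrow>
    small_family (\<lambda>N x. (of_real (c N) * \<psi> x) * m (inverse (real (Suc N)) *\<^sub>R x))"
| sum: "small_family u \<Longrightarrow> small_family v \<Longrightarrow> small_family (\<lambda>N x. u N x + v N x)"

lemma small_family_differentiable: "small_family u \<Longrightarrow> u N differentiable (at x)"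
proof (induction rule: small_family.induct)
  case (base \<psi> m c)
  show ?case
    using differentiable_affine[of m "inverse (real (Suc N))" 0] base
    by (auto intro!: differentiable_mult simp: schwartz_functions_iff smooth_withD(1))
qed auto

lemma small_family_partial_deriv: "small_family u \<Longrightarrow> small_family (\<lambda>N. partial_deriv i (u N))"
proof (induction rule: small_family.induct)
  case (base \<psi> m c)
  have \<psi>: "\<psi> differentiable (at x)" for x
    using base(1) by (auto simp: schwartz_functions_iff smooth_withD(1))
  have m: "m differentiable (at x)" for x
    using base(2) by (rule smooth_withD(1))
  have "small_family (\<lambda>N x. (of_real (c N) * partial_deriv i \<psi> x) * m (inverse (real (Suc N)) *\<^sub>R x)
     + (of_real (c N * inverse (real (Suc N))) * \<psi> x) * partial_deriv i m (inverse (real (Suc N)) *\<^sub>R x))"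
  proof (intro small_family.sum small_family.base)
    show "\<bar>c N * inverse (real (Suc N))\<bar> \<le> 1" for N
      using base(3)[of N] mult_mono[of "\<bar>c N\<bar>" 1 "inverse (real (Suc N))" 1]
      by (simp add: abs_mult field_simps)
  qed (use base smooth_withD(3)[OF base(2)] in \<open>auto intro: schwartz_partial_deriv\<close>)
  moreover have "partial_deriv i (\<lambda>x. (of_real (c N) * \<psi> x) * m (inverse (real (Suc N)) *\<^sub>R x)) =
    (\<lambda>x. (of_real (c N) * partial_deriv i \<psi> x) * m (inverse (real (Suc N)) *\<^sub>R x)
     + (of_real (c N * inverse (real (Suc N))) * \<psi> x) * partial_deriv i m (inverse (real (Suc N)) *\<^sub>R x))" for N
    using partial_deriv_mult[of "\<lambda>x. of_real (c N) * \<psi> x" "\<lambda>x. m (inverse (real (Suc N)) *\<^sub>R x)" i]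
      partial_deriv_affine[OF m, of i "inverse (real (Suc N))" 0]
      differentiable_affine[OF m, of "inverse (real (Suc N))" 0]
      partial_deriv_cmult[OF \<psi>, of i "of_real (c N)"]
    by (simp add: \<psi> mult_ac)
  ultimately show ?case by simp
next
  case (sum u v)
  then show ?case
    using small_family.sum[OF sum(3,4)]
    by (simp add: partial_deriv_add[OF small_family_differentiable small_family_differentiable])
qed

lemma small_family_bound:
  "small_family u \<Longrightarrow> \<exists>M. \<forall>N x. (1 + norm x) ^ k * cmod (u N x) \<le> M / real (Suc N)"
proof (induction rule: small_family.induct)
  case (base \<psi> m c)
  \<comment> \<open>One power of \<open>1 + norm x\<close> more than the claim needs:
    \<open>m\<close> confines the term to \<open>norm x \<ge> N + 1\<close>, where the extra power
    pays for the factor 1/(N+1).\<close>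
  obtain A where A: "\<And>x. (1 + norm x) ^ (Suc k) * cmod (\<psi> x) \<le> A"
    using schwartz_imp_rapid[OF base(1)] unfolding rapid_def by blast
  obtain D where D: "\<And>x. cmod (m x) \<le> D"
    using smooth_withD(2)[OF base(2)] unfolding bounded_iff by auto
  have D0: "D \<ge> 0" using D[of 0] by (rule order_trans[OF norm_ge_zero])
  have m0: "m x = 0" if "norm x < 1" for x
    using smooth_withD(2)[OF base(2)] that by auto
  have "(1 + norm x) ^ k * cmod ((of_real (c N) * \<psi> x) * m (inverse (real (Suc N)) *\<^sub>R x)) \<le> (A * D) / real (Suc N)" for N x
  proof (cases "norm x < real (Suc N)")
    case True
    then have "m (inverse (real (Suc N)) *\<^sub>R x) = 0" by (intro m0) (simp add: field_simps)
    moreover have "0 \<le> A" using A[of 0] by (simp add: order_trans[OF norm_ge_zero])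
    ultimately show ?thesis using D0 by simp
  next
    case False
    have "(1 + norm x) ^ k * cmod (\<psi> x) * real (Suc N) \<le> (1 + norm x) ^ k * cmod (\<psi> x) * (1 + norm x)"
      using False by (intro mult_left_mono) auto
    also have "\<dots> \<le> A" using A[of x] by (simp add: mult_ac)
    finally have 1: "(1 + norm x) ^ k * cmod (\<psi> x) \<le> A / real (Suc N)" by (simp add: field_simps)
    have "(1 + norm x) ^ k * cmod ((of_real (c N) * \<psi> x) * m (inverse (real (Suc N)) *\<^sub>R x))
      = \<bar>c N\<bar> * ((1 + norm x) ^ k * cmod (\<psi> x)) * cmod (m (inverse (real (Suc N)) *\<^sub>R x))"
      by (simp add: norm_mult mult_ac)
    also have "\<dots> \<le> 1 * (A / real (Suc N)) * D"
    proof (intro mult_mono 1 D base(3))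
      have "0 \<le> (1 + norm x) ^ k * cmod (\<psi> x)" by simp
      then show "0 \<le> 1 * (A / real (Suc N))" using 1 by linarith
    qed auto
    finally show ?thesis by simp
  qed
  then show ?case by blast
next
  case (sum u v)
  then obtain A D where AD: "\<And>N x. (1 + norm x) ^ k * cmod (u N x) \<le> A / real (Suc N)"
     "\<And>N x. (1 + norm x) ^ k * cmod (v N x) \<le> D / real (Suc N)" by blast
  have "(1 + norm x) ^ k * cmod (u N x + v N x) \<le> (A + D) / real (Suc N)" for N x
  proof -
    have "(1 + norm x) ^ k * cmod (u N x + v N x) \<le> (1 + norm x) ^ k * cmod (u N x) + (1 + norm x) ^ k * cmod (v N x)"
      using mult_left_mono[OF norm_triangle_ineq[of "u N x" "v N x"], of "(1 + norm x) ^ k"]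
      by (simp add: distrib_left)
    also have "\<dots> \<le> A / real (Suc N) + D / real (Suc N)" by (intro add_mono AD)
    finally show ?thesis by (simp only: add_divide_distrib)
  qed
  then show ?case by blast
qed

text \<open>Cutoffs dilated by N + 1 approximate in every seminorm, since the errors form a small
  family. The approximants have the form \<open>b N * \<phi>\<close>; the lemma serves to carry a
  bound from test functions over to Schwartz functions.\<close>

lemma test_functions_dense:
  fixes \<phi> :: "real^'n::finite \<Rightarrow> complex"
  assumes "\<phi> \<in> schwartz_functions"
  obtains b :: "nat \<Rightarrow> real^'n \<Rightarrow> complex" where "\<And>N. b N \<in> test_functions"
    "\<And>k m. (\<lambda>N. schwartz_seminorm k m (\<lambda>x. \<phi> x - b N x * \<phi> x)) \<longlonglongrightarrow> 0"
proof -
  obtain b :: "real^'n \<Rightarrow> real" and V where b: "(\<lambda>x. of_real (b x)) \<in> test_functions" "open V" "cball 0 1 \<subseteq> V"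
    "\<And>x. x \<in> V \<Longrightarrow> b x = 1"
    by (rule cutoff_function[of "cball (0 :: real^'n) 1" UNIV]) auto
  define m where "m x = 1 - complex_of_real (b x)" for x
  have m: "smooth_with (\<lambda>m. bounded (range m)) m"
  proof -
    have "smooth_with (\<lambda>m. bounded (range m)) (\<lambda>x. - complex_of_real (b x))"
    proof (rule smooth_with_mono[of rapid])
      show "smooth_with rapid (\<lambda>x. - complex_of_real (b x))"
        using schwartz_cmult[OF test_imp_schwartz[OF b(1)], of "- 1"] unfolding schwartz_functions_iff by simp
      show "bounded (range f)" if "rapid f" for f :: "real^'n \<Rightarrow> complex"
        using that[unfolded rapid_def, rule_format, of 0] by (auto simp: bounded_iff)
    qed
    then have "smooth_with (\<lambda>m. bounded (range m)) (\<lambda>x. 1 + - complex_of_real (b x))"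
      by (rule smooth_with_add[where B = "\<lambda>m. bounded (range m)", rotated])
         (auto intro: bounded_plus_comp smooth_with_const[where B = "\<lambda>m. bounded (range m)"])
    then show ?thesis by (simp add: m_def[abs_def])
  qed
  have m1: "m x = 0" if "x \<in> V" for x using b(4)[OF that] by (simp add: m_def)
  have m0: "partial_derivs \<alpha> m x = 0" if "x \<in> ball 0 1" for x \<alpha>
  proof -
    have "x \<in> V" using that b(3) by (auto simp: subset_iff)
    then show ?thesis by (intro partial_derivs_zero_on_open[of V m x \<alpha>] b(2) m1)
  qed
  then have m: "smooth_with (\<lambda>m. bounded (range m) \<and> (\<forall>x\<in>ball 0 1. m x = 0)) m"
    using m m0 by (simp add: smooth_with_def)
  define u where "u N x = \<phi> x - of_real (b (inverse (real (Suc N)) *\<^sub>R x)) * \<phi> x" for N x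
  have "u = (\<lambda>N x. (of_real 1 * \<phi> x) * m (inverse (real (Suc N)) *\<^sub>R x))"
    by (intro ext) (simp add: u_def m_def right_diff_distrib mult.commute)
  then have u: "small_family u"
    using small_family.base[OF assms m, of "\<lambda>_. 1"] by (simp only: abs_one order_refl)
  have u\<alpha>: "small_family (\<lambda>N. partial_derivs \<alpha> (u N))" for \<alpha>
  proof (induction \<alpha>)
    case (Cons i \<alpha>)
    show ?case unfolding partial_derivs_Cons by (rule small_family_partial_deriv[OF Cons])
  qed (simp only: partial_derivs_Nil u)
  have lim: "(\<lambda>N. schwartz_seminorm k d (u N)) \<longlonglongrightarrow> 0" for k d
  proof -
    have "\<forall>\<alpha>. \<exists>M. \<forall>N x. (1 + norm x) ^ k * cmod (partial_derivs \<alpha> (u N) x) \<le> M / real (Suc N)"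
      using small_family_bound[OF u\<alpha>, of k] by blast
    then obtain M where M: "(1 + norm x) ^ k * cmod (partial_derivs \<alpha> (u N) x) \<le> M \<alpha> / real (Suc N)" for \<alpha> N x
      using choice[of "\<lambda>\<alpha> M. \<forall>N x. (1 + norm x) ^ k * cmod (partial_derivs \<alpha> (u N) x) \<le> M / real (Suc N)"] by blast
    define M' where "M' = Max (M ` {\<alpha>. length \<alpha> \<le> d})"
    have "(1 + norm x) ^ k * cmod (partial_derivs \<alpha> (u N) x) \<le> M' / real (Suc N)" if "length \<alpha> \<le> d" for \<alpha> N x
    proof -
      have "M \<alpha> \<le> M'" unfolding M'_def using that finite_multi_indices by (intro Max_ge) auto
      then have "M \<alpha> / real (Suc N) \<le> M' / real (Suc N)" by (intro divide_right_mono) auto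
      then show ?thesis using M order_trans by blast
    qed
    then have up: "schwartz_seminorm k d (u N) \<le> real (card {\<alpha> :: 'n list. length \<alpha> \<le> d}) * (M' / real (Suc N))" for N
      by (rule schwartz_seminorm_least)
    have uS: "u N \<in> schwartz_functions" for N
    proof -
      have "(\<lambda>x. of_real (b (inverse (real (Suc N)) *\<^sub>R x)) * \<phi> x) \<in> schwartz_functions"
        using schwartz_mult[OF schwartz_affine[OF test_imp_schwartz[OF b(1)], of "inverse (real (Suc N))" 0] assms]
        by simp
      then show ?thesis unfolding u_def[abs_def] by (intro schwartz_diff assms)
    qed
    show ?thesis
    proof (rule tendsto_sandwich[OF _ _ tendsto_const])
      show "\<forall>\<^sub>F N in sequentially. 0 \<le> schwartz_seminorm k d (u N)"
        using schwartz_seminorm_nonneg[OF uS] by auto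
      show "\<forall>\<^sub>F N in sequentially. schwartz_seminorm k d (u N) \<le> real (card {\<alpha> :: 'n list. length \<alpha> \<le> d}) * M' * inverse (real (Suc N))"
        using up by (auto simp: divide_inverse mult_ac)
      show "(\<lambda>N. real (card {\<alpha> :: 'n list. length \<alpha> \<le> d}) * M' * inverse (real (Suc N))) \<longlonglongrightarrow> 0"
        using tendsto_mult_left[OF LIMSEQ_inverse_real_of_nat, of "real (card {\<alpha> :: 'n list. length \<alpha> \<le> d}) * M'"] by simp
    qed
  qed
  show ?thesis
  proof (rule that[of "\<lambda>N x. of_real (b (inverse (real (Suc N)) *\<^sub>R x))"])
    show "(\<lambda>x. complex_of_real (b (inverse (real (Suc N)) *\<^sub>R x))) \<in> test_functions" for N
    proof (rule test_functionsI)
      show "smooth (\<lambda>x. complex_of_real (b (inverse (real (Suc N)) *\<^sub>R x)))"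
        using smooth_affine[OF test_functionsD(1)[OF b(1)], of "inverse (real (Suc N))" 0] by simp
      show "compact ((\<lambda>x. real (Suc N) *\<^sub>R x) ` function_support (\<lambda>x. complex_of_real (b x)))"
        using test_functionsD(2)[OF b(1)] by (intro compact_continuous_image continuous_intros)
      fix x assume x: "x \<notin> (\<lambda>x. real (Suc N) *\<^sub>R x) ` function_support (\<lambda>x. complex_of_real (b x))"
      have "inverse (real (Suc N)) *\<^sub>R x \<notin> function_support (\<lambda>x. complex_of_real (b x))"
      proof
        assume "inverse (real (Suc N)) *\<^sub>R x \<in> function_support (\<lambda>x. complex_of_real (b x))"
        then have "real (Suc N) *\<^sub>R (inverse (real (Suc N)) *\<^sub>R x) \<in> (\<lambda>x. real (Suc N) *\<^sub>R x) ` function_support (\<lambda>x. complex_of_real (b x))"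
          by (rule imageI)
        then show False using x by simp
      qed
      then show "complex_of_real (b (inverse (real (Suc N)) *\<^sub>R x)) = 0"
        by (rule outside_function_support)
    qed
  qed (use lim in \<open>simp add: u_def[abs_def]\<close>)
qed

lemma tempered_tendsto:
  assumes T: "T \<in> tempered_distributions" and \<phi>: "\<phi> \<in> schwartz_functions" "\<And>N. \<psi> N \<in> schwartz_functions"
    and lim: "\<And>k m. (\<lambda>N. schwartz_seminorm k m (\<lambda>x. \<phi> x - \<psi> N x)) \<longlonglongrightarrow> 0"
  shows "(\<lambda>N. T (\<psi> N)) \<longlonglongrightarrow> T \<phi>"
proof -
  obtain C k m where C: "\<And>\<phi>. \<phi> \<in> schwartz_functions \<Longrightarrow> cmod (T \<phi>) \<le> C * schwartz_seminorm k m \<phi>"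
    using T unfolding tempered_distributions_def by blast
  have lin: "T (\<lambda>x. a * \<phi> x + c * \<psi> x) = a * T \<phi> + c * T \<psi>"
    if "\<phi> \<in> schwartz_functions" "\<psi> \<in> schwartz_functions" for \<phi> \<psi> a c
    using T that unfolding tempered_distributions_def complex_linear_on_def by blast
  have "T (\<lambda>x. \<phi> x - \<psi> N x) = T \<phi> - T (\<psi> N)" for N
    using lin[OF \<phi>(1) \<phi>(2), of 1 "- 1" N] by simp
  then have "cmod (T \<phi> - T (\<psi> N)) \<le> C * schwartz_seminorm k m (\<lambda>x. \<phi> x - \<psi> N x)" for N
    using C[OF schwartz_diff[OF \<phi>(1) \<phi>(2)[of N]]] by simp
  then have "(\<lambda>N. T \<phi> - T (\<psi> N)) \<longlonglongrightarrow> 0"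
  proof (rule Lim_null_comparison[OF always_eventually, rule_format])
    show "(\<lambda>N. C * schwartz_seminorm k m (\<lambda>x. \<phi> x - \<psi> N x)) \<longlonglongrightarrow> 0"
      using tendsto_mult_left[OF lim[of k m], of C] by simp
  qed
  then show ?thesis using tendsto_diff[OF tendsto_const[of "T \<phi>"], of "\<lambda>N. T \<phi> - T (\<psi> N)" 0 sequentially] by simp
qed

subsection \<open>Integrability\<close>

text \<open>With n the dimension, the integrand is at most the sum over k of (k+1)^-(n+2) times the
  indicator of the ball of radius k + 1. Whole balls are counted rather than shells, so their volume
  of order (k+1)^n leaves the series of 1/(k+1)^2; the exponent n + 1 would leave the harmonic
  series.\<close>

lemma integrable_decay:
  "integrable lborel (\<lambda>x::real^'n::finite. inverse ((1 + norm x) ^ (CARD('n) + 2)))"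
proof (rule integrableI_bounded)
  show "(\<lambda>x::real^'n. inverse ((1 + norm x) ^ (CARD('n) + 2))) \<in> borel_measurable lborel" by simp
  let ?n = "CARD('n)"
  let ?g = "\<lambda>k x. ennreal (inverse (real (Suc k) ^ (?n + 2))) * indicator (cball (0::real^'n) (real (Suc k))) x"
  have le: "ennreal (norm (inverse ((1 + norm x) ^ (?n + 2)))) \<le> (\<Sum>k. ?g k x)" for x :: "real^'n"
  proof -
    define k where "k = nat \<lfloor>norm x\<rfloor>"
    have k: "real k \<le> norm x" "norm x \<le> real (Suc k)"
      unfolding k_def using floor_correct[of "norm x"] by (simp_all add: of_nat_nat add.commute less_imp_le)
    have "inverse ((1 + norm x) ^ (?n + 2)) \<le> inverse (real (Suc k) ^ (?n + 2))"
      using k by (intro le_imp_inverse_le power_mono) auto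
    then have "ennreal (norm (inverse ((1 + norm x) ^ (?n + 2)))) \<le> ?g k x"
    proof -
      have "x \<in> cball 0 (real (Suc k))" using k(2) by simp
      then have "?g k x = ennreal (inverse (real (Suc k) ^ (?n + 2)))" by (simp only: indicator_simps mult_1_right)
      then show ?thesis
        using \<open>inverse ((1 + norm x) ^ (?n + 2)) \<le> inverse (real (Suc k) ^ (?n + 2))\<close>
        by (simp only:) (rule ennreal_leI, simp)
    qed
    also have "\<dots> = sum (\<lambda>k. ?g k x) {k}" by (simp only: sum.insert sum.empty finite.emptyI empty_iff not_False_eq_True add_0_right)
    also have "\<dots> \<le> (\<Sum>k. ?g k x)"
      by (rule sum_le_suminf) auto
    finally show ?thesis .
  qed
  have "(\<integral>\<^sup>+(x::real^'n). ennreal (norm (inverse ((1 + norm x) ^ (?n + 2)))) \<partial>lborel) \<le> (\<integral>\<^sup>+(x::real^'n). (\<Sum>k. ?g k x) \<partial>lborel)"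
    by (intro nn_integral_mono le)
  also have "\<dots> = (\<Sum>k. \<integral>\<^sup>+(x::real^'n). ?g k x \<partial>lborel)"
    by (intro nn_integral_suminf borel_measurable_times_ennreal borel_measurable_indicator) auto
  also have "\<dots> = (\<Sum>k. ennreal (unit_ball_vol (real ?n) * inverse (real (Suc k) ^ 2)))"
  proof (rule suminf_cong)
    fix k
    have "(\<integral>\<^sup>+(x::real^'n). ?g k x \<partial>lborel) = ennreal (inverse (real (Suc k) ^ (?n + 2))) * emeasure lborel (cball (0::real^'n) (real (Suc k)))"
      by (subst nn_integral_cmult_indicator) auto
    also have "\<dots> = ennreal (inverse (real (Suc k) ^ (?n + 2)) * (unit_ball_vol (real ?n) * real (Suc k) ^ ?n))"
      by (subst emeasure_cball) (auto simp: ennreal_mult')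
    also have "inverse (real (Suc k) ^ (?n + 2)) * (unit_ball_vol (real ?n) * real (Suc k) ^ ?n) = unit_ball_vol (real ?n) * inverse (real (Suc k) ^ 2)"
    proof -
      have "real (Suc k) ^ ?n \<noteq> 0" by (simp only: power_eq_0_iff) simp
      then show ?thesis by (simp only: power_add inverse_mult_distrib) (simp only: mult_ac, simp)
    qed
    finally show "(\<integral>\<^sup>+(x::real^'n). ?g k x \<partial>lborel) = ennreal (unit_ball_vol (real ?n) * inverse (real (Suc k) ^ 2))" .
  qed
  also have "\<dots> < \<infinity>"
  proof -
    have "summable (\<lambda>k. unit_ball_vol (real ?n) * inverse (real (Suc k) ^ 2))"
      using inverse_power_summable[of 2] by (intro summable_mult) (subst summable_Suc_iff, simp)
    then show ?thesis
      by (subst suminf_ennreal2) auto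
  qed
  finally show "(\<integral>\<^sup>+(x::real^'n). ennreal (norm (inverse ((1 + norm x) ^ (?n + 2)))) \<partial>lborel) < \<infinity>" .
qed

lemma integrable_of_decay:
  fixes f :: "real^'n::finite \<Rightarrow> 'b::{banach, second_countable_topology}"
  assumes "f \<in> borel_measurable lborel" "\<And>x. (1 + norm x) ^ (CARD('n) + 2) * norm (f x) \<le> C"
  shows "integrable lborel f" "(LINT x|lborel. norm (f x)) \<le>
    C * (LINT x|lborel. inverse ((1 + norm (x::real^'n)) ^ (CARD('n) + 2)))"
proof -
  have le: "norm (f x) \<le> C * inverse ((1 + norm x) ^ (CARD('n) + 2))" for x
  proof -
    have "(1 + norm x) ^ (CARD('n) + 2) > 0" by (simp add: add_pos_nonneg)
    then show ?thesis using assms(2)[of x] by (simp add: field_simps)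
  qed
  show int: "integrable lborel f"
    by (rule Bochner_Integration.integrable_bound[OF integrable_mult_right[OF integrable_decay, of C] assms(1)])
       (use le order_trans[OF le abs_ge_self] in auto)
  show "(LINT x|lborel. norm (f x)) \<le> C * (LINT x|lborel. inverse ((1 + norm (x::real^'n)) ^ (CARD('n) + 2)))"
    unfolding integral_mult_right_zero[symmetric]
    by (rule integral_mono) (use le int integrable_decay in auto)
qed

lemma schwartz_integrable:
  assumes "f \<in> schwartz_functions" shows "integrable lborel f"
proof -
  obtain C where "\<And>x. (1 + norm x) ^ (CARD('a) + 2) * cmod (f x) \<le> C"
    using schwartz_imp_rapid[OF assms] unfolding rapid_def by blast
  then show ?thesis
    using assms by (intro integrable_of_decay(1)[where C = C]) (auto dest: schwartz_measurable)
qed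

section \<open>The Fourier transform on Schwartz functions\<close>

lemma lborel_integral_affine:
  fixes f :: "'a::euclidean_space \<Rightarrow> 'b::{banach, second_countable_topology}"
  assumes [measurable]: "f \<in> borel_measurable borel" and c: "c \<noteq> 0"
  shows "(LINT x|lborel. f x) = \<bar>c\<bar> ^ DIM('a) *\<^sub>R (LINT x|lborel. f (t + c *\<^sub>R x))"
proof -
  have "(LINT x|lborel. f x) = (LINT x|density (distr lborel borel (\<lambda>x. t + c *\<^sub>R x)) (\<lambda>_. ennreal (\<bar>c\<bar> ^ DIM('a))). f x)"
    using lborel_affine[OF c, of t] by (simp add: ennreal_power)
  also have "\<dots> = (LINT x|distr lborel borel (\<lambda>x. t + c *\<^sub>R x). \<bar>c\<bar> ^ DIM('a) *\<^sub>R f x)"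
    by (rule integral_density) auto
  also have "\<dots> = (LINT x|lborel. \<bar>c\<bar> ^ DIM('a) *\<^sub>R f (t + c *\<^sub>R x))"
    by (rule integral_distr) auto
  finally show ?thesis by simp
qed

lemma lborel_integral_translate:
  fixes f :: "'a::euclidean_space \<Rightarrow> 'b::{banach, second_countable_topology}"
  assumes "f \<in> borel_measurable borel"
  shows "(LINT x|lborel. f (x + t)) = (LINT x|lborel. f x)"
  using lborel_integral_affine[OF assms, of 1 t] by (simp add: add.commute)

lemma lborel_integral_reflect:
  fixes f :: "'a::euclidean_space \<Rightarrow> 'b::{banach, second_countable_topology}"
  assumes "f \<in> borel_measurable borel"
  shows "(LINT x|lborel. f (t - x)) = (LINT x|lborel. f x)"
  using lborel_integral_affine[OF assms, of "-1" t] by simp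

lemma has_derivative_cis:
  assumes "(g has_derivative g') (at x)"
  shows "((\<lambda>x. cis (g x)) has_derivative (\<lambda>h. \<i> * of_real (g' h) * cis (g x))) (at x)"
proof -
  have "((\<lambda>x. \<i> * complex_of_real (g x)) has_derivative (\<lambda>h. \<i> * complex_of_real (g' h))) (at x)"
    by (intro has_derivative_mult_right has_derivative_of_real assms)
  moreover have "(exp has_derivative (\<lambda>h. exp (\<i> * complex_of_real (g x)) * h)) (at (\<i> * complex_of_real (g x)))"
    using DERIV_exp unfolding has_field_derivative_def .
  ultimately have "((\<lambda>x. exp (\<i> * complex_of_real (g x))) has_derivative
      (\<lambda>h. exp (\<i> * complex_of_real (g x)) * (\<i> * complex_of_real (g' h)))) (at x)"
    by (rule has_derivative_compose)
  then show ?thesis unfolding cis_conv_exp by (simp only: mult_ac)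
qed

lemma cis_has_derivative:
  "((\<lambda>x::real^'n::finite. cis (x \<bullet> \<xi>)) has_derivative (\<lambda>h. \<i> * of_real (h \<bullet> \<xi>) * cis (x \<bullet> \<xi>))) (at x)"
  by (intro has_derivative_cis has_derivative_inner_left has_derivative_ident)

lemma smooth_with_slow_cis: "smooth_with slow (\<lambda>x::real^'n::finite. cis (x \<bullet> \<xi>))"
proof (rule smooth_with_coinduct[where A = "\<lambda>h. \<exists>c. h = (\<lambda>x. c * cis (x \<bullet> \<xi>))"])
  show "\<exists>c. (\<lambda>x. cis (x \<bullet> \<xi>)) = (\<lambda>x. c * cis (x \<bullet> \<xi>))" by (intro exI[of _ 1]) simp
next
  fix g x i assume "\<exists>c. g = (\<lambda>x::real^'n. c * cis (x \<bullet> \<xi>))"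
  then obtain c where g: "g = (\<lambda>x. c * cis (x \<bullet> \<xi>))" by blast
  have D: "(g has_derivative (\<lambda>h. c * (\<i> * of_real (h \<bullet> \<xi>) * cis (x \<bullet> \<xi>)))) (at x)" for x
    unfolding g by (rule has_derivative_mult_right[OF cis_has_derivative])
  show "g differentiable (at x)" using D by (rule differentiableI)
  show "slow g" unfolding g by (rule slow_bounded[of _ "cmod c"]) (simp add: norm_mult)
  have "partial_deriv i g = (\<lambda>x. (c * \<i> * of_real (axis i 1 \<bullet> \<xi>)) * cis (x \<bullet> \<xi>))"
    using partial_deriv_eq[OF D] by (auto simp: mult.assoc)
  then show "\<exists>c. partial_deriv i g = (\<lambda>x. c * cis (x \<bullet> \<xi>))" by blast
qed

lemma schwartz_modulate:
  "f \<in> schwartz_functions \<Longrightarrow> (\<lambda>x. cis (- (x \<bullet> \<xi>)) * f x) \<in> schwartz_functions"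
  using schwartz_mult_slow[OF _ smooth_with_slow_cis, of f "- \<xi>"] by (simp add: mult.commute)

lemma integrable_modulate:
  assumes "integrable lborel (f :: real^'n::finite \<Rightarrow> complex)"
  shows "integrable lborel (\<lambda>x. cis (- (x \<bullet> \<xi>)) * f x)"
proof (rule Bochner_Integration.integrable_bound[OF assms])
  have "f \<in> borel_measurable borel" using assms by auto
  moreover have "(\<lambda>x. cis (- (x \<bullet> \<xi>))) \<in> borel_measurable borel"
    by (intro borel_measurable_continuous_onI continuous_intros)
  ultimately show "(\<lambda>x. cis (- (x \<bullet> \<xi>)) * f x) \<in> borel_measurable lborel" by simp
qed (simp add: norm_mult)

section \<open>Algebraic rules for the Fourier transform\<close>

lemma fourier_add:
  assumes "integrable lborel f" "integrable lborel g"
  shows "fourier (\<lambda>x. f x + g x) \<xi> = fourier f \<xi> + fourier g \<xi>"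
  unfolding fourier_def distrib_left by (intro Bochner_Integration.integral_add integrable_modulate assms)

lemma fourier_diff:
  assumes "integrable lborel f" "integrable lborel g"
  shows "fourier (\<lambda>x. f x - g x) \<xi> = fourier f \<xi> - fourier g \<xi>"
  unfolding fourier_def right_diff_distrib by (intro Bochner_Integration.integral_diff integrable_modulate assms)

lemma fourier_cmult: "fourier (\<lambda>x. c * f x) \<xi> = c * fourier f \<xi>"
  unfolding fourier_def by (simp add: mult.left_commute)

lemma inverse_fourier_eq:
  fixes f :: "real^'n::finite \<Rightarrow> complex"
  shows "inverse_fourier f x = of_real (1 / (2 * pi) ^ CARD('n)) * fourier f (- x)"
  unfolding inverse_fourier_def fourier_def inner_minus_right minus_minus inner_commute[of x] ..

lemma norm_fourier_le:
  assumes "integrable lborel f"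
  shows "cmod (fourier f \<xi>) \<le> (LINT x|lborel. cmod (f x))"
  unfolding fourier_def using integral_norm_bound[of lborel "\<lambda>x. cis (- (x \<bullet> \<xi>)) * f x"]
  by (simp add: norm_mult)

lemma fourier_cnj: "fourier (\<lambda>x. cnj (f x)) \<xi> = cnj (fourier f (- \<xi>))"
proof -
  have "cnj (fourier f (- \<xi>)) = (LINT x|lborel. cnj (cis (- (x \<bullet> - \<xi>)) * f x))"
    unfolding fourier_def by (rule Bochner_Integration.integral_cnj[symmetric])
  then show ?thesis by (simp add: fourier_def cis_cnj)
qed

lemma fourier_translate:
  assumes "f \<in> borel_measurable borel"
  shows "fourier (\<lambda>x. f (x + h)) \<xi> = cis (h \<bullet> \<xi>) * fourier f \<xi>"
proof -
  have [measurable]: "(\<lambda>x. cis (- (x \<bullet> \<xi>))) \<in> borel_measurable borel"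
    by (intro borel_measurable_continuous_onI continuous_intros)
  have "fourier (\<lambda>x. f (x + h)) \<xi> = (LINT x|lborel. (\<lambda>x. cis (h \<bullet> \<xi>) * (cis (- (x \<bullet> \<xi>)) * f x)) (x + h))"
    unfolding fourier_def by (simp add: inner_add_left mult.assoc[symmetric] cis_mult)
  also have "\<dots> = (LINT x|lborel. cis (h \<bullet> \<xi>) * (cis (- (x \<bullet> \<xi>)) * f x))"
    by (rule lborel_integral_translate) (use assms in measurable)
  finally show ?thesis by (simp add: fourier_def)
qed

lemma fourier_modulate:
  "fourier (\<lambda>x. cis (- (x \<bullet> \<zeta>)) * f x) \<xi> = fourier f (\<xi> + \<zeta>)"
  unfolding fourier_def by (simp add: inner_add_right mult.assoc[symmetric] cis_mult add.commute)

section \<open>Differentiation under the Fourier transform and the transform of a derivative\<close>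

lemma cis_remainder: "cmod (cis (- (t + s)) - cis (- t) + \<i> * of_real s * cis (- t)) \<le> s\<^sup>2"
proof -
  have "cis (- (t + s)) - cis (- t) + \<i> * of_real s * cis (- t) = cis (- t) * (iexp (- s) - (1 + \<i> * of_real (- s)))"
    by (simp add: cis_conv_exp algebra_simps exp_add[symmetric])
  then have "cmod (cis (- (t + s)) - cis (- t) + \<i> * of_real s * cis (- t)) = cmod (iexp (- s) - (1 + \<i> * of_real (- s)))"
    by (simp only: norm_mult norm_cis mult_1)
  also have "\<dots> \<le> \<bar>- s\<bar> ^ 2 / 2"
    using iexp_approx1[of "- s" 1] by (simp add: numeral_2_eq_2)
  also have "\<dots> \<le> s\<^sup>2" by simp
  finally show ?thesis .
qed

lemma schwartz_norm_power_integrable: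
  fixes f :: "real^'n::finite \<Rightarrow> complex"
  assumes "f \<in> schwartz_functions"
  shows "integrable lborel (\<lambda>x. norm x ^ k * cmod (f x))"
proof -
  obtain C where C: "\<And>x. (1 + norm x) ^ (CARD('n) + 2 + k) * cmod (f x) \<le> C"
    using schwartz_imp_rapid[OF assms] unfolding rapid_def by blast
  show ?thesis
  proof (rule integrable_of_decay(1)[where C = C])
    show "(\<lambda>x. norm x ^ k * cmod (f x)) \<in> borel_measurable lborel"
      using schwartz_measurable[OF assms] by simp
    fix x :: "real^'n"
    have "norm x ^ k \<le> (1 + norm x) ^ k" by (intro power_mono) auto
    then have "(1 + norm x) ^ (CARD('n) + 2) * (norm x ^ k * cmod (f x)) \<le>
      (1 + norm x) ^ (CARD('n) + 2) * ((1 + norm x) ^ k * cmod (f x))"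
      by (intro mult_left_mono mult_right_mono) auto
    also have "\<dots> \<le> C" using C[of x] by (simp only: power_add mult_ac)
    finally show "(1 + norm x) ^ (CARD('n) + 2) * norm (norm x ^ k * cmod (f x)) \<le> C"
      by (simp add: abs_mult)
  qed
qed

text \<open>The second order remainder of \<open>cis\<close>, uniform in the base point, is
  integrated against f. This bounds the error of the linear approximation by |h|^2 times the
  integral of |x|^2 |f| and gives the full derivative at once, not only partial ones.\<close>

lemma fourier_has_derivative:
  fixes f :: "real^'n::finite \<Rightarrow> complex"
  assumes f: "f \<in> schwartz_functions"
  shows "(fourier f has_derivative (\<lambda>h. fourier (\<lambda>x. - \<i> * of_real (x \<bullet> h) * f x) \<xi>)) (at \<xi>)"
proof -
  note [measurable] = schwartz_measurable[OF f]
  have intk: "integrable lborel (\<lambda>x. norm x ^ k * cmod (f x))" for k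
    by (rule schwartz_norm_power_integrable[OF f])
  have int1: "integrable lborel (\<lambda>x. - \<i> * of_real (x \<bullet> h) * f x)" for h
  proof (rule Bochner_Integration.integrable_bound[OF integrable_mult_right[OF intk[of 1], of "norm h"]])
    show "(\<lambda>x. - \<i> * of_real (x \<bullet> h) * f x) \<in> borel_measurable lborel" by measurable
    have "\<bar>x \<bullet> h\<bar> * cmod (f x) \<le> norm h * (norm x * cmod (f x))" for x
      using mult_right_mono[OF Cauchy_Schwarz_ineq2[of x h], of "cmod (f x)"] by (simp add: mult_ac)
    then show "AE x in lborel. norm (- \<i> * of_real (x \<bullet> h) * f x) \<le> norm (norm h * (norm x ^ 1 * cmod (f x)))"
      by (simp add: norm_mult)
  qed
  let ?L = "\<lambda>h. fourier (\<lambda>x. - \<i> * of_real (x \<bullet> h) * f x) \<xi>"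
  define M where "M = (LINT x|lborel. norm x ^ 2 * cmod (f x))"
  have lin: "bounded_linear ?L"
  proof (rule bounded_linear_intro)
    show "?L (h + k) = ?L h + ?L k" for h k
      using fourier_add[OF int1[of h] int1[of k]] by (simp add: inner_add_right algebra_simps)
    show "?L (r *\<^sub>R h) = r *\<^sub>R ?L h" for r h
      using fourier_cmult[of "of_real r" "\<lambda>x. - \<i> * of_real (x \<bullet> h) * f x" \<xi>]
      by (simp add: scaleR_conv_of_real[where 'a = complex] mult_ac)
    show "norm (?L h) \<le> norm h * (LINT x|lborel. norm x ^ 1 * cmod (f x))" for h
    proof -
      have "norm (?L h) \<le> (LINT x|lborel. cmod (- \<i> * of_real (x \<bullet> h) * f x))"
        by (rule norm_fourier_le[OF int1])
      also have "\<dots> \<le> (LINT x|lborel. norm h * (norm x ^ 1 * cmod (f x)))"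
      proof (rule integral_mono)
        show "integrable lborel (\<lambda>x. cmod (- \<i> * of_real (x \<bullet> h) * f x))"
          using int1 by (rule integrable_norm)
        show "integrable lborel (\<lambda>x. norm h * (norm x ^ 1 * cmod (f x)))"
          using intk by (rule integrable_mult_right)
        show "cmod (- \<i> * of_real (x \<bullet> h) * f x) \<le> norm h * (norm x ^ 1 * cmod (f x))" for x
          using mult_right_mono[OF Cauchy_Schwarz_ineq2[of x h], of "cmod (f x)"] by (simp add: norm_mult mult_ac)
      qed
      finally show ?thesis by (simp only: integral_mult_right_zero)
    qed
  qed
  have rem: "cmod (fourier f (\<xi> + h) - fourier f \<xi> - ?L h) \<le> (norm h)\<^sup>2 * M" for h
  proof -
    let ?r = "\<lambda>x. cis (- (x \<bullet> (\<xi> + h))) * f x - cis (- (x \<bullet> \<xi>)) * f x - cis (- (x \<bullet> \<xi>)) * (- \<i> * of_real (x \<bullet> h) * f x)"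
    note i1 = integrable_modulate[OF schwartz_integrable[OF f], of "\<xi> + h"]
    note i2 = integrable_modulate[OF schwartz_integrable[OF f], of \<xi>]
    note i3 = integrable_modulate[OF int1[of h], of \<xi>]
    note i12 = Bochner_Integration.integrable_diff[OF i1 i2]
    have int: "integrable lborel ?r"
      by (rule Bochner_Integration.integrable_diff[OF i12 i3])
    have eq: "(LINT x|lborel. ?r x) = fourier f (\<xi> + h) - fourier f \<xi> - ?L h"
      unfolding fourier_def Bochner_Integration.integral_diff[OF i12 i3] Bochner_Integration.integral_diff[OF i1 i2] ..
    have "cmod (fourier f (\<xi> + h) - fourier f \<xi> - ?L h) \<le> (LINT x|lborel. cmod (?r x))"
      unfolding eq[symmetric] by (rule integral_norm_bound)
    also have "\<dots> \<le> (LINT x|lborel. (norm h)\<^sup>2 * (norm x ^ 2 * cmod (f x)))"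
    proof (rule integral_mono)
      show "cmod (?r x) \<le> (norm h)\<^sup>2 * (norm x ^ 2 * cmod (f x))" for x
      proof -
        have "?r x = (cis (- (x \<bullet> \<xi> + x \<bullet> h)) - cis (- (x \<bullet> \<xi>)) + \<i> * of_real (x \<bullet> h) * cis (- (x \<bullet> \<xi>))) * f x"
        proof -
          have "A * y - B * y - B * (- \<i> * s * y) = (A - B + \<i> * s * B) * y" for A B s y :: complex
            by (simp add: algebra_simps)
          then show ?thesis unfolding inner_add_right by this
        qed
        then have "cmod (?r x) \<le> (x \<bullet> h)\<^sup>2 * cmod (f x)"
          using mult_right_mono[OF cis_remainder[of "x \<bullet> \<xi>" "x \<bullet> h"] norm_ge_zero[of "f x"]] by (simp only: norm_mult)
        also have "\<dots> \<le> (norm x * norm h)\<^sup>2 * cmod (f x)"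
          using Cauchy_Schwarz_ineq2[of x h] by (intro mult_right_mono norm_ge_zero) (simp add: abs_le_square_iff[symmetric] abs_mult)
        finally show ?thesis by (simp add: power_mult_distrib mult_ac)
      qed
      show "integrable lborel (\<lambda>x. cmod (?r x))" using int by (rule integrable_norm)
      show "integrable lborel (\<lambda>x. (norm h)\<^sup>2 * (norm x ^ 2 * cmod (f x)))"
        using intk by (rule integrable_mult_right)
    qed
    finally show ?thesis by (simp only: integral_mult_right_zero M_def)
  qed
  show ?thesis
    unfolding has_derivative_at
  proof (intro conjI lin)
    show "(\<lambda>h. norm (fourier f (\<xi> + h) - fourier f \<xi> - ?L h) / norm h) \<midarrow>0\<rightarrow> 0"
    proof (rule Lim_null_comparison)
      show "\<forall>\<^sub>F h in at 0. norm (norm (fourier f (\<xi> + h) - fourier f \<xi> - ?L h) / norm h) \<le> norm h * M"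
      proof (rule always_eventually, rule allI)
        fix h
        show "norm (norm (fourier f (\<xi> + h) - fourier f \<xi> - ?L h) / norm h) \<le> norm h * M"
        proof (cases "h = 0")
          case False
          have "norm (X / t) \<le> t * M" if "X \<le> t\<^sup>2 * M" "0 \<le> X" "0 < t" for X t
            using that by (simp add: divide_le_eq power2_eq_square mult_ac)
          from this[OF rem[of h] norm_ge_zero] False show ?thesis by simp
        qed simp
      qed
      show "(\<lambda>h. norm h * M) \<midarrow>0\<rightarrow> 0"
        by (intro tendsto_mult_left_zero tendsto_norm_zero tendsto_ident_at)
    qed
  qed
qed

lemma partial_deriv_fourier:
  assumes "f \<in> schwartz_functions"
  shows "partial_deriv i (fourier f) = fourier (\<lambda>x. - \<i> * (of_real (x $ i) * f x))"
  using partial_deriv_eq[OF fourier_has_derivative[OF assms]] by (auto simp: inner_axis mult.assoc)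

lemma difference_quotient_tendsto:
  assumes "(f has_vector_derivative D) (at (0::real))"
  shows "((\<lambda>t. (f t - f 0) /\<^sub>R t) \<longlongrightarrow> D) (at 0)"
proof -
  have "(\<lambda>t. norm (f (0 + t) - f 0 - t *\<^sub>R D) / norm t) \<midarrow>0\<rightarrow> 0"
    using assms unfolding has_vector_derivative_def has_derivative_at by blast
  then have "(\<lambda>t. norm ((f t - f 0) /\<^sub>R t - D)) \<midarrow>0\<rightarrow> 0"
  proof (rule Lim_transform_eventually)
    have "norm (f (0 + t) - f 0 - t *\<^sub>R D) / norm t = norm ((f t - f 0) /\<^sub>R t - D)" if "t \<noteq> 0" for t
    proof -
      have "(f t - f 0) /\<^sub>R t - D = (f (0 + t) - f 0 - t *\<^sub>R D) /\<^sub>R t"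
        using that by (simp add: scaleR_diff_right)
      then show ?thesis by (simp add: divide_inverse mult.commute)
    qed
    then show "\<forall>\<^sub>F t in at 0. norm (f (0 + t) - f 0 - t *\<^sub>R D) / norm t = norm ((f t - f 0) /\<^sub>R t - D)"
      by (simp add: eventually_at_filter)
  qed
  then show ?thesis by (simp add: Lim_null[of _ D] tendsto_norm_zero_iff)
qed

text \<open>Provides the integrable majorant for the limit of difference quotients. By the mean
  value theorem the quotient is bounded by a derivative at a point within distance h \<le> 1, and
  such a shift changes \<open>1 + norm x\<close> by at most a factor 2.\<close>

lemma difference_quotient_bound:
  fixes f :: "real^'n::finite \<Rightarrow> complex"
  assumes f: "f \<in> schwartz_functions"
  obtains C where "\<And>x h. 0 < h \<Longrightarrow> h \<le> 1 \<Longrightarrow>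
    (1 + norm x) ^ (CARD('n) + 2) * cmod ((f (x + h *\<^sub>R axis i 1) - f x) / of_real h) \<le> C"
proof -
  let ?p = "CARD('n) + 2"
  let ?D = "\<lambda>x. frechet_derivative f (at x)"
  have D: "(f has_derivative ?D x) (at x)" for x
    using f frechet_derivative_works smooth_withD(1) unfolding schwartz_functions_iff by blast
  obtain C where C: "\<And>x. (1 + norm x) ^ ?p * cmod (partial_deriv i f x) \<le> C"
    using schwartz_imp_rapid[OF schwartz_partial_deriv[OF f]] unfolding rapid_def by blast
  have "(1 + norm x) ^ ?p * cmod ((f (x + h *\<^sub>R axis i 1) - f x) / of_real h) \<le> 2 ^ ?p * C"
    if h: "0 < h" "h \<le> 1" for x h
  proof -
    define g where "g t = f (x + t *\<^sub>R axis i 1)" for t :: real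
    have g: "(g has_derivative (\<lambda>s. s *\<^sub>R partial_deriv i f (x + t *\<^sub>R axis i 1))) (at t)" for t
    proof -
      have "(g has_derivative (\<lambda>s. ?D (x + t *\<^sub>R axis i 1) (s *\<^sub>R axis i 1))) (at t)"
        unfolding g_def
        by (rule has_derivative_compose[OF _ D, of "\<lambda>t. x + t *\<^sub>R axis i 1" "\<lambda>s. s *\<^sub>R axis i 1"])
           (auto intro!: derivative_eq_intros)
      moreover have "?D (x + t *\<^sub>R axis i 1) (s *\<^sub>R axis i 1) = s *\<^sub>R partial_deriv i f (x + t *\<^sub>R axis i 1)" for s
        unfolding partial_deriv_def using has_derivative_linear[OF D] by (rule linear_cmul)
      ultimately show ?thesis by simp
    qed
    have cont: "continuous_on {0..h} g"
      using g by (intro continuous_at_imp_continuous_on ballI) (metis has_derivative_continuous)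
    obtain t where t: "t \<in> {0<..<h}" "norm (g h - g 0) \<le> norm ((h - 0) *\<^sub>R partial_deriv i f (x + t *\<^sub>R axis i 1))"
      using mvt_general[OF h(1) cont g] by blast
    let ?y = "x + t *\<^sub>R axis i 1"
    have "norm x \<le> norm ?y + norm (t *\<^sub>R axis i (1::real) :: real^'n)"
      using norm_triangle_ineq4[of ?y "t *\<^sub>R axis i 1"] by simp
    then have "norm x \<le> norm ?y + t" using t(1) by (simp add: norm_axis_1)
    moreover have "t \<le> 1" using t(1) h by simp
    moreover have "0 \<le> norm ?y" by (rule norm_ge_zero)
    ultimately have "1 + norm x \<le> 2 * (1 + norm ?y)" unfolding distrib_left by linarith
    then have "(1 + norm x) ^ ?p \<le> (2 * (1 + norm ?y)) ^ ?p"
      by (rule power_mono) (rule add_nonneg_nonneg[OF zero_le_one norm_ge_zero])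
    then have 1: "(1 + norm x) ^ ?p \<le> 2 ^ ?p * (1 + norm ?y) ^ ?p" by (simp only: power_mult_distrib)
    have 2: "0 \<le> 2 ^ ?p * (1 + norm ?y) ^ ?p"
      by (rule order_trans[OF _ 1]) (rule zero_le_power[OF add_nonneg_nonneg[OF zero_le_one norm_ge_zero]])
    have "cmod ((f (x + h *\<^sub>R axis i 1) - f x) / of_real h) \<le> cmod (partial_deriv i f ?y)"
      using t(2) h by (simp add: g_def norm_divide field_simps)
    then have "(1 + norm x) ^ ?p * cmod ((f (x + h *\<^sub>R axis i 1) - f x) / of_real h) \<le>
      2 ^ ?p * (1 + norm ?y) ^ ?p * cmod (partial_deriv i f ?y)"
      by (rule mult_mono[OF 1]) (fact 2, rule norm_ge_zero)
    also have "\<dots> \<le> 2 ^ ?p * C" unfolding mult.assoc by (rule mult_left_mono[OF C]) (rule zero_le_power[OF zero_le_numeral])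
    finally show ?thesis .
  qed
  then show ?thesis by (rule that)
qed

text \<open>There is no integration by parts: by the translation rule the transform of a difference
  quotient is \<open>(cis (h * \<xi> $ i) - 1) / h\<close> times the transform of f, and dominated
  convergence passes to the limit.\<close>

lemma fourier_partial_deriv:
  fixes f :: "real^'n::finite \<Rightarrow> complex"
  assumes f: "f \<in> schwartz_functions"
  shows "fourier (partial_deriv i f) \<xi> = \<i> * of_real (\<xi> $ i) * fourier f \<xi>"
proof -
  note [measurable] = schwartz_measurable[OF f] schwartz_measurable[OF schwartz_partial_deriv[OF f]]
  have [measurable]: "(\<lambda>x. cis (- (x \<bullet> \<xi>))) \<in> borel_measurable borel"
    by (intro borel_measurable_continuous_onI continuous_intros)
  define h where "h N = inverse (real (Suc N))" for N
  have h: "0 < h N" "h N \<le> 1" for N by (auto simp: h_def inverse_eq_divide)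
  have h0: "h \<longlonglongrightarrow> 0" unfolding h_def by (rule LIMSEQ_inverse_real_of_nat)
  have hat: "filterlim h (at 0) sequentially"
    using h h0 by (auto simp: filterlim_at less_imp_neq[symmetric] intro!: always_eventually)
  define q where "q N x = (f (x + h N *\<^sub>R axis i 1) - f x) / of_real (h N)" for N x
  obtain C where C: "\<And>x h. 0 < h \<Longrightarrow> h \<le> 1 \<Longrightarrow>
    (1 + norm x) ^ (CARD('n) + 2) * cmod ((f (x + h *\<^sub>R axis i 1) - f x) / of_real h) \<le> C"
    using difference_quotient_bound[OF f] by blast
  have qC: "cmod (q N x) \<le> C * inverse ((1 + norm x) ^ (CARD('n) + 2))" for N x
  proof -
    have "(1 + norm x) ^ (CARD('n) + 2) > 0" by (simp add: add_pos_nonneg)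
    then show ?thesis using C[OF h, of x N] by (simp add: q_def field_simps)
  qed
  have qlim: "(\<lambda>N. q N x) \<longlonglongrightarrow> partial_deriv i f x" for x
  proof -
    let ?D = "frechet_derivative f (at x)"
    have D: "(f has_derivative ?D) (at x)"
      using f frechet_derivative_works smooth_withD(1) unfolding schwartz_functions_iff by blast
    have "((\<lambda>t. f (x + t *\<^sub>R axis i 1)) has_derivative (\<lambda>s. ?D (s *\<^sub>R axis i 1))) (at 0)"
      by (rule has_derivative_compose[of "\<lambda>t. x + t *\<^sub>R axis i 1" "\<lambda>s. s *\<^sub>R axis i 1" 0 UNIV f ?D])
         (use D in \<open>auto intro!: derivative_eq_intros\<close>)
    moreover have "?D (s *\<^sub>R axis i 1) = s *\<^sub>R partial_deriv i f x" for s
      unfolding partial_deriv_def using has_derivative_linear[OF D] by (rule linear_cmul)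
    ultimately have "((\<lambda>t. f (x + t *\<^sub>R axis i 1)) has_vector_derivative partial_deriv i f x) (at 0)"
      by (simp add: has_vector_derivative_def)
    then have "((\<lambda>t. (f (x + t *\<^sub>R axis i 1) - f x) /\<^sub>R t) \<longlongrightarrow> partial_deriv i f x) (at 0)"
      using difference_quotient_tendsto by fastforce
    then have "(\<lambda>N. (f (x + h N *\<^sub>R axis i 1) - f x) /\<^sub>R h N) \<longlonglongrightarrow> partial_deriv i f x"
      by (rule filterlim_compose[OF _ hat])
    then show ?thesis by (simp add: q_def scaleR_conv_of_real divide_inverse mult.commute)
  qed
  have lim1: "(\<lambda>N. fourier (q N) \<xi>) \<longlonglongrightarrow> fourier (partial_deriv i f) \<xi>"
    unfolding fourier_def
  proof (rule integral_dominated_convergence[where w = "\<lambda>x. C * inverse ((1 + norm x) ^ (CARD('n) + 2))"])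
    show "integrable lborel (\<lambda>x::real^'n. C * inverse ((1 + norm x) ^ (CARD('n) + 2)))"
      by (intro integrable_mult_right integrable_decay)
    show "(\<lambda>x. cis (- (x \<bullet> \<xi>)) * q N x) \<in> borel_measurable lborel" for N unfolding q_def by measurable
    show "AE x in lborel. (\<lambda>N. cis (- (x \<bullet> \<xi>)) * q N x) \<longlonglongrightarrow> cis (- (x \<bullet> \<xi>)) * partial_deriv i f x"
      by (intro AE_I2 tendsto_intros qlim)
    show "AE x in lborel. norm (cis (- (x \<bullet> \<xi>)) * q N x) \<le> C * inverse ((1 + norm x) ^ (CARD('n) + 2))" for N
      using qC by (auto simp: norm_mult)
  qed measurable
  have fq: "fourier (q N) \<xi> = ((cis (h N * \<xi> $ i) - 1) / of_real (h N)) * fourier f \<xi>" for N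
  proof -
    have "fourier (q N) \<xi> = inverse (of_real (h N)) * fourier (\<lambda>x. f (x + h N *\<^sub>R axis i 1) - f x) \<xi>"
      unfolding q_def divide_inverse mult.commute[of _ "inverse _"] by (rule fourier_cmult)
    also have "fourier (\<lambda>x. f (x + h N *\<^sub>R axis i 1) - f x) \<xi> = fourier (\<lambda>x. f (x + h N *\<^sub>R axis i 1)) \<xi> - fourier f \<xi>"
      by (intro fourier_diff schwartz_integrable schwartz_translate f)
    also have "fourier (\<lambda>x. f (x + h N *\<^sub>R axis i 1)) \<xi> = cis (h N * \<xi> $ i) * fourier f \<xi>"
      using fourier_translate[of f "h N *\<^sub>R axis i 1" \<xi>] by (simp add: inner_axis')
    finally show ?thesis by (simp add: field_simps)
  qed
  have "((\<lambda>t. cis (t * \<xi> $ i)) has_vector_derivative (\<i> * of_real (\<xi> $ i))) (at 0)"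
  proof -
    have "((\<lambda>t. t * \<xi> $ i) has_derivative (\<lambda>t. t * \<xi> $ i)) (at 0)"
      by (intro has_derivative_mult_left has_derivative_ident)
    from has_derivative_cis[OF this] show ?thesis
      unfolding has_vector_derivative_def by (simp add: scaleR_conv_of_real[where 'a = complex] mult_ac)
  qed
  then have "((\<lambda>t. (cis (t * \<xi> $ i) - 1) /\<^sub>R t) \<longlongrightarrow> \<i> * of_real (\<xi> $ i)) (at 0)"
    using difference_quotient_tendsto by fastforce
  then have "(\<lambda>N. (cis (h N * \<xi> $ i) - 1) /\<^sub>R h N) \<longlonglongrightarrow> \<i> * of_real (\<xi> $ i)"
    by (rule filterlim_compose[OF _ hat])
  then have "(\<lambda>N. fourier (q N) \<xi>) \<longlonglongrightarrow> \<i> * of_real (\<xi> $ i) * fourier f \<xi>"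
    unfolding fq by (intro tendsto_mult_right) (simp add: scaleR_conv_of_real divide_inverse mult.commute)
  with lim1 show ?thesis by (rule LIMSEQ_unique)
qed

text \<open>Induction on k: \<open>1 + norm \<xi>\<close> is at most 1 plus the sum of the
  |\<xi>_i|, and each coordinate \<xi>_i turns into a derivative of f. The bound \<open>M\<close> is
  a variable of its own so that the induction hypothesis applies with the same \<open>M\<close> to f
  and to each of its partial derivatives.\<close>

lemma fourier_decay:
  "\<exists>C\<ge>0. \<forall>f\<in>(schwartz_functions :: (real^'n::finite \<Rightarrow> complex) set). \<forall>M \<xi>.
    (\<forall>\<alpha> x. length \<alpha> \<le> k \<longrightarrow> (1 + norm x) ^ (CARD('n) + 2) * cmod (partial_derivs \<alpha> f x) \<le> M) \<longrightarrow>
    (1 + norm \<xi>) ^ k * cmod (fourier f \<xi>) \<le> C * M"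
proof (induction k)
  case 0
  define I where "I = (LINT x|lborel. inverse ((1 + norm (x::real^'n)) ^ (CARD('n) + 2)))"
  have "I \<ge> 0" unfolding I_def by (rule Bochner_Integration.integral_nonneg) simp
  moreover have "(1 + norm \<xi>) ^ 0 * cmod (fourier f \<xi>) \<le> I * M"
    if f: "f \<in> schwartz_functions" and M: "\<forall>\<alpha> x. length \<alpha> \<le> 0 \<longrightarrow> (1 + norm x) ^ (CARD('n) + 2) * cmod (partial_derivs \<alpha> f x) \<le> M"
    for f :: "real^'n \<Rightarrow> complex" and M \<xi>
  proof -
    have "(1 + norm x) ^ (CARD('n) + 2) * cmod (f x) \<le> M" for x
      using M[rule_format, of "[]" x] by simp
    then have "(LINT x|lborel. cmod (f x)) \<le> M * I"
      unfolding I_def by (intro integrable_of_decay(2)) (use schwartz_measurable[OF f] in simp_all)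
    then show ?thesis using norm_fourier_le[OF schwartz_integrable[OF f], of \<xi>] by (simp add: mult.commute)
  qed
  ultimately show ?case by blast
next
  case (Suc k)
  then obtain C where C: "C \<ge> 0" and IH: "\<And>f M \<xi>. f \<in> schwartz_functions \<Longrightarrow>
    (\<And>\<alpha> x::real^'n. length \<alpha> \<le> k \<Longrightarrow> (1 + norm x) ^ (CARD('n) + 2) * cmod (partial_derivs \<alpha> f x) \<le> M) \<Longrightarrow>
    (1 + norm \<xi>) ^ k * cmod (fourier f \<xi>) \<le> C * M" by blast
  have "(1 + norm \<xi>) ^ Suc k * cmod (fourier f \<xi>) \<le> (C * (1 + real CARD('n))) * M"
    if f: "f \<in> schwartz_functions" and M: "\<forall>\<alpha> x. length \<alpha> \<le> Suc k \<longrightarrow> (1 + norm x) ^ (CARD('n) + 2) * cmod (partial_derivs \<alpha> f x) \<le> M"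
    for f :: "real^'n \<Rightarrow> complex" and M \<xi>
  proof -
    have 1: "(1 + norm \<xi>) ^ k * cmod (fourier f \<xi>) \<le> C * M"
      using M by (intro IH f) simp
    have 2: "(1 + norm \<xi>) ^ k * cmod (fourier (partial_deriv i f) \<xi>) \<le> C * M" for i
    proof (intro IH schwartz_partial_deriv f)
      fix \<alpha> :: "'n list" and x :: "real^'n" assume "length \<alpha> \<le> k"
      \<comment> \<open>The derivative in direction i acts first and therefore stands at the end of
        the list.\<close>
      then show "(1 + norm x) ^ (CARD('n) + 2) * cmod (partial_derivs \<alpha> (partial_deriv i f) x) \<le> M"
        using M[rule_format, of "\<alpha> @ [i]" x] by (simp add: partial_derivs_append)
    qed
    have "(1 + norm \<xi>) ^ Suc k * cmod (fourier f \<xi>) = (1 + norm \<xi>) * ((1 + norm \<xi>) ^ k * cmod (fourier f \<xi>))"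
      by simp
    also have "\<dots> \<le> (1 + (\<Sum>i\<in>UNIV. \<bar>\<xi> $ i\<bar>)) * ((1 + norm \<xi>) ^ k * cmod (fourier f \<xi>))"
      using norm_le_l1_cart[of \<xi>] by (intro mult_right_mono) simp_all
    also have "\<dots> = (1 + norm \<xi>) ^ k * cmod (fourier f \<xi>) + (\<Sum>i\<in>UNIV. (1 + norm \<xi>) ^ k * cmod (fourier (partial_deriv i f) \<xi>))"
    proof -
      have "(1 + norm \<xi>) ^ k * cmod (fourier (partial_deriv i f) \<xi>) = \<bar>\<xi> $ i\<bar> * ((1 + norm \<xi>) ^ k * cmod (fourier f \<xi>))" for i
        by (simp add: fourier_partial_deriv[OF f] norm_mult)
      then show ?thesis by (simp only: distrib_right mult_1_left sum_distrib_right)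
    qed
    also have "\<dots> \<le> C * M + (\<Sum>i\<in>(UNIV::'n set). C * M)"
      by (intro add_mono sum_mono 1 2)
    finally show ?thesis by (simp add: distrib_left distrib_right mult_ac)
  qed
  moreover have "0 \<le> C * (1 + real CARD('n))" using C by simp
  ultimately show ?case by (intro exI[of _ "C * (1 + real CARD('n))"] conjI ballI allI impI)
qed

lemma fourier_decay_seminorm:
  obtains C where "C \<ge> 0" "\<And>f \<xi>. f \<in> (schwartz_functions :: (real^'n::finite \<Rightarrow> complex) set) \<Longrightarrow>
    (1 + norm \<xi>) ^ k * cmod (fourier f \<xi>) \<le> C * schwartz_seminorm (CARD('n) + 2) k f"
proof -
  obtain C where C: "C \<ge> 0" and *: "\<And>f M \<xi>. f \<in> (schwartz_functions :: (real^'n::finite \<Rightarrow> complex) set) \<Longrightarrow>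
    (\<And>\<alpha> x. length \<alpha> \<le> k \<Longrightarrow> (1 + norm x) ^ (CARD('n) + 2) * cmod (partial_derivs \<alpha> f x) \<le> M) \<Longrightarrow>
    (1 + norm \<xi>) ^ k * cmod (fourier f \<xi>) \<le> C * M"
    using fourier_decay[of k] by blast
  show ?thesis
    by (rule that[OF C]) (intro * schwartz_seminorm_upper)
qed

lemma schwartz_fourier:
  fixes f :: "real^'n::finite \<Rightarrow> complex"
  assumes "f \<in> schwartz_functions"
  shows "fourier f \<in> schwartz_functions"
  unfolding schwartz_functions_iff
proof (rule smooth_with_coinduct[where A = "\<lambda>h. \<exists>f\<in>schwartz_functions. h = fourier f"])
  show "\<exists>g\<in>schwartz_functions. fourier f = fourier g"
    by (rule rev_bexI[OF assms refl])
next
  fix g :: "real^'n \<Rightarrow> complex" and x i assume "\<exists>f\<in>schwartz_functions. g = fourier f"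
  then obtain f where f: "f \<in> schwartz_functions" "g = fourier f" by blast
  show "g differentiable (at x)" unfolding f(2) using fourier_has_derivative[OF f(1)] by (rule differentiableI)
  show "rapid g"
    unfolding rapid_def
  proof
    fix k
    obtain C where "\<And>f \<xi>. f \<in> (schwartz_functions :: (real^'n \<Rightarrow> complex) set) \<Longrightarrow>
      (1 + norm \<xi>) ^ k * cmod (fourier f \<xi>) \<le> C * schwartz_seminorm (CARD('n) + 2) k f"
      using fourier_decay_seminorm by blast
    from this[OF f(1)] show "\<exists>C. \<forall>x. (1 + norm x) ^ k * cmod (g x) \<le> C" unfolding f(2) by blast
  qed
  show "\<exists>f\<in>schwartz_functions. partial_deriv i g = fourier f"
    unfolding f(2) partial_deriv_fourier[OF f(1)]
    by (intro rev_bexI[of "\<lambda>x. - \<i> * (of_real (x $ i) * f x)"] schwartz_cmult schwartz_coordinate f(1) refl)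
qed

lemma schwartz_inverse_fourier:
  assumes "f \<in> schwartz_functions"
  shows "inverse_fourier f \<in> schwartz_functions"
proof -
  have "(\<lambda>x. fourier f (0 - x)) \<in> schwartz_functions"
    by (intro schwartz_reflect schwartz_fourier assms)
  then have "(\<lambda>x. of_real (1 / (2 * pi) ^ CARD('a)) * fourier f (- x)) \<in> schwartz_functions"
    by (intro schwartz_cmult) simp
  then show ?thesis by (simp only: inverse_fourier_eq[abs_def])
qed

section \<open>The multiplication formula\<close>

lemma fourier_multiplication_formula:
  fixes f g :: "real^'n::finite \<Rightarrow> complex"
  assumes f: "integrable lborel f" and g: "integrable lborel g"
  shows "(LINT \<xi>|lborel. fourier f \<xi> * g \<xi>) = (LINT x|lborel. f x * fourier g x)"
proof -
  define h where "h x \<xi> = cis (- (x \<bullet> \<xi>)) * f x * g \<xi>" for x \<xi>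
  have [measurable]: "f \<in> borel_measurable borel" "g \<in> borel_measurable borel" using f g by auto
  have "(\<lambda>p::(real^'n) \<times> (real^'n). cis (- (fst p \<bullet> snd p))) \<in> borel_measurable borel"
    by (intro borel_measurable_continuous_onI continuous_intros)
  then have [measurable]: "(\<lambda>p::(real^'n) \<times> (real^'n). cis (- (fst p \<bullet> snd p))) \<in> borel_measurable (borel \<Otimes>\<^sub>M borel)"
    by (simp add: borel_prod)
  have norm: "norm (h x \<xi>) = cmod (f x) * cmod (g \<xi>)" for x \<xi> by (simp add: h_def norm_mult)
  have m: "(\<lambda>p. h (fst p) (snd p)) \<in> borel_measurable (lborel \<Otimes>\<^sub>M lborel)"
    unfolding h_def by measurable
  have int: "integrable (lborel \<Otimes>\<^sub>M lborel) (case_prod h)"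
  proof (rule lborel_pair.Fubini_integrable)
    show "case_prod h \<in> borel_measurable (lborel \<Otimes>\<^sub>M lborel)" using m by (simp add: case_prod_unfold)
    show "integrable lborel (\<lambda>x. LINT y|lborel. norm (case_prod h (x, y)))"
      using integrable_mult_left[OF integrable_norm[OF f]] by (simp add: norm)
    show "AE x in lborel. integrable lborel (\<lambda>y. case_prod h (x, y))"
    proof (rule AE_I2)
      fix x
      have "(\<lambda>y. case_prod h (x, y)) = (\<lambda>y. f x * (cis (- (y \<bullet> x)) * g y))"
        by (auto simp: h_def inner_commute)
      then show "integrable lborel (\<lambda>y. case_prod h (x, y))"
        using integrable_mult_right[OF integrable_modulate[OF g, of x], of "f x"] by simp
    qed
  qed
  have "(LINT \<xi>|lborel. fourier f \<xi> * g \<xi>) = (LINT \<xi>|lborel. LINT x|lborel. h x \<xi>)"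
    unfolding fourier_def h_def by simp
  also have "\<dots> = (LINT x|lborel. LINT \<xi>|lborel. h x \<xi>)"
    by (rule lborel_pair.Fubini_integral[OF int])
  also have "\<dots> = (LINT x|lborel. f x * fourier g x)"
  proof -
    have "(LINT \<xi>|lborel. h x \<xi>) = f x * fourier g x" for x
    proof -
      have "h x \<xi> = f x * (cis (- (\<xi> \<bullet> x)) * g \<xi>)" for \<xi> by (simp add: h_def inner_commute)
      then show ?thesis by (simp add: fourier_def)
    qed
    then show ?thesis by simp
  qed
  finally show ?thesis .
qed

subsection \<open>Fourier inversion\<close>

text \<open>Normalised so that the Fourier transform reproduces it up to the factor (2 pi)^(n/2), n
  being the dimension.\<close>

definition gauss :: "real^'n::finite \<Rightarrow> complex" where
  "gauss x = of_real (exp (- (norm x)\<^sup>2 / 2))"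

text \<open>Up to the factor sqrt(2 pi) this is the characteristic function of the standard normal
  distribution, evaluated at \<open>- s\<close>.\<close>

lemma integral_gauss_real:
  "(LINT t|lborel. complex_of_real (exp (- t\<^sup>2 / 2)) * cis (- (t * s))) = of_real (sqrt (2 * pi) * exp (- s\<^sup>2 / 2))"
  "integrable lborel (\<lambda>t. complex_of_real (exp (- t\<^sup>2 / 2)) * cis (- (t * s)))"
proof -
  have dens: "exp (- t\<^sup>2 / 2) = sqrt (2 * pi) * std_normal_density t" for t
    by (simp add: std_normal_density_def)
  have [measurable]: "(\<lambda>t. cis (- (t * s))) \<in> borel_measurable borel"
    by (intro borel_measurable_continuous_onI continuous_intros)
  have "integrable lborel std_normal_density"
    using integrable_std_normal_moment[of 0] by simp
  then have "integrable lborel (\<lambda>t. complex_of_real (exp (- t\<^sup>2 / 2)))"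
    unfolding dens of_real_mult by (intro integrable_mult_right integrable_of_real)
  then show "integrable lborel (\<lambda>t. complex_of_real (exp (- t\<^sup>2 / 2)) * cis (- (t * s)))"
    by (rule Bochner_Integration.integrable_bound) (auto simp: norm_mult)
  have "complex_of_real (exp (- (- s)\<^sup>2 / 2)) = (LINT t|std_normal_distribution. iexp ((- s) * t))"
    using char_std_normal_distribution unfolding char_def by metis
  also have "\<dots> = (LINT t|lborel. std_normal_density t *\<^sub>R iexp ((- s) * t))"
    by (rule integral_density) (auto simp: normal_density_nonneg)
  finally have *: "(LINT t|lborel. std_normal_density t *\<^sub>R iexp ((- s) * t)) = of_real (exp (- s\<^sup>2 / 2))" by simp
  have "(LINT t|lborel. complex_of_real (exp (- t\<^sup>2 / 2)) * cis (- (t * s))) =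
    (LINT t|lborel. of_real (sqrt (2 * pi)) * (std_normal_density t *\<^sub>R iexp ((- s) * t)))"
    unfolding dens cis_conv_exp by (simp add: scaleR_conv_of_real mult_ac)
  also have "\<dots> = of_real (sqrt (2 * pi)) * of_real (exp (- s\<^sup>2 / 2))"
    by (simp only: integral_mult_right_zero *)
  finally show "(LINT t|lborel. complex_of_real (exp (- t\<^sup>2 / 2)) * cis (- (t * s))) = of_real (sqrt (2 * pi) * exp (- s\<^sup>2 / 2))"
    by simp
qed

lemma fourier_gauss:
  fixes \<xi> :: "real^'n::finite"
  shows "fourier gauss \<xi> = of_real (sqrt (2 * pi) ^ CARD('n)) * gauss \<xi>"
    "integrable lborel (gauss :: real^'n \<Rightarrow> complex)"
proof -
  define g where "g s t = complex_of_real (exp (- t\<^sup>2 / 2)) * cis (- (t * s))" for s t :: real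
  interpret P: product_sigma_finite "\<lambda>_::real^'n. lborel :: real measure" ..
  have [measurable]: "g s \<in> borel_measurable borel" for s
    unfolding g_def by (intro borel_measurable_continuous_onI continuous_intros) auto
  have gi: "integrable lborel (g s)" and gI: "integral\<^sup>L lborel (g s) = of_real (sqrt (2 * pi)) * g 0 s" for s
    using integral_gauss_real[of s] by (simp_all add: g_def[abs_def])
  \<comment> \<open>Both the Gaussian and the exponential factor over the coordinates, so the
    integral against the product measure is a product of one-dimensional ones.\<close>
  have prod: "cis (- (x \<bullet> \<zeta>)) * gauss x = (\<Prod>b\<in>Basis. g (\<zeta> \<bullet> b) (x \<bullet> b))" for x \<zeta> :: "real^'n"
  proof -
    have "(norm x)\<^sup>2 = (\<Sum>b\<in>Basis. (x \<bullet> b)\<^sup>2)"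
      unfolding power2_norm_eq_inner by (subst euclidean_inner) (simp add: power2_eq_square)
    then have "exp (- (norm x)\<^sup>2 / 2) = (\<Prod>b\<in>Basis. exp (- (x \<bullet> b)\<^sup>2 / 2))"
      by (simp add: exp_sum[symmetric] sum_negf sum_divide_distrib)
    moreover have "cis (- (x \<bullet> \<zeta>)) = (\<Prod>b\<in>Basis. cis (- ((x \<bullet> b) * (\<zeta> \<bullet> b))))"
      by (simp add: cis_conv_exp exp_sum[symmetric] euclidean_inner[of x \<zeta>] sum_negf sum_distrib_left)
    ultimately show ?thesis
      by (simp add: gauss_def g_def prod.distrib mult.commute)
  qed
  have coord: "(\<Sum>b\<in>Basis. w b *\<^sub>R b) \<bullet> c = w c" if "c \<in> Basis" for w and c :: "real^'n"
    using that by simp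
  have eqf: "(\<Prod>b\<in>Basis. g (\<zeta> \<bullet> b) ((\<Sum>b\<in>Basis. w b *\<^sub>R b) \<bullet> b)) = (\<Prod>b\<in>Basis. g (\<zeta> \<bullet> b) (w b))"
    for w :: "real^'n \<Rightarrow> real" and \<zeta> :: "real^'n"
    by (intro prod.cong refl) (simp add: coord)
  have int: "integrable (\<Pi>\<^sub>M b\<in>(Basis :: (real^'n) set). lborel) (\<lambda>w. \<Prod>b\<in>Basis. g (\<zeta> \<bullet> b) (w b))" for \<zeta> :: "real^'n"
    by (rule P.product_integrable_prod) (simp_all add: gi)
  have m: "(\<lambda>w. \<Sum>b\<in>Basis. w b *\<^sub>R b) \<in> measurable (\<Pi>\<^sub>M b\<in>(Basis :: (real^'n) set). lborel) borel"
    by measurable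
  have mp: "(\<lambda>x::real^'n. \<Prod>b\<in>Basis. g (\<zeta> \<bullet> b) (x \<bullet> b)) \<in> borel_measurable borel" for \<zeta> :: "real^'n"
    by measurable
  have "fourier gauss \<xi> = (LINT x|lborel. (\<Prod>b\<in>Basis. g (\<xi> \<bullet> b) (x \<bullet> b)))"
    unfolding fourier_def prod ..
  also have "\<dots> = integral\<^sup>L (\<Pi>\<^sub>M b\<in>(Basis :: (real^'n) set). lborel) (\<lambda>w. \<Prod>b\<in>Basis. g (\<xi> \<bullet> b) (w b))"
    by (subst lborel_eq, subst integral_distr[OF m mp]) (simp only: eqf)
  also have "\<dots> = (\<Prod>b\<in>Basis. integral\<^sup>L lborel (g (\<xi> \<bullet> b)))"
    by (rule P.product_integral_prod) (simp_all add: gi)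
  also have "\<dots> = (\<Prod>b\<in>Basis. of_real (sqrt (2 * pi)) * g 0 (\<xi> \<bullet> b))"
    by (simp only: gI)
  also have "\<dots> = of_real (sqrt (2 * pi) ^ CARD('n)) * gauss \<xi>"
    using prod[of \<xi> 0] by (simp add: prod.distrib)
  finally show "fourier gauss \<xi> = of_real (sqrt (2 * pi) ^ CARD('n)) * gauss \<xi>" .
  have "integrable lborel (\<lambda>x::real^'n. \<Prod>b\<in>Basis. g (0 \<bullet> b) (x \<bullet> b))"
    by (subst lborel_eq, subst integrable_distr_eq[OF m mp]) (use int[of 0] in \<open>simp only: eqf\<close>)
  then show "integrable lborel (gauss :: real^'n \<Rightarrow> complex)"
    unfolding prod[symmetric] by simp
qed

lemma lborel_integrable_affine:
  fixes f :: "'a::euclidean_space \<Rightarrow> 'b::{banach, second_countable_topology}"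
  assumes f: "integrable lborel f" and c: "c \<noteq> 0"
  shows "integrable lborel (\<lambda>x. f (t + c *\<^sub>R x))"
proof -
  have [measurable]: "f \<in> borel_measurable borel" using f by auto
  have "integrable (density (distr lborel borel (\<lambda>x. t + c *\<^sub>R x)) (\<lambda>_. ennreal (\<bar>c\<bar> ^ DIM('a)))) f"
    using f lborel_affine[OF c, of t] by (simp add: ennreal_power)
  then have "integrable (distr lborel borel (\<lambda>x. t + c *\<^sub>R x)) (\<lambda>x. \<bar>c\<bar> ^ DIM('a) *\<^sub>R f x)"
    by (subst (asm) integrable_density) auto
  then have int: "integrable lborel (\<lambda>x. \<bar>c\<bar> ^ DIM('a) *\<^sub>R f (t + c *\<^sub>R x))"
    by (subst (asm) integrable_distr_eq) auto
  have cancel: "integrable lborel g" if "integrable lborel (\<lambda>x. k *\<^sub>R g x)" "k \<noteq> 0" for g :: "'a \<Rightarrow> 'b" and k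
    using integrable_scaleR_right[of "inverse k" lborel "\<lambda>x. k *\<^sub>R g x"] that by simp
  have "\<bar>c\<bar> ^ DIM('a) \<noteq> 0" using c by simp
  then show ?thesis by (rule cancel[OF int])
qed

lemma continuous_gauss: "continuous_on UNIV (gauss :: real^'n::finite \<Rightarrow> complex)"
  unfolding gauss_def by (intro continuous_intros) auto

text \<open>Inversion at the origin. By the multiplication formula for the Gaussian dilated by h,
  the integral of \<open>fourier f \<xi> * gauss (h \<xi>)\<close> equals K times that of
  \<open>f (h z) * gauss z\<close>, and dominated convergence for h tending to 0 applies on both
  sides. One factor K comes from the transform of the Gaussian, the other from its integral.\<close>

lemma fourier_integral:
  fixes f :: "real^'n::finite \<Rightarrow> complex"
  assumes f: "f \<in> schwartz_functions"
  shows "(LINT \<xi>|lborel. fourier f \<xi>) = of_real ((2 * pi) ^ CARD('n)) * f 0"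
proof -
  define K where "K = complex_of_real (sqrt (2 * pi) ^ CARD('n))"
  have KK: "K * K = of_real ((2 * pi) ^ CARD('n))"
  proof -
    have "K * K = of_real ((sqrt (2 * pi) * sqrt (2 * pi)) ^ CARD('n))"
      unfolding K_def by (simp only: power_mult_distrib of_real_mult)
    also have "sqrt (2 * pi) * sqrt (2 * pi) = 2 * pi" by simp
    finally show ?thesis .
  qed
  have gauss0: "gauss (0 :: real^'n) = 1" by (simp add: gauss_def)
  have Fgauss: "fourier gauss \<xi> = K * gauss \<xi>" for \<xi> :: "real^'n"
    using fourier_gauss(1)[of \<xi>] by (simp add: K_def)
  have intgauss: "(LINT x|lborel. gauss (x::real^'n)) = K"
    using Fgauss[of 0] by (simp add: fourier_def gauss0)
  have ig: "integrable lborel (gauss :: real^'n \<Rightarrow> complex)" by (rule fourier_gauss(2))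
  have gm [measurable]: "(gauss :: real^'n \<Rightarrow> complex) \<in> borel_measurable borel"
    by (intro borel_measurable_continuous_onI continuous_gauss)
  have fm [measurable]: "f \<in> borel_measurable borel" "fourier f \<in> borel_measurable borel"
    using f schwartz_fourier[OF f] by (auto intro: schwartz_measurable)
  have cm: "(\<lambda>x. cis (- (x \<bullet> \<zeta>))) \<in> borel_measurable borel" for \<zeta> :: "real^'n"
    by (intro borel_measurable_continuous_onI continuous_intros)
  define h where "h N = inverse (real (Suc N))" for N
  have h: "h N > 0" for N by (simp add: h_def)
  have h0: "h \<longlonglongrightarrow> 0" unfolding h_def by (rule LIMSEQ_inverse_real_of_nat)
  have gh: "(\<lambda>\<xi>. gauss (h N *\<^sub>R \<xi>)) \<in> borel_measurable (borel :: (real^'n) measure)" for N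
    by (rule measurable_compose[OF _ gm]) simp
  have hx: "(\<lambda>N. h N *\<^sub>R x) \<longlonglongrightarrow> 0" for x :: "real^'n"
    using tendsto_scaleR[OF h0 tendsto_const[of x]] by simp
  have Fh: "fourier (\<lambda>\<xi>. gauss (h N *\<^sub>R \<xi>)) y = of_real (inverse (h N) ^ CARD('n)) * (K * gauss (inverse (h N) *\<^sub>R y))" for N and y :: "real^'n"
  proof -
    have "fourier (\<lambda>\<xi>. gauss (h N *\<^sub>R \<xi>)) y =
      \<bar>inverse (h N)\<bar> ^ DIM(real^'n) *\<^sub>R (LINT x|lborel. cis (- ((0 + inverse (h N) *\<^sub>R x) \<bullet> y)) * gauss (h N *\<^sub>R (0 + inverse (h N) *\<^sub>R x)))"
      unfolding fourier_def
    proof (rule lborel_integral_affine)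
      have "(\<lambda>y. gauss (h N *\<^sub>R y)) \<in> borel_measurable (borel :: (real^'n) measure)"
        by (rule measurable_compose[OF _ gm]) simp
      then show "(\<lambda>x. cis (- (x \<bullet> y)) * gauss (h N *\<^sub>R x)) \<in> borel_measurable borel"
        by (intro borel_measurable_times cm)
    qed (use h[of N] in simp)
    also have "(\<lambda>x. cis (- ((0 + inverse (h N) *\<^sub>R x) \<bullet> y)) * gauss (h N *\<^sub>R (0 + inverse (h N) *\<^sub>R x))) =
      (\<lambda>x. cis (- (x \<bullet> (inverse (h N) *\<^sub>R y))) * gauss x)"
      using h[of N] by (auto simp: fun_eq_iff)
    also have "(LINT x|lborel. cis (- (x \<bullet> (inverse (h N) *\<^sub>R y))) * gauss x) = K * gauss (inverse (h N) *\<^sub>R y)"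
      using Fgauss by (simp only: fourier_def)
    finally show ?thesis using h[of N] by (simp add: scaleR_conv_of_real[where 'a = complex])
  qed
  have I: "(LINT \<xi>|lborel. fourier f \<xi> * gauss (h N *\<^sub>R \<xi>)) = K * (LINT z|lborel. f (h N *\<^sub>R z) * gauss z)" for N
  proof -
    have "integrable lborel (\<lambda>\<xi> :: real^'n. gauss (h N *\<^sub>R \<xi>))"
      using lborel_integrable_affine[OF ig, of "h N" 0] h[of N] by simp
    then have "(LINT \<xi>|lborel. fourier f \<xi> * gauss (h N *\<^sub>R \<xi>)) = (LINT y|lborel. f y * fourier (\<lambda>\<xi>. gauss (h N *\<^sub>R \<xi>)) y)"
      by (rule fourier_multiplication_formula[OF schwartz_integrable[OF f]])
    moreover have "(LINT y|lborel. f y * fourier (\<lambda>\<xi>. gauss (h N *\<^sub>R \<xi>)) y) =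
      K * (LINT z|lborel. f (h N *\<^sub>R z) * gauss z)"
    proof -
      let ?A = "complex_of_real (inverse (h N) ^ CARD('n))"
      have 1: "(LINT y|lborel. f y * (?A * (K * gauss (inverse (h N) *\<^sub>R y)))) =
        \<bar>h N\<bar> ^ DIM(real^'n) *\<^sub>R (LINT z|lborel. f (0 + h N *\<^sub>R z) * (?A * (K * gauss (inverse (h N) *\<^sub>R (0 + h N *\<^sub>R z)))))"
      proof (rule lborel_integral_affine)
        have "(\<lambda>y. gauss (inverse (h N) *\<^sub>R y)) \<in> borel_measurable (borel :: (real^'n) measure)"
          by (rule measurable_compose[OF _ gm]) simp
        then show "(\<lambda>y. f y * (?A * (K * gauss (inverse (h N) *\<^sub>R y)))) \<in> borel_measurable borel"
          by (intro borel_measurable_times borel_measurable_const fm(1))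
      qed (use h[of N] in simp)
      have 2: "f (0 + h N *\<^sub>R z) * (?A * (K * gauss (inverse (h N) *\<^sub>R (0 + h N *\<^sub>R z)))) = (?A * K) * (f (h N *\<^sub>R z) * gauss z)" for z
        using h[of N] by simp
      have "complex_of_real (\<bar>h N\<bar> ^ CARD('n)) * ?A = of_real ((\<bar>h N\<bar> * inverse (h N)) ^ CARD('n))"
        by (simp only: power_mult_distrib of_real_mult)
      moreover have "\<bar>h N\<bar> * inverse (h N) = 1" using h[of N] by simp
      ultimately have "complex_of_real (\<bar>h N\<bar> ^ CARD('n)) * ?A = 1" by simp
      then have 3: "complex_of_real (\<bar>h N\<bar> ^ CARD('n)) * ((?A * K) * y) = K * y" for y
        by (simp only: mult.assoc[symmetric] mult_1_left)
      show ?thesis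
        unfolding Fh 1 2 integral_mult_right_zero scaleR_conv_of_real[where 'a = complex] DIM_cart DIM_real mult_1_right
        by (rule 3)
    qed
    ultimately show ?thesis by (rule trans)
  qed
  have "(\<lambda>N. LINT \<xi>|lborel. fourier f \<xi> * gauss (h N *\<^sub>R \<xi>)) \<longlonglongrightarrow> (LINT \<xi>|lborel. fourier f \<xi>)"
  proof (rule integral_dominated_convergence[where w = "\<lambda>\<xi>. cmod (fourier f \<xi>)"
        and s = "\<lambda>N \<xi>. fourier f \<xi> * gauss (h N *\<^sub>R \<xi>)" and f = "fourier f" and M = lborel])
    show "(\<lambda>\<xi>. fourier f \<xi> * gauss (h N *\<^sub>R \<xi>)) \<in> borel_measurable lborel" for N
      using gh[of N] fm by simp
    show "fourier f \<in> borel_measurable lborel" using fm by simp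
    show "integrable lborel (\<lambda>\<xi>. cmod (fourier f \<xi>))"
      by (intro integrable_norm schwartz_integrable schwartz_fourier f)
    show "AE \<xi> in lborel. (\<lambda>N. fourier f \<xi> * gauss (h N *\<^sub>R \<xi>)) \<longlonglongrightarrow> fourier f \<xi>"
    proof (rule AE_I2)
      fix \<xi> :: "real^'n"
      have "(\<lambda>N. gauss (h N *\<^sub>R \<xi>)) \<longlonglongrightarrow> gauss (0 :: real^'n)"
        using continuous_on_tendsto_compose[OF continuous_gauss hx] by simp
      then show "(\<lambda>N. fourier f \<xi> * gauss (h N *\<^sub>R \<xi>)) \<longlonglongrightarrow> fourier f \<xi>"
        using tendsto_mult_left[of _ 1 sequentially "fourier f \<xi>"] by (simp add: gauss0)
    qed
    show "AE \<xi> in lborel. norm (fourier f \<xi> * gauss (h N *\<^sub>R \<xi>)) \<le> cmod (fourier f \<xi>)" for N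
      by (simp add: norm_mult gauss_def mult_left_le)
  qed
  moreover have "(\<lambda>N. K * (LINT z|lborel. f (h N *\<^sub>R z) * gauss z)) \<longlonglongrightarrow> K * (LINT z|lborel. f 0 * gauss (z :: real^'n))"
  proof (rule tendsto_mult_left)
    obtain C where C: "\<And>x. cmod (f x) \<le> C"
      using schwartz_imp_rapid[OF f, unfolded rapid_def, rule_format, of 0] by auto
    show "(\<lambda>N. LINT z|lborel. f (h N *\<^sub>R z) * gauss z) \<longlonglongrightarrow> (LINT z|lborel. f 0 * gauss (z :: real^'n))"
    proof (rule integral_dominated_convergence[where w = "\<lambda>z. C * cmod (gauss z)"
        and s = "\<lambda>N z. f (h N *\<^sub>R z) * gauss z" and f = "\<lambda>z :: real^'n. f 0 * gauss z" and M = lborel])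
      have "(\<lambda>z. f (h N *\<^sub>R z)) \<in> borel_measurable borel" for N
        by (rule measurable_compose[OF _ fm(1)]) simp
      then show "(\<lambda>z. f (h N *\<^sub>R z) * gauss z) \<in> borel_measurable lborel" for N
        using gm by simp
      show "(\<lambda>z :: real^'n. f 0 * gauss z) \<in> borel_measurable lborel" using gm by simp
      show "integrable lborel (\<lambda>z::real^'n. C * cmod (gauss z))"
        by (intro integrable_mult_right integrable_norm ig)
      show "AE z in lborel. (\<lambda>N. f (h N *\<^sub>R z) * gauss z) \<longlonglongrightarrow> f 0 * gauss z"
        using continuous_on_tendsto_compose[OF schwartz_imp_continuous[OF f] hx]
        by (intro AE_I2 tendsto_mult_right) simp
      show "AE z in lborel. norm (f (h N *\<^sub>R z) * gauss z) \<le> C * cmod (gauss z)" for N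
        by (intro AE_I2) (simp add: norm_mult C mult_right_mono)
    qed
  qed
  ultimately have "(LINT \<xi>|lborel. fourier f \<xi>) = K * (LINT z|lborel. f 0 * gauss (z :: real^'n))"
    unfolding I by (rule LIMSEQ_unique)
  also have "\<dots> = (K * K) * f 0"
    by (simp add: intgauss)
  finally show ?thesis by (simp only: KK)
qed

section \<open>Inversion, Parseval, Plancherel and the transform of a product\<close>

lemma inverse_fourier_fourier:
  fixes f :: "real^'n::finite \<Rightarrow> complex"
  assumes f: "f \<in> schwartz_functions"
  shows "inverse_fourier (fourier f) = f"
proof
  fix x
  \<comment> \<open>Inversion at x is inversion at the origin for the function translated by
    x.\<close>
  have "(LINT \<xi>|lborel. cis (x \<bullet> \<xi>) * fourier f \<xi>) = (LINT \<xi>|lborel. fourier (\<lambda>y. f (y + x)) \<xi>)"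
    by (simp only: fourier_translate[OF schwartz_measurable[OF f]])
  also have "\<dots> = of_real ((2 * pi) ^ CARD('n)) * f x"
    using fourier_integral[OF schwartz_translate[OF f, of x]] by simp
  finally show "inverse_fourier (fourier f) x = f x" by (simp add: inverse_fourier_def)
qed

lemma fourier_inverse_fourier:
  fixes f :: "real^'n::finite \<Rightarrow> complex"
  assumes f: "f \<in> schwartz_functions"
  shows "fourier (inverse_fourier f) = f"
proof
  fix \<xi> :: "real^'n"
  have [measurable]: "fourier f \<in> borel_measurable borel" by (intro schwartz_measurable schwartz_fourier f)
  have [measurable]: "(\<lambda>x. cis (x \<bullet> \<xi>)) \<in> borel_measurable borel"
    by (intro borel_measurable_continuous_onI continuous_intros)
  have "fourier (inverse_fourier f) \<xi> = of_real (1 / (2 * pi) ^ CARD('n)) * fourier (\<lambda>x. fourier f (- x)) \<xi>"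
    unfolding inverse_fourier_eq[abs_def] by (rule fourier_cmult)
  also have "fourier (\<lambda>x. fourier f (- x)) \<xi> = (LINT x|lborel. cis (x \<bullet> \<xi>) * fourier f x)"
    using lborel_integral_reflect[of "\<lambda>x. cis (x \<bullet> \<xi>) * fourier f x" 0]
    by (simp add: fourier_def[of "\<lambda>x. fourier f (- x)"])
  also have "of_real (1 / (2 * pi) ^ CARD('n)) * \<dots> = inverse_fourier (fourier f) \<xi>"
    by (simp only: inverse_fourier_def inner_commute[of \<xi>])
  finally show "fourier (inverse_fourier f) \<xi> = f \<xi>" by (simp only: inverse_fourier_fourier[OF f])
qed

text \<open>\<open>g\<close> is written as the transform of its inverse transform, after which the
  multiplication formula applies. The pairing is bilinear, as for distributions, hence the reflected
  argument of the second transform in place of a conjugate.\<close>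

lemma parseval:
  fixes f g :: "real^'n::finite \<Rightarrow> complex"
  assumes f: "f \<in> schwartz_functions" and g: "g \<in> schwartz_functions"
  shows "(LINT x|lborel. f x * g x) =
    of_real (1 / (2 * pi) ^ CARD('n)) * (LINT \<xi>|lborel. fourier f \<xi> * fourier g (- \<xi>))"
proof -
  have "(LINT x|lborel. f x * g x) = (LINT x|lborel. f x * fourier (inverse_fourier g) x)"
    by (simp only: fourier_inverse_fourier[OF g])
  also have "\<dots> = (LINT \<xi>|lborel. fourier f \<xi> * inverse_fourier g \<xi>)"
    by (intro fourier_multiplication_formula[symmetric] schwartz_integrable schwartz_inverse_fourier f g)
  also have "\<dots> = (LINT \<xi>|lborel. of_real (1 / (2 * pi) ^ CARD('n)) * (fourier f \<xi> * fourier g (- \<xi>)))"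
    by (simp only: inverse_fourier_eq mult.left_commute)
  finally show ?thesis by (simp only: integral_mult_right_zero)
qed

lemma plancherel:
  fixes f :: "real^'n::finite \<Rightarrow> complex"
  assumes f: "f \<in> schwartz_functions"
  shows "(LINT x|lborel. (cmod (f x))\<^sup>2) = 1 / (2 * pi) ^ CARD('n) * (LINT \<xi>|lborel. (cmod (fourier f \<xi>))\<^sup>2)"
proof -
  have "complex_of_real (LINT x|lborel. (cmod (f x))\<^sup>2) = (LINT x|lborel. f x * cnj (f x))"
    by (simp only: integral_complex_of_real[symmetric] complex_norm_square)
  also have "\<dots> = of_real (1 / (2 * pi) ^ CARD('n)) * (LINT \<xi>|lborel. fourier f \<xi> * cnj (fourier f \<xi>))"
    using parseval[OF f schwartz_cnj[OF f]] by (simp add: fourier_cnj)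
  also have "(LINT \<xi>|lborel. fourier f \<xi> * cnj (fourier f \<xi>)) = of_real (LINT \<xi>|lborel. (cmod (fourier f \<xi>))\<^sup>2)"
    by (simp only: integral_complex_of_real[symmetric] complex_norm_square)
  finally show ?thesis unfolding of_real_mult[symmetric] of_real_eq_iff .
qed

text \<open>Parseval's identity for f and the modulated g; the convolution arises because modulation
  is a shift on the Fourier side.\<close>

lemma fourier_mult:
  fixes f g :: "real^'n::finite \<Rightarrow> complex"
  assumes f: "f \<in> schwartz_functions" and g: "g \<in> schwartz_functions"
  shows "fourier (\<lambda>x. f x * g x) \<xi> =
    of_real (1 / (2 * pi) ^ CARD('n)) * (LINT \<eta>|lborel. fourier f \<eta> * fourier g (\<xi> - \<eta>))"
proof -
  have "fourier (\<lambda>x. f x * g x) \<xi> = (LINT x|lborel. f x * (cis (- (x \<bullet> \<xi>)) * g x))"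
    unfolding fourier_def by (simp only: mult.left_commute)
  also have "\<dots> = of_real (1 / (2 * pi) ^ CARD('n)) *
      (LINT \<eta>|lborel. fourier f \<eta> * fourier (\<lambda>x. cis (- (x \<bullet> \<xi>)) * g x) (- \<eta>))"
    by (rule parseval[OF f schwartz_modulate[OF g]])
  finally show ?thesis by (simp add: fourier_modulate)
qed

section \<open>Weights\<close>

text \<open>The last condition is Peetre's inequality.\<close>

definition admissible :: "(real^'n::finite \<Rightarrow> real) \<Rightarrow> bool" where
  "admissible w \<longleftrightarrow> (\<forall>\<xi>. w \<xi> > 0 \<and> w (- \<xi>) = w \<xi>) \<and>
    smooth_with slow (\<lambda>\<xi>. of_real (w \<xi>)) \<and> smooth_with slow (\<lambda>\<xi>. of_real (inverse (w \<xi>))) \<and>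
    (\<exists>A N. \<forall>\<xi> \<eta>. w \<xi> \<le> A * (1 + norm \<eta>) ^ N * w (\<xi> - \<eta>))"

lemma admissibleD:
  assumes "admissible w"
  shows "w \<xi> > 0" "w (- \<xi>) = w \<xi>" "smooth_with slow (\<lambda>\<xi>. of_real (w \<xi>))"
    "smooth_with slow (\<lambda>\<xi>. of_real (inverse (w \<xi>)))"
  using assms by (simp_all add: admissible_def)

lemma admissible_inverse:
  assumes "admissible w" shows "admissible (\<lambda>\<xi>. inverse (w \<xi>))"
proof -
  obtain A N where P: "\<And>\<xi> \<eta>. w \<xi> \<le> A * (1 + norm \<eta>) ^ N * w (\<xi> - \<eta>)"
    using assms unfolding admissible_def by blast
  \<comment> \<open>Peetre's inequality for w at the point \<open>\<xi> - \<eta>\<close> with shift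
    \<open>- \<eta>\<close>, which exchanges the roles of \<xi> and \<xi> - \<eta>.\<close>
  have "inverse (w \<xi>) \<le> A * (1 + norm \<eta>) ^ N * inverse (w (\<xi> - \<eta>))" for \<xi> \<eta>
    using P[of "\<xi> - \<eta>" "- \<eta>"] admissibleD(1)[OF assms, of \<xi>] admissibleD(1)[OF assms, of "\<xi> - \<eta>"]
    by (simp add: field_simps)
  then show ?thesis using admissibleD[OF assms] unfolding admissible_def inverse_inverse_eq by auto
qed

section \<open>Peetre's inequality and smoothness for the product weight\<close>

lemma block_norm_square: "(block_norm blk l \<xi>)\<^sup>2 = (\<Sum>i | blk i = l. (\<xi> $ i)\<^sup>2)"
  by (simp add: block_norm_def sum_nonneg)

lemma block_norm_le: "(block_norm blk l \<xi>)\<^sup>2 \<le> (norm \<xi>)\<^sup>2"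
  unfolding block_norm_square power2_norm_eq_inner inner_vec_def
  by (simp add: power2_eq_square) (rule sum_mono2, auto)

lemma block_norm_uminus: "block_norm blk l (- \<xi>) = block_norm blk l \<xi>"
  by (simp add: block_norm_def)

lemma block_norm_triangle: "(block_norm blk l (\<xi> + \<eta>))\<^sup>2 \<le> 2 * (block_norm blk l \<xi>)\<^sup>2 + 2 * (block_norm blk l \<eta>)\<^sup>2"
proof -
  have "(\<xi> $ i + \<eta> $ i)\<^sup>2 \<le> 2 * (\<xi> $ i)\<^sup>2 + 2 * (\<eta> $ i)\<^sup>2" for i
    using sum_squares_bound[of "\<xi> $ i" "\<eta> $ i"] by (simp add: power2_sum)
  then show ?thesis
    unfolding block_norm_square sum_distrib_left sum.distrib[symmetric] by (intro sum_mono) simp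
qed

lemma bracket_triangle:
  "1 + (block_norm blk l (\<xi> + \<eta>))\<^sup>2 \<le> 2 * (1 + (block_norm blk l \<xi>)\<^sup>2) * (1 + (block_norm blk l \<eta>)\<^sup>2)"
proof -
  have "1 + a \<le> 2 * (1 + p) * (1 + q)" if "a \<le> 2 * p + 2 * q" "0 \<le> p" "0 \<le> q" for a p q :: real
  proof -
    have "2 * (1 + p) * (1 + q) = 2 + (2 * p + 2 * q) + 2 * (p * q)" by (simp add: algebra_simps)
    moreover have "0 \<le> p * q" using that by simp
    ultimately show ?thesis using that(1) by linarith
  qed
  from this[OF block_norm_triangle] show ?thesis by simp
qed

text \<open>The brackets at \<xi> and \<xi> - \<eta> bound each other up to the factor 2 b, so
  either sign of \<open>t\<close> can be treated: \<open>p \<le> 2 * b * q\<close> serves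
  \<open>t \<ge> 0\<close>, and \<open>q \<le> 2 * b * p\<close> serves t < 0. Rounding |t| up to a
  natural number makes the factor a polynomial in \<open>norm \<eta>\<close>, the form in which
  \<open>admissible\<close> records it.\<close>

lemma bracket_powr_peetre:
  fixes \<xi> \<eta> :: "real^'n::finite"
  shows "(1 + (block_norm blk l \<xi>)\<^sup>2) powr t \<le>
    (2 * (1 + norm \<eta>)\<^sup>2) ^ nat \<lceil>\<bar>t\<bar>\<rceil> * (1 + (block_norm blk l (\<xi> - \<eta>))\<^sup>2) powr t"
proof -
  define p q b where "p = 1 + (block_norm blk l \<xi>)\<^sup>2" and "q = 1 + (block_norm blk l (\<xi> - \<eta>))\<^sup>2"
    and "b = 1 + (block_norm blk l \<eta>)\<^sup>2"
  have pos: "p > 0" "q > 0" "b \<ge> 1" by (auto simp: p_def q_def b_def add_pos_nonneg)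
  have pq: "p \<le> 2 * b * q" using bracket_triangle[of blk l \<eta> "\<xi> - \<eta>"] by (simp add: p_def q_def b_def)
  have qp: "q \<le> 2 * b * p"
    using bracket_triangle[of blk l "- \<eta>" \<xi>] by (simp add: p_def q_def b_def block_norm_uminus)
  have "p powr t \<le> (2 * b) powr \<bar>t\<bar> * q powr t"
  proof (cases "t \<ge> 0")
    case True
    then have "p powr t \<le> (2 * b * q) powr t" using pq pos by (intro powr_mono2) auto
    then show ?thesis using True by (simp add: powr_mult)
  next
    case False
    have "(2 * b * p) powr t \<le> q powr t" using qp pos False by (intro powr_mono2') auto
    then have "(2 * b) powr t * p powr t \<le> q powr t" by (simp add: powr_mult)
    moreover have "(2 * b) powr \<bar>t\<bar> * (2 * b) powr t = 1"
      using False pos by (simp add: powr_add[symmetric])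
    ultimately show ?thesis
      using mult_left_mono[of "(2 * b) powr t * p powr t" "q powr t" "(2 * b) powr \<bar>t\<bar>"]
      by (simp add: mult.assoc[symmetric])
  qed
  also have "(2 * b) powr \<bar>t\<bar> \<le> (2 * (1 + norm \<eta>)\<^sup>2) ^ nat \<lceil>\<bar>t\<bar>\<rceil>"
  proof -
    have "b \<le> (1 + norm \<eta>)\<^sup>2"
      using block_norm_le[of blk l \<eta>] norm_ge_zero[of \<eta>]
      unfolding b_def power2_sum one_power2 mult_1_right by linarith
    then have 1: "2 * b \<le> 2 * (1 + norm \<eta>)\<^sup>2" by simp
    have "(2 * b) powr \<bar>t\<bar> \<le> (2 * b) powr real (nat \<lceil>\<bar>t\<bar>\<rceil>)"
      using pos by (intro powr_mono) (auto simp: of_nat_nat)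
    also have "\<dots> = (2 * b) ^ nat \<lceil>\<bar>t\<bar>\<rceil>" using pos by (intro powr_realpow) auto
    also have "\<dots> \<le> (2 * (1 + norm \<eta>)\<^sup>2) ^ nat \<lceil>\<bar>t\<bar>\<rceil>" using 1 pos by (intro power_mono) auto
    finally show ?thesis .
  qed
  finally show ?thesis by (simp add: p_def q_def mult_right_mono)
qed

lemma smooth_with_slow_sum:
  "(\<And>i. i \<in> F \<Longrightarrow> smooth_with slow (f i)) \<Longrightarrow> smooth_with slow (\<lambda>x. \<Sum>i\<in>F. f i x)"
  by (induction F rule: infinite_finite_induct) (simp_all add: smooth_with_slow_add smooth_with_slow_const)

lemma smooth_with_slow_prod:
  "(\<And>i. i \<in> F \<Longrightarrow> smooth_with slow (f i)) \<Longrightarrow> smooth_with slow (\<lambda>x. \<Prod>i\<in>F. f i x)"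
  by (induction F rule: infinite_finite_induct) (simp_all add: smooth_with_slow_mult smooth_with_slow_const)

lemma smooth_weight:
  fixes blk :: "'n::finite \<Rightarrow> 'j::finite"
  shows "smooth_with slow (\<lambda>\<xi>. of_real (weight blk s \<xi>))"
proof -
  have "smooth_with slow (\<lambda>\<xi>. complex_of_real ((1 + (block_norm blk l \<xi>)\<^sup>2) powr (s $ l / 2)))" for l
  proof (rule smooth_powr)
    have lin: "smooth_with slow (\<lambda>\<xi>::real^'n. complex_of_real (\<xi> $ i))" for i
      by (intro smooth_with_slow_linear bounded_linear_compose[OF bounded_linear_of_real bounded_linear_vec_nth])
    show "smooth_with slow (\<lambda>\<xi>. complex_of_real (1 + (block_norm blk l \<xi>)\<^sup>2))"
      unfolding block_norm_square of_real_add of_real_sum of_real_1 of_real_power unfolding power2_eq_square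
      by (intro smooth_with_slow_add smooth_with_slow_const smooth_with_slow_sum smooth_with_slow_mult lin)
    show "0 < 1 + (block_norm blk l \<xi>)\<^sup>2" for \<xi> by (simp add: add_pos_nonneg)
    show "slow (\<lambda>\<xi>. complex_of_real (c * (1 + (block_norm blk l \<xi>)\<^sup>2) powr b))" for b c
    proof -
      have "cmod (complex_of_real (c * (1 + (block_norm blk l \<xi>)\<^sup>2) powr b)) \<le>
        (\<bar>c\<bar> * 2 ^ nat \<lceil>\<bar>b\<bar>\<rceil>) * (1 + norm \<xi>) ^ (2 * nat \<lceil>\<bar>b\<bar>\<rceil>)" for \<xi>
      proof -
        \<comment> \<open>Peetre's inequality with \<eta> = \<xi>: the bracket at the origin is 1,
          and polynomial growth of every real power is left.\<close>
        have "(1 + (block_norm blk l \<xi>)\<^sup>2) powr b \<le> (2 * (1 + norm \<xi>)\<^sup>2) ^ nat \<lceil>\<bar>b\<bar>\<rceil>"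
          using bracket_powr_peetre[of blk l \<xi> b \<xi>] by (simp add: block_norm_def)
        then have "\<bar>c\<bar> * (1 + (block_norm blk l \<xi>)\<^sup>2) powr b \<le> \<bar>c\<bar> * (2 * (1 + norm \<xi>)\<^sup>2) ^ nat \<lceil>\<bar>b\<bar>\<rceil>"
          by (rule mult_left_mono) simp
        then show ?thesis by (simp add: abs_mult norm_mult power_mult_distrib power_mult mult.assoc)
      qed
      then show ?thesis unfolding slow_def by (intro exI allI)
    qed
    show "slow (\<lambda>x::real^'n. 1)" "slow (\<lambda>x::real^'n. 0)" by (auto intro: slow_bounded)
  qed (rule slow_add slow_mult; assumption)+
  then show ?thesis
    unfolding weight_def of_real_prod by (intro smooth_with_slow_prod)
qed

lemma weight_uminus: "weight blk (- s) \<xi> = inverse (weight blk s \<xi>)"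
  unfolding weight_def prod_inversef[symmetric] by (simp add: powr_minus)

lemma weight_pos: "weight blk s \<xi> > 0"
  unfolding weight_def
proof (rule prod_pos)
  fix l
  have "1 + (block_norm blk l \<xi>)\<^sup>2 > 0" by (simp add: add_pos_nonneg)
  then show "(1 + (block_norm blk l \<xi>)\<^sup>2) powr (s $ l / 2) > 0" by simp
qed

lemma admissible_weight:
  fixes blk :: "'n::finite \<Rightarrow> 'j::finite"
  shows "admissible (weight blk s)"
  unfolding admissible_def
proof (intro conjI allI)
  show "weight blk s \<xi> > 0" for \<xi> by (rule weight_pos)
  show "weight blk s (- \<xi>) = weight blk s \<xi>" for \<xi> by (simp add: weight_def block_norm_uminus)
  show "smooth_with slow (\<lambda>\<xi>. complex_of_real (weight blk s \<xi>))" by (rule smooth_weight)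
  show "smooth_with slow (\<lambda>\<xi>. complex_of_real (inverse (weight blk s \<xi>)))"
    unfolding weight_uminus[symmetric] by (rule smooth_weight)
  \<comment> \<open>The exponents for the single blocks; in the product of the Peetre inequalities
    of all blocks they add up.\<close>
  define m where "m l = nat \<lceil>\<bar>s $ l / 2\<bar>\<rceil>" for l
  have "weight blk s \<xi> \<le> 2 ^ (\<Sum>l\<in>UNIV. m l) * (1 + norm \<eta>) ^ (2 * (\<Sum>l\<in>UNIV. m l)) * weight blk s (\<xi> - \<eta>)" for \<xi> \<eta>
  proof -
    have "weight blk s \<xi> \<le> (\<Prod>l\<in>UNIV. (2 * (1 + norm \<eta>)\<^sup>2) ^ m l * (1 + (block_norm blk l (\<xi> - \<eta>))\<^sup>2) powr (s $ l / 2))"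
      unfolding weight_def m_def by (intro prod_mono conjI bracket_powr_peetre) simp
    also have "\<dots> = (2 * (1 + norm \<eta>)\<^sup>2) ^ (\<Sum>l\<in>UNIV. m l) * weight blk s (\<xi> - \<eta>)"
      by (simp add: prod.distrib power_sum weight_def)
    finally show ?thesis by (simp add: power_mult_distrib power_mult)
  qed
  then show "\<exists>A N. \<forall>\<xi> \<eta>. weight blk s \<xi> \<le> A * (1 + norm \<eta>) ^ N * weight blk s (\<xi> - \<eta>)"
    by (intro exI allI)
qed

section \<open>Square integrable functions\<close>

lemma square_integrable_iff:
  "square_integrable f \<longleftrightarrow> f \<in> borel_measurable lborel \<and> (\<integral>\<^sup>+x. ennreal ((cmod (f x))\<^sup>2) \<partial>lborel) < \<infinity>"
  by (auto simp: square_integrable_def integrable_iff_bounded)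

lemma nn_integral_L2_norm:
  assumes "square_integrable f"
  shows "(\<integral>\<^sup>+x. ennreal ((cmod (f x))\<^sup>2) \<partial>lborel) = ennreal ((L2_norm f)\<^sup>2)"
proof -
  have "(\<integral>\<^sup>+x. ennreal ((cmod (f x))\<^sup>2) \<partial>lborel) = ennreal (LINT x|lborel. (cmod (f x))\<^sup>2)"
    using assms by (intro nn_integral_eq_integral) (auto simp: square_integrable_def)
  moreover have "(LINT x|lborel. (cmod (f x))\<^sup>2) \<ge> 0" by (rule Bochner_Integration.integral_nonneg) simp
  ultimately show ?thesis by (simp add: L2_norm_def)
qed

lemma L2_norm_nonneg [simp]: "L2_norm f \<ge> 0"
  by (simp add: L2_norm_def)

lemma ennreal_power2_le_imp_le:
  assumes "a\<^sup>2 \<le> (ennreal b)\<^sup>2" "b \<ge> 0"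
  shows "a \<le> ennreal b"
proof (cases a rule: ennreal_cases)
  case (real r)
  have "ennreal (r\<^sup>2) \<le> ennreal (b\<^sup>2)" using assms real by (simp add: ennreal_power)
  then have "r\<^sup>2 \<le> b\<^sup>2" by (subst (asm) ennreal_le_iff) auto
  then show ?thesis using real assms(2) by (auto intro!: ennreal_leI power2_le_imp_le)
next
  case top
  then show ?thesis using assms by (simp add: power2_eq_square ennreal_mult[symmetric] top_unique)
qed

lemma L2_Cauchy_Schwarz:
  assumes f: "square_integrable f" and g: "square_integrable g"
  shows "integrable lborel (\<lambda>x. f x * g x)" "cmod (LINT x|lborel. f x * g x) \<le> L2_norm f * L2_norm g"
proof -
  have [measurable]: "f \<in> borel_measurable borel" "g \<in> borel_measurable borel"
    using f g by (auto simp: square_integrable_def)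
  have "(\<integral>\<^sup>+x. ennreal (cmod (f x)) * ennreal (cmod (g x)) \<partial>lborel)\<^sup>2 \<le>
    (\<integral>\<^sup>+x. (ennreal (cmod (f x)))\<^sup>2 \<partial>lborel) * (\<integral>\<^sup>+x. (ennreal (cmod (g x)))\<^sup>2 \<partial>lborel)"
    by (rule Cauchy_Schwarz_nn_integral) auto
  also have "\<dots> = ennreal ((L2_norm f)\<^sup>2) * ennreal ((L2_norm g)\<^sup>2)"
    using nn_integral_L2_norm[OF f] nn_integral_L2_norm[OF g] by (simp add: ennreal_power)
  also have "\<dots> = (ennreal (L2_norm f * L2_norm g))\<^sup>2"
    by (simp add: ennreal_power ennreal_mult[symmetric] power_mult_distrib)
  finally have "(\<integral>\<^sup>+x. ennreal (cmod (f x)) * ennreal (cmod (g x)) \<partial>lborel)\<^sup>2 \<le> (ennreal (L2_norm f * L2_norm g))\<^sup>2" .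
  then have "(\<integral>\<^sup>+x. ennreal (cmod (f x)) * ennreal (cmod (g x)) \<partial>lborel) \<le> ennreal (L2_norm f * L2_norm g)"
    by (rule ennreal_power2_le_imp_le) simp
  then have le: "(\<integral>\<^sup>+x. ennreal (cmod (f x * g x)) \<partial>lborel) \<le> ennreal (L2_norm f * L2_norm g)"
    by (simp only: norm_mult ennreal_mult[OF norm_ge_zero norm_ge_zero])
  show int: "integrable lborel (\<lambda>x. f x * g x)"
  proof (rule integrableI_bounded)
    show "(\<integral>\<^sup>+x. ennreal (norm (f x * g x)) \<partial>lborel) < \<infinity>" using le_less_trans[OF le] by simp
  qed simp
  have "ennreal (cmod (LINT x|lborel. f x * g x)) \<le> ennreal (L2_norm f * L2_norm g)"
    using integral_norm_bound_ennreal[OF int] le by (rule order_trans)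
  then show "cmod (LINT x|lborel. f x * g x) \<le> L2_norm f * L2_norm g"
    by (subst (asm) ennreal_le_iff) auto
qed

lemma schwartz_square_integrable: "f \<in> schwartz_functions \<Longrightarrow> square_integrable f"
  unfolding square_integrable_def
proof
  assume f: "f \<in> schwartz_functions"
  then show "f \<in> borel_measurable lborel" using schwartz_measurable by simp
  have "integrable lborel (\<lambda>x. f x * cnj (f x))" by (intro schwartz_integrable schwartz_mult schwartz_cnj f)
  then have "integrable lborel (\<lambda>x. complex_of_real ((cmod (f x))\<^sup>2))" by (simp only: complex_norm_square)
  from integrable_Re[OF this] show "integrable lborel (\<lambda>x. (cmod (f x))\<^sup>2)" by (simp only: Re_complex_of_real)
qed

section \<open>Sobolev norms of localised Schwartz functions\<close>

text \<open>The Sobolev norm with symbol \<open>w\<close>, without the factor (2 pi)^(-n/2) from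
  Plancherel's theorem.\<close>

definition wnorm :: "(real^'n::finite \<Rightarrow> real) \<Rightarrow> (real^'n \<Rightarrow> complex) \<Rightarrow> real" where
  "wnorm w f = L2_norm (\<lambda>\<xi>. of_real (w \<xi>) * fourier f \<xi>)"

lemma wnorm_nonneg [simp]: "wnorm w f \<ge> 0"
  by (simp add: wnorm_def)

lemma schwartz_weighted_fourier:
  assumes "admissible w" "f \<in> schwartz_functions"
  shows "(\<lambda>\<xi>. of_real (w \<xi>) * fourier f \<xi>) \<in> schwartz_functions"
  using schwartz_mult_slow[OF schwartz_fourier[OF assms(2)] admissibleD(3)[OF assms(1)]]
  by (simp only: mult.commute)

lemma nn_integral_wnorm:
  assumes "admissible w" "f \<in> schwartz_functions"
  shows "(\<integral>\<^sup>+\<xi>. ennreal ((w \<xi> * cmod (fourier f \<xi>))\<^sup>2) \<partial>lborel) = ennreal ((wnorm w f)\<^sup>2)"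
proof -
  have "cmod (of_real (w \<xi>) * fourier f \<xi>) = w \<xi> * cmod (fourier f \<xi>)" for \<xi>
    using admissibleD(1)[OF assms(1), of \<xi>] by (simp add: norm_mult)
  then show ?thesis
    using nn_integral_L2_norm[OF schwartz_square_integrable[OF schwartz_weighted_fourier[OF assms]]]
    by (simp only: wnorm_def)
qed

section \<open>Measurability and integrals of convolutions\<close>

lemma admissible_measurable:
  fixes w :: "real^'n::finite \<Rightarrow> real"
  assumes "admissible w" shows "w \<in> borel_measurable borel"
proof -
  have "continuous_on UNIV (\<lambda>\<xi>. complex_of_real (w \<xi>))"
    by (rule smooth_imp_continuous[OF smooth_with_imp_smooth[OF admissibleD(3)[OF assms]]])
  from continuous_on_Re[OF this] have "(\<lambda>\<xi>. Re (complex_of_real (w \<xi>))) \<in> borel_measurable borel"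
    by (rule borel_measurable_continuous_onI)
  then show ?thesis by simp
qed

lemma nn_integral_translate:
  fixes f :: "'a::euclidean_space \<Rightarrow> ennreal"
  assumes [measurable]: "f \<in> borel_measurable borel"
  shows "(\<integral>\<^sup>+x. f (x - t) \<partial>lborel) = (\<integral>\<^sup>+x. f x \<partial>lborel)"
proof -
  have "(\<integral>\<^sup>+x. f x \<partial>lborel) = (\<integral>\<^sup>+x. f x \<partial>distr lborel borel ((+) (- t)))"
    by (simp only: lborel_distr_plus)
  also have "\<dots> = (\<integral>\<^sup>+x. f (- t + x) \<partial>lborel)" by (rule nn_integral_distr) auto
  finally show ?thesis by simp
qed

lemma nn_integral_convolution:
  fixes k u :: "real^'n::finite \<Rightarrow> ennreal"
  assumes [measurable]: "k \<in> borel_measurable borel" "u \<in> borel_measurable borel"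
  shows "(\<integral>\<^sup>+\<xi>. \<integral>\<^sup>+\<eta>. k \<eta> * u (\<xi> - \<eta>) \<partial>lborel \<partial>lborel) = (\<integral>\<^sup>+\<eta>. k \<eta> \<partial>lborel) * (\<integral>\<^sup>+\<xi>. u \<xi> \<partial>lborel)"
proof -
  have "(\<lambda>p. k (fst p) * u (snd p - fst p)) \<in> borel_measurable (borel \<Otimes>\<^sub>M borel)" by measurable
  then have m: "case_prod (\<lambda>\<eta> \<xi>. k \<eta> * u (\<xi> - \<eta>)) \<in> borel_measurable (lborel \<Otimes>\<^sub>M lborel)"
    by (simp add: case_prod_unfold)
  have "(\<integral>\<^sup>+\<xi>. \<integral>\<^sup>+\<eta>. k \<eta> * u (\<xi> - \<eta>) \<partial>lborel \<partial>lborel) = (\<integral>\<^sup>+\<eta>. \<integral>\<^sup>+\<xi>. k \<eta> * u (\<xi> - \<eta>) \<partial>lborel \<partial>lborel)"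
    by (rule lborel_pair.Fubini'[OF m])
  also have "\<dots> = (\<integral>\<^sup>+\<eta>. k \<eta> * (\<integral>\<^sup>+\<xi>. u (\<xi> - \<eta>) \<partial>lborel) \<partial>lborel)"
    by (intro nn_integral_cong nn_integral_cmult) simp
  also have "\<dots> = (\<integral>\<^sup>+\<eta>. k \<eta> * (\<integral>\<^sup>+\<xi>. u \<xi> \<partial>lborel) \<partial>lborel)"
    by (simp only: nn_integral_translate[OF assms(2)])
  also have "\<dots> = (\<integral>\<^sup>+\<eta>. k \<eta> \<partial>lborel) * (\<integral>\<^sup>+\<xi>. u \<xi> \<partial>lborel)"
    by (rule nn_integral_multc) simp
  finally show ?thesis .
qed

lemma schwartz_bracket_integrable:
  fixes f :: "real^'n::finite \<Rightarrow> complex"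
  assumes "f \<in> schwartz_functions"
  shows "integrable lborel (\<lambda>x. (1 + norm x) ^ k * cmod (f x))"
proof -
  obtain C where C: "\<And>x. (1 + norm x) ^ (CARD('n) + 2 + k) * cmod (f x) \<le> C"
    using schwartz_imp_rapid[OF assms] unfolding rapid_def by blast
  show ?thesis
  proof (rule integrable_of_decay(1)[where C = C])
    show "(\<lambda>x. (1 + norm x) ^ k * cmod (f x)) \<in> borel_measurable lborel"
      using schwartz_measurable[OF assms] by simp
    show "(1 + norm x) ^ (CARD('n) + 2) * norm ((1 + norm x) ^ k * cmod (f x)) \<le> C" for x
      using C[of x] by (simp add: abs_mult power_add mult_ac)
  qed
qed

section \<open>Translation, pairing and multiplication in the weighted norms\<close>

lemma wnorm_translate:
  assumes "f \<in> schwartz_functions"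
  shows "wnorm w (\<lambda>x. f (x + h)) = wnorm w f"
  unfolding wnorm_def L2_norm_def fourier_translate[OF schwartz_measurable[OF assms]]
  by (simp add: norm_mult)

lemma wnorm_cmult: "wnorm w (\<lambda>x. c * f x) = cmod c * wnorm w f"
proof -
  have "(LINT \<xi>|lborel. (cmod (of_real (w \<xi>) * (c * fourier f \<xi>)))\<^sup>2) =
    (LINT \<xi>|lborel. (cmod c)\<^sup>2 * (cmod (of_real (w \<xi>) * fourier f \<xi>))\<^sup>2)"
    by (simp add: norm_mult power_mult_distrib mult_ac)
  then show ?thesis by (simp add: wnorm_def L2_norm_def fourier_cmult real_sqrt_mult)
qed

text \<open>Since w is even, \<open>w \<xi> * inverse (w (- \<xi>)) = 1\<close> may be inserted into
  Parseval's identity; this splits the weight between the two functions before the Cauchy--Schwarz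
  inequality is applied.\<close>

lemma pairing_bound:
  fixes f g :: "real^'n::finite \<Rightarrow> complex"
  assumes w: "admissible w" and f: "f \<in> schwartz_functions" and g: "g \<in> schwartz_functions"
  shows "cmod (LINT x|lborel. f x * g x) \<le> 1 / (2 * pi) ^ CARD('n) * (wnorm w f * wnorm (\<lambda>\<xi>. inverse (w \<xi>)) g)"
proof -
  let ?f = "\<lambda>\<xi>. of_real (w \<xi>) * fourier f \<xi>" and ?g = "\<lambda>\<xi>. of_real (inverse (w \<xi>)) * fourier g \<xi>"
  have S: "?f \<in> schwartz_functions" "?g \<in> schwartz_functions"
    by (rule schwartz_weighted_fourier[OF w f], rule schwartz_weighted_fourier[OF admissible_inverse[OF w] g])
  have S': "(\<lambda>\<xi>. ?g (- \<xi>)) \<in> schwartz_functions"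
    using schwartz_reflect[OF S(2), of 0] by (simp only: diff_0)
  have "(LINT x|lborel. f x * g x) = of_real (1 / (2 * pi) ^ CARD('n)) * (LINT \<xi>|lborel. ?f \<xi> * ?g (- \<xi>))"
  proof -
    have "?f \<xi> * ?g (- \<xi>) = fourier f \<xi> * fourier g (- \<xi>)" for \<xi>
      using admissibleD(1)[OF w, of \<xi>] by (simp add: admissibleD(2)[OF w])
    then show ?thesis by (simp only: parseval[OF f g])
  qed
  moreover have "cmod (LINT \<xi>|lborel. ?f \<xi> * ?g (- \<xi>)) \<le> L2_norm ?f * L2_norm (\<lambda>\<xi>. ?g (- \<xi>))"
    by (intro L2_Cauchy_Schwarz schwartz_square_integrable S S')
  moreover have "L2_norm (\<lambda>\<xi>. ?g (- \<xi>)) = L2_norm ?g"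
  proof -
    have "(\<lambda>\<xi>. (cmod (?g \<xi>))\<^sup>2) \<in> borel_measurable borel"
      by (rule borel_measurable_power, rule measurable_compose[OF schwartz_measurable[OF S(2)] borel_measurable_norm])
    from lborel_integral_reflect[OF this, of 0] show ?thesis by (simp only: L2_norm_def diff_0)
  qed
  ultimately have "cmod (LINT x|lborel. f x * g x) \<le> cmod (of_real (1 / (2 * pi) ^ CARD('n))) * (L2_norm ?f * L2_norm ?g)"
    by (simp only: norm_mult) (rule mult_left_mono, simp_all only: norm_ge_zero)
  then show ?thesis by (simp only: wnorm_def norm_of_real) simp
qed

lemma peetre:
  fixes w :: "real^'n::finite \<Rightarrow> real"
  assumes "admissible w"
  obtains A N where "A > 0" "\<And>\<xi> \<eta>. w \<xi> \<le> A * (1 + norm \<eta>) ^ N * w (\<xi> - \<eta>)"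
proof -
  obtain A N where P: "\<And>\<xi> \<eta>. w \<xi> \<le> A * (1 + norm \<eta>) ^ N * w (\<xi> - \<eta>)"
    using assms unfolding admissible_def by blast
  have "0 < A"
    using P[of 0 0] admissibleD(1)[OF assms, of 0] by (simp add: mult_le_cancel_right1)
  then show ?thesis using P by (rule that)
qed

text \<open>Multiplication by \<theta> becomes convolution with its transform. Peetre's inequality
  moves w from \<xi> to \<xi> - \<eta> at the price of a polynomial in \<eta>, which the decay of
  the transform of \<theta> absorbs. What remains is Young's inequality: convolution with the
  integrable kernel \<open>k\<close> has norm at most its integral K on L2.\<close>

lemma wnorm_mult_le:
  fixes w :: "real^'n::finite \<Rightarrow> real"
  assumes w: "admissible w" and \<theta>: "\<theta> \<in> schwartz_functions"
  obtains C where "C \<ge> 0" "\<And>f. f \<in> schwartz_functions \<Longrightarrow> wnorm w (\<lambda>x. \<theta> x * f x) \<le> C * wnorm w f"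
proof -
  obtain A N where A: "A > 0" and P: "\<And>\<xi> \<eta>. w \<xi> \<le> A * (1 + norm \<eta>) ^ N * w (\<xi> - \<eta>)"
    using peetre[OF w] by blast
  define c where "c = 1 / (2 * pi) ^ CARD('n)"
  have c: "c > 0" by (simp add: c_def)
  define k where "k \<eta> = c * A * ((1 + norm \<eta>) ^ N * cmod (fourier \<theta> \<eta>))" for \<eta>
  have k0: "k \<eta> \<ge> 0" for \<eta> using c A by (simp add: k_def)
  have ki: "integrable lborel k"
    unfolding k_def by (intro integrable_mult_right schwartz_bracket_integrable schwartz_fourier \<theta>)
  define K where "K = (LINT \<eta>|lborel. k \<eta>)"
  have K: "K \<ge> 0" "(\<integral>\<^sup>+\<eta>. ennreal (k \<eta>) \<partial>lborel) = ennreal K"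
    unfolding K_def using k0 ki by (auto intro: nn_integral_eq_integral)
  have [measurable]: "k \<in> borel_measurable borel" using ki by auto
  have "wnorm w (\<lambda>x. \<theta> x * f x) \<le> K * wnorm w f" if f: "f \<in> schwartz_functions" for f
  proof -
    define u where "u \<xi> = w \<xi> * cmod (fourier f \<xi>)" for \<xi>
    have u0: "u \<xi> \<ge> 0" for \<xi> using admissibleD(1)[OF w, of \<xi>] by (simp add: u_def)
    have [measurable]: "u \<in> borel_measurable borel"
      unfolding u_def using admissible_measurable[OF w] schwartz_measurable[OF schwartz_fourier[OF f]] by simp
    have ineq: "ennreal (w \<xi> * cmod (fourier (\<lambda>x. \<theta> x * f x) \<xi>)) \<le> (\<integral>\<^sup>+\<eta>. ennreal (k \<eta> * u (\<xi> - \<eta>)) \<partial>lborel)" for \<xi>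
    proof -
      have S: "(\<lambda>\<eta>. fourier \<theta> \<eta> * fourier f (\<xi> - \<eta>)) \<in> schwartz_functions"
        by (intro schwartz_mult schwartz_reflect schwartz_fourier \<theta> f)
      have "w \<xi> * cmod (fourier (\<lambda>x. \<theta> x * f x) \<xi>) = c * w \<xi> * cmod (LINT \<eta>|lborel. fourier \<theta> \<eta> * fourier f (\<xi> - \<eta>))"
        unfolding fourier_mult[OF \<theta> f] c_def by (simp add: norm_mult norm_divide norm_power)
      also have "ennreal \<dots> = ennreal (c * w \<xi>) * ennreal (cmod (LINT \<eta>|lborel. fourier \<theta> \<eta> * fourier f (\<xi> - \<eta>)))"
        using c admissibleD(1)[OF w, of \<xi>] by (intro ennreal_mult) auto
      also have "\<dots> \<le> ennreal (c * w \<xi>) * (\<integral>\<^sup>+\<eta>. ennreal (cmod (fourier \<theta> \<eta> * fourier f (\<xi> - \<eta>))) \<partial>lborel)"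
        by (intro mult_left_mono integral_norm_bound_ennreal schwartz_integrable S) simp
      also have "\<dots> = (\<integral>\<^sup>+\<eta>. ennreal (c * w \<xi>) * ennreal (cmod (fourier \<theta> \<eta> * fourier f (\<xi> - \<eta>))) \<partial>lborel)"
        using schwartz_measurable[OF S] by (intro nn_integral_cmult[symmetric]) simp
      also have "\<dots> \<le> (\<integral>\<^sup>+\<eta>. ennreal (k \<eta> * u (\<xi> - \<eta>)) \<partial>lborel)"
      proof (rule nn_integral_mono)
        fix \<eta>
        have "c * w \<xi> * cmod (fourier \<theta> \<eta> * fourier f (\<xi> - \<eta>)) \<le>
          c * (A * (1 + norm \<eta>) ^ N * w (\<xi> - \<eta>)) * cmod (fourier \<theta> \<eta> * fourier f (\<xi> - \<eta>))"
          using c by (intro mult_right_mono mult_left_mono P) auto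
        also have "\<dots> = k \<eta> * u (\<xi> - \<eta>)" by (simp add: k_def u_def norm_mult mult_ac)
        finally show "ennreal (c * w \<xi>) * ennreal (cmod (fourier \<theta> \<eta> * fourier f (\<xi> - \<eta>))) \<le> ennreal (k \<eta> * u (\<xi> - \<eta>))"
          using c admissibleD(1)[OF w, of \<xi>] by (subst ennreal_mult[symmetric]) (auto intro: ennreal_leI)
      qed
      finally show ?thesis .
    qed
    \<comment> \<open>Cauchy--Schwarz for \<open>sqrt k\<close> and \<open>sqrt k * u\<close>, the
      usual proof of Young's inequality.\<close>
    have sq: "ennreal ((w \<xi> * cmod (fourier (\<lambda>x. \<theta> x * f x) \<xi>))\<^sup>2) \<le> ennreal K * (\<integral>\<^sup>+\<eta>. ennreal (k \<eta>) * ennreal ((u (\<xi> - \<eta>))\<^sup>2) \<partial>lborel)" for \<xi>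
    proof -
      have "ennreal ((w \<xi> * cmod (fourier (\<lambda>x. \<theta> x * f x) \<xi>))\<^sup>2) = (ennreal (w \<xi> * cmod (fourier (\<lambda>x. \<theta> x * f x) \<xi>)))\<^sup>2"
        using admissibleD(1)[OF w, of \<xi>] by (simp add: ennreal_power)
      also have "\<dots> \<le> (\<integral>\<^sup>+\<eta>. ennreal (k \<eta> * u (\<xi> - \<eta>)) \<partial>lborel)\<^sup>2"
        by (intro power_mono ineq) simp
      also have "\<dots> = (\<integral>\<^sup>+\<eta>. ennreal (sqrt (k \<eta>)) * ennreal (sqrt (k \<eta>) * u (\<xi> - \<eta>)) \<partial>lborel)\<^sup>2"
        using k0 u0 by (simp add: ennreal_mult[symmetric] mult.assoc[symmetric])
      also have "\<dots> \<le> (\<integral>\<^sup>+\<eta>. (ennreal (sqrt (k \<eta>)))\<^sup>2 \<partial>lborel) * (\<integral>\<^sup>+\<eta>. (ennreal (sqrt (k \<eta>) * u (\<xi> - \<eta>)))\<^sup>2 \<partial>lborel)"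
        by (rule Cauchy_Schwarz_nn_integral) measurable
      also have "\<dots> = ennreal K * (\<integral>\<^sup>+\<eta>. ennreal (k \<eta>) * ennreal ((u (\<xi> - \<eta>))\<^sup>2) \<partial>lborel)"
        using k0 u0 by (simp add: ennreal_power power_mult_distrib ennreal_mult K(2))
      finally show ?thesis .
    qed
    have "ennreal ((wnorm w (\<lambda>x. \<theta> x * f x))\<^sup>2) = (\<integral>\<^sup>+\<xi>. ennreal ((w \<xi> * cmod (fourier (\<lambda>x. \<theta> x * f x) \<xi>))\<^sup>2) \<partial>lborel)"
      by (rule nn_integral_wnorm[symmetric, OF w schwartz_mult[OF \<theta> f]])
    also have "\<dots> \<le> (\<integral>\<^sup>+\<xi>. ennreal K * (\<integral>\<^sup>+\<eta>. ennreal (k \<eta>) * ennreal ((u (\<xi> - \<eta>))\<^sup>2) \<partial>lborel) \<partial>lborel)"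
      by (intro nn_integral_mono sq)
    also have "\<dots> = ennreal K * (\<integral>\<^sup>+\<xi>. \<integral>\<^sup>+\<eta>. ennreal (k \<eta>) * ennreal ((u (\<xi> - \<eta>))\<^sup>2) \<partial>lborel \<partial>lborel)"
      by (rule nn_integral_cmult) measurable
    also have "(\<integral>\<^sup>+\<xi>. \<integral>\<^sup>+\<eta>. ennreal (k \<eta>) * ennreal ((u (\<xi> - \<eta>))\<^sup>2) \<partial>lborel \<partial>lborel) =
      ennreal K * (\<integral>\<^sup>+\<xi>. ennreal ((u \<xi>)\<^sup>2) \<partial>lborel)"
      unfolding K(2)[symmetric] by (rule nn_integral_convolution[of "\<lambda>\<eta>. ennreal (k \<eta>)" "\<lambda>\<xi>. ennreal ((u \<xi>)\<^sup>2)"]) measurable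
    also have "(\<integral>\<^sup>+\<xi>. ennreal ((u \<xi>)\<^sup>2) \<partial>lborel) = ennreal ((wnorm w f)\<^sup>2)"
      unfolding u_def by (rule nn_integral_wnorm[OF w f])
    finally have "ennreal ((wnorm w (\<lambda>x. \<theta> x * f x))\<^sup>2) \<le> ennreal ((K * wnorm w f)\<^sup>2)"
      using K(1) by (simp add: ennreal_mult[symmetric] power2_eq_square mult_ac)
    then have "(wnorm w (\<lambda>x. \<theta> x * f x))\<^sup>2 \<le> (K * wnorm w f)\<^sup>2" by (subst (asm) ennreal_le_iff) auto
    then show ?thesis by (rule power2_le_imp_le) (simp add: K(1))
  qed
  then show ?thesis by (rule that[OF K(1)])
qed

text \<open>For fixed \<open>\<xi>\<close> the map \<open>y \<mapsto> fourier (\<theta>(\<cdot> - y) f) \<xi>\<close> is itself a Fourier transform, so its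
  \<open>L\<^sup>2\<close> norm in \<open>y\<close> is given by Plancherel.\<close>

lemma fourier_window:
  fixes f \<theta> :: "real^'n::finite \<Rightarrow> complex"
  assumes f: "f \<in> schwartz_functions" and \<theta>: "\<theta> \<in> schwartz_functions"
  shows "fourier (\<lambda>x. \<theta> (x - y) * f x) \<xi> =
    of_real (1 / (2 * pi) ^ CARD('n)) * fourier (\<lambda>\<eta>. fourier \<theta> \<eta> * fourier f (\<xi> - \<eta>)) y"
proof -
  have \<theta>y: "(\<lambda>x. \<theta> (x - y)) \<in> schwartz_functions"
    using schwartz_translate[OF \<theta>, of "- y"] by simp
  have "fourier (\<lambda>x. \<theta> (x - y)) \<eta> = cis (- (\<eta> \<bullet> y)) * fourier \<theta> \<eta>" for \<eta>
    using fourier_translate[OF schwartz_measurable[OF \<theta>], of "- y" \<eta>] by (simp add: inner_commute)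
  then show ?thesis
    unfolding fourier_mult[OF \<theta>y f] fourier_def[of "\<lambda>\<eta>. fourier \<theta> \<eta> * fourier f (\<xi> - \<eta>)"]
    by (simp only: mult.assoc)
qed

lemma nn_integral_window:
  fixes f \<theta> :: "real^'n::finite \<Rightarrow> complex"
  assumes f: "f \<in> schwartz_functions" and \<theta>: "\<theta> \<in> schwartz_functions"
  shows "(\<integral>\<^sup>+y. ennreal ((cmod (fourier (\<lambda>x. \<theta> (x - y) * f x) \<xi>))\<^sup>2) \<partial>lborel) =
    (\<integral>\<^sup>+\<eta>. ennreal (1 / (2 * pi) ^ CARD('n) * (cmod (fourier \<theta> \<eta> * fourier f (\<xi> - \<eta>)))\<^sup>2) \<partial>lborel)"
proof -
  define c where "c = 1 / (2 * pi) ^ CARD('n)"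
  have c: "c > 0" by (simp add: c_def)
  define G where "G \<eta> = fourier \<theta> \<eta> * fourier f (\<xi> - \<eta>)" for \<eta>
  have G: "G \<in> schwartz_functions"
    unfolding G_def by (intro schwartz_mult schwartz_reflect schwartz_fourier f \<theta>)
  have int: "integrable lborel (\<lambda>y. (cmod (h y))\<^sup>2)" if "h \<in> schwartz_functions" for h :: "real^'n \<Rightarrow> complex"
    using schwartz_square_integrable[OF that] by (simp add: square_integrable_def)
  have V: "(cmod (fourier (\<lambda>x. \<theta> (x - y) * f x) \<xi>))\<^sup>2 = c\<^sup>2 * (cmod (fourier G y))\<^sup>2" for y
    unfolding fourier_window[OF f \<theta>] G_def[abs_def, symmetric] c_def[symmetric]
    by (simp add: norm_mult power_mult_distrib)
  have "(\<integral>\<^sup>+y. ennreal ((cmod (fourier (\<lambda>x. \<theta> (x - y) * f x) \<xi>))\<^sup>2) \<partial>lborel) =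
    ennreal (LINT y|lborel. c\<^sup>2 * (cmod (fourier G y))\<^sup>2)"
    unfolding V by (intro nn_integral_eq_integral integrable_mult_right int schwartz_fourier G) simp
  \<comment> \<open>Two factors c come from squaring the product formula; Plancherel's theorem uses
    up one of them.\<close>
  also have "(LINT y|lborel. c\<^sup>2 * (cmod (fourier G y))\<^sup>2) = c * (c * (LINT y|lborel. (cmod (fourier G y))\<^sup>2))"
    by (simp add: power2_eq_square)
  also have "c * (LINT y|lborel. (cmod (fourier G y))\<^sup>2) = (LINT \<eta>|lborel. (cmod (G \<eta>))\<^sup>2)"
    unfolding c_def by (rule plancherel[OF G, symmetric])
  also have "c * (LINT \<eta>|lborel. (cmod (G \<eta>))\<^sup>2) = (LINT \<eta>|lborel. c * (cmod (G \<eta>))\<^sup>2)"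
    by simp
  also have "ennreal \<dots> = (\<integral>\<^sup>+\<eta>. ennreal (c * (cmod (G \<eta>))\<^sup>2) \<partial>lborel)"
    using c by (intro nn_integral_eq_integral[symmetric] integrable_mult_right int G) simp
  finally show ?thesis unfolding c_def G_def .
qed

text \<open>Joint measurability in position and frequency is what the exchange of the two
  integrations requires; it follows from joint continuity of the integrand.\<close>

lemma window_measurable:
  fixes f \<theta> :: "real^'n::finite \<Rightarrow> complex"
  assumes f: "f \<in> schwartz_functions" and \<theta>: "\<theta> \<in> schwartz_functions"
  shows "(\<lambda>p. fourier (\<lambda>x. \<theta> (x - fst p) * f x) (snd p)) \<in> borel_measurable (borel \<Otimes>\<^sub>M borel)"
proof -
  have c: "continuous_on UNIV (\<lambda>q::((real^'n) \<times> (real^'n)) \<times> (real^'n).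
      cis (- (snd q \<bullet> snd (fst q))) * (\<theta> (snd q - fst (fst q)) * f (snd q)))"
    by (intro continuous_intros continuous_on_compose2[OF schwartz_imp_continuous[OF \<theta>]]
        continuous_on_compose2[OF schwartz_imp_continuous[OF f]]) auto
  have "case_prod (\<lambda>p x. cis (- (x \<bullet> snd p)) * (\<theta> (x - fst p) * f x)) \<in>
      borel_measurable ((borel \<Otimes>\<^sub>M borel) \<Otimes>\<^sub>M lborel)"
    using borel_measurable_continuous_onI[OF c]
    by (simp add: case_prod_unfold borel_prod[symmetric] cong: measurable_cong_sets)
  from lborel.borel_measurable_lebesgue_integral[OF this] show ?thesis
    by (simp only: fourier_def)
qed

lemma wnorm_window_measurable:
  fixes f \<theta> :: "real^'n::finite \<Rightarrow> complex"
  assumes w: "admissible w" and f: "f \<in> schwartz_functions" and \<theta>: "\<theta> \<in> schwartz_functions"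
  shows "(\<lambda>p. ennreal ((w (snd p) * cmod (fourier (\<lambda>x. \<theta> (x - fst p) * f x) (snd p)))\<^sup>2)) \<in> borel_measurable (borel \<Otimes>\<^sub>M borel)"
proof -
  note [measurable] = window_measurable[OF f \<theta>] admissible_measurable[OF w]
  show ?thesis by measurable
qed

lemma schwartz_window:
  "f \<in> schwartz_functions \<Longrightarrow> \<theta> \<in> schwartz_functions \<Longrightarrow> (\<lambda>x. \<theta> (x - y) * f x) \<in> schwartz_functions"
  using schwartz_mult[OF schwartz_translate[of \<theta> "- y"], of f] by simp

text \<open>At each frequency the integral over the position y is known exactly, so squares appear
  from the outset and, unlike in \<open>wnorm_mult_le\<close>, no Cauchy--Schwarz step is needed.
  After Peetre's inequality a convolution of nonnegative functions is left, and the constant is the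
  integral of \<open>k\<close>.\<close>

lemma wnorm_window_integral:
  fixes w :: "real^'n::finite \<Rightarrow> real"
  assumes w: "admissible w" and \<theta>: "\<theta> \<in> schwartz_functions"
  obtains C where "C \<ge> 0" "\<And>f. f \<in> schwartz_functions \<Longrightarrow>
    (\<integral>\<^sup>+y. ennreal ((wnorm w (\<lambda>x. \<theta> (x - y) * f x))\<^sup>2) \<partial>lborel) \<le> ennreal (C * (wnorm w f)\<^sup>2)"
proof -
  obtain A N where A: "A > 0" and P: "\<And>\<xi> \<eta>. w \<xi> \<le> A * (1 + norm \<eta>) ^ N * w (\<xi> - \<eta>)"
    using peetre[OF w] by blast
  define c where "c = 1 / (2 * pi) ^ CARD('n)"
  have c: "c > 0" by (simp add: c_def)
  \<comment> \<open>The squared modulus of the transform is written as a product with its conjugate,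
    which exhibits it as the modulus of one Schwartz function.\<close>
  define k where "k \<eta> = c * A\<^sup>2 * ((1 + norm \<eta>) ^ (2 * N) * cmod (fourier \<theta> \<eta> * cnj (fourier \<theta> \<eta>)))" for \<eta>
  have k0: "k \<eta> \<ge> 0" for \<eta> using c by (simp add: k_def)
  have ki: "integrable lborel k"
    unfolding k_def
    by (intro integrable_mult_right schwartz_bracket_integrable schwartz_mult schwartz_cnj schwartz_fourier \<theta>)
  define K where "K = (LINT \<eta>|lborel. k \<eta>)"
  have K: "K \<ge> 0" "(\<integral>\<^sup>+\<eta>. ennreal (k \<eta>) \<partial>lborel) = ennreal K"
    unfolding K_def using k0 ki by (auto intro: nn_integral_eq_integral)
  have [measurable]: "k \<in> borel_measurable borel" using ki by auto
  have "(\<integral>\<^sup>+y. ennreal ((wnorm w (\<lambda>x. \<theta> (x - y) * f x))\<^sup>2) \<partial>lborel) \<le> ennreal (K * (wnorm w f)\<^sup>2)"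
    if f: "f \<in> schwartz_functions" for f
  proof -
    define u where "u \<xi> = w \<xi> * cmod (fourier f \<xi>)" for \<xi>
    have [measurable]: "u \<in> borel_measurable borel"
      unfolding u_def using admissible_measurable[OF w] schwartz_measurable[OF schwartz_fourier[OF f]] by simp
    have m: "case_prod (\<lambda>y \<xi>. ennreal ((w \<xi> * cmod (fourier (\<lambda>x. \<theta> (x - y) * f x) \<xi>))\<^sup>2)) \<in> borel_measurable (lborel \<Otimes>\<^sub>M lborel)"
      using wnorm_window_measurable[OF w f \<theta>] by (simp add: case_prod_unfold cong: measurable_cong_sets)
    have pt: "(\<integral>\<^sup>+y. ennreal ((w \<xi> * cmod (fourier (\<lambda>x. \<theta> (x - y) * f x) \<xi>))\<^sup>2) \<partial>lborel) \<le>
      (\<integral>\<^sup>+\<eta>. ennreal (k \<eta>) * ennreal ((u (\<xi> - \<eta>))\<^sup>2) \<partial>lborel)" for \<xi>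
    proof -
      have G: "(\<lambda>\<eta>. fourier \<theta> \<eta> * fourier f (\<xi> - \<eta>)) \<in> schwartz_functions"
        by (intro schwartz_mult schwartz_reflect schwartz_fourier f \<theta>)
      have mV: "(\<lambda>y. ennreal ((cmod (fourier (\<lambda>x. \<theta> (x - y) * f x) \<xi>))\<^sup>2)) \<in> borel_measurable lborel"
        unfolding fourier_window[OF f \<theta>]
        using schwartz_measurable[OF schwartz_fourier[OF G]] by simp
      have "(\<integral>\<^sup>+y. ennreal ((w \<xi> * cmod (fourier (\<lambda>x. \<theta> (x - y) * f x) \<xi>))\<^sup>2) \<partial>lborel) =
        (\<integral>\<^sup>+y. ennreal ((w \<xi>)\<^sup>2) * ennreal ((cmod (fourier (\<lambda>x. \<theta> (x - y) * f x) \<xi>))\<^sup>2) \<partial>lborel)"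
        by (simp add: power_mult_distrib ennreal_mult)
      also have "\<dots> = ennreal ((w \<xi>)\<^sup>2) * (\<integral>\<^sup>+\<eta>. ennreal (c * (cmod (fourier \<theta> \<eta> * fourier f (\<xi> - \<eta>)))\<^sup>2) \<partial>lborel)"
        unfolding c_def nn_integral_window[OF f \<theta>, symmetric] by (rule nn_integral_cmult[OF mV])
      also have "\<dots> = (\<integral>\<^sup>+\<eta>. ennreal ((w \<xi>)\<^sup>2) * ennreal (c * (cmod (fourier \<theta> \<eta> * fourier f (\<xi> - \<eta>)))\<^sup>2) \<partial>lborel)"
        using schwartz_measurable[OF G] by (intro nn_integral_cmult[symmetric]) simp
      also have "\<dots> \<le> (\<integral>\<^sup>+\<eta>. ennreal (k \<eta>) * ennreal ((u (\<xi> - \<eta>))\<^sup>2) \<partial>lborel)"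
      proof (rule nn_integral_mono)
        fix \<eta>
        have "(w \<xi>)\<^sup>2 \<le> (A * (1 + norm \<eta>) ^ N * w (\<xi> - \<eta>))\<^sup>2"
          using admissibleD(1)[OF w, of \<xi>] by (intro power_mono P) simp
        then have "(w \<xi>)\<^sup>2 * (c * (cmod (fourier \<theta> \<eta> * fourier f (\<xi> - \<eta>)))\<^sup>2) \<le>
          (A * (1 + norm \<eta>) ^ N * w (\<xi> - \<eta>))\<^sup>2 * (c * (cmod (fourier \<theta> \<eta> * fourier f (\<xi> - \<eta>)))\<^sup>2)"
          using c by (intro mult_right_mono) auto
        also have "\<dots> = k \<eta> * (u (\<xi> - \<eta>))\<^sup>2"
          unfolding k_def u_def
          by (simp only: norm_mult power_mult_distrib complex_mod_cnj power_mult power2_eq_square) (simp only: mult_ac power_mult_distrib)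
        finally show "ennreal ((w \<xi>)\<^sup>2) * ennreal (c * (cmod (fourier \<theta> \<eta> * fourier f (\<xi> - \<eta>)))\<^sup>2) \<le> ennreal (k \<eta>) * ennreal ((u (\<xi> - \<eta>))\<^sup>2)"
          using c k0 by (simp add: ennreal_mult[symmetric] ennreal_leI)
      qed
      finally show ?thesis .
    qed
    have "(\<integral>\<^sup>+y. ennreal ((wnorm w (\<lambda>x. \<theta> (x - y) * f x))\<^sup>2) \<partial>lborel) =
      (\<integral>\<^sup>+y. \<integral>\<^sup>+\<xi>. ennreal ((w \<xi> * cmod (fourier (\<lambda>x. \<theta> (x - y) * f x) \<xi>))\<^sup>2) \<partial>lborel \<partial>lborel)"
      by (simp only: nn_integral_wnorm[OF w schwartz_window[OF f \<theta>]])
    also have "\<dots> = (\<integral>\<^sup>+\<xi>. \<integral>\<^sup>+y. ennreal ((w \<xi> * cmod (fourier (\<lambda>x. \<theta> (x - y) * f x) \<xi>))\<^sup>2) \<partial>lborel \<partial>lborel)"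
      by (rule lborel_pair.Fubini'[OF m, symmetric])
    also have "\<dots> \<le> (\<integral>\<^sup>+\<xi>. \<integral>\<^sup>+\<eta>. ennreal (k \<eta>) * ennreal ((u (\<xi> - \<eta>))\<^sup>2) \<partial>lborel \<partial>lborel)"
      by (intro nn_integral_mono pt)
    also have "\<dots> = ennreal K * (\<integral>\<^sup>+\<xi>. ennreal ((u \<xi>)\<^sup>2) \<partial>lborel)"
      unfolding K(2)[symmetric] by (rule nn_integral_convolution[of "\<lambda>\<eta>. ennreal (k \<eta>)" "\<lambda>\<xi>. ennreal ((u \<xi>)\<^sup>2)"]) measurable
    also have "(\<integral>\<^sup>+\<xi>. ennreal ((u \<xi>)\<^sup>2) \<partial>lborel) = ennreal ((wnorm w f)\<^sup>2)"
      unfolding u_def by (rule nn_integral_wnorm[OF w f])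
    finally show ?thesis using K(1) by (simp add: ennreal_mult)
  qed
  then show ?thesis by (rule that[OF K(1)])
qed

section \<open>Separation and local finiteness of the integer lattice; localisation and
  gluing\<close>

lemma int_lattice_diff: "x \<in> int_lattice \<Longrightarrow> y \<in> int_lattice \<Longrightarrow> x - y \<in> int_lattice"
  by (simp add: int_lattice_def)

lemma int_lattice_separated:
  assumes "x \<in> int_lattice" "y \<in> int_lattice" "x \<noteq> y"
  shows "1 \<le> norm (x - y)"
proof -
  obtain i where i: "x $ i \<noteq> y $ i" using assms(3) by (auto simp: vec_eq_iff)
  have "(x - y) $ i \<in> \<int>" using assms by (simp add: int_lattice_def)
  moreover have "(x - y) $ i \<noteq> 0" using i by simp
  ultimately have "1 \<le> \<bar>(x - y) $ i\<bar>" by (rule Ints_nonzero_abs_ge1)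
  then show ?thesis using component_le_norm_cart[of "x - y" i] by linarith
qed

lemma finite_int_lattice_bounded:
  fixes S :: "(real^'n::finite) set"
  assumes "bounded S"
  shows "finite (int_lattice \<inter> S)"
proof -
  obtain R where R: "\<And>x. x \<in> S \<Longrightarrow> norm x \<le> R" using assms unfolding bounded_iff by blast
  define m where "m = \<lceil>R\<rceil>"
  have "int_lattice \<inter> S \<subseteq> (\<lambda>f. \<chi> i. real_of_int (f i)) ` (PiE UNIV (\<lambda>_. {- m..m}))"
  proof
    fix x :: "real^'n" assume x: "x \<in> int_lattice \<inter> S"
    define f where "f i = \<lfloor>x $ i\<rfloor>" for i
    have f: "real_of_int (f i) = x $ i" for i
      using x by (auto simp: f_def int_lattice_def elim!: Ints_cases)
    have "f i \<in> {- m..m}" for i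
    proof -
      have "\<bar>x $ i\<bar> \<le> R" using component_le_norm_cart[of x i] R[of x] x by auto
      then have "\<bar>real_of_int (f i)\<bar> \<le> real_of_int m" using f[of i] by (simp add: m_def) linarith
      then show ?thesis by auto
    qed
    then have "f \<in> PiE UNIV (\<lambda>_. {- m..m})" by auto
    moreover have "x = (\<chi> i. real_of_int (f i))" by (simp add: vec_eq_iff f)
    ultimately show "x \<in> (\<lambda>f. \<chi> i. real_of_int (f i)) ` (PiE UNIV (\<lambda>_. {- m..m}))" by blast
  qed
  moreover have "finite (PiE (UNIV :: 'n set) (\<lambda>_. {- m..m}))" by (rule finite_PiE) auto
  ultimately show ?thesis by (rule finite_subset[OF _ finite_imageI])
qed

text \<open>For \<open>y\<close> near \<open>\<gamma>\<close> the window \<open>\<theta>(\<cdot> - \<gamma>)\<close> is absorbed by a larger window centred at \<open>y\<close>. Averaging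
  over \<open>y\<close> in the disjoint balls around the lattice points turns the sum into an integral.\<close>

lemma localisation_bound:
  fixes w :: "real^'n::finite \<Rightarrow> real"
  assumes w: "admissible w" and \<theta>: "\<theta> \<in> test_functions"
  obtains C where "C \<ge> 0" "\<And>f F. f \<in> schwartz_functions \<Longrightarrow> finite F \<Longrightarrow> F \<subseteq> int_lattice \<Longrightarrow>
    (\<Sum>\<gamma>\<in>F. (wnorm w (\<lambda>x. \<theta> (x - \<gamma>) * f x))\<^sup>2) \<le> C * (wnorm w f)\<^sup>2"
proof -
  note \<theta>S = test_imp_schwartz[OF \<theta>]
  \<comment> \<open>The support is enlarged by the radius 1/4 of the averaging balls. For y in the
    ball around \<gamma>, the larger window \<beta>, which is 1 on \<open>D\<close>, then equals 1
    at \<open>x - y\<close> whenever \<open>x - \<gamma>\<close> lies in the support of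
    \<theta>.\<close>
  define D where "D = (\<Union>x\<in>function_support \<theta>. \<Union>y\<in>cball (0::real^'n) (1/4). {x + y})"
  have "compact D" unfolding D_def by (rule compact_sums'[OF test_functionsD(2)[OF \<theta>] compact_cball])
  then obtain b :: "real^'n \<Rightarrow> real" and V where b: "(\<lambda>x. of_real (b x)) \<in> test_functions" "D \<subseteq> V"
    "\<And>x. x \<in> V \<Longrightarrow> b x = 1"
    by (rule cutoff_function[of D UNIV]) auto
  define \<beta> where "\<beta> x = complex_of_real (b x)" for x
  have \<beta>S: "\<beta> \<in> schwartz_functions" using test_imp_schwartz[OF b(1)] by (simp only: \<beta>_def[abs_def])
  obtain C1 where C1: "C1 \<ge> 0" "\<And>f. f \<in> schwartz_functions \<Longrightarrow> wnorm w (\<lambda>x. \<theta> x * f x) \<le> C1 * wnorm w f"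
    using wnorm_mult_le[OF w \<theta>S] by blast
  obtain C2 where C2: "C2 \<ge> 0" "\<And>f. f \<in> schwartz_functions \<Longrightarrow>
    (\<integral>\<^sup>+y. ennreal ((wnorm w (\<lambda>x. \<beta> (x - y) * f x))\<^sup>2) \<partial>lborel) \<le> ennreal (C2 * (wnorm w f)\<^sup>2)"
    using wnorm_window_integral[OF w \<beta>S] by blast
  \<comment> \<open>Volume of a ball of radius 1/4. Distinct lattice points have distance at least
    1, so these balls are disjoint; dividing by v turns the integral over a ball into an
    average.\<close>
  define v where "v = unit_ball_vol (real DIM(real^'n)) * (1/4) ^ DIM(real^'n)"
  have v: "v > 0" "emeasure lborel (ball (\<gamma>::real^'n) (1/4)) = ennreal v" for \<gamma>
    by (simp_all add: v_def emeasure_ball)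
  have C1': "wnorm w (\<lambda>x. \<theta> (x - \<gamma>) * g x) \<le> C1 * wnorm w g" if g: "g \<in> schwartz_functions" for g \<gamma>
  proof -
    have "wnorm w (\<lambda>x. \<theta> (x - \<gamma>) * g x) = wnorm w (\<lambda>x. \<theta> x * g (x + \<gamma>))"
      using wnorm_translate[OF schwartz_mult[OF \<theta>S schwartz_translate[OF g, of \<gamma>]], of w "- \<gamma>"] by simp
    also have "\<dots> \<le> C1 * wnorm w (\<lambda>x. g (x + \<gamma>))" by (rule C1(2)[OF schwartz_translate[OF g]])
    finally show ?thesis by (simp only: wnorm_translate[OF g])
  qed
  have main: "(\<Sum>\<gamma>\<in>F. (wnorm w (\<lambda>x. \<theta> (x - \<gamma>) * f x))\<^sup>2) \<le> (C1\<^sup>2 * C2 / v) * (wnorm w f)\<^sup>2"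
    if f: "f \<in> schwartz_functions" and F: "finite F" "F \<subseteq> int_lattice" for f F
  proof -
    define g where "g y = ennreal ((wnorm w (\<lambda>x. \<beta> (x - y) * f x))\<^sup>2)" for y
    have "g = (\<lambda>y. \<integral>\<^sup>+\<xi>. ennreal ((w \<xi> * cmod (fourier (\<lambda>x. \<beta> (x - y) * f x) \<xi>))\<^sup>2) \<partial>lborel)"
      unfolding g_def by (simp only: nn_integral_wnorm[OF w schwartz_window[OF f \<beta>S]])
    moreover have "(\<lambda>p. ennreal ((w (snd p) * cmod (fourier (\<lambda>x. \<beta> (x - fst p) * f x) (snd p)))\<^sup>2)) \<in> borel_measurable (borel \<Otimes>\<^sub>M lborel)"
      using wnorm_window_measurable[OF w f \<beta>S] by (simp cong: measurable_cong_sets)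
    ultimately have gm [measurable]: "g \<in> borel_measurable borel"
      using lborel.borel_measurable_nn_integral_fst by fastforce
    have pt: "ennreal ((wnorm w (\<lambda>x. \<theta> (x - \<gamma>) * f x))\<^sup>2) \<le> ennreal (C1\<^sup>2) * g y" if y: "y \<in> ball \<gamma> (1/4)" for \<gamma> y
    proof -
      have "\<theta> (x - \<gamma>) * f x = \<theta> (x - \<gamma>) * (\<beta> (x - y) * f x)" for x
      proof (cases "x - \<gamma> \<in> function_support \<theta>")
        case True
        have "\<gamma> - y \<in> cball 0 (1/4)" using y by (simp add: dist_norm norm_minus_commute)
        then have "(x - \<gamma>) + (\<gamma> - y) \<in> D" unfolding D_def using True by blast
        then have "\<beta> (x - y) = 1" using b(2,3) by (auto simp: \<beta>_def)
        then show ?thesis by simp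
      qed (simp add: outside_function_support)
      then have "(\<lambda>x. \<theta> (x - \<gamma>) * f x) = (\<lambda>x. \<theta> (x - \<gamma>) * (\<beta> (x - y) * f x))" by (rule ext)
      then have "wnorm w (\<lambda>x. \<theta> (x - \<gamma>) * f x) \<le> C1 * wnorm w (\<lambda>x. \<beta> (x - y) * f x)"
        using C1'[OF schwartz_window[OF f \<beta>S], of \<gamma> y] by (simp only:)
      then have "(wnorm w (\<lambda>x. \<theta> (x - \<gamma>) * f x))\<^sup>2 \<le> (C1 * wnorm w (\<lambda>x. \<beta> (x - y) * f x))\<^sup>2"
        by (intro power_mono) auto
      then have "ennreal ((wnorm w (\<lambda>x. \<theta> (x - \<gamma>) * f x))\<^sup>2) \<le> ennreal ((C1 * wnorm w (\<lambda>x. \<beta> (x - y) * f x))\<^sup>2)"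
        by (rule ennreal_leI)
      then show ?thesis unfolding g_def by (simp only: power_mult_distrib ennreal_mult zero_le_power2)
    qed
    have disj: "(\<Sum>\<gamma>\<in>F. indicator (ball \<gamma> (1/4)) y :: ennreal) \<le> 1" for y
    proof (cases "\<exists>\<gamma>\<in>F. y \<in> ball \<gamma> (1/4)")
      case True
      then obtain \<gamma> where \<gamma>: "\<gamma> \<in> F" "y \<in> ball \<gamma> (1/4)" by blast
      have "y \<notin> ball \<delta> (1/4)" if "\<delta> \<in> F" "\<delta> \<noteq> \<gamma>" for \<delta>
      proof
        assume "y \<in> ball \<delta> (1/4)"
        then have "dist \<delta> \<gamma> < 1/2" using \<gamma>(2) dist_triangle2[of \<delta> \<gamma> y] by (simp add: dist_commute)
        then show False using int_lattice_separated[of \<delta> \<gamma>] that \<gamma> F(2) by (auto simp: dist_norm)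
      qed
      then have "(\<Sum>\<gamma>\<in>F. indicator (ball \<gamma> (1/4)) y :: ennreal) = (\<Sum>\<delta>\<in>F. if \<delta> = \<gamma> then 1 else 0)"
        using \<gamma> by (intro sum.cong refl) auto
      then show ?thesis using \<gamma>(1) F(1) by simp
    next
      case False
      then have "(\<Sum>\<gamma>\<in>F. indicator (ball \<gamma> (1/4)) y :: ennreal) = 0" by (intro sum.neutral) auto
      then show ?thesis by simp
    qed
    have one: "ennreal v * ennreal ((wnorm w (\<lambda>x. \<theta> (x - \<gamma>) * f x))\<^sup>2) \<le>
      (\<integral>\<^sup>+y. ennreal (C1\<^sup>2) * g y * indicator (ball \<gamma> (1/4)) y \<partial>lborel)" for \<gamma>
    proof -
      have "ennreal v * ennreal ((wnorm w (\<lambda>x. \<theta> (x - \<gamma>) * f x))\<^sup>2) =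
        (\<integral>\<^sup>+y. ennreal ((wnorm w (\<lambda>x. \<theta> (x - \<gamma>) * f x))\<^sup>2) * indicator (ball \<gamma> (1/4)) y \<partial>lborel)"
        by (subst nn_integral_cmult_indicator) (simp_all add: v mult.commute)
      also have "\<dots> \<le> (\<integral>\<^sup>+y. ennreal (C1\<^sup>2) * g y * indicator (ball \<gamma> (1/4)) y \<partial>lborel)"
      proof (rule nn_integral_mono)
        fix y
        show "ennreal ((wnorm w (\<lambda>x. \<theta> (x - \<gamma>) * f x))\<^sup>2) * indicator (ball \<gamma> (1/4)) y \<le>
          ennreal (C1\<^sup>2) * g y * indicator (ball \<gamma> (1/4)) y"
        proof (cases "y \<in> ball \<gamma> (1/4)")
          case True
          then show ?thesis using pt[OF True] by (simp only: indicator_simps mult_1_right)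
        next
          case False
          then show ?thesis by (simp del: mem_ball)
        qed
      qed
      finally show ?thesis .
    qed
    have "ennreal v * ennreal (\<Sum>\<gamma>\<in>F. (wnorm w (\<lambda>x. \<theta> (x - \<gamma>) * f x))\<^sup>2) =
      (\<Sum>\<gamma>\<in>F. ennreal v * ennreal ((wnorm w (\<lambda>x. \<theta> (x - \<gamma>) * f x))\<^sup>2))"
      by (subst sum_ennreal[symmetric]) (simp_all only: zero_le_power2 sum_distrib_left)
    also have "\<dots> \<le> (\<Sum>\<gamma>\<in>F. \<integral>\<^sup>+y. ennreal (C1\<^sup>2) * g y * indicator (ball \<gamma> (1/4)) y \<partial>lborel)"
      by (intro sum_mono one)
    also have "\<dots> = (\<integral>\<^sup>+y. (\<Sum>\<gamma>\<in>F. ennreal (C1\<^sup>2) * g y * indicator (ball \<gamma> (1/4)) y) \<partial>lborel)"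
      by (rule nn_integral_sum[symmetric], intro borel_measurable_times_ennreal borel_measurable_indicator) (use gm in simp_all)
    also have "\<dots> \<le> (\<integral>\<^sup>+y. ennreal (C1\<^sup>2) * g y \<partial>lborel)"
    proof (rule nn_integral_mono)
      fix y
      show "(\<Sum>\<gamma>\<in>F. ennreal (C1\<^sup>2) * g y * indicator (ball \<gamma> (1/4)) y) \<le> ennreal (C1\<^sup>2) * g y"
        using mult_left_mono[OF disj[of y], of "ennreal (C1\<^sup>2) * g y"]
        by (simp only: sum_distrib_left mult_1_right zero_le)
    qed
    also have "\<dots> = ennreal (C1\<^sup>2) * (\<integral>\<^sup>+y. g y \<partial>lborel)" by (rule nn_integral_cmult) simp
    also have "\<dots> \<le> ennreal (C1\<^sup>2) * ennreal (C2 * (wnorm w f)\<^sup>2)"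
      unfolding g_def by (intro mult_left_mono C2(2) f) simp
    finally have "ennreal (v * (\<Sum>\<gamma>\<in>F. (wnorm w (\<lambda>x. \<theta> (x - \<gamma>) * f x))\<^sup>2)) \<le> ennreal (C1\<^sup>2 * (C2 * (wnorm w f)\<^sup>2))"
      using v(1) C2(1) by (simp add: ennreal_mult sum_nonneg)
    then have "v * (\<Sum>\<gamma>\<in>F. (wnorm w (\<lambda>x. \<theta> (x - \<gamma>) * f x))\<^sup>2) \<le> C1\<^sup>2 * (C2 * (wnorm w f)\<^sup>2)"
      using C2(1) by (subst (asm) ennreal_le_iff) auto
    then show ?thesis using v(1) by (simp add: field_simps)
  qed
  have "C1\<^sup>2 * C2 / v \<ge> 0" using C2(1) v(1) by simp
  then show ?thesis using main by (rule that)
qed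

text \<open>The extremal function in \<open>pairing_bound\<close>. Its transform is w^2 times the
  conjugate of the transform of g at the reflected point, so that in Parseval's identity the pairing
  becomes the integral of a square.\<close>

lemma dual_function:
  fixes w :: "real^'n::finite \<Rightarrow> real"
  assumes w: "admissible w" and g: "g \<in> schwartz_functions"
  obtains \<phi> where "\<phi> \<in> schwartz_functions" "wnorm (\<lambda>\<xi>. inverse (w \<xi>)) \<phi> = wnorm w g"
    "(LINT x|lborel. g x * \<phi> x) = of_real (1 / (2 * pi) ^ CARD('n) * (wnorm w g)\<^sup>2)"
proof -
  define h where "h \<xi> = of_real (w \<xi>) * (of_real (w \<xi>) * cnj (fourier g (0 - \<xi>)))" for \<xi>
  have h: "h \<in> schwartz_functions"
  proof -
    have "(\<lambda>\<xi>. (cnj (fourier g (0 - \<xi>)) * of_real (w \<xi>)) * of_real (w \<xi>)) \<in> schwartz_functions"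
      by (intro schwartz_mult_slow[OF _ admissibleD(3)[OF w]] schwartz_cnj schwartz_reflect schwartz_fourier g)
    then show ?thesis unfolding h_def by (simp only: mult_ac)
  qed
  define \<phi> where "\<phi> = inverse_fourier h"
  have \<phi>: "\<phi> \<in> schwartz_functions" unfolding \<phi>_def by (rule schwartz_inverse_fourier[OF h])
  have F\<phi>: "fourier \<phi> = h" unfolding \<phi>_def by (rule fourier_inverse_fourier[OF h])
  let ?W = "\<lambda>\<xi>. of_real (w \<xi>) * fourier g \<xi>"
  have W: "?W \<in> schwartz_functions" by (rule schwartz_weighted_fourier[OF w g])
  have Wm: "(\<lambda>\<xi>. (cmod (?W \<xi>))\<^sup>2) \<in> borel_measurable borel"
    by (rule borel_measurable_power, rule measurable_compose[OF schwartz_measurable[OF W] borel_measurable_norm])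
  have "cmod (of_real (inverse (w \<xi>)) * h \<xi>) = cmod (?W (0 - \<xi>))" for \<xi>
    using admissibleD(1,2)[OF w, of \<xi>] by (simp add: h_def norm_mult norm_inverse)
  then have 1: "wnorm (\<lambda>\<xi>. inverse (w \<xi>)) \<phi> = wnorm w g"
    unfolding wnorm_def L2_norm_def F\<phi> by (simp only: lborel_integral_reflect[OF Wm])
  have "fourier g \<xi> * h (- \<xi>) = of_real ((cmod (?W \<xi>))\<^sup>2)" for \<xi>
    unfolding complex_norm_square h_def by (simp add: admissibleD(2)[OF w] mult_ac)
  then have "(LINT x|lborel. g x * \<phi> x) = of_real (1 / (2 * pi) ^ CARD('n)) * of_real (LINT \<xi>|lborel. (cmod (?W \<xi>))\<^sup>2)"
    unfolding parseval[OF g \<phi>] F\<phi> by (simp only: integral_complex_of_real)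
  also have "(LINT \<xi>|lborel. (cmod (?W \<xi>))\<^sup>2) = (wnorm w g)\<^sup>2"
    unfolding wnorm_def L2_norm_def by (rule real_sqrt_pow2[symmetric]) (rule Bochner_Integration.integral_nonneg, simp)
  finally show ?thesis using \<phi> 1 by (intro that) (simp_all only: of_real_mult)
qed

text \<open>This is the adjoint of the localisation bound for the inverse weight.\<close>

lemma gluing_bound:
  fixes w :: "real^'n::finite \<Rightarrow> real"
  assumes w: "admissible w" and \<theta>: "\<theta> \<in> test_functions"
  obtains C where "C \<ge> 0" "\<And>\<psi> F. \<psi> ` F \<subseteq> schwartz_functions \<Longrightarrow> finite F \<Longrightarrow> F \<subseteq> int_lattice \<Longrightarrow>
    (wnorm w (\<lambda>x. \<Sum>\<gamma>\<in>F. \<theta> (x - \<gamma>) * \<psi> \<gamma> x))\<^sup>2 \<le> C * (\<Sum>\<gamma>\<in>F. (wnorm w (\<psi> \<gamma>))\<^sup>2)"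
proof -
  let ?w' = "\<lambda>\<xi>. inverse (w \<xi>)"
  note \<theta>S = test_imp_schwartz[OF \<theta>]
  obtain C where C: "C \<ge> 0" and CB: "\<And>f F. f \<in> schwartz_functions \<Longrightarrow> finite F \<Longrightarrow> F \<subseteq> int_lattice \<Longrightarrow>
    (\<Sum>\<gamma>\<in>F. (wnorm ?w' (\<lambda>x. \<theta> (x - \<gamma>) * f x))\<^sup>2) \<le> C * (wnorm ?w' f)\<^sup>2"
    using localisation_bound[OF admissible_inverse[OF w] \<theta>] by blast
  have main: "(wnorm w (\<lambda>x. \<Sum>\<gamma>\<in>F. \<theta> (x - \<gamma>) * \<psi> \<gamma> x))\<^sup>2 \<le> C * (\<Sum>\<gamma>\<in>F. (wnorm w (\<psi> \<gamma>))\<^sup>2)"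
    if "\<psi> ` F \<subseteq> schwartz_functions" and F: "finite F" "F \<subseteq> int_lattice" for \<psi> F
  proof -
    have \<psi>: "\<psi> \<gamma> \<in> schwartz_functions" if "\<gamma> \<in> F" for \<gamma>
      using \<open>\<psi> ` F \<subseteq> schwartz_functions\<close> that by blast
    define c where "c = 1 / (2 * pi) ^ CARD('n)"
    have c: "c > 0" by (simp add: c_def)
    define g where "g x = (\<Sum>\<gamma>\<in>F. \<theta> (x - \<gamma>) * \<psi> \<gamma> x)" for x
    have g: "g \<in> schwartz_functions"
      unfolding g_def by (intro schwartz_sum schwartz_window \<psi> \<theta>S)
    \<comment> \<open>Pairing g with its extremal function gives the square of its norm; each
      \<theta>(x - \<gamma>) is then moved from \<psi> over to \<phi>, where the localisation bound
      applies.\<close>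
    obtain \<phi> where \<phi>: "\<phi> \<in> schwartz_functions" "wnorm ?w' \<phi> = wnorm w g"
      "(LINT x|lborel. g x * \<phi> x) = of_real (c * (wnorm w g)\<^sup>2)"
      unfolding c_def using dual_function[OF w g] by blast
    define a where "a \<gamma> = wnorm w (\<psi> \<gamma>)" for \<gamma>
    define d where "d \<gamma> = wnorm ?w' (\<lambda>x. \<theta> (x - \<gamma>) * \<phi> x)" for \<gamma>
    have "(LINT x|lborel. g x * \<phi> x) = (LINT x|lborel. (\<Sum>\<gamma>\<in>F. \<psi> \<gamma> x * (\<theta> (x - \<gamma>) * \<phi> x)))"
      unfolding g_def sum_distrib_right by (simp only: mult_ac)
    also have "\<dots> = (\<Sum>\<gamma>\<in>F. LINT x|lborel. \<psi> \<gamma> x * (\<theta> (x - \<gamma>) * \<phi> x))"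
      by (intro Bochner_Integration.integral_sum schwartz_integrable schwartz_mult[OF \<psi>] schwartz_window[OF \<phi>(1) \<theta>S])
    finally have "cmod (of_real (c * (wnorm w g)\<^sup>2)) = cmod (\<Sum>\<gamma>\<in>F. LINT x|lborel. \<psi> \<gamma> x * (\<theta> (x - \<gamma>) * \<phi> x))"
      by (simp only: \<phi>(3))
    then have "c * (wnorm w g)\<^sup>2 = cmod (\<Sum>\<gamma>\<in>F. LINT x|lborel. \<psi> \<gamma> x * (\<theta> (x - \<gamma>) * \<phi> x))"
      using c by (simp only: norm_of_real) simp
    also have "\<dots> \<le> (\<Sum>\<gamma>\<in>F. c * (a \<gamma> * d \<gamma>))"
    proof (rule order_trans[OF norm_sum sum_mono])
      fix \<gamma> assume "\<gamma> \<in> F"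
      then show "cmod (LINT x|lborel. \<psi> \<gamma> x * (\<theta> (x - \<gamma>) * \<phi> x)) \<le> c * (a \<gamma> * d \<gamma>)"
        unfolding c_def a_def d_def by (intro pairing_bound[OF w] \<psi> schwartz_window[OF \<phi>(1) \<theta>S])
    qed
    finally have "(wnorm w g)\<^sup>2 \<le> (\<Sum>\<gamma>\<in>F. a \<gamma> * d \<gamma>)"
      using c by (simp add: sum_distrib_left[symmetric])
    then have "((wnorm w g)\<^sup>2)\<^sup>2 \<le> (\<Sum>\<gamma>\<in>F. a \<gamma> * d \<gamma>)\<^sup>2" by (intro power_mono) auto
    also have "\<dots> \<le> (\<Sum>\<gamma>\<in>F. (a \<gamma>)\<^sup>2) * (\<Sum>\<gamma>\<in>F. (d \<gamma>)\<^sup>2)" by (rule Cauchy_Schwarz_ineq_sum)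
    also have "\<dots> \<le> (\<Sum>\<gamma>\<in>F. (a \<gamma>)\<^sup>2) * (C * (wnorm w g)\<^sup>2)"
      unfolding d_def \<phi>(2)[symmetric] by (intro mult_left_mono CB \<phi>(1) F sum_nonneg) simp
    finally have "(wnorm w g)\<^sup>2 * (wnorm w g)\<^sup>2 \<le> (C * (\<Sum>\<gamma>\<in>F. (a \<gamma>)\<^sup>2)) * (wnorm w g)\<^sup>2"
      by (simp add: power2_eq_square mult_ac)
    \<comment> \<open>The norm of \<phi> equals that of g and reappears squared on the right, so one
      factor \<open>(wnorm w g)^2\<close> cancels.\<close>
    then have "(wnorm w g)\<^sup>2 \<le> C * (\<Sum>\<gamma>\<in>F. (a \<gamma>)\<^sup>2)"
    proof (cases "wnorm w g = 0")
      case True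
      then show ?thesis using C by (simp add: sum_nonneg)
    next
      case False
      then have "(wnorm w g)\<^sup>2 > 0" by simp
      then show ?thesis
        using \<open>(wnorm w g)\<^sup>2 * (wnorm w g)\<^sup>2 \<le> (C * (\<Sum>\<gamma>\<in>F. (a \<gamma>)\<^sup>2)) * (wnorm w g)\<^sup>2\<close>
        by (rule mult_right_le_imp_le[rotated])
    qed
    then show ?thesis unfolding g_def a_def .
  qed
  show ?thesis using C main by (rule that)
qed

section \<open>Completeness of \<open>L\<^sup>2\<close> and the Riesz representation\<close>

lemma square_integrable_add:
  assumes f: "square_integrable f" and g: "square_integrable g"
  shows "square_integrable (\<lambda>x. f x + g x)"
proof -
  have [measurable]: "f \<in> borel_measurable borel" "g \<in> borel_measurable borel"
    using f g by (auto simp: square_integrable_def)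
  have "integrable lborel (\<lambda>x. (cmod (f x + g x))\<^sup>2)"
  proof (rule Bochner_Integration.integrable_bound)
    show "integrable lborel (\<lambda>x. 2 * (cmod (f x))\<^sup>2 + 2 * (cmod (g x))\<^sup>2)"
      using f g by (intro Bochner_Integration.integrable_add integrable_mult_right) (simp_all add: square_integrable_def)
    have "(cmod (f x + g x))\<^sup>2 \<le> 2 * (cmod (f x))\<^sup>2 + 2 * (cmod (g x))\<^sup>2" for x
    proof -
      have "(cmod (f x + g x))\<^sup>2 \<le> (cmod (f x) + cmod (g x))\<^sup>2" by (intro power_mono norm_triangle_ineq) simp
      also have "\<dots> \<le> 2 * (cmod (f x))\<^sup>2 + 2 * (cmod (g x))\<^sup>2"
        using sum_squares_bound[of "cmod (f x)" "cmod (g x)"] by (simp add: power2_sum)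
      finally show ?thesis .
    qed
    then show "AE x in lborel. norm ((cmod (f x + g x))\<^sup>2) \<le> norm (2 * (cmod (f x))\<^sup>2 + 2 * (cmod (g x))\<^sup>2)"
      by simp
  qed simp
  then show ?thesis by (simp add: square_integrable_def)
qed

lemma square_integrable_cmult: "square_integrable f \<Longrightarrow> square_integrable (\<lambda>x. c * f x)"
  by (auto simp: square_integrable_def norm_mult power_mult_distrib intro: borel_measurable_times)

lemma square_integrable_diff:
  assumes "square_integrable f" "square_integrable g"
  shows "square_integrable (\<lambda>x. f x - g x)"
  using square_integrable_add[OF assms(1) square_integrable_cmult[OF assms(2), of "-1"]] by simp

lemma square_integrable_cnj: "square_integrable f \<Longrightarrow> square_integrable (\<lambda>x. cnj (f x))"
proof -
  assume f: "square_integrable f"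
  then have "f \<in> borel_measurable borel" by (simp add: square_integrable_def)
  then have "(\<lambda>x. cnj (f x)) \<in> borel_measurable borel"
    by (rule measurable_compose) (intro borel_measurable_continuous_onI continuous_intros)
  then show ?thesis using f by (simp add: square_integrable_def)
qed

lemma L2_norm_cnj [simp]: "L2_norm (\<lambda>x. cnj (f x)) = L2_norm f"
  by (simp add: L2_norm_def)

lemma L2_norm_square: "(L2_norm f)\<^sup>2 = (LINT x|lborel. (cmod (f x))\<^sup>2)"
  unfolding L2_norm_def by (rule real_sqrt_pow2) (rule Bochner_Integration.integral_nonneg, simp)

lemma L2_norm_cmult: "L2_norm (\<lambda>x. c * f x) = cmod c * L2_norm f"
  by (simp add: L2_norm_def norm_mult power_mult_distrib real_sqrt_mult)

lemma L2_norm_add_square: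
  assumes f: "square_integrable f" and g: "square_integrable g"
  shows "(L2_norm (\<lambda>x. f x + g x))\<^sup>2 = (L2_norm f)\<^sup>2 + 2 * Re (LINT x|lborel. f x * cnj (g x)) + (L2_norm g)\<^sup>2"
proof -
  have int: "integrable lborel (\<lambda>x. f x * cnj (g x))"
    by (rule L2_Cauchy_Schwarz(1)[OF f square_integrable_cnj[OF g]])
  have i: "integrable lborel (\<lambda>x. (cmod (f x))\<^sup>2)" "integrable lborel (\<lambda>x. (cmod (g x))\<^sup>2)"
    using f g by (auto simp: square_integrable_def)
  have i2: "integrable lborel (\<lambda>x. 2 * Re (f x * cnj (g x)))"
    by (rule integrable_mult_right) (rule integrable_Re[OF int])
  have "(cmod (f x + g x))\<^sup>2 = (cmod (f x))\<^sup>2 + 2 * Re (f x * cnj (g x)) + (cmod (g x))\<^sup>2" for x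
    unfolding cmod_power2 by (simp add: power2_eq_square algebra_simps)
  then have "(L2_norm (\<lambda>x. f x + g x))\<^sup>2 = (LINT x|lborel. (cmod (f x))\<^sup>2 + 2 * Re (f x * cnj (g x)) + (cmod (g x))\<^sup>2)"
    by (simp only: L2_norm_square)
  also have "\<dots> = (LINT x|lborel. (cmod (f x))\<^sup>2) + (LINT x|lborel. 2 * Re (f x * cnj (g x))) + (LINT x|lborel. (cmod (g x))\<^sup>2)"
    using Bochner_Integration.integral_add[OF Bochner_Integration.integrable_add[OF i(1) i2] i(2)]
      Bochner_Integration.integral_add[OF i(1) i2] by (simp only:)
  also have "(LINT x|lborel. 2 * Re (f x * cnj (g x))) = 2 * (LINT x|lborel. Re (f x * cnj (g x)))"
    by (rule integral_mult_right_zero)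
  also have "(LINT x|lborel. Re (f x * cnj (g x))) = Re (LINT x|lborel. f x * cnj (g x))"
    by (rule integral_Re[OF int])
  finally show ?thesis by (simp only: L2_norm_square)
qed

lemma L2_norm_diff_square:
  assumes f: "square_integrable f" and g: "square_integrable g"
  shows "(L2_norm (\<lambda>x. f x - g x))\<^sup>2 = (L2_norm f)\<^sup>2 - 2 * Re (LINT x|lborel. f x * cnj (g x)) + (L2_norm g)\<^sup>2"
proof -
  have "L2_norm (\<lambda>x. - g x) = L2_norm g" by (simp add: L2_norm_def)
  then show ?thesis using L2_norm_add_square[OF f square_integrable_cmult[OF g, of "- 1"]] by simp
qed

text \<open>The rate 8 = 2 * 4 leaves room on both sides. Weighted by 2^n, the squared increments
  have integrals bounded by C (1/4)^n, which is summable; and an almost everywhere finite sum of the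
  weighted squares bounds the n-th increment by a constant times 2^(-n/2), which is summable too and
  forces pointwise convergence.\<close>

lemma L2_complete:
  fixes \<phi> :: "nat \<Rightarrow> real^'n::finite \<Rightarrow> complex"
  assumes \<phi>: "\<And>n. square_integrable (\<phi> n)" and C: "C \<ge> 0"
    and Cauchy: "\<And>n k. n \<le> k \<Longrightarrow> (L2_norm (\<lambda>x. \<phi> k x - \<phi> n x))\<^sup>2 \<le> C * (1/8) ^ n"
  obtains g where "square_integrable g" "\<And>n. (L2_norm (\<lambda>x. g x - \<phi> n x))\<^sup>2 \<le> C * (1/8) ^ n"
proof -
  have m [measurable]: "\<phi> n \<in> borel_measurable borel" for n
    using \<phi>[of n] by (simp add: square_integrable_def)
  have nn: "(\<integral>\<^sup>+x. ennreal ((cmod (\<phi> k x - \<phi> n x))\<^sup>2) \<partial>lborel) \<le> ennreal (C * (1/8) ^ n)" if "n \<le> k" for n k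
    unfolding nn_integral_L2_norm[OF square_integrable_diff[OF \<phi>[of k] \<phi>[of n]]] by (rule ennreal_leI[OF Cauchy[OF that]])
  define D where "D n x = ennreal (2 ^ n * (cmod (\<phi> (Suc n) x - \<phi> n x))\<^sup>2)" for n x
  have Dm [measurable]: "D n \<in> borel_measurable borel" for n unfolding D_def by measurable
  have "(\<integral>\<^sup>+x. (\<Sum>n. D n x) \<partial>lborel) = (\<Sum>n. \<integral>\<^sup>+x. D n x \<partial>lborel)"
    by (rule nn_integral_suminf) simp
  also have "\<dots> \<le> (\<Sum>n. ennreal (C * (1/4) ^ n))"
  proof (rule suminf_le)
    fix n
    have "(\<integral>\<^sup>+x. D n x \<partial>lborel) = (\<integral>\<^sup>+x. ennreal (2 ^ n) * ennreal ((cmod (\<phi> (Suc n) x - \<phi> n x))\<^sup>2) \<partial>lborel)"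
      unfolding D_def by (simp add: ennreal_mult)
    also have "\<dots> = ennreal (2 ^ n) * (\<integral>\<^sup>+x. ennreal ((cmod (\<phi> (Suc n) x - \<phi> n x))\<^sup>2) \<partial>lborel)"
      by (rule nn_integral_cmult) measurable
    also have "\<dots> \<le> ennreal (2 ^ n) * ennreal (C * (1/8) ^ n)"
      by (rule mult_left_mono[OF nn[OF le_SucI[OF order_refl]]]) simp
    also have "\<dots> = ennreal (2 ^ n * (C * (1/8) ^ n))" using C by (simp add: ennreal_mult)
    also have "2 ^ n * (C * (1/8) ^ n) = C * (1/4) ^ n"
    proof -
      have "2 ^ n * (C * (1/8) ^ n) = C * (2 * (1/8)) ^ n" by (simp only: power_mult_distrib mult_ac)
      then show ?thesis by simp
    qed
    finally show "(\<integral>\<^sup>+x. D n x \<partial>lborel) \<le> ennreal (C * (1/4) ^ n)" .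
  qed auto
  also have "\<dots> < \<infinity>"
  proof -
    have "summable (\<lambda>n. C * (1/4::real) ^ n)" by (intro summable_mult summable_geometric) simp
    then show ?thesis using C by (subst suminf_ennreal2) auto
  qed
  finally have "AE x in lborel. (\<Sum>n. D n x) \<noteq> \<infinity>"
    by (intro nn_integral_PInf_AE) auto
  then have conv: "AE x in lborel. convergent (\<lambda>n. \<phi> n x)"
  proof (rule AE_mp, intro AE_I2 impI)
    fix x assume fin: "(\<Sum>n. D n x) \<noteq> \<infinity>"
    define S where "S = enn2real (\<Sum>n. D n x)"
    have S: "(\<Sum>n. D n x) = ennreal S" using fin by (simp add: S_def ennreal_enn2real_if)
    have S0: "S \<ge> 0" by (simp add: S_def)
    have le: "cmod (\<phi> (Suc n) x - \<phi> n x) \<le> sqrt S * (1 / sqrt 2) ^ n" for n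
    proof -
      have "D n x \<le> (\<Sum>n. D n x)" using sum_le_suminf[of "\<lambda>n. D n x" "{n}"] by simp
      then have "D n x \<le> ennreal S" by (simp only: S)
      then have "2 ^ n * (cmod (\<phi> (Suc n) x - \<phi> n x))\<^sup>2 \<le> S"
        unfolding D_def using S0 by (subst (asm) ennreal_le_iff) auto
      then have "(cmod (\<phi> (Suc n) x - \<phi> n x))\<^sup>2 \<le> S / 2 ^ n" by (simp add: field_simps)
      also have "\<dots> = (sqrt S * (1 / sqrt 2) ^ n)\<^sup>2"
      proof -
        have "((1 / sqrt 2) ^ n)\<^sup>2 = ((1 / sqrt 2)\<^sup>2) ^ n" by (simp only: power_mult[symmetric] mult.commute)
        also have "(1 / sqrt 2)\<^sup>2 = 1 / (2::real)" by (simp add: power_divide)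
        finally show ?thesis using S0 by (simp add: power_mult_distrib power_divide)
      qed
      finally show ?thesis by (rule power2_le_imp_le) (simp add: S0)
    qed
    have "summable (\<lambda>n. sqrt S * (1 / sqrt 2) ^ n)"
      by (intro summable_mult summable_geometric) simp
    then have "summable (\<lambda>n. \<phi> (Suc n) x - \<phi> n x)"
      by (rule summable_comparison_test'[where N = 0]) (rule le)
    then have "convergent (\<lambda>n. \<Sum>i<n. \<phi> (Suc i) x - \<phi> i x)" by (simp add: summable_iff_convergent)
    then have "convergent (\<lambda>n. \<phi> n x - \<phi> 0 x)" by (simp only: sum_lessThan_telescope[of "\<lambda>n. \<phi> n x"])
    then have "convergent (\<lambda>n. (\<phi> n x - \<phi> 0 x) + \<phi> 0 x)" by (rule convergent_add[OF _ convergent_const])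
    then show "convergent (\<lambda>n. \<phi> n x)" by simp
  qed
  define g where "g x = lim (\<lambda>n. \<phi> n x)" for x
  have gm [measurable]: "g \<in> borel_measurable borel" unfolding g_def by measurable
  \<comment> \<open>Fatou's lemma hands the Cauchy bound on to the pointwise limit.\<close>
  have bound: "(\<integral>\<^sup>+x. ennreal ((cmod (g x - \<phi> n x))\<^sup>2) \<partial>lborel) \<le> ennreal (C * (1/8) ^ n)" for n
  proof -
    have "(\<integral>\<^sup>+x. ennreal ((cmod (g x - \<phi> n x))\<^sup>2) \<partial>lborel) =
      (\<integral>\<^sup>+x. liminf (\<lambda>k. ennreal ((cmod (\<phi> k x - \<phi> n x))\<^sup>2)) \<partial>lborel)"
    proof (rule nn_integral_cong_AE, rule AE_mp[OF conv], intro AE_I2 impI)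
      fix x assume "convergent (\<lambda>n. \<phi> n x)"
      then have "(\<lambda>k. \<phi> k x) \<longlonglongrightarrow> g x" unfolding g_def by (simp add: convergent_LIMSEQ_iff)
      then have "(\<lambda>k. ennreal ((cmod (\<phi> k x - \<phi> n x))\<^sup>2)) \<longlonglongrightarrow> ennreal ((cmod (g x - \<phi> n x))\<^sup>2)"
        by (intro tendsto_ennrealI tendsto_intros)
      then show "ennreal ((cmod (g x - \<phi> n x))\<^sup>2) = liminf (\<lambda>k. ennreal ((cmod (\<phi> k x - \<phi> n x))\<^sup>2))"
        using lim_imp_Liminf[OF sequentially_bot] by metis
    qed
    also have "\<dots> \<le> liminf (\<lambda>k. \<integral>\<^sup>+x. ennreal ((cmod (\<phi> k x - \<phi> n x))\<^sup>2) \<partial>lborel)"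
      by (rule nn_integral_liminf) measurable
    also have "\<dots> \<le> ennreal (C * (1/8) ^ n)"
    proof (rule Liminf_le)
      show "\<forall>\<^sub>F k in sequentially. (\<integral>\<^sup>+x. ennreal ((cmod (\<phi> k x - \<phi> n x))\<^sup>2) \<partial>lborel) \<le> ennreal (C * (1/8) ^ n)"
        using nn by (auto simp: eventually_sequentially)
    qed simp
    finally show ?thesis .
  qed
  have diff: "square_integrable (\<lambda>x. g x - \<phi> n x)" for n
    unfolding square_integrable_iff using le_less_trans[OF bound[of n]] by simp
  have "square_integrable (\<lambda>x. (g x - \<phi> 0 x) + \<phi> 0 x)"
    by (rule square_integrable_add[OF diff \<phi>])
  then have "square_integrable g" by simp
  moreover have "(L2_norm (\<lambda>x. g x - \<phi> n x))\<^sup>2 \<le> C * (1/8) ^ n" for n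
    using bound[of n] C unfolding nn_integral_L2_norm[OF diff] by (subst (asm) ennreal_le_iff) auto
  ultimately show ?thesis by (rule that)
qed

lemma quadratic_nonneg_imp_zero:
  assumes "\<And>t::real. 2 * t * r + t\<^sup>2 * s \<ge> 0" "s \<ge> 0"
  shows "r = 0"
proof -
  \<comment> \<open>The minimum lies at t = - r / s, which needs s > 0; the denominator s + 1 avoids
    the case s = 0.\<close>
  define a where "a = r / (s + 1)"
  have r: "r = a * (s + 1)" using assms(2) by (simp add: a_def)
  have "2 * (- a) * r + (- a)\<^sup>2 * s = - (a\<^sup>2 * (s + 2))"
    unfolding r by (simp add: power2_eq_square algebra_simps)
  then have "a\<^sup>2 * (s + 2) \<le> 0" using assms(1)[of "- a"] by simp
  then show ?thesis using assms(2) unfolding r by (simp add: mult_le_0_iff)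
qed

text \<open>For a represented functional, \<open>J\<close> is the squared distance to the
  representing function up to a constant, so a minimising sequence of \<open>J\<close> is sought.
  \<open>W\<close> is merely a subspace: the sequence converges in L2 to some g that may lie outside
  \<open>W\<close>, which is why first order conditions are obtained by passing to the limit. The
  pairing being bilinear, the conjugate of g represents \<open>L\<close>.\<close>

lemma L2_riesz:
  fixes L :: "(real^'n::finite \<Rightarrow> complex) \<Rightarrow> complex"
  assumes sq: "\<And>\<phi>. \<phi> \<in> W \<Longrightarrow> square_integrable \<phi>" and zero: "(\<lambda>x. 0) \<in> W"
    and add: "\<And>\<phi> \<psi>. \<phi> \<in> W \<Longrightarrow> \<psi> \<in> W \<Longrightarrow> (\<lambda>x. \<phi> x + \<psi> x) \<in> W"
    and cmult: "\<And>c \<phi>. \<phi> \<in> W \<Longrightarrow> (\<lambda>x. c * \<phi> x) \<in> W"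
    and lin: "\<And>\<phi> \<psi> a c. \<phi> \<in> W \<Longrightarrow> \<psi> \<in> W \<Longrightarrow> L (\<lambda>x. a * \<phi> x + c * \<psi> x) = a * L \<phi> + c * L \<psi>"
    and bound: "\<And>\<phi>. \<phi> \<in> W \<Longrightarrow> cmod (L \<phi>) \<le> M * L2_norm \<phi>" and M: "M \<ge> 0"
  shows "\<exists>f. square_integrable f \<and> L2_norm f \<le> M \<and> (\<forall>\<phi>\<in>W. L \<phi> = (LINT x|lborel. f x * \<phi> x))"
proof -
  define J where "J \<phi> = (L2_norm \<phi>)\<^sup>2 - 2 * Re (L \<phi>)" for \<phi>
  have lower: "- (M\<^sup>2) \<le> J \<phi>" if "\<phi> \<in> W" for \<phi>
  proof -
    have "Re (L \<phi>) \<le> M * L2_norm \<phi>" using complex_Re_le_cmod[of "L \<phi>"] bound[OF that] by linarith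
    moreover have "0 \<le> (L2_norm \<phi> - M)\<^sup>2" by simp
    ultimately show ?thesis unfolding J_def power2_diff by (simp add: mult.commute)
  qed
  define m where "m = Inf (J ` W)"
  have bdd: "bdd_below (J ` W)"
    using lower by (intro bdd_belowI2[of _ "- (M\<^sup>2)"])
  have ne: "J ` W \<noteq> {}"
    using zero by blast
  have mle: "m \<le> J \<phi>" if "\<phi> \<in> W" for \<phi>
    unfolding m_def by (rule cInf_lower[OF imageI[OF that] bdd])
  \<comment> \<open>The precision (1/8)^n yields the rate of convergence that
    \<open>L2_complete\<close> asks for.\<close>
  have "\<exists>\<phi>\<in>W. J \<phi> < m + (1/8) ^ n" for n
  proof -
    have "Inf (J ` W) < m + (1/8) ^ n" unfolding m_def by simp
    from cInf_lessD[OF ne this] show ?thesis by blast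
  qed
  then have "\<forall>n. \<exists>\<phi>. \<phi> \<in> W \<and> J \<phi> < m + (1/8) ^ n" by blast
  from choice[OF this] obtain \<phi> where \<phi>: "\<And>n. \<phi> n \<in> W" and J\<phi>: "\<And>n. J (\<phi> n) < m + (1/8) ^ n"
    by blast
  \<comment> \<open>Parallelogram law, with the midpoint of \<alpha> and \<beta> as competitor for
    the infimum m.\<close>
  have para: "(L2_norm (\<lambda>x. \<alpha> x - \<beta> x))\<^sup>2 \<le> 2 * J \<alpha> + 2 * J \<beta> - 4 * m"
    if \<alpha>: "\<alpha> \<in> W" and \<beta>: "\<beta> \<in> W" for \<alpha> \<beta>
  proof -
    define s where "s x = 1/2 * \<alpha> x + 1/2 * \<beta> x" for x
    have s: "s \<in> W" unfolding s_def by (intro add cmult \<alpha> \<beta>)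
    have "s = (\<lambda>x. 1/2 * (\<alpha> x + \<beta> x))" by (simp add: s_def fun_eq_iff distrib_left)
    then have "L2_norm s = 1/2 * L2_norm (\<lambda>x. \<alpha> x + \<beta> x)" by (simp only: L2_norm_cmult) simp
    then have ns: "(L2_norm s)\<^sup>2 = (L2_norm (\<lambda>x. \<alpha> x + \<beta> x))\<^sup>2 / 4"
      by (simp only: power_mult_distrib) (simp add: power2_eq_square)
    have ls: "L s = 1/2 * L \<alpha> + 1/2 * L \<beta>" unfolding s_def[abs_def] by (rule lin[OF \<alpha> \<beta>])
    have "m \<le> (L2_norm (\<lambda>x. \<alpha> x + \<beta> x))\<^sup>2 / 4 - Re (L \<alpha>) - Re (L \<beta>)"
      using mle[OF s] unfolding J_def ns ls by simp
    then have "(L2_norm (\<lambda>x. \<alpha> x - \<beta> x))\<^sup>2 \<le>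
      2 * (L2_norm \<alpha>)\<^sup>2 + 2 * (L2_norm \<beta>)\<^sup>2 - 4 * Re (L \<alpha>) - 4 * Re (L \<beta>) - 4 * m"
      using L2_norm_add_square[OF sq[OF \<alpha>] sq[OF \<beta>]] L2_norm_diff_square[OF sq[OF \<alpha>] sq[OF \<beta>]]
      by linarith
    then show ?thesis by (simp add: J_def)
  qed
  have Cauchy: "(L2_norm (\<lambda>x. \<phi> k x - \<phi> n x))\<^sup>2 \<le> 4 * (1/8) ^ n" if "n \<le> k" for n k
  proof -
    have "(1/8::real) ^ k \<le> (1/8) ^ n" using that by (intro power_decreasing) auto
    then show ?thesis using para[OF \<phi>[of k] \<phi>[of n]] J\<phi>[of k] J\<phi>[of n] by linarith
  qed
  obtain g where g: "square_integrable g" and gb: "\<And>n. (L2_norm (\<lambda>x. g x - \<phi> n x))\<^sup>2 \<le> 4 * (1/8) ^ n"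
    using L2_complete[OF sq[OF \<phi>] _ Cauchy] by auto
  have "(\<lambda>n. 4 * (1/8::real) ^ n) \<longlonglongrightarrow> 4 * 0" by (intro tendsto_intros LIMSEQ_power_zero) simp
  then have lim8: "(\<lambda>n. 4 * (1/8::real) ^ n) \<longlonglongrightarrow> 0" by simp
  have "(\<lambda>n. (L2_norm (\<lambda>x. g x - \<phi> n x))\<^sup>2) \<longlonglongrightarrow> 0"
    by (rule tendsto_sandwich[OF _ _ tendsto_const lim8]) (use gb in auto)
  then have glim: "(\<lambda>n. L2_norm (\<lambda>x. g x - \<phi> n x)) \<longlonglongrightarrow> 0"
    using tendsto_real_sqrt[of "\<lambda>n. (L2_norm (\<lambda>x. g x - \<phi> n x))\<^sup>2" 0] by (simp only: real_sqrt_abs abs_of_nonneg[OF L2_norm_nonneg] real_sqrt_zero)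
  have Jlim: "(\<lambda>n. J (\<phi> n)) \<longlonglongrightarrow> m"
  proof (rule tendsto_sandwich[of "\<lambda>_. m" _ _ "\<lambda>n. m + (1/8) ^ n"])
    have "(\<lambda>n. m + (1/8) ^ n) \<longlonglongrightarrow> m + 0" by (intro tendsto_intros LIMSEQ_power_zero) simp
    then show "(\<lambda>n. m + (1/8) ^ n) \<longlonglongrightarrow> m" by simp
    show "\<forall>\<^sub>F n in sequentially. J (\<phi> n) \<le> m + (1/8) ^ n"
      by (intro always_eventually allI less_imp_le J\<phi>)
    show "\<forall>\<^sub>F n in sequentially. m \<le> J (\<phi> n)"
      by (intro always_eventually allI mle \<phi>)
  qed simp
  have pairlim: "(\<lambda>n. LINT x|lborel. \<phi> n x * cnj (\<psi> x)) \<longlonglongrightarrow> (LINT x|lborel. g x * cnj (\<psi> x))"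
    if \<psi>: "square_integrable \<psi>" for \<psi>
  proof -
    have "cmod ((LINT x|lborel. g x * cnj (\<psi> x)) - (LINT x|lborel. \<phi> n x * cnj (\<psi> x))) \<le> L2_norm (\<lambda>x. g x - \<phi> n x) * L2_norm \<psi>" for n
    proof -
      have "(LINT x|lborel. g x * cnj (\<psi> x)) - (LINT x|lborel. \<phi> n x * cnj (\<psi> x)) = (LINT x|lborel. (g x - \<phi> n x) * cnj (\<psi> x))"
        unfolding left_diff_distrib
        by (rule Bochner_Integration.integral_diff[symmetric]) (intro L2_Cauchy_Schwarz(1) g sq \<phi> square_integrable_cnj \<psi>)+
      then show ?thesis
        using L2_Cauchy_Schwarz(2)[OF square_integrable_diff[OF g sq[OF \<phi>[of n]]] square_integrable_cnj[OF \<psi>]] by simp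
    qed
    then have "(\<lambda>n. (LINT x|lborel. g x * cnj (\<psi> x)) - (LINT x|lborel. \<phi> n x * cnj (\<psi> x))) \<longlonglongrightarrow> 0"
    proof (rule Lim_null_comparison[OF always_eventually, rule_format])
      show "(\<lambda>n. L2_norm (\<lambda>x. g x - \<phi> n x) * L2_norm \<psi>) \<longlonglongrightarrow> 0"
        using tendsto_mult_right[OF glim, of "L2_norm \<psi>"] by simp
    qed
    from tendsto_diff[OF tendsto_const[of "LINT x|lborel. g x * cnj (\<psi> x)"] this] show ?thesis by simp
  qed
  have Re_eq: "Re (LINT x|lborel. g x * cnj (\<psi> x)) = Re (L \<psi>)" if \<psi>: "\<psi> \<in> W" for \<psi>
  proof -
    define r where "r = Re (LINT x|lborel. g x * cnj (\<psi> x)) - Re (L \<psi>)"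
    \<comment> \<open>First variation of J along \<psi>: each \<open>\<phi> n + t * \<psi>\<close>
      lies in \<open>W\<close>, so J there is at least m; as n grows, the lower order terms cancel
      against m and a nonnegative quadratic in t without constant term is left.\<close>
    have "2 * t * r + t\<^sup>2 * (L2_norm \<psi>)\<^sup>2 \<ge> 0" for t
    proof -
      have J: "J (\<lambda>x. 1 * \<phi> n x + of_real t * \<psi> x) = J (\<phi> n) + 2 * t * (Re (LINT x|lborel. \<phi> n x * cnj (\<psi> x)) - Re (L \<psi>)) + t\<^sup>2 * (L2_norm \<psi>)\<^sup>2" for n
      proof -
        have "(LINT x|lborel. 1 * \<phi> n x * cnj (of_real t * \<psi> x)) = of_real t * (LINT x|lborel. \<phi> n x * cnj (\<psi> x))"
          unfolding integral_mult_right_zero[symmetric] by (simp add: mult.left_commute)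
        moreover have "L2_norm (\<lambda>x. of_real t * \<psi> x) = \<bar>t\<bar> * L2_norm \<psi>" by (simp add: L2_norm_cmult)
        moreover have "L (\<lambda>x. 1 * \<phi> n x + of_real t * \<psi> x) = L (\<phi> n) + of_real t * L \<psi>"
          using lin[OF \<phi>[of n] \<psi>, of 1 "of_real t"] by simp
        ultimately show ?thesis
          using L2_norm_add_square[OF sq[OF \<phi>[of n]] square_integrable_cmult[OF sq[OF \<psi>], of "of_real t"]]
          by (simp add: J_def power_mult_distrib right_diff_distrib)
      qed
      have "m \<le> J (\<phi> n) + 2 * t * (Re (LINT x|lborel. \<phi> n x * cnj (\<psi> x)) - Re (L \<psi>)) + t\<^sup>2 * (L2_norm \<psi>)\<^sup>2" for n
        unfolding J[symmetric] by (rule mle[OF add[OF cmult[OF \<phi>] cmult[OF \<psi>]]])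
      moreover have "(\<lambda>n. J (\<phi> n) + 2 * t * (Re (LINT x|lborel. \<phi> n x * cnj (\<psi> x)) - Re (L \<psi>)) + t\<^sup>2 * (L2_norm \<psi>)\<^sup>2)
          \<longlonglongrightarrow> m + 2 * t * r + t\<^sup>2 * (L2_norm \<psi>)\<^sup>2"
        unfolding r_def by (intro tendsto_intros Jlim pairlim[OF sq[OF \<psi>]])
      ultimately have "m \<le> m + 2 * t * r + t\<^sup>2 * (L2_norm \<psi>)\<^sup>2"
        by (intro LIMSEQ_le_const[of _ "m + 2 * t * r + t\<^sup>2 * (L2_norm \<psi>)\<^sup>2" m] exI[of _ 0] allI impI)
      then show ?thesis by simp
    qed
    then have "r = 0" by (rule quadratic_nonneg_imp_zero) simp
    then show ?thesis by (simp add: r_def)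
  qed
  have rep: "L \<psi> = (LINT x|lborel. cnj (g x) * \<psi> x)" if \<psi>: "\<psi> \<in> W" for \<psi>
  proof -
    let ?I = "LINT x|lborel. g x * cnj (\<psi> x)"
    \<comment> \<open>Replacing \<psi> by \<i> times \<psi> turns the identity of real parts into
      one of imaginary parts.\<close>
    have i\<psi>: "(\<lambda>x. \<i> * \<psi> x) \<in> W" by (rule cmult[OF \<psi>])
    have "L (\<lambda>x. \<i> * \<psi> x) = \<i> * L \<psi>" using lin[OF \<psi> zero, of \<i> 0] by simp
    moreover have "(LINT x|lborel. g x * cnj (\<i> * \<psi> x)) = (- \<i>) * ?I"
      unfolding integral_mult_right_zero[symmetric] by (simp add: mult.left_commute)
    ultimately have "Im ?I = - Im (L \<psi>)" using Re_eq[OF i\<psi>] by simp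
    then have "L \<psi> = cnj ?I" using Re_eq[OF \<psi>] by (simp add: complex_eq_iff)
    also have "\<dots> = (LINT x|lborel. cnj (g x * cnj (\<psi> x)))" by (rule Bochner_Integration.integral_cnj[symmetric])
    finally show ?thesis by simp
  qed
  have "(L2_norm g)\<^sup>2 \<le> M\<^sup>2"
  proof (rule LIMSEQ_le_const)
    have "(\<lambda>n. 4 * (1/8) ^ n + M\<^sup>2) \<longlonglongrightarrow> 0 + M\<^sup>2" by (intro tendsto_add lim8 tendsto_const)
    then show "(\<lambda>n. 4 * (1/8) ^ n + M\<^sup>2) \<longlonglongrightarrow> M\<^sup>2" by simp
    \<comment> \<open>The mixed term of the squared norm of g - \<phi> n is twice the real part of
      \<open>L (\<phi> n)\<close>, so that square is the squared norm of g plus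
      \<open>J (\<phi> n)\<close>, and J is at least - M^2.\<close>
    have "(L2_norm g)\<^sup>2 \<le> 4 * (1/8) ^ n + M\<^sup>2" for n
      using L2_norm_diff_square[OF g sq[OF \<phi>[of n]]] gb[of n] lower[OF \<phi>[of n]] Re_eq[OF \<phi>[of n]]
      unfolding J_def by linarith
    then show "\<exists>N. \<forall>n\<ge>N. (L2_norm g)\<^sup>2 \<le> 4 * (1/8) ^ n + M\<^sup>2" by blast
  qed
  then have "L2_norm g \<le> M" using M by (rule power2_le_imp_le)
  then show ?thesis
    by (intro exI[of _ "\<lambda>x. cnj (g x)"] conjI ballI square_integrable_cnj g rep) simp
qed

section \<open>Square integrable functions are determined by their pairings with test
  functions\<close>

lemma compact_subset_positive:
  fixes A :: "'a::euclidean_space set"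
  assumes A: "A \<in> sets borel" "A \<subseteq> cball 0 R" and pos: "emeasure lborel A > 0"
  obtains C where "compact C" "C \<subseteq> A" "measure lborel C > 0"
proof -
  have fin: "emeasure lborel A < \<infinity>"
    using emeasure_mono[OF A(2), of lborel] emeasure_lborel_cball_finite[of "0::'a" R] by (simp add: le_less_trans)
  define e where "e = measure lborel A"
  have e: "e > 0" "emeasure lborel A = ennreal e"
  proof -
    show e2: "emeasure lborel A = ennreal e"
      unfolding e_def by (rule emeasure_eq_ennreal_measure) (use fin in simp)
    show "e > 0" using pos unfolding e2 by simp
  qed
  \<comment> \<open>Inner regularity from outer regularity: an open set around the complement of A
    in a ball, with excess below the measure e of A, leaves a compact part of A of positive
    measure.\<close>
  define B where "B = cball 0 R - A"
  have B: "B \<in> sets borel" using A(1) by (simp add: B_def)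
  obtain U where U: "open U" "B \<subseteq> U" "emeasure lborel (U - B) < ennreal e"
    using outer_regular_lborel[OF B e(1)] by blast
  define C where "C = cball 0 R - U"
  have C: "compact C" unfolding C_def using U(1) by (intro compact_diff compact_cball)
  have CA: "C \<subseteq> A" using U(2) by (auto simp: C_def B_def)
  have "A \<subseteq> C \<union> (U - B)" using A(2) by (auto simp: C_def B_def)
  then have "emeasure lborel A \<le> emeasure lborel (C \<union> (U - B))"
    using U(1) B C by (intro emeasure_mono) (auto intro: compact_imp_closed borel_closed borel_open)
  also have "\<dots> \<le> emeasure lborel C + emeasure lborel (U - B)"
    using U(1) B C by (intro emeasure_subadditive) (auto intro: compact_imp_closed borel_closed borel_open)
  finally have le: "ennreal e \<le> emeasure lborel C + emeasure lborel (U - B)" by (simp only: e(2))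
  have "measure lborel C \<noteq> 0"
  proof
    assume "measure lborel C = 0"
    then have "emeasure lborel C = 0"
      using emeasure_lborel_cbox_finite emeasure_compact_finite[OF C] by (simp add: emeasure_eq_ennreal_measure less_top)
    then show False using le U(3) by simp
  qed
  then have "measure lborel C > 0" using measure_nonneg[of lborel C] by linarith
  with C CA show ?thesis by (rule that)
qed

text \<open>The indicator of C is the pointwise limit of cutoffs that are 1 on C and supported in
  shrinking neighbourhoods of C.\<close>

lemma integral_compact_zero:
  fixes h :: "real^'n::finite \<Rightarrow> complex"
  assumes h: "square_integrable h" and zero: "\<And>\<phi>. \<phi> \<in> test_functions \<Longrightarrow> (LINT x|lborel. h x * \<phi> x) = 0"
    and C: "compact C"
  shows "(LINT x|lborel. h x * indicator C x) = 0"
proof -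
  define W where "W n = (\<Union>x\<in>C. ball x (inverse (real (Suc n))))" for n
  have W: "open (W n)" "C \<subseteq> W n" for n by (auto simp: W_def)
  have "\<exists>b. (\<lambda>x. complex_of_real (b x)) \<in> test_functions \<and> (\<forall>x\<in>C. b x = 1) \<and> (\<forall>x. 0 \<le> b x \<and> b x \<le> 1) \<and>
    function_support (\<lambda>x. complex_of_real (b x)) \<subseteq> W n" for n
    by (rule cutoff_function[OF C W[of n]]) blast
  then have "\<forall>n. \<exists>b. (\<lambda>x. complex_of_real (b x)) \<in> test_functions \<and> (\<forall>x\<in>C. b x = 1) \<and> (\<forall>x. 0 \<le> b x \<and> b x \<le> 1) \<and>
    function_support (\<lambda>x. complex_of_real (b x)) \<subseteq> W n" by (rule allI)
  from choice[OF this] obtain b where b: "\<And>n. (\<lambda>x. complex_of_real (b n x)) \<in> test_functions" "\<And>n x. x \<in> C \<Longrightarrow> b n x = 1"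
    "\<And>n x. 0 \<le> b n x \<and> b n x \<le> (1::real)" "\<And>n. function_support (\<lambda>x. complex_of_real (b n x)) \<subseteq> W n" by metis
  have Wsub: "W n \<subseteq> W 0" for n
  proof -
    have "inverse (real (Suc n)) \<le> inverse (real (Suc 0))" by (intro le_imp_inverse_le) auto
    then show ?thesis unfolding W_def by (intro UN_mono order_refl subset_ball)
  qed
  have "bounded (W 0)"
  proof -
    obtain R where R: "\<And>x. x \<in> C \<Longrightarrow> norm x \<le> R" using compact_imp_bounded[OF C] bounded_iff by blast
    have "norm y \<le> R + 1" if y: "y \<in> W 0" for y
    proof -
      obtain x where "x \<in> C" "dist x y < 1" using y by (auto simp: W_def)
      then show ?thesis using R[of x] norm_triangle_sub[of y x] by (simp add: dist_norm norm_minus_commute)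
    qed
    then show ?thesis unfolding bounded_iff by blast
  qed
  then have "compact (closure (W 0))" by (simp add: compact_closure)
  \<comment> \<open>h is square integrable but may fail to be integrable; multiplied by one fixed
    test function that is 1 on all the neighbourhoods, it provides the integrable majorant.\<close>
  then obtain d :: "real^'n \<Rightarrow> real" and V where d: "(\<lambda>x. complex_of_real (d x)) \<in> test_functions" "closure (W 0) \<subseteq> V" "\<And>x. x \<in> V \<Longrightarrow> d x = 1"
    by (rule cutoff_function[of "closure (W 0)" UNIV]) auto
  have d1: "d x = 1" if "x \<in> W n" for x n
    using that Wsub[of n] d(2,3) closure_subset[of "W 0"] by blast
  have [measurable]: "h \<in> borel_measurable borel" using h by (simp add: square_integrable_def)
  have [measurable]: "C \<in> sets borel" using C by (intro borel_closed compact_imp_closed)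
  have bm: "(\<lambda>x. complex_of_real (b n x)) \<in> borel_measurable borel" for n
    by (rule schwartz_measurable[OF test_imp_schwartz[OF b(1)]])
  have outside: "b n x = 0" if "x \<notin> W n" for n x
    using outside_function_support[of x "\<lambda>x. complex_of_real (b n x)"] b(4)[of n] that by auto
  have "(\<lambda>n. LINT x|lborel. h x * complex_of_real (b n x)) \<longlonglongrightarrow> (LINT x|lborel. h x * indicator C x)"
  proof (rule integral_dominated_convergence[where w = "\<lambda>x. cmod (h x * complex_of_real (d x))"
        and s = "\<lambda>n x. h x * complex_of_real (b n x)" and f = "\<lambda>x. h x * indicator C x" and M = lborel])
    show "integrable lborel (\<lambda>x. cmod (h x * complex_of_real (d x)))"
      by (intro integrable_norm L2_Cauchy_Schwarz(1) h schwartz_square_integrable test_imp_schwartz d(1))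
    show "(\<lambda>x. h x * complex_of_real (b n x)) \<in> borel_measurable lborel" for n using bm[of n] by simp
    show "(\<lambda>x. h x * indicator C x) \<in> borel_measurable lborel" by simp
    show "AE x in lborel. cmod (h x * complex_of_real (b n x)) \<le> cmod (h x * complex_of_real (d x))" for n
    proof (rule AE_I2)
      fix x
      have "\<bar>b n x\<bar> \<le> \<bar>d x\<bar>"
        using b(3)[of n x] d1[of x n] outside[of x n] by (cases "x \<in> W n") auto
      then show "cmod (h x * complex_of_real (b n x)) \<le> cmod (h x * complex_of_real (d x))"
        by (simp add: norm_mult mult_left_mono)
    qed
    show "AE x in lborel. (\<lambda>n. h x * complex_of_real (b n x)) \<longlonglongrightarrow> h x * indicator C x"
    proof (rule AE_I2)
      fix x
      have "\<forall>\<^sub>F n in sequentially. h x * complex_of_real (b n x) = h x * indicator C x"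
      proof (cases "x \<in> C")
        case True
        then show ?thesis using b(2) by simp
      next
        case False
        obtain e where e: "e > 0" "\<And>y. y \<in> C \<Longrightarrow> e \<le> dist x y"
          using separate_point_closed[OF compact_imp_closed[OF C] False] by blast
        obtain N where N: "inverse (real (Suc N)) < e" using reals_Archimedean[OF e(1)] by blast
        have "x \<notin> W n" if "n \<ge> N" for n
        proof
          assume "x \<in> W n"
          then obtain y where y: "y \<in> C" "dist y x < inverse (real (Suc n))" by (auto simp: W_def)
          have "inverse (real (Suc n)) \<le> inverse (real (Suc N))" using that by (intro le_imp_inverse_le) auto
          moreover have "dist x y < inverse (real (Suc n))" using y(2) by (simp only: dist_commute)
          ultimately show False using e(2)[OF y(1)] N by linarith
        qed
        then have "\<forall>n\<ge>N. h x * complex_of_real (b n x) = h x * indicator C x"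
          using False outside by simp
        then show ?thesis unfolding eventually_sequentially by blast
      qed
      then show "(\<lambda>n. h x * complex_of_real (b n x)) \<longlonglongrightarrow> h x * indicator C x"
        by (rule tendsto_eventually)
    qed
  qed
  then have "(\<lambda>n. 0) \<longlonglongrightarrow> (LINT x|lborel. h x * indicator C x)" by (simp only: zero[OF b(1)])
  then show ?thesis by (rule LIMSEQ_unique[OF _ tendsto_const])
qed

text \<open>Otherwise the real part of c h exceeds some 1/(k+1) on a bounded set of positive
  measure, and the integral of c h over a compact part of that set would be positive instead of 0.
  The factor c lets one argument treat both signs of the real and of the imaginary part.\<close>

lemma AE_Re_nonpos:
  fixes h :: "real^'n::finite \<Rightarrow> complex"
  assumes h: "square_integrable h" and zero: "\<And>\<phi>. \<phi> \<in> test_functions \<Longrightarrow> (LINT x|lborel. h x * \<phi> x) = 0"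
  shows "AE x in lborel. Re (c * h x) \<le> 0"
proof -
  have [measurable]: "h \<in> borel_measurable borel" using h by (simp add: square_integrable_def)
  define A where "A k = {x \<in> cball 0 (real k). Re (c * h x) > inverse (real (Suc k))}" for k
  have [measurable]: "A k \<in> sets borel" for k unfolding A_def by measurable
  have null: "A k \<in> null_sets lborel" for k
  proof (rule ccontr)
    assume "A k \<notin> null_sets lborel"
    then have "emeasure lborel (A k) > 0" by (simp add: null_sets_def zero_less_iff_neq_zero)
    moreover have "A k \<subseteq> cball 0 (real k)" by (auto simp: A_def)
    ultimately obtain C where C: "compact C" "C \<subseteq> A k" "measure lborel C > 0"
      using compact_subset_positive[of "A k" "real k"] by auto
    have Cm [measurable]: "C \<in> sets borel" using C(1) by (intro borel_closed compact_imp_closed)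
    have fin: "emeasure lborel C < \<infinity>" using emeasure_compact_finite[OF C(1)] by simp
    have "square_integrable (\<lambda>x. indicator C x :: complex)"
    proof -
      have "(\<lambda>x. (cmod (indicator C x))\<^sup>2) = (indicator C :: _ \<Rightarrow> real)" by (auto simp: indicator_def)
      then show ?thesis using fin Cm by (simp add: square_integrable_def)
    qed
    then have int: "integrable lborel (\<lambda>x. h x * indicator C x)" by (rule L2_Cauchy_Schwarz(1)[OF h])
    have int2: "integrable lborel (\<lambda>x. c * (h x * indicator C x))" by (intro integrable_mult_right int)
    have "inverse (real (Suc k)) * measure lborel C = (LINT x|lborel. inverse (real (Suc k)) * indicator C x)"
      by simp
    also have "\<dots> \<le> (LINT x|lborel. Re (c * (h x * indicator C x)))"
    proof (rule integral_mono)
      show "integrable lborel (\<lambda>x. inverse (real (Suc k)) * indicator C x)" using fin by simp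
      show "integrable lborel (\<lambda>x. Re (c * (h x * indicator C x)))" by (rule integrable_Re[OF int2])
      fix x
      show "inverse (real (Suc k)) * indicator C x \<le> Re (c * (h x * indicator C x))"
      proof (cases "x \<in> C")
        case True
        then have "inverse (real (Suc k)) < Re (c * h x)" using C(2) by (auto simp: A_def)
        then show ?thesis using True by simp
      qed simp
    qed
    also have "\<dots> = Re (LINT x|lborel. c * (h x * indicator C x))" by (rule integral_Re[OF int2])
    also have "\<dots> = 0" by (simp only: integral_mult_right_zero integral_compact_zero[OF h zero C(1)]) simp
    finally have "inverse (real (Suc k)) * measure lborel C \<le> 0" .
    moreover have "inverse (real (Suc k)) * measure lborel C > 0" using C(3) by simp
    ultimately show False by linarith
  qed
  have "AE x in lborel. \<forall>k. x \<notin> A k"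
    unfolding AE_all_countable using AE_not_in[OF null] by blast
  then show ?thesis
  proof (rule AE_mp, intro AE_I2 impI)
    fix x assume x: "\<forall>k. x \<notin> A k"
    show "Re (c * h x) \<le> 0"
    proof (rule ccontr)
      assume "\<not> Re (c * h x) \<le> 0"
      then obtain N where N: "inverse (real (Suc N)) < Re (c * h x)" using reals_Archimedean[of "Re (c * h x)"] by auto
      obtain M where M: "norm x \<le> real M" using real_arch_simple by blast
      define k where "k = max N M"
      have "inverse (real (Suc k)) \<le> inverse (real (Suc N))" by (intro le_imp_inverse_le) (auto simp: k_def)
      then have "inverse (real (Suc k)) < Re (c * h x)" using N by (rule le_less_trans)
      moreover have "norm x \<le> real k" using M by (simp add: k_def)
      ultimately have "x \<in> A k" unfolding A_def by simp
      then show False using x by blast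
    qed
  qed
qed

lemma AE_zero_of_test_functions:
  fixes h :: "real^'n::finite \<Rightarrow> complex"
  assumes "square_integrable h" "\<And>\<phi>. \<phi> \<in> test_functions \<Longrightarrow> (LINT x|lborel. h x * \<phi> x) = 0"
  shows "AE x in lborel. h x = 0"
proof -
  have *: "AE x in lborel. Re (c * h x) \<le> 0" for c
    by (rule AE_Re_nonpos[OF assms(1)]) (rule assms(2))
  from *[of 1] *[of "- 1"] *[of \<i>] *[of "- \<i>"] show ?thesis
    by eventually_elim (simp add: complex_eq_iff)
qed

text \<open>The pairing with f is represented once more by the Riesz theorem, now by some g of norm
  at most M; f and g agree almost everywhere because their pairings with test functions coincide.
  This takes the place of density of the Schwartz functions in L2.\<close>

lemma L2_norm_le_dual:
  fixes f :: "real^'n::finite \<Rightarrow> complex"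
  assumes f: "square_integrable f" and M: "M \<ge> 0"
    and bound: "\<And>\<phi>. \<phi> \<in> schwartz_functions \<Longrightarrow> cmod (LINT x|lborel. f x * \<phi> x) \<le> M * L2_norm \<phi>"
  shows "L2_norm f \<le> M"
proof -
  have int: "integrable lborel (\<lambda>x. f x * \<phi> x)" if "\<phi> \<in> schwartz_functions" for \<phi>
    by (rule L2_Cauchy_Schwarz(1)[OF f schwartz_square_integrable[OF that]])
  have lin: "(LINT x|lborel. f x * (a * \<phi> x + c * \<psi> x)) = a * (LINT x|lborel. f x * \<phi> x) + c * (LINT x|lborel. f x * \<psi> x)"
    if "\<phi> \<in> schwartz_functions" "\<psi> \<in> schwartz_functions" for \<phi> \<psi> a c
  proof -
    have "(LINT x|lborel. f x * (a * \<phi> x + c * \<psi> x)) = (LINT x|lborel. a * (f x * \<phi> x) + c * (f x * \<psi> x))"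
      by (simp only: distrib_left mult.left_commute)
    also have "\<dots> = (LINT x|lborel. a * (f x * \<phi> x)) + (LINT x|lborel. c * (f x * \<psi> x))"
      by (rule Bochner_Integration.integral_add) (intro integrable_mult_right int that)+
    finally show ?thesis by (simp only: integral_mult_right_zero)
  qed
  obtain g where g: "square_integrable g" "L2_norm g \<le> M"
    "\<And>\<phi>. \<phi> \<in> schwartz_functions \<Longrightarrow> (LINT x|lborel. f x * \<phi> x) = (LINT x|lborel. g x * \<phi> x)"
    using L2_riesz[of schwartz_functions "\<lambda>\<phi>. LINT x|lborel. f x * \<phi> x" M,
        OF schwartz_square_integrable schwartz_zero schwartz_add schwartz_cmult lin bound M] by blast
  have "(LINT x|lborel. (f x - g x) * \<phi> x) = 0" if "\<phi> \<in> test_functions" for \<phi>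
  proof -
    note \<phi> = test_imp_schwartz[OF that]
    have "(LINT x|lborel. (f x - g x) * \<phi> x) = (LINT x|lborel. f x * \<phi> x) - (LINT x|lborel. g x * \<phi> x)"
      unfolding left_diff_distrib
      by (rule Bochner_Integration.integral_diff[OF int[OF \<phi>] L2_Cauchy_Schwarz(1)[OF g(1) schwartz_square_integrable[OF \<phi>]]])
    then show ?thesis by (simp only: g(3)[OF \<phi>] diff_self)
  qed
  then have "AE x in lborel. f x - g x = 0"
    by (rule AE_zero_of_test_functions[OF square_integrable_diff[OF f g(1)]])
  then have "AE x in lborel. (cmod (f x))\<^sup>2 = (cmod (g x))\<^sup>2" by eventually_elim simp
  then have "(LINT x|lborel. (cmod (f x))\<^sup>2) = (LINT x|lborel. (cmod (g x))\<^sup>2)"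
    using f g(1) by (intro integral_cong_AE) (auto simp: square_integrable_def)
  then show ?thesis using g(2) by (simp only: L2_norm_def)
qed

section \<open>Sobolev spaces by duality\<close>

text \<open>The transpose of the multiplier, acting on the functions rather than on the functional.
  Its symbol is w(- \<xi>), so for even w it is the multiplier itself.\<close>

definition symbol_mult :: "(real^'n::finite \<Rightarrow> real) \<Rightarrow> (real^'n \<Rightarrow> complex) \<Rightarrow> real^'n \<Rightarrow> complex" where
  "symbol_mult w \<phi> = fourier (\<lambda>\<xi>. of_real (w \<xi>) * inverse_fourier \<phi> \<xi>)"

lemma fourier_multiplier_eq: "fourier_multiplier w T \<phi> = T (symbol_mult w \<phi>)"
  by (simp add: fourier_multiplier_def inverse_fourier_distr_def mult_distr_def fourier_distr_def symbol_mult_def)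

lemma schwartz_weighted:
  "admissible w \<Longrightarrow> f \<in> schwartz_functions \<Longrightarrow> (\<lambda>\<xi>. of_real (w \<xi>) * f \<xi>) \<in> schwartz_functions"
  using schwartz_mult_slow[OF _ admissibleD(3)] by (simp only: mult.commute)

lemma schwartz_symbol_mult:
  "admissible w \<Longrightarrow> \<phi> \<in> schwartz_functions \<Longrightarrow> symbol_mult w \<phi> \<in> schwartz_functions"
  unfolding symbol_mult_def by (intro schwartz_fourier schwartz_weighted schwartz_inverse_fourier)

lemma symbol_mult_inverse:
  fixes \<phi> :: "real^'n::finite \<Rightarrow> complex"
  assumes w: "admissible w" and \<phi>: "\<phi> \<in> schwartz_functions"
  shows "symbol_mult w (symbol_mult (\<lambda>\<xi>. inverse (w \<xi>)) \<phi>) = \<phi>"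
    "symbol_mult (\<lambda>\<xi>. inverse (w \<xi>)) (symbol_mult w \<phi>) = \<phi>"
proof -
  note w' = admissible_inverse[OF w]
  have inv: "inverse_fourier (symbol_mult v \<phi>) = (\<lambda>\<xi>. of_real (v \<xi>) * inverse_fourier \<phi> \<xi>)" if "admissible v" for v
    unfolding symbol_mult_def
    by (rule inverse_fourier_fourier[OF schwartz_weighted[OF that schwartz_inverse_fourier[OF \<phi>]]])
  have nz: "w \<xi> \<noteq> 0" for \<xi> using admissibleD(1)[OF w, of \<xi>] by simp
  have "symbol_mult w (symbol_mult (\<lambda>\<xi>. inverse (w \<xi>)) \<phi>) = fourier (inverse_fourier \<phi>)"
    unfolding symbol_mult_def[of w] inv[OF w'] by (simp add: nz mult.assoc[symmetric])
  then show "symbol_mult w (symbol_mult (\<lambda>\<xi>. inverse (w \<xi>)) \<phi>) = \<phi>" by (simp only: fourier_inverse_fourier[OF \<phi>])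
  have "symbol_mult (\<lambda>\<xi>. inverse (w \<xi>)) (symbol_mult w \<phi>) = fourier (inverse_fourier \<phi>)"
    unfolding symbol_mult_def[of "\<lambda>\<xi>. inverse (w \<xi>)"] inv[OF w] by (simp add: nz mult.assoc[symmetric])
  then show "symbol_mult (\<lambda>\<xi>. inverse (w \<xi>)) (symbol_mult w \<phi>) = \<phi>" by (simp only: fourier_inverse_fourier[OF \<phi>])
qed

lemma symbol_mult_linear:
  assumes w: "admissible w" and \<phi>: "\<phi> \<in> schwartz_functions" and \<psi>: "\<psi> \<in> schwartz_functions"
  shows "symbol_mult w (\<lambda>x. a * \<phi> x + c * \<psi> x) \<xi> = a * symbol_mult w \<phi> \<xi> + c * symbol_mult w \<psi> \<xi>"
proof -
  have lin: "fourier (\<lambda>x. a * f x + c * g x) \<eta> = a * fourier f \<eta> + c * fourier g \<eta>"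
    if "f \<in> schwartz_functions" "g \<in> schwartz_functions" for f g \<eta>
    using fourier_add[OF schwartz_integrable[OF schwartz_cmult[OF that(1)]] schwartz_integrable[OF schwartz_cmult[OF that(2)]], of a c \<eta>]
    by (simp only: fourier_cmult)
  have "(\<lambda>\<eta>. of_real (w \<eta>) * inverse_fourier (\<lambda>x. a * \<phi> x + c * \<psi> x) \<eta>) =
    (\<lambda>\<eta>. a * (of_real (w \<eta>) * inverse_fourier \<phi> \<eta>) + c * (of_real (w \<eta>) * inverse_fourier \<psi> \<eta>))"
    unfolding inverse_fourier_eq lin[OF \<phi> \<psi>] by (simp add: distrib_left add_divide_distrib mult_ac)
  then show ?thesis
    unfolding symbol_mult_def
    by (simp only: lin[OF schwartz_weighted[OF w schwartz_inverse_fourier[OF \<phi>]] schwartz_weighted[OF w schwartz_inverse_fourier[OF \<psi>]]])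
qed

text \<open>For squared norms the inverse transform contributes (2 pi)^(-2n) and Plancherel's
  theorem (2 pi)^n, which leaves the stated root.\<close>

lemma L2_norm_symbol_mult:
  fixes \<phi> :: "real^'n::finite \<Rightarrow> complex"
  assumes w: "admissible w" and \<phi>: "\<phi> \<in> schwartz_functions"
  shows "L2_norm (symbol_mult w \<phi>) = sqrt (1 / (2 * pi) ^ CARD('n)) * wnorm w \<phi>"
proof -
  define p where "p = (2 * pi) ^ CARD('n)"
  have p: "p > 0" by (simp add: p_def)
  define g where "g \<xi> = of_real (w \<xi>) * inverse_fourier \<phi> \<xi>" for \<xi>
  have g: "g \<in> schwartz_functions" unfolding g_def by (rule schwartz_weighted[OF w schwartz_inverse_fourier[OF \<phi>]])
  let ?W = "\<lambda>\<xi>. of_real (w \<xi>) * fourier \<phi> \<xi>"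
  have W: "?W \<in> schwartz_functions" by (rule schwartz_weighted_fourier[OF w \<phi>])
  have Wm: "(\<lambda>\<xi>. (cmod (?W \<xi>))\<^sup>2) \<in> borel_measurable borel"
    by (rule borel_measurable_power, rule measurable_compose[OF schwartz_measurable[OF W] borel_measurable_norm])
  have gW: "(cmod (g \<xi>))\<^sup>2 = (1 / p)\<^sup>2 * (cmod (?W (0 - \<xi>)))\<^sup>2" for \<xi>
    unfolding g_def inverse_fourier_eq p_def[symmetric]
    using p by (simp add: norm_mult norm_divide power_mult_distrib power_divide admissibleD(2)[OF w])
  have "(LINT \<xi>|lborel. (cmod (g \<xi>))\<^sup>2) = (1 / p)\<^sup>2 * (LINT \<xi>|lborel. (cmod (?W \<xi>))\<^sup>2)"
    unfolding gW integral_mult_right_zero by (simp only: lborel_integral_reflect[OF Wm])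
  moreover have "(LINT \<xi>|lborel. (cmod (g \<xi>))\<^sup>2) = 1 / p * (LINT x|lborel. (cmod (fourier g x))\<^sup>2)"
    unfolding p_def by (rule plancherel[OF g])
  ultimately have "(LINT x|lborel. (cmod (fourier g x))\<^sup>2) = 1 / p * (LINT \<xi>|lborel. (cmod (?W \<xi>))\<^sup>2)"
    using p by (simp add: power2_eq_square field_simps)
  moreover have "symbol_mult w \<phi> = fourier g" by (simp only: symbol_mult_def g_def[abs_def])
  ultimately show ?thesis
    unfolding L2_norm_def wnorm_def p_def[symmetric] by (simp only: real_sqrt_mult)
qed

section \<open>The weighted norms as continuous seminorms, and the dual norm\<close>

lemma L2_norm_triangle:
  assumes f: "square_integrable f" and g: "square_integrable g"
  shows "L2_norm (\<lambda>x. f x + g x) \<le> L2_norm f + L2_norm g"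
proof -
  have "Re (LINT x|lborel. f x * cnj (g x)) \<le> L2_norm f * L2_norm g"
    using complex_Re_le_cmod[of "LINT x|lborel. f x * cnj (g x)"] L2_Cauchy_Schwarz(2)[OF f square_integrable_cnj[OF g]]
    unfolding L2_norm_cnj by linarith
  then have "(L2_norm (\<lambda>x. f x + g x))\<^sup>2 \<le> (L2_norm f + L2_norm g)\<^sup>2"
    unfolding L2_norm_add_square[OF f g] power2_sum by simp
  then show ?thesis by (rule power2_le_imp_le) simp
qed

lemma wnorm_triangle:
  assumes w: "admissible w" and f: "f \<in> schwartz_functions" and g: "g \<in> schwartz_functions"
  shows "wnorm w (\<lambda>x. f x + g x) \<le> wnorm w f + wnorm w g"
  unfolding wnorm_def fourier_add[OF schwartz_integrable[OF f] schwartz_integrable[OF g]] distrib_left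
  by (intro L2_norm_triangle schwartz_square_integrable schwartz_weighted_fourier w f g)

text \<open>Makes every functional that is bounded by such a norm tempered. Of the decay of the
  transform, N powers compensate the growth of w, and n + 2 powers are left for the
  integral.\<close>

lemma wnorm_seminorm:
  fixes w :: "real^'n::finite \<Rightarrow> real"
  assumes w: "admissible w"
  obtains C k m where "C \<ge> 0" "\<And>f. f \<in> schwartz_functions \<Longrightarrow> wnorm w f \<le> C * schwartz_seminorm k m f"
proof -
  let ?p = "CARD('n) + 2"
  obtain A N where A: "\<And>\<xi>. cmod (of_real (w \<xi>)) \<le> A * (1 + norm \<xi>) ^ N"
    using smooth_withD(2)[OF admissibleD(3)[OF w]] unfolding slow_def by blast
  have A0: "A \<ge> 0" using order_trans[OF norm_ge_zero A[of 0]] by simp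
  obtain C where C: "C \<ge> 0" "\<And>f \<xi>. f \<in> (schwartz_functions :: (real^'n \<Rightarrow> complex) set) \<Longrightarrow>
    (1 + norm \<xi>) ^ (N + ?p) * cmod (fourier f \<xi>) \<le> C * schwartz_seminorm ?p (N + ?p) f"
    using fourier_decay_seminorm by blast
  define I where "I = (LINT x|lborel. inverse ((1 + norm (x::real^'n)) ^ ?p))"
  have I: "I \<ge> 0" unfolding I_def by (rule Bochner_Integration.integral_nonneg) simp
  have "wnorm w f \<le> (A * C * sqrt I) * schwartz_seminorm ?p (N + ?p) f" if f: "f \<in> schwartz_functions" for f
  proof -
    define s where "s = schwartz_seminorm ?p (N + ?p) f"
    have s: "s \<ge> 0" unfolding s_def by (rule schwartz_seminorm_nonneg[OF f])
    let ?W = "\<lambda>\<xi>. of_real (w \<xi>) * fourier f \<xi>"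
    have W: "?W \<in> schwartz_functions" by (rule schwartz_weighted_fourier[OF w f])
    have pt: "(1 + norm \<xi>) ^ ?p * cmod (?W \<xi>) \<le> A * C * s" for \<xi>
    proof -
      have "(1 + norm \<xi>) ^ ?p * cmod (?W \<xi>) \<le> (1 + norm \<xi>) ^ ?p * (A * (1 + norm \<xi>) ^ N * cmod (fourier f \<xi>))"
        unfolding norm_mult by (intro mult_left_mono mult_right_mono A) auto
      also have "\<dots> = A * ((1 + norm \<xi>) ^ (N + ?p) * cmod (fourier f \<xi>))" by (simp only: power_add mult_ac)
      also have "\<dots> \<le> A * (C * s)" unfolding s_def by (intro mult_left_mono C(2) f A0)
      finally show ?thesis by (simp only: mult.assoc)
    qed
    have "(LINT \<xi>|lborel. norm ((cmod (?W \<xi>))\<^sup>2)) \<le> (A * C * s)\<^sup>2 * I"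
      unfolding I_def
    proof (rule integrable_of_decay(2))
      show "(\<lambda>\<xi>. (cmod (?W \<xi>))\<^sup>2) \<in> borel_measurable lborel" using schwartz_measurable[OF W] by simp
      fix \<xi> :: "real^'n"
      have 1: "1 \<le> (1 + norm \<xi>) ^ ?p" by (rule one_le_power) simp
      have "(1 + norm \<xi>) ^ ?p * (cmod (?W \<xi>))\<^sup>2 \<le> (1 + norm \<xi>) ^ ?p * ((1 + norm \<xi>) ^ ?p * (cmod (?W \<xi>))\<^sup>2)"
        using mult_right_mono[OF 1, of "(1 + norm \<xi>) ^ ?p * (cmod (?W \<xi>))\<^sup>2"] by simp
      also have "\<dots> = ((1 + norm \<xi>) ^ ?p * cmod (?W \<xi>))\<^sup>2" by (simp only: power2_eq_square mult_ac)
      also have "\<dots> \<le> (A * C * s)\<^sup>2" by (rule power_mono[OF pt]) simp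
      finally show "(1 + norm \<xi>) ^ ?p * norm ((cmod (?W \<xi>))\<^sup>2) \<le> (A * C * s)\<^sup>2" by simp
    qed
    then have "(wnorm w f)\<^sup>2 \<le> (A * C * s)\<^sup>2 * I" unfolding wnorm_def L2_norm_square by simp
    also have "\<dots> = (A * C * sqrt I * s)\<^sup>2" using I by (simp add: power_mult_distrib)
    finally show ?thesis unfolding s_def[symmetric]
      by (rule power2_le_imp_le) (intro mult_nonneg_nonneg A0 C(1) s real_sqrt_ge_zero I)
  qed
  moreover have "A * C * sqrt I \<ge> 0" using A0 C(1) I by simp
  ultimately show ?thesis using that by blast
qed

text \<open>The Sobolev norm of order -s. It is formed with \<open>symbol_mult\<close> rather than
  \<open>wnorm\<close> so that the duality bound holds with constant 1 and no power of 2 pi appears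
  in it.\<close>

definition dual_norm :: "('n::finite \<Rightarrow> 'j::finite) \<Rightarrow> real^'j \<Rightarrow> (real^'n \<Rightarrow> complex) \<Rightarrow> real" where
  "dual_norm blk s \<psi> = L2_norm (symbol_mult (\<lambda>\<xi>. inverse (weight blk s \<xi>)) \<psi>)"

context
  fixes blk :: "'n::finite \<Rightarrow> 'j::finite" and s :: "real^'j"
begin

abbreviation dual_weight :: "real^'n \<Rightarrow> real" where
  "dual_weight \<equiv> (\<lambda>\<xi>. inverse (weight blk s \<xi>))"

lemma admissible_dual_weight: "admissible dual_weight"
  by (rule admissible_inverse[OF admissible_weight])

lemma dual_norm_nonneg [simp]: "dual_norm blk s \<psi> \<ge> 0"
  by (simp add: dual_norm_def)

lemma dual_norm_eq:
  "\<psi> \<in> schwartz_functions \<Longrightarrow> dual_norm blk s \<psi> = sqrt (1 / (2 * pi) ^ CARD('n)) * wnorm dual_weight \<psi>"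
  unfolding dual_norm_def by (rule L2_norm_symbol_mult[OF admissible_dual_weight])

lemma dual_norm_triangle:
  assumes f: "f \<in> schwartz_functions" and g: "g \<in> schwartz_functions"
  shows "dual_norm blk s (\<lambda>x. f x + g x) \<le> dual_norm blk s f + dual_norm blk s g"
  unfolding dual_norm_eq[OF f] dual_norm_eq[OF g] dual_norm_eq[OF schwartz_add[OF f g]] distrib_left[symmetric]
  by (intro mult_left_mono wnorm_triangle admissible_dual_weight f g) simp

lemma dual_norm_cmult:
  assumes f: "f \<in> schwartz_functions"
  shows "dual_norm blk s (\<lambda>x. c * f x) = cmod c * dual_norm blk s f"
  unfolding dual_norm_eq[OF f] dual_norm_eq[OF schwartz_cmult[OF f]] wnorm_cmult by simp

lemma dual_norm_seminorm:
  obtains C k m where "C \<ge> 0" "\<And>f. f \<in> schwartz_functions \<Longrightarrow> dual_norm blk s f \<le> C * schwartz_seminorm k m f"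
proof -
  obtain C k m where C: "C \<ge> 0" "\<And>f. f \<in> schwartz_functions \<Longrightarrow> wnorm dual_weight f \<le> C * schwartz_seminorm k m f"
    using wnorm_seminorm[OF admissible_dual_weight] by blast
  have "dual_norm blk s f \<le> (sqrt (1 / (2 * pi) ^ CARD('n)) * C) * schwartz_seminorm k m f" if "f \<in> schwartz_functions" for f
    unfolding dual_norm_eq[OF that] mult.assoc by (intro mult_left_mono C(2) that) simp
  moreover have "sqrt (1 / (2 * pi) ^ CARD('n)) * C \<ge> 0" using C(1) by simp
  ultimately show ?thesis using that by blast
qed

section \<open>Sobolev membership and norm characterised by bounds on test functions\<close>

lemma bessel_image_pairing:
  assumes "square_integrable f" "\<forall>\<phi>\<in>schwartz_functions. fourier_multiplier (weight blk s) T \<phi> = (LINT x|lborel. f x * \<phi> x)"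
    and \<psi>: "\<psi> \<in> schwartz_functions"
  shows "T \<psi> = (LINT x|lborel. f x * symbol_mult dual_weight \<psi> x)"
  using assms(2)[rule_format, OF schwartz_symbol_mult[OF admissible_dual_weight \<psi>]]
  unfolding fourier_multiplier_eq symbol_mult_inverse(1)[OF admissible_weight \<psi>] .

lemma bessel_image_bound:
  assumes "bessel_image blk s u f" "\<psi> \<in> test_functions"
  shows "cmod (u \<psi>) \<le> L2_norm f * dual_norm blk s \<psi>"
proof -
  note \<psi> = test_imp_schwartz[OF assms(2)]
  obtain T where f: "square_integrable f" and T: "\<forall>\<phi>\<in>test_functions. T \<phi> = u \<phi>"
    "\<forall>\<phi>\<in>schwartz_functions. fourier_multiplier (weight blk s) T \<phi> = (LINT x|lborel. f x * \<phi> x)"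
    using assms(1) unfolding bessel_image_def by blast
  have "u \<psi> = (LINT x|lborel. f x * symbol_mult dual_weight \<psi> x)"
    using bessel_image_pairing[OF f T(2) \<psi>] T(1) assms(2) by simp
  then show ?thesis
    using L2_Cauchy_Schwarz(2)[OF f schwartz_square_integrable[OF schwartz_symbol_mult[OF admissible_dual_weight \<psi>]]]
    by (simp only: dual_norm_def)
qed

text \<open>The bound is given on test functions, while \<open>L2_norm_le_dual\<close> tests with
  Schwartz functions. Dilated cutoffs bridge the gap, because both the tempered T and the dual norm
  are continuous for the Schwartz seminorms. Afterwards every \<phi> is reached as the image of its
  own \<open>symbol_mult\<close> under the inverse symbol.\<close>

lemma bessel_image_norm_le:
  assumes u: "bessel_image blk s u f" and M: "M \<ge> 0"
    and bound: "\<And>\<psi>. \<psi> \<in> test_functions \<Longrightarrow> cmod (u \<psi>) \<le> M * dual_norm blk s \<psi>"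
  shows "L2_norm f \<le> M"
proof -
  obtain T where f: "square_integrable f" and Tt: "T \<in> tempered_distributions" and T: "\<And>\<phi>. \<phi> \<in> test_functions \<Longrightarrow> T \<phi> = u \<phi>"
    "\<And>\<phi>. \<phi> \<in> schwartz_functions \<Longrightarrow> fourier_multiplier (weight blk s) T \<phi> = (LINT x|lborel. f x * \<phi> x)"
    using u unfolding bessel_image_def by blast
  obtain C k m where C: "C \<ge> 0" "\<And>f. f \<in> schwartz_functions \<Longrightarrow> dual_norm blk s f \<le> C * schwartz_seminorm k m f"
    using dual_norm_seminorm by blast
  have TS: "cmod (T \<psi>) \<le> M * dual_norm blk s \<psi>" if \<psi>: "\<psi> \<in> schwartz_functions" for \<psi>
  proof -
    obtain b where b: "\<And>N. b N \<in> test_functions"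
      "\<And>k m. (\<lambda>N. schwartz_seminorm k m (\<lambda>x. \<psi> x - b N x * \<psi> x)) \<longlonglongrightarrow> 0"
      using test_functions_dense[OF \<psi>] by blast
    have bt: "(\<lambda>x. b N x * \<psi> x) \<in> test_functions" for N
      by (rule test_mult_smooth[OF b(1) schwartz_imp_smooth[OF \<psi>]])
    note bS = test_imp_schwartz[OF bt]
    have lim: "(\<lambda>N. T (\<lambda>x. b N x * \<psi> x)) \<longlonglongrightarrow> T \<psi>"
      by (rule tempered_tendsto[OF Tt \<psi> bS b(2)])
    have le: "cmod (T (\<lambda>x. b N x * \<psi> x)) \<le> M * (dual_norm blk s \<psi> + C * schwartz_seminorm k m (\<lambda>x. \<psi> x - b N x * \<psi> x))" for N
    proof -
      have d: "(\<lambda>x. - 1 * (\<psi> x - b N x * \<psi> x)) \<in> schwartz_functions"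
        by (intro schwartz_cmult schwartz_diff \<psi> bS)
      have "dual_norm blk s (\<lambda>x. b N x * \<psi> x) \<le> dual_norm blk s \<psi> + dual_norm blk s (\<lambda>x. - 1 * (\<psi> x - b N x * \<psi> x))"
        using dual_norm_triangle[OF \<psi> d] by simp
      also have "dual_norm blk s (\<lambda>x. - 1 * (\<psi> x - b N x * \<psi> x)) = dual_norm blk s (\<lambda>x. \<psi> x - b N x * \<psi> x)"
        unfolding dual_norm_cmult[OF schwartz_diff[OF \<psi> bS]] by simp
      also have "\<dots> \<le> C * schwartz_seminorm k m (\<lambda>x. \<psi> x - b N x * \<psi> x)"
        by (intro C(2) schwartz_diff \<psi> bS)
      finally have "dual_norm blk s (\<lambda>x. b N x * \<psi> x) \<le> dual_norm blk s \<psi> + C * schwartz_seminorm k m (\<lambda>x. \<psi> x - b N x * \<psi> x)"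
        by simp
      then have "M * dual_norm blk s (\<lambda>x. b N x * \<psi> x) \<le>
        M * (dual_norm blk s \<psi> + C * schwartz_seminorm k m (\<lambda>x. \<psi> x - b N x * \<psi> x))"
        by (rule mult_left_mono[OF _ M])
      then show ?thesis using bound[OF bt, of N] unfolding T(1)[OF bt] by (rule order_trans[rotated])
    qed
    have "(\<lambda>N. M * (dual_norm blk s \<psi> + C * schwartz_seminorm k m (\<lambda>x. \<psi> x - b N x * \<psi> x)))
      \<longlonglongrightarrow> M * (dual_norm blk s \<psi> + C * 0)"
      by (intro tendsto_mult_left tendsto_add tendsto_const b(2))
    then have "cmod (T \<psi>) \<le> M * (dual_norm blk s \<psi> + C * 0)"
      by (rule LIMSEQ_le[OF tendsto_norm[OF lim]]) (use le in blast)
    then show ?thesis by simp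
  qed
  show ?thesis
  proof (rule L2_norm_le_dual[OF f M])
    fix \<phi> :: "real^'n \<Rightarrow> complex" assume \<phi>: "\<phi> \<in> schwartz_functions"
    define \<psi> where "\<psi> = symbol_mult (weight blk s) \<phi>"
    have \<psi>: "\<psi> \<in> schwartz_functions" unfolding \<psi>_def by (rule schwartz_symbol_mult[OF admissible_weight \<phi>])
    have "(LINT x|lborel. f x * \<phi> x) = T \<psi>"
      using T(2)[OF \<phi>] by (simp only: fourier_multiplier_eq \<psi>_def)
    moreover have "L2_norm \<phi> = dual_norm blk s \<psi>"
      unfolding dual_norm_def \<psi>_def symbol_mult_inverse(2)[OF admissible_weight \<phi>] ..
    ultimately show "cmod (LINT x|lborel. f x * \<phi> x) \<le> M * L2_norm \<phi>"
      using TS[OF \<psi>] by (simp only: mult_ac)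
  qed
qed

text \<open>\<open>u\<close> is meaningful on test functions only, so it is pulled back to the space
  \<open>W\<close> of those \<phi> which the symbol maps to test functions; there the dual norm
  becomes the plain L2 norm and the Riesz theorem produces f. The tempered extension T is defined
  from f, not from u, and agrees with u because every test function is the image of an element of
  \<open>W\<close>.\<close>

lemma bessel_image_exists:
  assumes lin: "complex_linear_on test_functions u" and M: "M \<ge> 0"
    and bound: "\<And>\<psi>. \<psi> \<in> test_functions \<Longrightarrow> cmod (u \<psi>) \<le> M * dual_norm blk s \<psi>"
  shows "\<exists>f. bessel_image blk s u f"
proof -
  note w' = admissible_dual_weight and w = admissible_weight[of blk s]
  define W where "W = {\<phi> \<in> schwartz_functions. symbol_mult (weight blk s) \<phi> \<in> test_functions}"
  have WS: "\<phi> \<in> schwartz_functions" and Wt: "symbol_mult (weight blk s) \<phi> \<in> test_functions" if "\<phi> \<in> W" for \<phi>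
    using that by (auto simp: W_def)
  have mlin: "symbol_mult (weight blk s) (\<lambda>x. a * \<phi> x + c * \<psi> x) =
      (\<lambda>x. a * symbol_mult (weight blk s) \<phi> x + c * symbol_mult (weight blk s) \<psi> x)"
    if "\<phi> \<in> schwartz_functions" "\<psi> \<in> schwartz_functions" for \<phi> \<psi> a c
    by (rule ext) (rule symbol_mult_linear[OF w that])
  have Wlin: "(\<lambda>x. a * \<phi> x + c * \<psi> x) \<in> W" if "\<phi> \<in> W" "\<psi> \<in> W" for \<phi> \<psi> a c
    unfolding W_def mem_Collect_eq mlin[OF WS[OF that(1)] WS[OF that(2)]]
    by (intro conjI schwartz_add schwartz_cmult test_add test_cmult WS Wt that)
  have W0: "(\<lambda>x. 0) \<in> W"
  proof -
    have "symbol_mult (weight blk s) (\<lambda>x. 0) = (\<lambda>x. 0)"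
      using mlin[OF schwartz_zero schwartz_zero, of 0 0] by simp
    then show ?thesis by (simp add: W_def schwartz_zero test_zero)
  qed
  define L where "L \<phi> = u (symbol_mult (weight blk s) \<phi>)" for \<phi>
  have "\<exists>f. square_integrable f \<and> L2_norm f \<le> M \<and> (\<forall>\<phi>\<in>W. L \<phi> = (LINT x|lborel. f x * \<phi> x))"
  proof (rule L2_riesz[of W L M, OF _ W0 _ _ _ _ M])
    show "square_integrable \<phi>" if "\<phi> \<in> W" for \<phi> by (rule schwartz_square_integrable[OF WS[OF that]])
    show "(\<lambda>x. \<phi> x + \<psi> x) \<in> W" if "\<phi> \<in> W" "\<psi> \<in> W" for \<phi> \<psi> using Wlin[OF that, of 1 1] by simp
    show "(\<lambda>x. c * \<phi> x) \<in> W" if "\<phi> \<in> W" for c \<phi> using Wlin[OF that W0, of c 0] by simp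
    show "L (\<lambda>x. a * \<phi> x + c * \<psi> x) = a * L \<phi> + c * L \<psi>" if "\<phi> \<in> W" "\<psi> \<in> W" for \<phi> \<psi> a c
      using lin Wt[OF that(1)] Wt[OF that(2)]
      unfolding L_def mlin[OF WS[OF that(1)] WS[OF that(2)]] complex_linear_on_def by blast
    show "cmod (L \<phi>) \<le> M * L2_norm \<phi>" if "\<phi> \<in> W" for \<phi>
    proof -
      have "L2_norm \<phi> = dual_norm blk s (symbol_mult (weight blk s) \<phi>)"
        unfolding dual_norm_def symbol_mult_inverse(2)[OF w WS[OF that]] ..
      then show ?thesis using bound[OF Wt[OF that]] by (simp only: L_def mult_ac)
    qed
  qed
  then obtain f where f: "square_integrable f" "L2_norm f \<le> M" "\<And>\<phi>. \<phi> \<in> W \<Longrightarrow> L \<phi> = (LINT x|lborel. f x * \<phi> x)"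
    by blast
  define T where "T \<psi> = (LINT x|lborel. f x * symbol_mult dual_weight \<psi> x)" for \<psi>
  have int: "integrable lborel (\<lambda>x. f x * symbol_mult dual_weight \<psi> x)" if "\<psi> \<in> schwartz_functions" for \<psi>
    by (rule L2_Cauchy_Schwarz(1)[OF f(1) schwartz_square_integrable[OF schwartz_symbol_mult[OF w' that]]])
  have Ttemp: "T \<in> tempered_distributions"
    unfolding tempered_distributions_def mem_Collect_eq
  proof (rule conjI)
    show "complex_linear_on schwartz_functions T"
      unfolding complex_linear_on_def
    proof (intro ballI allI)
      fix \<phi> \<psi> :: "real^'n \<Rightarrow> complex" and a c
      assume \<phi>: "\<phi> \<in> schwartz_functions" and \<psi>: "\<psi> \<in> schwartz_functions"
      have "T (\<lambda>x. a * \<phi> x + c * \<psi> x) =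
        (LINT x|lborel. a * (f x * symbol_mult dual_weight \<phi> x) + c * (f x * symbol_mult dual_weight \<psi> x))"
        unfolding T_def symbol_mult_linear[OF w' \<phi> \<psi>] by (simp only: distrib_left mult.left_commute)
      also have "\<dots> = (LINT x|lborel. a * (f x * symbol_mult dual_weight \<phi> x)) + (LINT x|lborel. c * (f x * symbol_mult dual_weight \<psi> x))"
        by (rule Bochner_Integration.integral_add) (intro integrable_mult_right int \<phi> \<psi>)+
      finally show "T (\<lambda>x. a * \<phi> x + c * \<psi> x) = a * T \<phi> + c * T \<psi>" by (simp only: integral_mult_right_zero T_def)
    qed
    obtain C k m where C: "C \<ge> 0" "\<And>f. f \<in> schwartz_functions \<Longrightarrow> dual_norm blk s f \<le> C * schwartz_seminorm k m f"
      using dual_norm_seminorm by blast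
    have "cmod (T \<psi>) \<le> (L2_norm f * C) * schwartz_seminorm k m \<psi>" if \<psi>: "\<psi> \<in> schwartz_functions" for \<psi>
    proof -
      have "cmod (T \<psi>) \<le> L2_norm f * dual_norm blk s \<psi>"
        using L2_Cauchy_Schwarz(2)[OF f(1) schwartz_square_integrable[OF schwartz_symbol_mult[OF w' \<psi>]]]
        unfolding dual_norm_def T_def .
      also have "\<dots> \<le> L2_norm f * (C * schwartz_seminorm k m \<psi>)"
        by (intro mult_left_mono C(2) \<psi>) auto
      finally show ?thesis by (simp only: mult.assoc)
    qed
    then show "\<exists>C k m. \<forall>\<phi>\<in>schwartz_functions. cmod (T \<phi>) \<le> C * schwartz_seminorm k m \<phi>" by blast
  qed
  have "T \<psi> = u \<psi>" if \<psi>: "\<psi> \<in> test_functions" for \<psi>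
  proof -
    note \<psi>S = test_imp_schwartz[OF \<psi>]
    have "symbol_mult dual_weight \<psi> \<in> W"
      unfolding W_def mem_Collect_eq symbol_mult_inverse(1)[OF w \<psi>S]
      by (intro conjI schwartz_symbol_mult w' \<psi>S \<psi>)
    from f(3)[OF this] show ?thesis
      unfolding T_def L_def symbol_mult_inverse(1)[OF w \<psi>S] by (rule sym)
  qed
  moreover have "fourier_multiplier (weight blk s) T \<phi> = (LINT x|lborel. f x * \<phi> x)" if "\<phi> \<in> schwartz_functions" for \<phi>
    unfolding fourier_multiplier_eq T_def symbol_mult_inverse(2)[OF w that] ..
  ultimately have "bessel_image blk s u f"
    unfolding bessel_image_def using f(1) Ttemp by blast
  then show ?thesis by blast
qed

lemma sobolev_bound:
  assumes "u \<in> sobolev blk s" "\<psi> \<in> test_functions"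
  shows "cmod (u \<psi>) \<le> sobolev_norm blk s u * dual_norm blk s \<psi>"
proof -
  have "bessel_image blk s u (SOME f. bessel_image blk s u f)"
    using assms(1) unfolding sobolev_def mem_Collect_eq by (rule someI_ex)
  from bessel_image_bound[OF this assms(2)] show ?thesis by (simp only: sobolev_norm_def)
qed

text \<open>Together with \<open>sobolev_bound\<close> this identifies the norm as the least
  constant in the duality bound, so the choice made in the definition of the norm never matters
  again.\<close>

lemma sobolev_norm_le:
  assumes "u \<in> sobolev blk s" "M \<ge> 0"
    and "\<And>\<psi>. \<psi> \<in> test_functions \<Longrightarrow> cmod (u \<psi>) \<le> M * dual_norm blk s \<psi>"
  shows "sobolev_norm blk s u \<le> M"
proof -
  have "bessel_image blk s u (SOME f. bessel_image blk s u f)"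
    using assms(1) unfolding sobolev_def mem_Collect_eq by (rule someI_ex)
  from bessel_image_norm_le[OF this assms(2,3)] show ?thesis by (simp only: sobolev_norm_def)
qed

lemma sobolevI:
  assumes "complex_linear_on test_functions u" "M \<ge> 0"
    and "\<And>\<psi>. \<psi> \<in> test_functions \<Longrightarrow> cmod (u \<psi>) \<le> M * dual_norm blk s \<psi>"
  shows "u \<in> sobolev blk s"
  unfolding sobolev_def mem_Collect_eq by (rule bessel_image_exists[OF assms])

lemma sobolev_norm_nonneg: "sobolev_norm blk s u \<ge> 0"
  by (simp add: sobolev_norm_def)

end

section \<open>Supports of distributions\<close>

lemma complex_linear_onD:
  assumes "complex_linear_on V u" "\<phi> \<in> V" "\<psi> \<in> V"
  shows "u (\<lambda>x. a * \<phi> x + c * \<psi> x) = a * u \<phi> + c * u \<psi>"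
  using assms unfolding complex_linear_on_def by blast

lemma distribution_linear: "u \<in> distributions \<Longrightarrow> complex_linear_on test_functions u"
  by (simp add: distributions_def)

lemma distributionsD:
  assumes "u \<in> distributions" "compact L"
  shows "\<exists>C m. \<forall>\<phi>\<in>test_functions. function_support \<phi> \<subseteq> L \<longrightarrow> cmod (u \<phi>) \<le> C * schwartz_seminorm 0 m \<phi>"
  using assms by (simp add: distributions_def)

lemma linear_zero: "complex_linear_on test_functions u \<Longrightarrow> u (\<lambda>x. 0) = 0"
  using complex_linear_onD[of test_functions u "\<lambda>x. 0" "\<lambda>x. 0" 0 0] test_zero by simp

lemma linear_sum:
  assumes u: "complex_linear_on test_functions u" and f: "\<And>i. i \<in> F \<Longrightarrow> f i \<in> test_functions"
  shows "u (\<lambda>x. \<Sum>i\<in>F. f i x) = (\<Sum>i\<in>F. u (f i))"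
  using f
proof (induction F rule: infinite_finite_induct)
  case (insert i F)
  have "u (\<lambda>x. 1 * f i x + 1 * (\<Sum>i\<in>F. f i x)) = 1 * u (f i) + 1 * u (\<lambda>x. \<Sum>i\<in>F. f i x)"
    by (rule complex_linear_onD[OF u]) (auto intro!: test_sum insert.prems)
  then show ?case using insert by simp
qed (simp_all add: linear_zero[OF u])

text \<open>In place of a partition of unity, \<phi> is multiplied by one factor
  \<open>1 - b c\<close> after another. Each part removed is supported in a ball where u vanishes,
  so the value of u never changes, and after the last factor nothing of \<phi> is left.\<close>

lemma distribution_vanishes:
  fixes u :: "'n::finite functional"
  assumes u: "u \<in> distributions" and \<phi>: "\<phi> \<in> test_functions"
    and disj: "function_support \<phi> \<inter> distribution_support u = {}"
  shows "u \<phi> = 0"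
proof -
  note lin = distribution_linear[OF u]
  \<comment> \<open>The radius is doubled because a bump that is 1 on the ball of radius r may reach
    out to radius 2 * r.\<close>
  define P where "P c r \<longleftrightarrow> r > 0 \<and> (\<forall>\<psi>\<in>test_functions. function_support \<psi> \<subseteq> cball c (2 * r) \<longrightarrow> u \<psi> = 0)"
    for c :: "real^'n" and r :: real
  have "\<exists>r. P c r" if c: "c \<in> function_support \<phi>" for c
  proof -
    have "c \<notin> distribution_support u" using c disj by blast
    then obtain V where V: "open V" "c \<in> V" "\<And>\<psi>. \<psi> \<in> test_functions \<Longrightarrow> function_support \<psi> \<subseteq> V \<Longrightarrow> u \<psi> = 0"
      unfolding distribution_support_def by blast
    obtain e where e: "e > 0" "cball c e \<subseteq> V" using V(1,2) open_contains_cball by blast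
    have "P c (e / 2)" unfolding P_def using e V(3) by auto
    then show ?thesis ..
  qed
  then have "\<forall>c\<in>function_support \<phi>. \<exists>r. P c r" by blast
  from bchoice[OF this] obtain r where r: "\<And>c. c \<in> function_support \<phi> \<Longrightarrow> P c (r c)" by blast
  have rpos: "r c > 0" and rV: "\<And>\<psi>. \<psi> \<in> test_functions \<Longrightarrow> function_support \<psi> \<subseteq> cball c (2 * r c) \<Longrightarrow> u \<psi> = 0"
    if "c \<in> function_support \<phi>" for c
    using r[OF that] by (auto simp: P_def)
  have cov: "function_support \<phi> \<subseteq> (\<Union>c\<in>function_support \<phi>. ball c (r c))"
    using rpos by (auto intro!: UN_I)
  obtain D where D: "D \<subseteq> function_support \<phi>" "finite D" "function_support \<phi> \<subseteq> (\<Union>c\<in>D. ball c (r c))"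
    by (rule compactE_image[OF test_functionsD(2)[OF \<phi>] _ cov]) auto
  define Q where "Q c b \<longleftrightarrow> smooth (\<lambda>x. complex_of_real (b x)) \<and> (\<forall>x. dist c x \<le> r c \<longrightarrow> b x = 1) \<and> (\<forall>x. dist c x \<ge> 2 * r c \<longrightarrow> b x = 0)"
    for c and b :: "real^'n \<Rightarrow> real"
  have "\<forall>c\<in>D. \<exists>b. Q c b"
    unfolding Q_def using ball_bump[OF rpos] D(1) by blast
  from bchoice[OF this] obtain b where b: "\<And>c. c \<in> D \<Longrightarrow> Q c (b c)" by blast
  have b: "smooth (\<lambda>x. complex_of_real (b c x))" "\<And>x. dist c x \<le> r c \<Longrightarrow> b c x = 1" "\<And>x. dist c x \<ge> 2 * r c \<Longrightarrow> b c x = 0"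
    if "c \<in> D" for c
    using b[OF that] by (auto simp: Q_def)
  have sm: "smooth (\<lambda>x. \<Prod>c\<in>F. 1 - complex_of_real (b c x))" if "F \<subseteq> D" for F
  proof (rule smooth_prod)
    fix c assume "c \<in> F"
    then have "smooth (\<lambda>x. 1 + (- 1) * complex_of_real (b c x))"
      using that b(1) by (intro smooth_add smooth_mult smooth_const) blast
    then show "smooth (\<lambda>x. 1 - complex_of_real (b c x))" by simp
  qed
  have "u (\<lambda>x. \<phi> x * (\<Prod>c\<in>F. 1 - complex_of_real (b c x))) = u \<phi>" if "finite F" "F \<subseteq> D" for F
    using that
  proof (induction F rule: finite_induct)
    case (insert c F)
    define \<phi>' where "\<phi>' x = \<phi> x * (\<Prod>c\<in>F. 1 - complex_of_real (b c x))" for x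
    have \<phi>': "\<phi>' \<in> test_functions"
      unfolding \<phi>'_def using insert.prems by (intro test_mult_smooth[OF \<phi>] sm) simp
    have c: "c \<in> D" using insert.prems by simp
    have t: "(\<lambda>x. \<phi>' x * complex_of_real (b c x)) \<in> test_functions" by (rule test_mult_smooth[OF \<phi>' b(1)[OF c]])
    have "function_support (\<lambda>x. \<phi>' x * complex_of_real (b c x)) \<subseteq> cball c (2 * r c)"
      by (subst function_support_subset) (auto simp: b(3)[OF c])
    then have z: "u (\<lambda>x. \<phi>' x * complex_of_real (b c x)) = 0"
      using rV[of c] c D(1) t by blast
    have "(\<lambda>x. \<phi> x * (\<Prod>c\<in>insert c F. 1 - complex_of_real (b c x))) = (\<lambda>x. 1 * \<phi>' x + (- 1) * (\<phi>' x * complex_of_real (b c x)))"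
      using insert.hyps by (auto simp: fun_eq_iff \<phi>'_def algebra_simps)
    then have "u (\<lambda>x. \<phi> x * (\<Prod>c\<in>insert c F. 1 - complex_of_real (b c x))) = 1 * u \<phi>' + (- 1) * u (\<lambda>x. \<phi>' x * complex_of_real (b c x))"
      by (simp only: complex_linear_onD[OF lin \<phi>' t])
    then show ?case using insert z unfolding \<phi>'_def by simp
  qed simp
  then have "u (\<lambda>x. \<phi> x * (\<Prod>c\<in>D. 1 - complex_of_real (b c x))) = u \<phi>" using D(2) by blast
  moreover have "\<phi> x * (\<Prod>c\<in>D. 1 - complex_of_real (b c x)) = 0" for x
  proof (cases "x \<in> function_support \<phi>")
    case True
    then obtain c where c: "c \<in> D" "dist c x < r c" using D(3) by auto
    then have "1 - complex_of_real (b c x) = 0" using b(2)[OF c(1)] by simp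
    then have "\<exists>c\<in>D. 1 - complex_of_real (b c x) = 0" using c(1) by blast
    then show ?thesis using D(2) by (simp add: prod_zero)
  qed (simp add: outside_function_support)
  ultimately show ?thesis using linear_zero[OF lin] by simp
qed

section \<open>Behaviour of supports and seminorms under translation and change of order\<close>

lemma function_support_translate:
  "function_support (\<lambda>x. \<phi> (x + h)) \<subseteq> (\<lambda>x. x - h) ` function_support \<phi>"
proof (rule function_support_subset[THEN iffD2], goal_cases)
  case 1
  show ?case by (rule closed_translation_subtract) (simp add: function_support_def)
next
  case 2
  show ?case
  proof (rule allI, rule impI)
    fix x assume x: "x \<notin> (\<lambda>x. x - h) ` function_support \<phi>"
    have "x + h \<notin> function_support \<phi>"
    proof
      assume "x + h \<in> function_support \<phi>"
      then have "(x + h) - h \<in> (\<lambda>x. x - h) ` function_support \<phi>" by (rule imageI)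
      then show False using x by simp
    qed
    then show "\<phi> (x + h) = 0" by (rule outside_function_support)
  qed
qed

lemma seminorm_translate:
  assumes "smooth \<phi>"
  shows "schwartz_seminorm 0 m (\<lambda>x. \<phi> (x + h)) = schwartz_seminorm 0 m \<phi>"
proof -
  have "(SUP x. (1 + norm x) ^ 0 * cmod (partial_derivs \<alpha> (\<lambda>x. \<phi> (x + h)) x)) = (SUP x. (1 + norm x) ^ 0 * cmod (partial_derivs \<alpha> \<phi> x))" for \<alpha>
  proof -
    have "partial_derivs \<alpha> (\<lambda>x. \<phi> (x + h)) = (\<lambda>x. partial_derivs \<alpha> \<phi> (x + h))"
      using partial_derivs_affine[OF assms, of \<alpha> 1 h] by simp
    then have "range (\<lambda>x. (1 + norm x) ^ 0 * cmod (partial_derivs \<alpha> (\<lambda>x. \<phi> (x + h)) x)) = (\<lambda>x. cmod (partial_derivs \<alpha> \<phi> x)) ` range (\<lambda>x. x + h)"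
      by (simp only: image_image power_0 mult_1_left)
    also have "range (\<lambda>x. x + h) = UNIV" by (rule surj_plus_right)
    finally show ?thesis by (simp only: power_0 mult_1_left)
  qed
  then show ?thesis by (simp only: schwartz_seminorm_def)
qed

lemma seminorm_mono:
  assumes \<phi>: "\<phi> \<in> schwartz_functions" and "m \<le> m'"
  shows "schwartz_seminorm k m \<phi> \<le> schwartz_seminorm k m' \<phi>"
  unfolding schwartz_seminorm_def
proof (rule sum_mono2[OF finite_multi_indices])
  show "{\<alpha>. length \<alpha> \<le> m} \<subseteq> {\<alpha>. length \<alpha> \<le> m'}" using assms(2) by auto
  fix \<alpha> :: "'a list"
  have "bdd_above (range (\<lambda>x. (1 + norm x) ^ k * cmod (partial_derivs \<alpha> \<phi> x)))"
    using schwartz_imp_rapid[OF schwartz_partial_derivs[OF \<phi>]] unfolding rapid_def bdd_above_def by blast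
  from cSUP_upper[OF UNIV_I this, of 0]
  show "0 \<le> (SUP x. (1 + norm x) ^ k * cmod (partial_derivs \<alpha> \<phi> x))"
    by (rule order_trans[rotated]) simp
qed

section \<open>Sums of translates\<close>

text \<open>The almost-orthogonality constants depend on \<theta> but not on \<open>U\<close>. They
  are therefore obtained outside this locale and handed to the two main estimates as hypotheses, so
  that one constant serves all families.\<close>

locale lattice_family =
  fixes blk :: "'n::finite \<Rightarrow> 'j::finite" and s :: "real^'j" and K V :: "(real^'n) set"
    and \<theta> :: "real^'n \<Rightarrow> complex" and U :: "real^'n \<Rightarrow> 'n functional"
  assumes K: "compact K" and \<theta>: "\<theta> \<in> test_functions" and V: "open V" "K \<subseteq> V" "\<And>x. x \<in> V \<Longrightarrow> \<theta> x = 1"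
    and sep: "\<And>\<gamma> x. \<gamma> \<in> int_lattice \<Longrightarrow> \<gamma> \<noteq> 0 \<Longrightarrow> x \<in> function_support \<theta> \<Longrightarrow> x + \<gamma> \<notin> K"
    and Us: "\<And>\<gamma>. \<gamma> \<in> int_lattice \<Longrightarrow> U \<gamma> \<in> sobolev blk s"
    and Ud: "\<And>\<gamma>. \<gamma> \<in> int_lattice \<Longrightarrow> U \<gamma> \<in> distributions_in K"
begin

lemma U_distribution: "\<gamma> \<in> int_lattice \<Longrightarrow> U \<gamma> \<in> distributions"
  using Ud by (simp add: distributions_in_def)

lemma U_linear: "\<gamma> \<in> int_lattice \<Longrightarrow> complex_linear_on test_functions (U \<gamma>)"
  by (rule distribution_linear[OF U_distribution])

lemma U_vanishes:
  assumes "\<gamma> \<in> int_lattice" "\<phi> \<in> test_functions" "function_support \<phi> \<inter> K = {}"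
  shows "U \<gamma> \<phi> = 0"
  using assms Ud[OF assms(1)] by (intro distribution_vanishes) (auto simp: distributions_in_def)

text \<open>\<open>\<phi> - \<theta> \<phi>\<close> vanishes on the open set \<open>V\<close> around
  \<open>K\<close>, so its closed support misses \<open>K\<close>; knowing \<theta> = 1 on
  \<open>K\<close> alone would not give this.\<close>

lemma U_localised:
  assumes \<gamma>: "\<gamma> \<in> int_lattice" and \<phi>: "\<phi> \<in> test_functions"
  shows "U \<gamma> (\<lambda>x. \<theta> x * \<phi> x) = U \<gamma> \<phi>"
proof -
  have t: "(\<lambda>x. \<theta> x * \<phi> x) \<in> test_functions"
    by (rule test_mult_smooth[OF \<theta> test_functionsD(1)[OF \<phi>]])
  define \<psi> where "\<psi> x = 1 * \<phi> x + (- 1) * (\<theta> x * \<phi> x)" for x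
  have \<psi>: "\<psi> \<in> test_functions" unfolding \<psi>_def by (intro test_add test_cmult \<phi> t)
  have "function_support \<psi> \<subseteq> - V"
    using V(1,3) by (subst function_support_subset) (auto simp: \<psi>_def)
  then have "U \<gamma> \<psi> = 0" using V(2) by (intro U_vanishes \<gamma> \<psi>) auto
  moreover have "U \<gamma> \<psi> = 1 * U \<gamma> \<phi> + (- 1) * U \<gamma> (\<lambda>x. \<theta> x * \<phi> x)"
    unfolding \<psi>_def[abs_def] by (rule complex_linear_onD[OF U_linear[OF \<gamma>] \<phi> t])
  ultimately show ?thesis by simp
qed

text \<open>The lattice points \<gamma> for which \<open>K + \<gamma>\<close> meets
  \<open>L\<close>. On functions supported in \<open>L\<close> only these terms act, so the lattice
  sum becomes a finite sum whose index set depends on \<open>L\<close> alone, as continuity on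
  \<open>L\<close> requires.\<close>

definition relevant :: "(real^'n) set \<Rightarrow> (real^'n) set" where
  "relevant L = int_lattice \<inter> {x - y |x y. x \<in> L \<and> y \<in> K}"

lemma finite_relevant: "compact L \<Longrightarrow> finite (relevant L)"
  unfolding relevant_def by (intro finite_int_lattice_bounded compact_imp_bounded compact_differences K)

lemma translate_U_zero:
  assumes \<gamma>: "\<gamma> \<in> int_lattice" and \<phi>: "\<phi> \<in> test_functions" "function_support \<phi> \<subseteq> L" and nr: "\<gamma> \<notin> relevant L"
  shows "translate \<gamma> (U \<gamma>) \<phi> = 0"
  unfolding translate_def
proof (rule U_vanishes[OF \<gamma> test_translate[OF \<phi>(1)]])
  note function_support_translate[of \<phi> \<gamma>]
  moreover have "x - \<gamma> \<notin> K" if "x \<in> function_support \<phi>" for x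
  proof
    assume "x - \<gamma> \<in> K"
    then have "x - (x - \<gamma>) \<in> {x - y |x y. x \<in> L \<and> y \<in> K}" using that \<phi>(2) by blast
    then show False using nr \<gamma> by (simp add: relevant_def)
  qed
  ultimately show "function_support (\<lambda>x. \<phi> (x + \<gamma>)) \<inter> K = {}" by blast
qed

lemma summable_translates:
  assumes "\<phi> \<in> test_functions"
  shows "(\<lambda>\<gamma>. translate \<gamma> (U \<gamma>) \<phi>) summable_on int_lattice"
proof -
  have fin: "finite (relevant (function_support \<phi>))" by (rule finite_relevant[OF test_functionsD(2)[OF assms]])
  have "(\<lambda>\<gamma>. translate \<gamma> (U \<gamma>) \<phi>) summable_on relevant (function_support \<phi>)" by (rule summable_on_finite[OF fin])
  then show ?thesis
  proof (rule summable_on_cong_neutral[THEN iffD1, rotated 3])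
    show "translate \<gamma> (U \<gamma>) \<phi> = 0" if "\<gamma> \<in> int_lattice - relevant (function_support \<phi>)" for \<gamma>
      using that assms by (intro translate_U_zero[OF _ _ order_refl]) auto
  qed (auto simp: relevant_def)
qed

lemma lattice_sum_eq:
  assumes \<phi>: "\<phi> \<in> test_functions" and F: "finite F" "F \<subseteq> int_lattice" "relevant (function_support \<phi>) \<subseteq> F"
  shows "lattice_sum U \<phi> = (\<Sum>\<gamma>\<in>F. U \<gamma> (\<lambda>x. \<phi> (x + \<gamma>)))"
proof -
  have "lattice_sum U \<phi> = (\<Sum>\<^sub>\<infinity>\<gamma>\<in>F. translate \<gamma> (U \<gamma>) \<phi>)"
    unfolding lattice_sum_def
  proof (rule infsum_cong_neutral)
    show "translate \<gamma> (U \<gamma>) \<phi> = 0" if "\<gamma> \<in> int_lattice - F" for \<gamma>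
      using that F(3) by (intro translate_U_zero[OF _ \<phi> order_refl]) auto
  qed (use F(2) in auto)
  then show ?thesis using F(1) by (simp add: translate_def)
qed

lemma relevant_mono: "L \<subseteq> L' \<Longrightarrow> relevant L \<subseteq> relevant L'"
  unfolding relevant_def by blast

lemma relevant_subset: "relevant L \<subseteq> int_lattice"
  by (auto simp: relevant_def)

lemma finite_sum_bound:
  assumes L: "compact L" and F: "finite F" "F \<subseteq> int_lattice"
  shows "\<exists>C m. C \<ge> 0 \<and> (\<forall>\<phi>\<in>test_functions. function_support \<phi> \<subseteq> L \<longrightarrow>
    cmod (\<Sum>\<gamma>\<in>F. U \<gamma> (\<lambda>x. \<phi> (x + \<gamma>))) \<le> C * schwartz_seminorm 0 m \<phi>)"
  using F
proof (induction F rule: finite_induct)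
  case empty
  show ?case by (intro exI[of _ 0]) simp
next
  case (insert \<gamma> F)
  have "F \<subseteq> int_lattice" using insert.prems by simp
  from insert.IH[OF this] obtain C m where C: "C \<ge> 0" "\<And>\<phi>. \<phi> \<in> test_functions \<Longrightarrow> function_support \<phi> \<subseteq> L \<Longrightarrow>
    cmod (\<Sum>\<gamma>\<in>F. U \<gamma> (\<lambda>x. \<phi> (x + \<gamma>))) \<le> C * schwartz_seminorm 0 m \<phi>" by blast
  have \<gamma>: "\<gamma> \<in> int_lattice" using insert.prems by simp
  define L' where "L' = (\<lambda>x. x - \<gamma>) ` L"
  have L': "compact L'" unfolding L'_def using L by (intro compact_continuous_image continuous_intros)
  obtain D k where D: "\<forall>\<phi>\<in>test_functions. function_support \<phi> \<subseteq> L' \<longrightarrow> cmod (U \<gamma> \<phi>) \<le> D * schwartz_seminorm 0 k \<phi>"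
    using distributionsD[OF U_distribution[OF \<gamma>] L'] by (elim exE)
  have "cmod (\<Sum>\<gamma>\<in>insert \<gamma> F. U \<gamma> (\<lambda>x. \<phi> (x + \<gamma>))) \<le> (C + \<bar>D\<bar>) * schwartz_seminorm 0 (max m k) \<phi>"
    if \<phi>: "\<phi> \<in> test_functions" "function_support \<phi> \<subseteq> L" for \<phi>
  proof -
    note \<phi>S = test_imp_schwartz[OF \<phi>(1)]
    have "function_support (\<lambda>x. \<phi> (x + \<gamma>)) \<subseteq> L'"
      unfolding L'_def by (rule order_trans[OF function_support_translate image_mono[OF \<phi>(2)]])
    then have "cmod (U \<gamma> (\<lambda>x. \<phi> (x + \<gamma>))) \<le> D * schwartz_seminorm 0 k \<phi>"
      using D[rule_format, OF test_translate[OF \<phi>(1)]] seminorm_translate[OF test_functionsD(1)[OF \<phi>(1)]] by simp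
    also have "\<dots> \<le> \<bar>D\<bar> * schwartz_seminorm 0 (max m k) \<phi>"
      by (rule mult_mono[OF abs_ge_self seminorm_mono[OF \<phi>S max.cobounded2] abs_ge_zero schwartz_seminorm_nonneg[OF \<phi>S]])
    finally have 1: "cmod (U \<gamma> (\<lambda>x. \<phi> (x + \<gamma>))) \<le> \<bar>D\<bar> * schwartz_seminorm 0 (max m k) \<phi>" .
    have 2: "cmod (\<Sum>\<gamma>\<in>F. U \<gamma> (\<lambda>x. \<phi> (x + \<gamma>))) \<le> C * schwartz_seminorm 0 (max m k) \<phi>"
      by (rule order_trans[OF C(2)[OF \<phi>] mult_left_mono[OF seminorm_mono[OF \<phi>S max.cobounded1] C(1)]])
    show ?thesis
      using norm_triangle_mono[OF 1 2] insert.hyps by (simp add: distrib_right add.commute)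
  qed
  moreover have "C + \<bar>D\<bar> \<ge> 0" using C(1) by simp
  ultimately show ?case by (intro exI[of _ "C + \<bar>D\<bar>"] exI[of _ "max m k"] conjI ballI impI)
qed

lemma lattice_sum_linear: "complex_linear_on test_functions (lattice_sum U)"
  unfolding complex_linear_on_def
proof (intro ballI allI)
  fix \<phi> \<psi> :: "real^'n \<Rightarrow> complex" and a c assume \<phi>: "\<phi> \<in> test_functions" and \<psi>: "\<psi> \<in> test_functions"
  \<comment> \<open>One compact set for both functions, so that all three sums run over the same
    finite index set.\<close>
  define L where "L = function_support \<phi> \<union> function_support \<psi>"
  have L: "compact L" unfolding L_def by (intro compact_Un test_functionsD(2) \<phi> \<psi>)
  define F where "F = relevant L"
  have F: "finite F" "F \<subseteq> int_lattice" unfolding F_def by (rule finite_relevant[OF L], rule relevant_subset)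
  have t: "(\<lambda>x. a * \<phi> x + c * \<psi> x) \<in> test_functions" by (intro test_add test_cmult \<phi> \<psi>)
  have "function_support (\<lambda>x. a * \<phi> x + c * \<psi> x) \<subseteq> L"
    by (subst function_support_subset[OF compact_imp_closed[OF L]]) (simp add: L_def outside_function_support)
  then have "lattice_sum U (\<lambda>x. a * \<phi> x + c * \<psi> x) = (\<Sum>\<gamma>\<in>F. U \<gamma> (\<lambda>x. a * \<phi> (x + \<gamma>) + c * \<psi> (x + \<gamma>)))"
    by (intro lattice_sum_eq t F) (simp add: F_def relevant_mono)
  also have "\<dots> = (\<Sum>\<gamma>\<in>F. a * U \<gamma> (\<lambda>x. \<phi> (x + \<gamma>)) + c * U \<gamma> (\<lambda>x. \<psi> (x + \<gamma>)))"
  proof (rule sum.cong[OF refl])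
    fix \<gamma> assume "\<gamma> \<in> F"
    then show "U \<gamma> (\<lambda>x. a * \<phi> (x + \<gamma>) + c * \<psi> (x + \<gamma>)) = a * U \<gamma> (\<lambda>x. \<phi> (x + \<gamma>)) + c * U \<gamma> (\<lambda>x. \<psi> (x + \<gamma>))"
      using F(2) by (intro complex_linear_onD[OF U_linear] test_translate \<phi> \<psi>) blast
  qed
  also have "\<dots> = a * lattice_sum U \<phi> + c * lattice_sum U \<psi>"
  proof -
    have "lattice_sum U \<phi> = (\<Sum>\<gamma>\<in>F. U \<gamma> (\<lambda>x. \<phi> (x + \<gamma>)))"
      by (intro lattice_sum_eq \<phi> F) (simp add: F_def L_def relevant_mono)
    moreover have "lattice_sum U \<psi> = (\<Sum>\<gamma>\<in>F. U \<gamma> (\<lambda>x. \<psi> (x + \<gamma>)))"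
      by (intro lattice_sum_eq \<psi> F) (simp add: F_def L_def relevant_mono)
    ultimately show ?thesis by (simp add: sum.distrib sum_distrib_left)
  qed
  finally show "lattice_sum U (\<lambda>x. a * \<phi> x + c * \<psi> x) = a * lattice_sum U \<phi> + c * lattice_sum U \<psi>" .
qed

lemma lattice_sum_distribution: "lattice_sum U \<in> distributions"
  unfolding distributions_def mem_Collect_eq
proof (intro conjI allI impI lattice_sum_linear)
  fix L :: "(real^'n) set" assume L: "compact L"
  obtain C m where C: "\<And>\<phi>. \<phi> \<in> test_functions \<Longrightarrow> function_support \<phi> \<subseteq> L \<Longrightarrow>
    cmod (\<Sum>\<gamma>\<in>relevant L. U \<gamma> (\<lambda>x. \<phi> (x + \<gamma>))) \<le> C * schwartz_seminorm 0 m \<phi>"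
    using finite_sum_bound[OF L finite_relevant[OF L] relevant_subset] by blast
  have "cmod (lattice_sum U \<phi>) \<le> C * schwartz_seminorm 0 m \<phi>" if "\<phi> \<in> test_functions" "function_support \<phi> \<subseteq> L" for \<phi>
    using C[OF that] lattice_sum_eq[OF that(1) finite_relevant[OF L] relevant_subset relevant_mono[OF that(2)]] by simp
  then show "\<exists>C m. \<forall>\<phi>\<in>test_functions. function_support \<phi> \<subseteq> L \<longrightarrow> cmod (lattice_sum U \<phi>) \<le> C * schwartz_seminorm 0 m \<phi>"
    by blast
qed

end

lemma test_shift: "\<phi> \<in> test_functions \<Longrightarrow> (\<lambda>x. \<phi> (x - h)) \<in> test_functions"
  using test_translate[of \<phi> "- h"] by simp

section \<open>Bounds for the dual norm\<close>

lemma dual_norm_square: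
  fixes \<psi> :: "real^'n::finite \<Rightarrow> complex"
  shows "\<psi> \<in> schwartz_functions \<Longrightarrow>
  (dual_norm blk s \<psi>)\<^sup>2 = 1 / (2 * pi) ^ CARD('n) * (wnorm (\<lambda>\<xi>. inverse (weight blk s \<xi>)) \<psi>)\<^sup>2"
  by (simp add: dual_norm_eq power_mult_distrib)

lemma dual_norm_shift:
  assumes "f \<in> schwartz_functions"
  shows "dual_norm blk s (\<lambda>x. f (x + h)) = dual_norm blk s f"
  unfolding dual_norm_eq[OF assms] dual_norm_eq[OF schwartz_translate[OF assms]] wnorm_translate[OF assms] ..

lemma dual_norm_zero: "dual_norm blk s (\<lambda>x. 0) = 0"
  using dual_norm_cmult[OF schwartz_zero, of blk s 0] by simp

lemma dual_norm_localisation: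
  fixes blk :: "'n::finite \<Rightarrow> 'j::finite"
  assumes \<theta>: "\<theta> \<in> test_functions"
  obtains C where "C \<ge> 0" "\<And>f F. f \<in> schwartz_functions \<Longrightarrow> finite F \<Longrightarrow> F \<subseteq> int_lattice \<Longrightarrow>
    (\<Sum>\<gamma>\<in>F. (dual_norm blk s (\<lambda>x. \<theta> (x - \<gamma>) * f x))\<^sup>2) \<le> C * (dual_norm blk s f)\<^sup>2"
proof -
  let ?w = "\<lambda>\<xi>. inverse (weight blk s \<xi>)"
  obtain C where C: "C \<ge> 0" and CB: "\<And>f F. f \<in> schwartz_functions \<Longrightarrow> finite F \<Longrightarrow> F \<subseteq> int_lattice \<Longrightarrow>
    (\<Sum>\<gamma>\<in>F. (wnorm ?w (\<lambda>x. \<theta> (x - \<gamma>) * f x))\<^sup>2) \<le> C * (wnorm ?w f)\<^sup>2"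
    by (rule localisation_bound[OF admissible_dual_weight[of blk s] \<theta>], rule that)
  have "(\<Sum>\<gamma>\<in>F. (dual_norm blk s (\<lambda>x. \<theta> (x - \<gamma>) * f x))\<^sup>2) \<le> C * (dual_norm blk s f)\<^sup>2"
    if f: "f \<in> schwartz_functions" and F: "finite F" "F \<subseteq> int_lattice" for f F
    unfolding dual_norm_square[OF f] dual_norm_square[OF schwartz_window[OF f test_imp_schwartz[OF \<theta>]]]
      sum_distrib_left[symmetric] mult.left_commute[of C]
    by (rule mult_left_mono[OF CB[OF f F]]) simp
  with C show ?thesis by (rule that)
qed

lemma dual_norm_gluing:
  fixes blk :: "'n::finite \<Rightarrow> 'j::finite"
  assumes \<theta>: "\<theta> \<in> test_functions"
  obtains C where "C \<ge> 0" "\<And>\<psi> F. \<psi> ` F \<subseteq> schwartz_functions \<Longrightarrow> finite F \<Longrightarrow> F \<subseteq> int_lattice \<Longrightarrow>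
    (dual_norm blk s (\<lambda>x. \<Sum>\<gamma>\<in>F. \<theta> (x - \<gamma>) * \<psi> \<gamma> x))\<^sup>2 \<le> C * (\<Sum>\<gamma>\<in>F. (dual_norm blk s (\<psi> \<gamma>))\<^sup>2)"
proof -
  let ?w = "\<lambda>\<xi>. inverse (weight blk s \<xi>)"
  obtain C where C: "C \<ge> 0" and CB: "\<And>\<psi> F. \<psi> ` F \<subseteq> schwartz_functions \<Longrightarrow> finite F \<Longrightarrow> F \<subseteq> int_lattice \<Longrightarrow>
    (wnorm ?w (\<lambda>x. \<Sum>\<gamma>\<in>F. \<theta> (x - \<gamma>) * \<psi> \<gamma> x))\<^sup>2 \<le> C * (\<Sum>\<gamma>\<in>F. (wnorm ?w (\<psi> \<gamma>))\<^sup>2)"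
    by (rule gluing_bound[OF admissible_dual_weight[of blk s] \<theta>], rule that)
  have "(dual_norm blk s (\<lambda>x. \<Sum>\<gamma>\<in>F. \<theta> (x - \<gamma>) * \<psi> \<gamma> x))\<^sup>2 \<le> C * (\<Sum>\<gamma>\<in>F. (dual_norm blk s (\<psi> \<gamma>))\<^sup>2)"
    if \<psi>F: "\<psi> ` F \<subseteq> schwartz_functions" and F: "finite F" "F \<subseteq> int_lattice" for \<psi> F
  proof -
    have \<psi>: "\<psi> \<gamma> \<in> schwartz_functions" if "\<gamma> \<in> F" for \<gamma>
      using \<psi>F that by blast
    have g: "(\<lambda>x. \<Sum>\<gamma>\<in>F. \<theta> (x - \<gamma>) * \<psi> \<gamma> x) \<in> schwartz_functions"
      by (intro schwartz_sum schwartz_window \<psi> test_imp_schwartz[OF \<theta>])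
    have "(\<Sum>\<gamma>\<in>F. (dual_norm blk s (\<psi> \<gamma>))\<^sup>2) = (\<Sum>\<gamma>\<in>F. 1 / (2 * pi) ^ CARD('n) * (wnorm ?w (\<psi> \<gamma>))\<^sup>2)"
      by (rule sum.cong[OF refl]) (rule dual_norm_square[OF \<psi>])
    also have "\<dots> = 1 / (2 * pi) ^ CARD('n) * (\<Sum>\<gamma>\<in>F. (wnorm ?w (\<psi> \<gamma>))\<^sup>2)" by (rule sum_distrib_left[symmetric])
    finally show ?thesis
      unfolding dual_norm_square[OF g] using mult_left_mono[OF CB[OF \<psi>F F], of "1 / (2 * pi) ^ CARD('n)"]
      by (simp only: mult.left_commute[of C]) simp
  qed
  with C show ?thesis by (rule that)
qed

lemma sobolev_norm_nearly_attained:
  fixes blk :: "'n::finite \<Rightarrow> 'j::finite"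
  assumes u: "u \<in> sobolev blk s" and lin: "complex_linear_on test_functions u"
    and t: "0 \<le> t" "t = 0 \<or> t < sobolev_norm blk s u"
  shows "\<exists>\<psi>\<in>test_functions. dual_norm blk s \<psi> = t \<and> (\<exists>r. u \<psi> = complex_of_real r \<and> t\<^sup>2 \<le> r)"
proof (cases "t = 0")
  case True
  show ?thesis
    by (rule bexI[OF _ test_zero]) (use True in \<open>simp add: dual_norm_zero linear_zero[OF lin]\<close>)
next
  case False
  then have t0: "0 < t" and tn: "t < sobolev_norm blk s u" using t by auto
  have "\<exists>\<psi>\<in>test_functions. t * dual_norm blk s \<psi> < cmod (u \<psi>)"
  proof (rule ccontr)
    assume "\<not> ?thesis"
    then have "\<And>\<psi>. \<psi> \<in> test_functions \<Longrightarrow> cmod (u \<psi>) \<le> t * dual_norm blk s \<psi>" by (meson not_less)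
    from sobolev_norm_le[OF u t(1) this] show False using tn by simp
  qed
  then obtain \<phi> where \<phi>: "\<phi> \<in> test_functions" "t * dual_norm blk s \<phi> < cmod (u \<phi>)" by (elim bexE)
  define d where "d = dual_norm blk s \<phi>"
  have "d \<noteq> 0"
    using sobolev_bound[OF u \<phi>(1)] \<phi>(2) unfolding d_def[symmetric] by auto
  then have d: "d > 0" unfolding d_def using dual_norm_nonneg[of blk s \<phi>] by linarith
  define c where "c = complex_of_real (t / d) * cnj (sgn (u \<phi>))"
  have u0: "cmod (u \<phi>) > 0" using \<phi>(2) t0 d unfolding d_def by (meson less_trans mult_pos_pos)
  have "cmod c = t / d" unfolding c_def norm_mult complex_mod_cnj norm_sgn norm_of_real using u0 t0 d by simp
  then have dn: "dual_norm blk s (\<lambda>x. c * \<phi> x) = t"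
    unfolding dual_norm_cmult[OF test_imp_schwartz[OF \<phi>(1)]] d_def[symmetric] using d by simp
  have "cnj (sgn (u \<phi>)) * u \<phi> = complex_of_real (cmod (u \<phi>))"
  proof -
    have "cnj (sgn (u \<phi>)) * u \<phi> = (u \<phi> * cnj (u \<phi>)) / complex_of_real (cmod (u \<phi>))"
      by (simp add: sgn_eq)
    also have "\<dots> = complex_of_real (cmod (u \<phi>))"
      unfolding complex_norm_square[symmetric] using u0 by (simp add: power2_eq_square)
    finally show ?thesis .
  qed
  then have cu: "c * u \<phi> = complex_of_real (t / d * cmod (u \<phi>))" by (simp add: c_def mult.assoc)
  have "u (\<lambda>x. c * \<phi> x) = complex_of_real (t / d * cmod (u \<phi>))"
    using complex_linear_onD[OF lin \<phi>(1) \<phi>(1), of c 0] cu by simp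
  moreover have "t\<^sup>2 \<le> t / d * cmod (u \<phi>)"
  proof -
    have "t / d * (t * d) \<le> t / d * cmod (u \<phi>)"
      using \<phi>(2) t0 d unfolding d_def[symmetric] by (intro mult_left_mono) auto
    then show ?thesis using d by (simp add: power2_eq_square)
  qed
  ultimately show ?thesis by (intro bexI[OF _ test_cmult[OF \<phi>(1), of c]] conjI dn exI)
qed

section \<open>The two estimates\<close>

context lattice_family
begin

text \<open>The support of \<theta> shifted by a nonzero lattice vector misses \<open>K\<close>, so
  every term but the \<gamma>-th vanishes, and in that term \<theta> may be dropped. This is how the
  sum gives back its individual coefficients.\<close>

lemma lattice_sum_window:
  assumes \<gamma>: "\<gamma> \<in> int_lattice" and \<psi>: "\<psi> \<in> test_functions"
  shows "lattice_sum U (\<lambda>x. \<theta> (x - \<gamma>) * \<psi> (x - \<gamma>)) = U \<gamma> \<psi>"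
proof -
  define h where "h x = \<theta> x * \<psi> x" for x
  have h: "h \<in> test_functions" unfolding h_def by (rule test_mult_smooth[OF \<theta> test_functionsD(1)[OF \<psi>]])
  note g = test_shift[OF h, of \<gamma>]
  have supp: "function_support h \<subseteq> function_support \<theta>"
    by (subst function_support_subset) (auto simp: h_def outside_function_support function_support_def[of \<theta>, symmetric], simp add: function_support_def)
  have zero: "U \<delta> (\<lambda>x. h (x + \<delta> - \<gamma>)) = 0" if \<delta>: "\<delta> \<in> int_lattice" "\<delta> \<noteq> \<gamma>" for \<delta>
  proof -
    have "U \<delta> (\<lambda>x. h (x + (\<delta> - \<gamma>))) = 0"
    proof (rule U_vanishes[OF \<delta>(1) test_translate[OF h]])
      have "y - (\<delta> - \<gamma>) \<notin> K" if "y \<in> function_support h" for y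
        using sep[OF int_lattice_diff[OF \<gamma> \<delta>(1)] _ subsetD[OF supp that]] \<delta>(2) by (simp add: algebra_simps)
      then show "function_support (\<lambda>x. h (x + (\<delta> - \<gamma>))) \<inter> K = {}"
        using function_support_translate[of h "\<delta> - \<gamma>"] by blast
    qed
    then show ?thesis by (simp only: add_diff_eq)
  qed
  define F where "F = insert \<gamma> (relevant (function_support (\<lambda>x. h (x - \<gamma>))))"
  have F: "finite F" "F \<subseteq> int_lattice"
    unfolding F_def using finite_relevant[OF test_functionsD(2)[OF g]] relevant_subset \<gamma> by auto
  have "lattice_sum U (\<lambda>x. h (x - \<gamma>)) = (\<Sum>\<delta>\<in>F. U \<delta> (\<lambda>x. h (x + \<delta> - \<gamma>)))"
    by (rule lattice_sum_eq[OF g F]) (simp add: F_def subset_insertI)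
  also have "\<dots> = (\<Sum>\<delta>\<in>{\<gamma>}. U \<delta> (\<lambda>x. h (x + \<delta> - \<gamma>)))"
    by (rule sum.mono_neutral_right[OF F(1)]) (use F(2) zero in \<open>auto simp: F_def\<close>)
  also have "\<dots> = U \<gamma> \<psi>" using U_localised[OF \<gamma> \<psi>] by (simp add: h_def[abs_def])
  finally show ?thesis by (simp only: h_def)
qed

lemma lattice_sum_bound:
  assumes C: "C \<ge> 0" and CB: "\<And>f F. f \<in> schwartz_functions \<Longrightarrow> finite F \<Longrightarrow> F \<subseteq> int_lattice \<Longrightarrow>
      (\<Sum>\<gamma>\<in>F. (dual_norm blk s (\<lambda>x. \<theta> (x - \<gamma>) * f x))\<^sup>2) \<le> C * (dual_norm blk s f)\<^sup>2"
    and summ: "(\<lambda>\<gamma>. (sobolev_norm blk s (U \<gamma>))\<^sup>2) summable_on int_lattice"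
    and \<phi>: "\<phi> \<in> test_functions"
  shows "cmod (lattice_sum U \<phi>) \<le>
    sqrt C * sqrt (\<Sum>\<^sub>\<infinity>\<gamma>\<in>int_lattice. (sobolev_norm blk s (U \<gamma>))\<^sup>2) * dual_norm blk s \<phi>"
proof -
  define F where "F = relevant (function_support \<phi>)"
  have F: "finite F" "F \<subseteq> int_lattice"
    unfolding F_def by (rule finite_relevant[OF test_functionsD(2)[OF \<phi>]], rule relevant_subset)
  define S where "S = (\<Sum>\<^sub>\<infinity>\<gamma>\<in>int_lattice. (sobolev_norm blk s (U \<gamma>))\<^sup>2)"
  define a where "a \<gamma> = sobolev_norm blk s (U \<gamma>)" for \<gamma>
  define d where "d \<gamma> = dual_norm blk s (\<lambda>x. \<theta> (x - \<gamma>) * \<phi> x)" for \<gamma>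
  have S: "(\<Sum>\<gamma>\<in>F. (a \<gamma>)\<^sup>2) \<le> S"
    unfolding a_def S_def by (rule finite_sum_le_infsum[OF summ F]) simp
  have S0: "S \<ge> 0" unfolding S_def by (rule infsum_nonneg) simp
  \<comment> \<open>Inserting \<theta> does not change the value of \<open>U \<gamma>\<close>, but
    it replaces the dual norm of \<phi> by that of a localised piece, and these norms are square
    summable.\<close>
  have pt: "cmod (U \<gamma> (\<lambda>x. \<phi> (x + \<gamma>))) \<le> a \<gamma> * d \<gamma>" if "\<gamma> \<in> F" for \<gamma>
  proof -
    have \<gamma>: "\<gamma> \<in> int_lattice" using that F(2) by (rule subsetD[rotated])
    have t: "(\<lambda>x. \<theta> x * \<phi> (x + \<gamma>)) \<in> test_functions"
      by (rule test_mult_smooth[OF \<theta> test_functionsD(1)[OF test_translate[OF \<phi>]]])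
    have "dual_norm blk s (\<lambda>x. \<theta> x * \<phi> (x + \<gamma>)) = d \<gamma>"
      unfolding d_def
      using dual_norm_shift[OF schwartz_window[OF test_imp_schwartz[OF \<phi>] test_imp_schwartz[OF \<theta>], of \<gamma>], of blk s \<gamma>]
      by (simp only: add_diff_cancel_right')
    then show ?thesis
      using sobolev_bound[OF Us[OF \<gamma>] t] U_localised[OF \<gamma> test_translate[OF \<phi>, of \<gamma>]] by (simp only: a_def)
  qed
  have "cmod (lattice_sum U \<phi>) \<le> (\<Sum>\<gamma>\<in>F. a \<gamma> * d \<gamma>)"
    unfolding lattice_sum_eq[OF \<phi> F eq_refl[OF F_def[symmetric]]]
    by (rule order_trans[OF norm_sum sum_mono[OF pt]])
  then have "(cmod (lattice_sum U \<phi>))\<^sup>2 \<le> (\<Sum>\<gamma>\<in>F. a \<gamma> * d \<gamma>)\<^sup>2" by (rule power_mono) simp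
  also have "\<dots> \<le> (\<Sum>\<gamma>\<in>F. (a \<gamma>)\<^sup>2) * (\<Sum>\<gamma>\<in>F. (d \<gamma>)\<^sup>2)" by (rule Cauchy_Schwarz_ineq_sum)
  also have "\<dots> \<le> S * (C * (dual_norm blk s \<phi>)\<^sup>2)"
    by (rule mult_mono[OF S CB[OF test_imp_schwartz[OF \<phi>] F, folded d_def] S0]) (simp add: sum_nonneg)
  also have "\<dots> = (sqrt C * sqrt S * dual_norm blk s \<phi>)\<^sup>2"
    using C S0 by (simp add: power_mult_distrib)
  finally have "cmod (lattice_sum U \<phi>) \<le> sqrt C * sqrt S * dual_norm blk s \<phi>"
    by (rule power2_le_imp_le) (use C S0 in simp)
  then show ?thesis by (simp only: S_def)
qed

text \<open>Let T be the sum of the squares of the \<open>t \<gamma>\<close>, A the norm of the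
  lattice sum, and g the glued function. Pairing gives T \<le> A |g| in the dual norm, gluing gives
  |g|^2 \<le> C T, and together T \<le> C A^2.\<close>

lemma coefficient_sum_le:
  assumes CB: "\<And>\<psi> F. \<psi> ` F \<subseteq> schwartz_functions \<Longrightarrow> finite F \<Longrightarrow> F \<subseteq> int_lattice \<Longrightarrow>
    (dual_norm blk s (\<lambda>x. \<Sum>\<gamma>\<in>F. \<theta> (x - \<gamma>) * \<psi> \<gamma> x))\<^sup>2 \<le> C * (\<Sum>\<gamma>\<in>F. (dual_norm blk s (\<psi> \<gamma>))\<^sup>2)"
    and C: "C \<ge> 0" and L: "lattice_sum U \<in> sobolev blk s" and F: "finite F" "F \<subseteq> int_lattice"
  shows "(\<Sum>\<gamma>\<in>F. (sobolev_norm blk s (U \<gamma>))\<^sup>2) \<le> C * (sobolev_norm blk s (lattice_sum U))\<^sup>2"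
proof (rule field_le_mult_one_interval)
  \<comment> \<open>The factor z < 1 leaves room below each norm, which test functions need not
    attain; the inequality for all such z implies the one for z = 1. Since the norms occur squared,
    \<open>t \<gamma>\<close> carries the root of z.\<close>
  fix z :: real assume z: "0 < z" "z < 1"
  define a where "a \<gamma> = sobolev_norm blk s (U \<gamma>)" for \<gamma>
  define A where "A = sobolev_norm blk s (lattice_sum U)"
  define t where "t \<gamma> = sqrt z * a \<gamma>" for \<gamma>
  have t0: "0 \<le> t \<gamma>" for \<gamma> unfolding t_def a_def using z by (simp add: sobolev_norm_nonneg)
  have t1: "t \<gamma> = 0 \<or> t \<gamma> < a \<gamma>" for \<gamma>
  proof (cases "a \<gamma> = 0")
    case False
    then have "a \<gamma> > 0" unfolding a_def using sobolev_norm_nonneg[of blk s "U \<gamma>"] by linarith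
    then show ?thesis using z by (simp add: t_def)
  qed (simp add: t_def)
  have "\<forall>\<gamma>\<in>F. \<exists>\<psi>. \<psi> \<in> test_functions \<and> dual_norm blk s \<psi> = t \<gamma> \<and> (\<exists>r. U \<gamma> \<psi> = complex_of_real r \<and> (t \<gamma>)\<^sup>2 \<le> r)"
  proof (rule ballI)
    fix \<gamma> assume "\<gamma> \<in> F"
    then have \<gamma>: "\<gamma> \<in> int_lattice" using F(2) by (rule subsetD[rotated])
    show "\<exists>\<psi>. \<psi> \<in> test_functions \<and> dual_norm blk s \<psi> = t \<gamma> \<and> (\<exists>r. U \<gamma> \<psi> = complex_of_real r \<and> (t \<gamma>)\<^sup>2 \<le> r)"
      using sobolev_norm_nearly_attained[OF Us[OF \<gamma>] U_linear[OF \<gamma>] t0 t1[unfolded a_def], folded Bex_def]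
      by (simp only: Bex_def)
  qed
  from bchoice[OF this] obtain \<psi> where \<psi>: "\<forall>\<gamma>\<in>F. \<psi> \<gamma> \<in> test_functions \<and> dual_norm blk s (\<psi> \<gamma>) = t \<gamma> \<and>
    (\<exists>r. U \<gamma> (\<psi> \<gamma>) = complex_of_real r \<and> (t \<gamma>)\<^sup>2 \<le> r)" by (elim exE)
  have \<psi>t: "\<psi> \<gamma> \<in> test_functions" if "\<gamma> \<in> F" for \<gamma> by (rule \<psi>[rule_format, OF that, THEN conjunct1])
  have \<psi>n: "dual_norm blk s (\<psi> \<gamma>) = t \<gamma>" if "\<gamma> \<in> F" for \<gamma>
    by (rule \<psi>[rule_format, OF that, THEN conjunct2, THEN conjunct1])
  have "\<forall>\<gamma>\<in>F. \<exists>r. U \<gamma> (\<psi> \<gamma>) = complex_of_real r \<and> (t \<gamma>)\<^sup>2 \<le> r"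
    by (rule ballI) (rule \<psi>[rule_format, THEN conjunct2, THEN conjunct2])
  from bchoice[OF this] obtain r where r: "\<forall>\<gamma>\<in>F. U \<gamma> (\<psi> \<gamma>) = complex_of_real (r \<gamma>) \<and> (t \<gamma>)\<^sup>2 \<le> r \<gamma>" by (elim exE)
  define \<psi>' where "\<psi>' \<gamma> x = \<psi> \<gamma> (x - \<gamma>)" for \<gamma> x
  have \<psi>': "\<psi>' \<gamma> \<in> test_functions" if "\<gamma> \<in> F" for \<gamma> unfolding \<psi>'_def by (rule test_shift[OF \<psi>t[OF that]])
  have \<psi>'n: "dual_norm blk s (\<psi>' \<gamma>) = t \<gamma>" if "\<gamma> \<in> F" for \<gamma>
    using dual_norm_shift[OF test_imp_schwartz[OF \<psi>t[OF that]], of blk s "- \<gamma>"] \<psi>n[OF that]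
    by (simp add: \<psi>'_def[abs_def])
  have gt: "(\<lambda>x. \<theta> (x - \<gamma>) * \<psi>' \<gamma> x) \<in> test_functions" if "\<gamma> \<in> F" for \<gamma>
    by (rule test_mult_smooth[OF test_shift[OF \<theta>] test_functionsD(1)[OF \<psi>'[OF that]]])
  have \<psi>'S: "\<psi>' ` F \<subseteq> schwartz_functions" using test_imp_schwartz[OF \<psi>'] by blast
  define g where "g x = (\<Sum>\<gamma>\<in>F. \<theta> (x - \<gamma>) * \<psi>' \<gamma> x)" for x
  have g: "g \<in> test_functions" unfolding g_def by (rule test_sum[OF gt])
  have "lattice_sum U g = (\<Sum>\<gamma>\<in>F. lattice_sum U (\<lambda>x. \<theta> (x - \<gamma>) * \<psi>' \<gamma> x))"
    unfolding g_def[abs_def] by (rule linear_sum[OF lattice_sum_linear gt])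
  also have "\<dots> = (\<Sum>\<gamma>\<in>F. complex_of_real (r \<gamma>))"
  proof (rule sum.cong[OF refl])
    fix \<gamma> assume \<gamma>: "\<gamma> \<in> F"
    show "lattice_sum U (\<lambda>x. \<theta> (x - \<gamma>) * \<psi>' \<gamma> x) = complex_of_real (r \<gamma>)"
      unfolding \<psi>'_def lattice_sum_window[OF subsetD[OF F(2) \<gamma>] \<psi>t[OF \<gamma>]] by (rule r[rule_format, OF \<gamma>, THEN conjunct1])
  qed
  finally have Lg: "lattice_sum U g = complex_of_real (\<Sum>\<gamma>\<in>F. r \<gamma>)" by simp
  define T where "T = (\<Sum>\<gamma>\<in>F. (t \<gamma>)\<^sup>2)"
  have T0: "T \<ge> 0" unfolding T_def by (rule sum_nonneg) simp
  have "T \<le> (\<Sum>\<gamma>\<in>F. r \<gamma>)" unfolding T_def by (rule sum_mono) (rule r[rule_format, THEN conjunct2])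
  also have "\<dots> \<le> cmod (lattice_sum U g)" unfolding Lg norm_of_real by (rule abs_ge_self)
  also have "\<dots> \<le> A * dual_norm blk s g" unfolding A_def by (rule sobolev_bound[OF L g])
  finally have "T\<^sup>2 \<le> (A * dual_norm blk s g)\<^sup>2" by (rule power_mono[OF _ T0])
  also have "\<dots> = A\<^sup>2 * (dual_norm blk s g)\<^sup>2" by (rule power_mult_distrib)
  also have "\<dots> \<le> A\<^sup>2 * (C * (\<Sum>\<gamma>\<in>F. (dual_norm blk s (\<psi>' \<gamma>))\<^sup>2))"
    unfolding g_def[abs_def] by (rule mult_left_mono[OF CB[OF \<psi>'S F]]) simp_all
  also have "(\<Sum>\<gamma>\<in>F. (dual_norm blk s (\<psi>' \<gamma>))\<^sup>2) = T"
    unfolding T_def by (rule sum.cong[OF refl]) (simp only: \<psi>'n)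
  finally have TT: "T * T \<le> (C * A\<^sup>2) * T" by (simp only: power2_eq_square mult_ac)
  have "T \<le> C * A\<^sup>2"
  proof (cases "T = 0")
    case True
    then show ?thesis using C by simp
  next
    case False
    then have "T > 0" using T0 by simp
    with TT show ?thesis by (rule mult_right_le_imp_le)
  qed
  moreover have "T = z * (\<Sum>\<gamma>\<in>F. (a \<gamma>)\<^sup>2)"
    using z by (simp add: T_def t_def power_mult_distrib sum_distrib_left)
  ultimately show "z * (\<Sum>\<gamma>\<in>F. (sobolev_norm blk s (U \<gamma>))\<^sup>2) \<le> C * (sobolev_norm blk s (lattice_sum U))\<^sup>2"
    by (simp only: a_def A_def)
qed

end

section \<open>Choice of the cutoff from the separation of the lattice translates\<close>

lemma closed_int_lattice_nonzero: "closed (int_lattice - {0} :: (real^'n::finite) set)"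
proof (rule discrete_imp_closed[of 1])
  show "\<forall>x\<in>int_lattice - {0}. \<forall>y\<in>int_lattice - {0::real^'n}. dist y x < 1 \<longrightarrow> y = x"
  proof (intro ballI impI, rule ccontr)
    fix x y :: "real^'n" assume "x \<in> int_lattice - {0}" "y \<in> int_lattice - {0}" "dist y x < 1" "y \<noteq> x"
    then show False using int_lattice_separated[of y x] by (simp add: dist_norm)
  qed
qed simp

text \<open>The sum \<open>Z\<close> of \<open>K\<close> and the nonzero lattice points is closed,
  being a sum of a compact and a closed set, and the hypothesis on differences makes it disjoint
  from \<open>K\<close>. A cutoff supported in the complement of \<open>Z\<close> has the required
  separation, since x = (x + \<gamma>) + (- \<gamma>).\<close>

lemma lattice_cutoff:
  fixes K :: "(real^'n::finite) set"
  assumes K: "compact K" and disj: "{x - y |x y. x \<in> K \<and> y \<in> K} \<inter> int_lattice = {0}"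
  obtains \<theta> V where "\<theta> \<in> test_functions" "open V" "K \<subseteq> V" "\<And>x. x \<in> V \<Longrightarrow> \<theta> x = 1"
    "\<And>\<gamma> x. \<gamma> \<in> int_lattice \<Longrightarrow> \<gamma> \<noteq> 0 \<Longrightarrow> x \<in> function_support \<theta> \<Longrightarrow> x + \<gamma> \<notin> K"
proof -
  define Z where "Z = (\<Union>x\<in>K. \<Union>y\<in>int_lattice - {0}. {x + y})"
  have "closed Z" unfolding Z_def by (rule compact_closed_sums[OF K closed_int_lattice_nonzero])
  then have oZ: "open (- Z)" by (rule open_Compl)
  have KZ: "K \<subseteq> - Z"
  proof (rule subsetI, rule ComplI)
    fix x assume x: "x \<in> K" "x \<in> Z"
    then obtain k y where k: "k \<in> K" "y \<in> int_lattice" "y \<noteq> 0" "x = k + y" unfolding Z_def by auto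
    have "x - k \<in> {x - y |x y. x \<in> K \<and> y \<in> K}" using x(1) k(1) by blast
    then have "y \<in> {x - y |x y. x \<in> K \<and> y \<in> K} \<inter> int_lattice" using k by simp
    then show False using disj k(3) by simp
  qed
  obtain b :: "real^'n \<Rightarrow> real" and V where b: "(\<lambda>x. complex_of_real (b x)) \<in> test_functions" "open V" "K \<subseteq> V"
    "\<And>x. x \<in> V \<Longrightarrow> b x = 1" "function_support (\<lambda>x. complex_of_real (b x)) \<subseteq> - Z"
    by (rule cutoff_function[OF K oZ KZ], rule that)
  show ?thesis
  proof (rule that[OF b(1-3)])
    show "complex_of_real (b x) = 1" if "x \<in> V" for x using b(4)[OF that] by simp
    fix \<gamma> x :: "real^'n" assume g: "\<gamma> \<in> int_lattice" "\<gamma> \<noteq> 0" and x: "x \<in> function_support (\<lambda>x. complex_of_real (b x))"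
    show "x + \<gamma> \<notin> K"
    proof
      assume "x + \<gamma> \<in> K"
      moreover have "- \<gamma> \<in> int_lattice - {0}" using g by (simp add: int_lattice_def)
      moreover have "x \<in> {(x + \<gamma>) + (- \<gamma>)}" by simp
      ultimately have "x \<in> Z" unfolding Z_def by (intro UN_I)
      then show False using b(5) x by (auto dest: subsetD)
    qed
  qed
qed

theorem lemma2p3:
  fixes blk :: "'n::finite \<Rightarrow> 'j::finite"
    and s :: "real^'j"
    and K :: "(real^'n) set"
  assumes "surj blk"
    and "compact K"
    and "{x - y |x y. x \<in> K \<and> y \<in> K} \<inter> int_lattice = {0}"
  shows "(\<forall>U :: real^'n \<Rightarrow> 'n functional.
            (\<forall>\<gamma>\<in>int_lattice. U \<gamma> \<in> sobolev blk s \<inter> distributions_in K) \<longrightarrow>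
              (\<forall>\<phi>\<in>test_functions. (\<lambda>\<gamma>. translate \<gamma> (U \<gamma>) \<phi>) summable_on int_lattice) \<and>
              lattice_sum U \<in> distributions \<and>
              (lattice_sum U \<in> sobolev blk s \<longleftrightarrow>
                (\<lambda>\<gamma>. (sobolev_norm blk s (U \<gamma>))\<^sup>2) summable_on int_lattice)) \<and>
         (\<exists>C\<ge>1. \<forall>U :: real^'n \<Rightarrow> 'n functional.
            (\<forall>\<gamma>\<in>int_lattice. U \<gamma> \<in> sobolev blk s \<inter> distributions_in K) \<and>
            lattice_sum U \<in> sobolev blk s \<longrightarrow>
              inverse C * sobolev_norm blk s (lattice_sum U)
                \<le> sqrt (\<Sum>\<^sub>\<infinity>\<gamma>\<in>int_lattice. (sobolev_norm blk s (U \<gamma>))\<^sup>2) \<and>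
              sqrt (\<Sum>\<^sub>\<infinity>\<gamma>\<in>int_lattice. (sobolev_norm blk s (U \<gamma>))\<^sup>2)
                \<le> C * sobolev_norm blk s (lattice_sum U))"
proof -
  \<comment> \<open>The cutoff and the two constants are fixed before any family \<open>U\<close> is
    considered.\<close>
  obtain \<theta> :: "real^'n \<Rightarrow> complex" and V where \<theta>: "\<theta> \<in> test_functions" and V: "open V" "K \<subseteq> V" "\<And>x. x \<in> V \<Longrightarrow> \<theta> x = 1"
    and sep: "\<And>\<gamma> x. \<gamma> \<in> int_lattice \<Longrightarrow> \<gamma> \<noteq> 0 \<Longrightarrow> x \<in> function_support \<theta> \<Longrightarrow> x + \<gamma> \<notin> K"
    by (rule lattice_cutoff[OF assms(2,3)], rule that)
  obtain C1 where C1: "C1 \<ge> 0" and loc: "\<And>f F. f \<in> schwartz_functions \<Longrightarrow> finite F \<Longrightarrow> F \<subseteq> int_lattice \<Longrightarrow>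
    (\<Sum>\<gamma>\<in>F. (dual_norm blk s (\<lambda>x. \<theta> (x - \<gamma>) * f x))\<^sup>2) \<le> C1 * (dual_norm blk s f)\<^sup>2"
    by (rule dual_norm_localisation[OF \<theta>, of blk s], rule that)
  obtain C2 where C2: "C2 \<ge> 0" and glue: "\<And>\<psi> F. \<psi> ` F \<subseteq> schwartz_functions \<Longrightarrow> finite F \<Longrightarrow> F \<subseteq> int_lattice \<Longrightarrow>
    (dual_norm blk s (\<lambda>x. \<Sum>\<gamma>\<in>F. \<theta> (x - \<gamma>) * \<psi> \<gamma> x))\<^sup>2 \<le> C2 * (\<Sum>\<gamma>\<in>F. (dual_norm blk s (\<psi> \<gamma>))\<^sup>2)"
    by (rule dual_norm_gluing[OF \<theta>, of blk s], rule that)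
  let ?N = "\<lambda>U \<gamma>. (sobolev_norm blk s (U \<gamma>))\<^sup>2"
  have family: "lattice_family blk s K V \<theta> U" if "\<forall>\<gamma>\<in>int_lattice. U \<gamma> \<in> sobolev blk s \<inter> distributions_in K" for U
    by (unfold_locales) (use assms(2) \<theta> V sep that in auto)
  have upper: "?N U summable_on int_lattice \<and> infsum (?N U) int_lattice \<le> C2 * (sobolev_norm blk s (lattice_sum U))\<^sup>2"
    if U: "\<forall>\<gamma>\<in>int_lattice. U \<gamma> \<in> sobolev blk s \<inter> distributions_in K" and L: "lattice_sum U \<in> sobolev blk s" for U
  proof -
    \<comment> \<open>The bound is uniform over finite \<open>F\<close>, so it yields summability
      and then passes to the infinite sum.\<close>
    have le: "(\<Sum>\<gamma>\<in>F. ?N U \<gamma>) \<le> C2 * (sobolev_norm blk s (lattice_sum U))\<^sup>2" if "finite F" "F \<subseteq> int_lattice" for F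
      by (rule lattice_family.coefficient_sum_le[OF family[OF U] glue C2 L that])
    have summ: "?N U summable_on int_lattice"
      by (rule nonneg_bounded_partial_sums_imp_summable_on[of _ _ "C2 * (sobolev_norm blk s (lattice_sum U))\<^sup>2"])
        (use le in \<open>auto simp: eventually_finite_subsets_at_top intro!: exI[of _ "{}"]\<close>)
    have "infsum (?N U) int_lattice \<le> C2 * (sobolev_norm blk s (lattice_sum U))\<^sup>2"
      by (rule infsum_le_finite_sums[OF summ le])
    with summ show ?thesis by (rule conjI)
  qed
  have lower: "lattice_sum U \<in> sobolev blk s \<and> sobolev_norm blk s (lattice_sum U) \<le> sqrt C1 * sqrt (infsum (?N U) int_lattice)"
    if U: "\<forall>\<gamma>\<in>int_lattice. U \<gamma> \<in> sobolev blk s \<inter> distributions_in K" and summ: "?N U summable_on int_lattice" for U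
  proof -
    note b = lattice_family.lattice_sum_bound[OF family[OF U] C1 loc summ]
    have "0 \<le> infsum (?N U) int_lattice" by (rule infsum_nonneg) simp
    then have nn: "0 \<le> sqrt C1 * sqrt (infsum (?N U) int_lattice)" using C1 by simp
    have "lattice_sum U \<in> sobolev blk s"
      by (rule sobolevI[OF lattice_family.lattice_sum_linear[OF family[OF U]] nn b])
    with sobolev_norm_le[OF this nn b] show ?thesis by (intro conjI)
  qed
  \<comment> \<open>\<open>sqrt C1\<close> serves the bound for the norm of the sum,
    \<open>sqrt C2\<close> the bound for the coefficients, and the summand 1 ensures
    \<open>C \<ge> 1\<close>.\<close>
  define C where "C = 1 + sqrt C1 + sqrt C2"
  have C: "C \<ge> 1" "sqrt C1 \<le> C" "sqrt C2 \<le> C" using C1 C2 by (simp_all add: C_def)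
  have first: "(\<forall>\<phi>\<in>test_functions. (\<lambda>\<gamma>. translate \<gamma> (U \<gamma>) \<phi>) summable_on int_lattice) \<and>
      lattice_sum U \<in> distributions \<and> (lattice_sum U \<in> sobolev blk s \<longleftrightarrow> ?N U summable_on int_lattice)"
    if U: "\<forall>\<gamma>\<in>int_lattice. U \<gamma> \<in> sobolev blk s \<inter> distributions_in K" for U
    using lattice_family.summable_translates[OF family[OF U]] lattice_family.lattice_sum_distribution[OF family[OF U]]
      upper[OF U] lower[OF U] by blast
  have second: "inverse C * sobolev_norm blk s (lattice_sum U) \<le> sqrt (infsum (?N U) int_lattice) \<and>
      sqrt (infsum (?N U) int_lattice) \<le> C * sobolev_norm blk s (lattice_sum U)"
    if U: "\<forall>\<gamma>\<in>int_lattice. U \<gamma> \<in> sobolev blk s \<inter> distributions_in K" and L: "lattice_sum U \<in> sobolev blk s" for U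
  proof -
    note summ = upper[OF U L, THEN conjunct1]
    define S where "S = infsum (?N U) int_lattice"
    define A where "A = sobolev_norm blk s (lattice_sum U)"
    have A0: "A \<ge> 0" unfolding A_def by (rule sobolev_norm_nonneg)
    have S0: "S \<ge> 0" unfolding S_def by (rule infsum_nonneg) simp
    have "A \<le> sqrt C1 * sqrt S" unfolding A_def S_def by (rule lower[OF U summ, THEN conjunct2])
    also have "\<dots> \<le> C * sqrt S" by (rule mult_right_mono[OF C(2)]) (use S0 in simp)
    finally have "inverse C * A \<le> sqrt S" using C(1) by (simp add: field_simps)
    moreover have "sqrt S \<le> sqrt C2 * A"
      using real_sqrt_le_mono[OF upper[OF U L, THEN conjunct2, folded S_def A_def]] A0 by (simp add: real_sqrt_mult)
    then have "sqrt S \<le> C * A" using mult_right_mono[OF C(3) A0] by linarith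
    ultimately show ?thesis unfolding S_def A_def by (rule conjI)
  qed
  show ?thesis
  proof (rule conjI, rule allI, rule impI)
    fix U :: "real^'n \<Rightarrow> 'n functional" assume "\<forall>\<gamma>\<in>int_lattice. U \<gamma> \<in> sobolev blk s \<inter> distributions_in K"
    then show "(\<forall>\<phi>\<in>test_functions. (\<lambda>\<gamma>. translate \<gamma> (U \<gamma>) \<phi>) summable_on int_lattice) \<and>
      lattice_sum U \<in> distributions \<and> (lattice_sum U \<in> sobolev blk s \<longleftrightarrow> ?N U summable_on int_lattice)"
      by (rule first)
  qed (rule exI[of _ C], rule conjI[OF C(1)], rule allI, rule impI, erule conjE, rule second)
qed

end
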